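(* Let $\iota: R\to A$ be a Frobenius extension and let $T$ be a Wakamatsu tilting left $R$-module. Put $U=A\otimes_RT$, $S=\operatorname{End}_R(T)$, $B=\operatorname{End}_A(U)$, and let $\rho:S\to B$, $\rho(s)=1_A\otimes s$, be the natural ring homomorphism. Assume that $U\in\operatorname{add}_R(T)$ as an $R$-module and that $T$ has finite projective dimension both as a left $R$-module and as a right $S$-module. Then $U$ is Wakamatsu tilting over $A$, $\rho: S\to B$ is a Frobenius extension, and $U$ has finite projective dimension both as a left $A$-module and as a right $B$-module. Moreover, the Brenner--Butler--Miyashita equivalences $$T\otimes_S-:\mathbf{KT}(T_S)\rightleftarrows\mathbf{KE}({}_RT):\operatorname{Hom}_R(T,-),\qquad U\otimes_B-:\mathbf{KT}(U_B)\rightleftarrows\mathbf{KE}({}_AU):\operatorname{Hom}_A(U,-)$$ associated with ${}_RT_S$ and ${}_AU_B$ are compatible with extension and restriction of scalars. More precisely, the functors $B\otimes_S-:\mathbf{KT}(T_S)\to\mathbf{KT}(U_B)$, $\operatorname{Res}:\mathbf{KT}(U_B)\to\mathbf{KT}(T_S)$ (along $\rho$), $A\otimes_R-:\mathbf{KE}({}_RT)\to\mathbf{KE}({}_AU)$ and $\operatorname{Res}:\mathbf{KE}({}_AU)\to\mathbf{KE}({}_RT)$ (along $\iota$) are well defined, and there are natural isomorphisms of functors: $A\otimes_R(T\otimes_S M)\cong U\otimes_B(B\otimes_S M)$ for $M\in\mathbf{KT}(T_S)$; $B\otimes_S\operatorname{Hom}_R(T,N)\cong\operatorname{Hom}_A(U,A\otimes_RN)$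 for $N\in\mathbf{KE}({}_RT)$; $T\otimes_S\operatorname{Res}X\cong\operatorname{Res}(U\otimes_BX)$ for $X\in\mathbf{KT}(U_B)$; $\operatorname{Hom}_R(T,\operatorname{Res}Y)\cong\operatorname{Res}\operatorname{Hom}_A(U,Y)$ for $Y\in\mathbf{KE}({}_AU)$.
   Context: All rings are associative with unit; modules are left modules unless otherwise specified, and $\operatorname{Mod}(R)$ is the category of left $R$-modules. A ring extension $\iota:R\to A$ is a unital ring homomorphism, and $\operatorname{Res}$ denotes restriction of scalars. It is a Frobenius extension if $A$ is finitely generated projective as a left $R$-module and $A\cong\operatorname{Hom}_R(A,R)$ as $A$-$R$-bimodules, where $(af)(x)=f(xa)$ and $(fr)(x)=f(x)r$. For an $R$-module $M$, $\operatorname{add}_R(M)$ is the class of direct summands of finite direct sums of copies of $M$. An $R$-module $T$ is Wakamatsu tilting if: (1) $T$ has a projective resolution by finitely generated projective $R$-modules; (2) $\operatorname{Ext}_R^i(T,T)=0$ for all $i>0$; (3) there is an exact sequence $0\to R\to T_0\to T_1\to T_2\to\cdots$ with each $T_j\in\operatorname{add}_R(T)$ which remains exact after applying $\operatorname{Hom}_R(-,T)$. Endomorphism rings use the right-action convention $s_1s_2=s_2\circ s_1$, so $T$ is an $R$-$S$-bimodule via $ts=s(t)$ and $U$ is similarly an $A$-$B$-bimodule. Explicitly, $(a\otimes t)\rho(s)=a\otimes ts$. Define the full subcategories $\mathbf{KT}(T_S)=\{M\in\operatorname{Mod}(S)\mid \operatorname{Tor}_i^S(T,M)=0 \text{ for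 all } i>0\}$ and $\mathbf{KE}({}_RT)=\{N\in\operatorname{Mod}(R)\mid \operatorname{Ext}_R^i(T,N)=0\text{ for all } i>0\}$, and likewise $\mathbf{KT}(U_B)\subseteq\operatorname{Mod}(B)$ and $\mathbf{KE}({}_AU)\subseteq\operatorname{Mod}(A)$. The Brenner--Butler--Miyashita equivalence of a Wakamatsu tilting bimodule ${}_RT_S$ of finite projective dimension on both sides is the equivalence $\mathbf{KT}(T_S)\simeq\mathbf{KE}({}_RT)$ given by the adjoint pair $(T\otimes_S-,\operatorname{Hom}_R(T,-))$. *)

theory Defs
  imports "HOL-Algebra.Algebra"
begin

text \<open>
  The library locale \<open>module\<close> demands a commutative base ring, so left modules over an arbitrary
  ring are introduced here on the library record \<open>module\<close>. The fields \<open>mult\<close> and \<open>one\<close> which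
  that record inherits from \<open>ring\<close> carry no meaning for a module.
\<close>

section \<open>Left and right modules, bimodules\<close>

locale left_module = R?: ring R + M?: abelian_group M
  for R :: "('r, 'c) ring_scheme" (structure) and M :: "('r, 'm, 'd) module_scheme" (structure) +
  assumes smult_closed: "\<lbrakk>r \<in> carrier R; x \<in> carrier M\<rbrakk> \<Longrightarrow> r \<odot>\<^bsub>M\<^esub> x \<in> carrier M"
    and smult_l_distr: "\<lbrakk>r \<in> carrier R; s \<in> carrier R; x \<in> carrier M\<rbrakk>
          \<Longrightarrow> (r \<oplus>\<^bsub>R\<^esub> s) \<odot>\<^bsub>M\<^esub> x = r \<odot>\<^bsub>M\<^esub> x \<oplus>\<^bsub>M\<^esub> s \<odot>\<^bsub>M\<^esub> x"
    and smult_r_distr: "\<lbrakk>r \<in> carrier R; x \<in> carrier M; y \<in> carrier M\<rbrakk>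
          \<Longrightarrow> r \<odot>\<^bsub>M\<^esub> (x \<oplus>\<^bsub>M\<^esub> y) = r \<odot>\<^bsub>M\<^esub> x \<oplus>\<^bsub>M\<^esub> r \<odot>\<^bsub>M\<^esub> y"
    and smult_assoc1: "\<lbrakk>r \<in> carrier R; s \<in> carrier R; x \<in> carrier M\<rbrakk>
          \<Longrightarrow> (r \<otimes>\<^bsub>R\<^esub> s) \<odot>\<^bsub>M\<^esub> x = r \<odot>\<^bsub>M\<^esub> (s \<odot>\<^bsub>M\<^esub> x)"
    and smult_one: "x \<in> carrier M \<Longrightarrow> \<one>\<^bsub>R\<^esub> \<odot>\<^bsub>M\<^esub> x = x"

text \<open>Homomorphisms are extensional, so that equal homomorphisms are equal as HOL functions.\<close>

definition mod_hom ::
  "('r, 'c) ring_scheme \<Rightarrow> ('r, 'm, 'd) module_scheme \<Rightarrow> ('r, 'n, 'e) module_scheme \<Rightarrow> ('m \<Rightarrow> 'n) set"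
  where "mod_hom R M N = {f \<in> carrier M \<rightarrow>\<^sub>E carrier N.
    (\<forall>x\<in>carrier M. \<forall>y\<in>carrier M. f (x \<oplus>\<^bsub>M\<^esub> y) = f x \<oplus>\<^bsub>N\<^esub> f y) \<and>
    (\<forall>r\<in>carrier R. \<forall>x\<in>carrier M. f (r \<odot>\<^bsub>M\<^esub> x) = r \<odot>\<^bsub>N\<^esub> f x)}"

definition mod_iso ::
  "('r, 'c) ring_scheme \<Rightarrow> ('r, 'm, 'd) module_scheme \<Rightarrow> ('r, 'n, 'e) module_scheme \<Rightarrow> ('m \<Rightarrow> 'n) set"
  where "mod_iso R M N = {f \<in> mod_hom R M N. bij_betw f (carrier M) (carrier N)}"

text \<open>A right module over \<open>S\<close> is a left module over \<open>opp_ring S\<close>.\<close>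

definition opp_ring :: "'r ring \<Rightarrow> 'r ring"
  where "opp_ring S = S\<lparr>monoid.mult := (\<lambda>x y. y \<otimes>\<^bsub>S\<^esub> x)\<rparr>"

record ('r, 'm, 's) bimodule = "('r, 'm) module" +
  rsmult :: "'m \<Rightarrow> 's \<Rightarrow> 'm"

definition right_mod :: "('r, 'm, 's) bimodule \<Rightarrow> ('s, 'm) module"
  where "right_mod T = \<lparr>carrier = carrier T, monoid.mult = undefined, one = undefined, ring.zero = \<zero>\<^bsub>T\<^esub>,
    ring.add = ring.add T, module.smult = (\<lambda>s t. rsmult T t s)\<rparr>"

definition left_mod :: "('r, 'm, 's) bimodule \<Rightarrow> ('r, 'm) module"
  where "left_mod T = \<lparr>carrier = carrier T, monoid.mult = undefined, one = undefined, ring.zero = \<zero>\<^bsub>T\<^esub>,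
    ring.add = ring.add T, module.smult = module.smult T\<rparr>"

definition reg_mod :: "'r ring \<Rightarrow> ('r, 'r) module"
  where "reg_mod R = \<lparr>carrier = carrier R, monoid.mult = undefined, one = undefined, ring.zero = \<zero>\<^bsub>R\<^esub>,
    ring.add = ring.add R, module.smult = monoid.mult R\<rparr>"

definition res :: "('r \<Rightarrow> 'a) \<Rightarrow> ('a, 'm) module \<Rightarrow> ('r, 'm) module"
  where "res \<phi> M = \<lparr>carrier = carrier M, monoid.mult = undefined, one = undefined, ring.zero = \<zero>\<^bsub>M\<^esub>,
    ring.add = ring.add M, module.smult = (\<lambda>r x. \<phi> r \<odot>\<^bsub>M\<^esub> x)\<rparr>"

text \<open>\<open>A\<close> as an \<open>A\<close>-\<open>R\<close>-bimodule along \<open>\<phi>\<close>.\<close>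

definition ext_bimod :: "'a ring \<Rightarrow> ('r \<Rightarrow> 'a) \<Rightarrow> ('a, 'a, 'r) bimodule"
  where "ext_bimod A \<phi> = \<lparr>carrier = carrier A, monoid.mult = undefined, one = undefined, ring.zero = \<zero>\<^bsub>A\<^esub>,
    ring.add = ring.add A, module.smult = monoid.mult A, rsmult = (\<lambda>a r. a \<otimes>\<^bsub>A\<^esub> \<phi> r)\<rparr>"

text \<open>The module with underlying additive group \<open>G\<close>, where \<open>G\<close> is given multiplicatively.\<close>

definition mk_module :: "'m monoid \<Rightarrow> ('r \<Rightarrow> 'm \<Rightarrow> 'm) \<Rightarrow> ('r, 'm) module"
  where "mk_module G act = \<lparr>carrier = carrier G, monoid.mult = undefined, one = undefined, ring.zero = \<one>\<^bsub>G\<^esub>,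
    ring.add = monoid.mult G, module.smult = act\<rparr>"


section \<open>Direct sums, finitely generated and projective modules\<close>

definition dsum :: "('r, 'm) module \<Rightarrow> ('r, 'n) module \<Rightarrow> ('r, 'm \<times> 'n) module"
  where "dsum M N = \<lparr>carrier = carrier M \<times> carrier N, monoid.mult = undefined, one = undefined,
    ring.zero = (\<zero>\<^bsub>M\<^esub>, \<zero>\<^bsub>N\<^esub>),
    ring.add = (\<lambda>(x, y) (x', y'). (x \<oplus>\<^bsub>M\<^esub> x', y \<oplus>\<^bsub>N\<^esub> y')),
    module.smult = (\<lambda>r (x, y). (r \<odot>\<^bsub>M\<^esub> x, r \<odot>\<^bsub>N\<^esub> y))\<rparr>"

text \<open>The direct sum of copies of \<open>M\<close> indexed by \<open>I\<close>: finitely supported families.\<close>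

definition copies :: "'x set \<Rightarrow> ('r, 'm) module \<Rightarrow> ('r, 'x \<Rightarrow> 'm) module"
  where "copies I M = \<lparr>
    carrier = {f. (\<forall>x. f x \<in> carrier M) \<and> (\<forall>x. x \<notin> I \<longrightarrow> f x = \<zero>\<^bsub>M\<^esub>) \<and> finite {x. f x \<noteq> \<zero>\<^bsub>M\<^esub>}},
    monoid.mult = undefined, one = undefined,
    ring.zero = (\<lambda>x. \<zero>\<^bsub>M\<^esub>),
    ring.add = (\<lambda>f g x. f x \<oplus>\<^bsub>M\<^esub> g x),
    module.smult = (\<lambda>r f x. r \<odot>\<^bsub>M\<^esub> f x)\<rparr>"

text \<open>A complement of \<open>N\<close> is isomorphic to a submodule of \<open>M\<close>, hence may be sought in the type of \<open>M\<close>.\<close>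

definition direct_summand :: "'r ring \<Rightarrow> ('r, 'n) module \<Rightarrow> ('r, 'm) module \<Rightarrow> bool"
  where "direct_summand R N M \<longleftrightarrow> left_module R N \<and> left_module R M \<and>
    (\<exists>K :: ('r, 'm) module. left_module R K \<and> mod_iso R (dsum N K) M \<noteq> {})"

definition add_mod :: "'r ring \<Rightarrow> ('r, 'm) module \<Rightarrow> ('r, 'n) module set"
  where "add_mod R M = {N. \<exists>n::nat. direct_summand R N (copies {..<n} M)}"

definition fin_gen :: "'r ring \<Rightarrow> ('r, 'm) module \<Rightarrow> bool"
  where "fin_gen R M \<longleftrightarrow> left_module R M \<and>
    (\<exists>G \<subseteq> carrier M. finite G \<and>
      (\<forall>x\<in>carrier M. \<exists>c\<in>G \<rightarrow> carrier R. x = (\<Oplus>\<^bsub>M\<^esub>g\<in>G. c g \<odot>\<^bsub>M\<^esub> g)))"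

text \<open>
  Projective means direct summand of a free module. A direct summand \<open>P\<close> of some free module is a
  direct summand of the free module on its own underlying set, so index sets in the type of \<open>P\<close>
  suffice.
\<close>

definition projective :: "'r ring \<Rightarrow> ('r, 'p) module \<Rightarrow> bool"
  where "projective R P \<longleftrightarrow> left_module R P \<and>
    (\<exists>I :: 'p set. direct_summand R P (copies I (reg_mod R)))"


section \<open>Homology and exactness\<close>

definition exact_at ::
  "('l, 'c) ring_scheme \<Rightarrow> ('l \<Rightarrow> 'm) \<Rightarrow> ('m, 'd) ring_scheme \<Rightarrow> ('m \<Rightarrow> 'n) \<Rightarrow> ('n, 'e) ring_scheme \<Rightarrow> bool"
  where "exact_at L f M g N \<longleftrightarrow> f ` carrier L = {x \<in> carrier M. g x = \<zero>\<^bsub>N\<^esub>}"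

text \<open>Chain complexes \<open>C\<close> have differentials \<open>d i : C (Suc i) \<rightarrow> C i\<close>, cochain complexes have
  differentials \<open>d i : C i \<rightarrow> C (Suc i)\<close>; groups are written multiplicatively.\<close>

definition homology :: "(nat \<Rightarrow> 'm monoid) \<Rightarrow> (nat \<Rightarrow> 'm \<Rightarrow> 'm) \<Rightarrow> nat \<Rightarrow> 'm set monoid"
  where "homology C d i =
    (C i)\<lparr>carrier := (case i of 0 \<Rightarrow> carrier (C 0) | Suc j \<Rightarrow> kernel (C i) (C j) (d j))\<rparr>
      Mod (d i ` carrier (C (Suc i)))"

definition cohomology :: "(nat \<Rightarrow> 'm monoid) \<Rightarrow> (nat \<Rightarrow> 'm \<Rightarrow> 'm) \<Rightarrow> nat \<Rightarrow> 'm set monoid"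
  where "cohomology C d i =
    (C i)\<lparr>carrier := kernel (C i) (C (Suc i)) (d i)\<rparr>
      Mod (case i of 0 \<Rightarrow> {\<one>\<^bsub>C 0\<^esub>} | Suc j \<Rightarrow> d j ` carrier (C j))"


section \<open>Projective resolutions\<close>

definition projective_resolution ::
  "'r ring \<Rightarrow> ('r, 'm) module \<Rightarrow> (nat \<Rightarrow> ('r, 'p) module) \<Rightarrow> (nat \<Rightarrow> 'p \<Rightarrow> 'p) \<Rightarrow> ('p \<Rightarrow> 'm) \<Rightarrow> bool"
  where "projective_resolution R M P d e \<longleftrightarrow>
    left_module R M \<and> (\<forall>i. projective R (P i)) \<and>
    (\<forall>i. d i \<in> mod_hom R (P (Suc i)) (P i)) \<and> e \<in> mod_hom R (P 0) M \<and>
    e ` carrier (P 0) = carrier M \<and>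
    exact_at (P 1) (d 0) (P 0) e M \<and>
    (\<forall>i. exact_at (P (Suc (Suc i))) (d (Suc i)) (P (Suc i)) (d i) (P i))"

text \<open>
  The standard free resolution of \<open>M\<close>, on which Ext and Tor are computed. The module in degree 0 is
  free on the elements of \<open>M\<close>; the module in degree \<open>n + 1\<close> is free on all formal \<open>R\<close>-linear
  combinations of basis elements of degree \<open>n\<close> which represent an element of the kernel of
  the preceding map. The recursive datatype accommodates the bases of all degrees in one type; a list
  \<open>[(r\<^sub>1, b\<^sub>1), \<dots>]\<close> stands for \<open>r\<^sub>1 b\<^sub>1 + \<dots>\<close>.
\<close>

datatype ('r, 'm) syz = Elt 'm | Syz "('r \<times> ('r, 'm) syz) list"

primrec syz_elt :: "('r, 'm) syz \<Rightarrow> 'm" where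
  "syz_elt (Elt m) = m"
| "syz_elt (Syz xs) = undefined"

definition formal_sum :: "'r ring \<Rightarrow> ('r \<times> 'x) list \<Rightarrow> 'x \<Rightarrow> 'r"
  where "formal_sum R xs b =
    foldr (\<lambda>(r, b') acc. if b' = b then r \<oplus>\<^bsub>R\<^esub> acc else acc) xs \<zero>\<^bsub>R\<^esub>"

primrec syz_vec :: "'r ring \<Rightarrow> ('r, 'm) syz \<Rightarrow> ('r, 'm) syz \<Rightarrow> 'r" where
  "syz_vec R (Elt m) = undefined"
| "syz_vec R (Syz xs) = formal_sum R xs"

definition std_aug :: "'r ring \<Rightarrow> ('r, 'm) module \<Rightarrow> (('r, 'm) syz \<Rightarrow> 'r) \<Rightarrow> 'm"
  where "std_aug R M f = (\<Oplus>\<^bsub>M\<^esub>b\<in>{b. f b \<noteq> \<zero>\<^bsub>R\<^esub>}. f b \<odot>\<^bsub>M\<^esub> syz_elt b)"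

definition std_bd :: "'r ring \<Rightarrow> (('r, 'm) syz \<Rightarrow> 'r) \<Rightarrow> ('r, 'm) syz \<Rightarrow> 'r"
  where "std_bd R f = (\<lambda>c. \<Oplus>\<^bsub>R\<^esub>b\<in>{b. f b \<noteq> \<zero>\<^bsub>R\<^esub>}. f b \<otimes>\<^bsub>R\<^esub> syz_vec R b c)"

primrec std_basis :: "'r ring \<Rightarrow> ('r, 'm) module \<Rightarrow> nat \<Rightarrow> ('r, 'm) syz set" where
  "std_basis R M 0 = Elt ` carrier M"
| "std_basis R M (Suc n) = {Syz xs | xs. set xs \<subseteq> carrier R \<times> std_basis R M n \<and>
     (if n = 0 then std_aug R M (formal_sum R xs) = \<zero>\<^bsub>M\<^esub>
      else std_bd R (formal_sum R xs) = (\<lambda>_. \<zero>\<^bsub>R\<^esub>))}"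

definition std_res :: "'r ring \<Rightarrow> ('r, 'm) module \<Rightarrow> nat \<Rightarrow> ('r, ('r, 'm) syz \<Rightarrow> 'r) module"
  where "std_res R M n = copies (std_basis R M n) (reg_mod R)"

text \<open>
  Every module of projective dimension at most \<open>n\<close> has a projective resolution of length \<open>n\<close>
  consisting of the standard resolution in degrees below \<open>n\<close> and a submodule of it in degree \<open>n\<close>,
  so that the type chosen here for the resolution is no restriction.
\<close>

definition finite_proj_dim :: "'r ring \<Rightarrow> ('r, 'm) module \<Rightarrow> bool"
  where "finite_proj_dim R M \<longleftrightarrow>
    (\<exists>(P :: nat \<Rightarrow> ('r, ('r, 'm) syz \<Rightarrow> 'r) module) d e n.
      projective_resolution R M P d e \<and> (\<forall>i>n. carrier (P i) = {\<zero>\<^bsub>P i\<^esub>}))"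


section \<open>Hom and Ext\<close>

definition hom_grp ::
  "'r ring \<Rightarrow> ('r, 'm, 'd) module_scheme \<Rightarrow> ('r, 'n, 'e) module_scheme \<Rightarrow> ('m \<Rightarrow> 'n) monoid"
  where "hom_grp R M N = \<lparr>carrier = mod_hom R M N,
    monoid.mult = (\<lambda>f g. \<lambda>x\<in>carrier M. f x \<oplus>\<^bsub>N\<^esub> g x), one = (\<lambda>x\<in>carrier M. \<zero>\<^bsub>N\<^esub>)\<rparr>"

definition Ext :: "'r ring \<Rightarrow> nat \<Rightarrow> ('r, 'm) module \<Rightarrow> ('r, 'n) module
    \<Rightarrow> ((('r, 'm) syz \<Rightarrow> 'r) \<Rightarrow> 'n) set monoid"
  where "Ext R i M N = cohomology (\<lambda>n. hom_grp R (std_res R M n) N)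
    (\<lambda>n g. compose (carrier (std_res R M (Suc n))) g (std_bd R)) i"

text \<open>For an \<open>R\<close>-\<open>S\<close>-bimodule \<open>T\<close>, the left \<open>S\<close>-module of \<open>R\<close>-homomorphisms from \<open>T\<close> to \<open>N\<close>,
  with \<open>(s f)(t) = f(t s)\<close>.\<close>

definition hom_mod :: "'r ring \<Rightarrow> ('r, 't, 's) bimodule \<Rightarrow> ('r, 'n) module \<Rightarrow> ('s, 't \<Rightarrow> 'n) module"
  where "hom_mod R T N = mk_module (hom_grp R T N) (\<lambda>s f. \<lambda>t\<in>carrier T. f (rsmult T t s))"

text \<open>Endomorphism rings use the convention \<open>s\<^sub>1 s\<^sub>2 = s\<^sub>2 \<circ> s\<^sub>1\<close>.\<close>

definition end_ring :: "'r ring \<Rightarrow> ('r, 't) module \<Rightarrow> ('t \<Rightarrow> 't) ring"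
  where "end_ring R T = \<lparr>carrier = mod_hom R T T,
    monoid.mult = (\<lambda>s\<^sub>1 s\<^sub>2. compose (carrier T) s\<^sub>2 s\<^sub>1), one = (\<lambda>t\<in>carrier T. t),
    ring.zero = (\<lambda>t\<in>carrier T. \<zero>\<^bsub>T\<^esub>), ring.add = (\<lambda>s\<^sub>1 s\<^sub>2. \<lambda>t\<in>carrier T. s\<^sub>1 t \<oplus>\<^bsub>T\<^esub> s\<^sub>2 t)\<rparr>"

definition end_bimod :: "('r, 't) module \<Rightarrow> ('r, 't, 't \<Rightarrow> 't) bimodule"
  where "end_bimod T = \<lparr>carrier = carrier T, monoid.mult = undefined, one = undefined, ring.zero = \<zero>\<^bsub>T\<^esub>,
    ring.add = ring.add T, module.smult = module.smult T, rsmult = (\<lambda>t s. s t)\<rparr>"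


section \<open>Tensor products and Tor\<close>

text \<open>\<open>T\<close> is a right \<open>S\<close>-module (encoded over \<open>opp_ring S\<close>) and \<open>M\<close> a left one; only for
  \<open>tensor_mod\<close> is \<open>T\<close> a bimodule.\<close>

definition tensor_rel :: "'s ring \<Rightarrow> ('s, 't) module \<Rightarrow> ('s, 'm) module \<Rightarrow> ('t \<times> 'm \<Rightarrow>\<^sub>0 int) set"
  where "tensor_rel S T M = generate (free_Abelian_group (carrier T \<times> carrier M))
    ({frag_of (t \<oplus>\<^bsub>T\<^esub> t', m) - frag_of (t, m) - frag_of (t', m) | t t' m.
        t \<in> carrier T \<and> t' \<in> carrier T \<and> m \<in> carrier M} \<union>
     {frag_of (t, m \<oplus>\<^bsub>M\<^esub> m') - frag_of (t, m) - frag_of (t, m') | t m m'.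
        t \<in> carrier T \<and> m \<in> carrier M \<and> m' \<in> carrier M} \<union>
     {frag_of (s \<odot>\<^bsub>T\<^esub> t, m) - frag_of (t, s \<odot>\<^bsub>M\<^esub> m) | s t m.
        s \<in> carrier S \<and> t \<in> carrier T \<and> m \<in> carrier M})"

definition tensor_grp ::
  "'s ring \<Rightarrow> ('s, 't) module \<Rightarrow> ('s, 'm) module \<Rightarrow> ('t \<times> 'm \<Rightarrow>\<^sub>0 int) set monoid"
  where "tensor_grp S T M = free_Abelian_group (carrier T \<times> carrier M) Mod tensor_rel S T M"

text \<open>The map \<open>f \<otimes> g\<close>, induced on cosets by \<open>(t, m) \<mapsto> (f t, g m)\<close>. The union is over equal cosets.\<close>

definition tensor_map ::
  "'s ring \<Rightarrow> ('s, 't) module \<Rightarrow> ('s, 'm) module \<Rightarrow> ('s, 'u) module \<Rightarrow> ('s, 'n) module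
    \<Rightarrow> ('t \<Rightarrow> 'u) \<Rightarrow> ('m \<Rightarrow> 'n) \<Rightarrow> ('t \<times> 'm \<Rightarrow>\<^sub>0 int) set \<Rightarrow> ('u \<times> 'n \<Rightarrow>\<^sub>0 int) set"
  where "tensor_map S T M T' M' f g = (\<lambda>Z\<in>carrier (tensor_grp S T M).
    \<Union>z\<in>Z. tensor_rel S T' M' #>\<^bsub>free_Abelian_group (carrier T' \<times> carrier M')\<^esub>
      frag_extend (\<lambda>(t, m). frag_of (f t, g m)) z)"

definition tensor_mod ::
  "'s ring \<Rightarrow> ('a, 't, 's) bimodule \<Rightarrow> ('s, 'm) module \<Rightarrow> ('a, ('t \<times> 'm \<Rightarrow>\<^sub>0 int) set) module"
  where "tensor_mod S T M = mk_module (tensor_grp S (right_mod T) M)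
    (\<lambda>a. tensor_map S (right_mod T) M (right_mod T) M (\<lambda>t. a \<odot>\<^bsub>T\<^esub> t) (\<lambda>m. m))"

definition Tor :: "'s ring \<Rightarrow> nat \<Rightarrow> ('s, 't) module \<Rightarrow> ('s, 'm) module
    \<Rightarrow> ((('s, 't) syz \<Rightarrow> 's) \<times> 'm \<Rightarrow>\<^sub>0 int) set set monoid"
  where "Tor S i T M = homology (\<lambda>n. tensor_grp S (std_res (opp_ring S) T n) M)
    (\<lambda>n. tensor_map S (std_res (opp_ring S) T (Suc n)) M (std_res (opp_ring S) T n) M
      (std_bd (opp_ring S)) (\<lambda>m. m)) i"


section \<open>Frobenius extensions and Wakamatsu tilting modules\<close>

text \<open>The \<open>A\<close>-\<open>R\<close>-bimodule of \<open>R\<close>-homomorphisms from \<open>A\<close> to \<open>R\<close>, with \<open>(a f)(x) = f(x a)\<close>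
  and \<open>(f r)(x) = f(x) r\<close>.\<close>

definition frob_dual :: "'r ring \<Rightarrow> 'a ring \<Rightarrow> ('r \<Rightarrow> 'a) \<Rightarrow> ('a, 'a \<Rightarrow> 'r, 'r) bimodule"
  where "frob_dual R A \<phi> =
    \<lparr>carrier = mod_hom R (res \<phi> (reg_mod A)) (reg_mod R), monoid.mult = undefined, one = undefined,
     ring.zero = (\<lambda>x\<in>carrier A. \<zero>\<^bsub>R\<^esub>),
     ring.add = (\<lambda>f g. \<lambda>x\<in>carrier A. f x \<oplus>\<^bsub>R\<^esub> g x),
     module.smult = (\<lambda>a f. \<lambda>x\<in>carrier A. f (x \<otimes>\<^bsub>A\<^esub> a)),
     rsmult = (\<lambda>f r. \<lambda>x\<in>carrier A. f x \<otimes>\<^bsub>R\<^esub> r)\<rparr>"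

definition bimod_iso ::
  "'a ring \<Rightarrow> 'r ring \<Rightarrow> ('a, 'm, 'r) bimodule \<Rightarrow> ('a, 'n, 'r) bimodule \<Rightarrow> ('m \<Rightarrow> 'n) set"
  where "bimod_iso A R M N = mod_iso A (left_mod M) (left_mod N) \<inter>
    mod_iso (opp_ring R) (right_mod M) (right_mod N)"

definition frobenius_extension :: "'r ring \<Rightarrow> 'a ring \<Rightarrow> ('r \<Rightarrow> 'a) \<Rightarrow> bool"
  where "frobenius_extension R A \<phi> \<longleftrightarrow> ring R \<and> ring A \<and> \<phi> \<in> ring_hom R A \<and>
    fin_gen R (res \<phi> (reg_mod A)) \<and> projective R (res \<phi> (reg_mod A)) \<and>
    bimod_iso A R (ext_bimod A \<phi>) (frob_dual R A \<phi>) \<noteq> {}"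

text \<open>
  Finitely generated projective modules are isomorphic to submodules of some \<open>R\<^sup>n\<close>, and modules in
  \<open>add_mod R T\<close> to submodules of some \<open>T\<^sup>n\<close>; this accounts for the types of the sequences
  \<open>P\<close> and \<open>C\<close> below.
\<close>

definition wakamatsu_tilting :: "'r ring \<Rightarrow> ('r, 't) module \<Rightarrow> bool"
  where "wakamatsu_tilting R T \<longleftrightarrow> left_module R T \<and>
    (\<exists>(P :: nat \<Rightarrow> ('r, nat \<Rightarrow> 'r) module) d e.
      projective_resolution R T P d e \<and> (\<forall>i. fin_gen R (P i))) \<and>
    (\<forall>i>0. trivial_group (Ext R i T T)) \<and>
    (\<exists>(C :: nat \<Rightarrow> ('r, nat \<Rightarrow> 't) module) e d.
      (\<forall>j. C j \<in> add_mod R T) \<and>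
      e \<in> mod_hom R (reg_mod R) (C 0) \<and> (\<forall>j. d j \<in> mod_hom R (C j) (C (Suc j))) \<and>
      \<comment> \<open>exactness of the coresolution of \<open>R\<close>\<close>
      inj_on e (carrier R) \<and>
      exact_at (reg_mod R) e (C 0) (d 0) (C 1) \<and>
      (\<forall>j. exact_at (C j) (d j) (C (Suc j)) (d (Suc j)) (C (Suc (Suc j)))) \<and>
      \<comment> \<open>exactness after applying \<open>Hom(-, T)\<close>\<close>
      (\<lambda>g. compose (carrier R) g e) ` mod_hom R (C 0) T = mod_hom R (reg_mod R) T \<and>
      (\<lambda>g. compose (carrier (C 0)) g (d 0)) ` mod_hom R (C 1) T
        = kernel (hom_grp R (C 0) T) (hom_grp R (reg_mod R) T) (\<lambda>g. compose (carrier R) g e) \<and>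
      (\<forall>j. (\<lambda>g. compose (carrier (C (Suc j))) g (d (Suc j))) ` mod_hom R (C (Suc (Suc j))) T
        = kernel (hom_grp R (C (Suc j)) T) (hom_grp R (C j) T)
            (\<lambda>g. compose (carrier (C j)) g (d j))))"

text \<open>For an \<open>R\<close>-\<open>S\<close>-bimodule \<open>T\<close>: the classes of left \<open>S\<close>-modules (resp. left \<open>R\<close>-modules) on
  which the higher Tor (resp. Ext) of \<open>T\<close> vanishes.\<close>

definition KT :: "'s ring \<Rightarrow> ('r, 't, 's) bimodule \<Rightarrow> ('s, 'm) module set"
  where "KT S T = {M. left_module S M \<and> (\<forall>i>0. trivial_group (Tor S i (right_mod T) M))}"

definition KE :: "'r ring \<Rightarrow> ('r, 't, 's) bimodule \<Rightarrow> ('r, 'n) module set"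
  where "KE R T = {N. left_module R N \<and> (\<forall>i>0. trivial_group (Ext R i (left_mod T) N))}"


section \<open>Functors between full subcategories of module categories\<close>

text \<open>
  A set of modules stands for the full subcategory it spans. Since the carriers of the modules
  in one category share a HOL type, \<open>Mod(R)\<close> appears as the category of \<open>R\<close>-modules with carrier in a
  type \<open>'m\<close>, where \<open>'m\<close> is arbitrary.
\<close>

record ('r, 'm, 's, 'n) mod_functor =
  obj :: "('r, 'm) module \<Rightarrow> ('s, 'n) module"
  arr :: "('r, 'm) module \<Rightarrow> ('r, 'm) module \<Rightarrow> ('m \<Rightarrow> 'm) \<Rightarrow> ('n \<Rightarrow> 'n)"

definition is_functor :: "'r ring \<Rightarrow> ('r, 'm) module set \<Rightarrow> 's ring \<Rightarrow> ('s, 'n) module set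
    \<Rightarrow> ('r, 'm, 's, 'n) mod_functor \<Rightarrow> bool"
  where "is_functor R C S D F \<longleftrightarrow>
    (\<forall>M\<in>C. obj F M \<in> D) \<and>
    (\<forall>M\<in>C. \<forall>N\<in>C. \<forall>f\<in>mod_hom R M N. arr F M N f \<in> mod_hom S (obj F M) (obj F N)) \<and>
    (\<forall>M\<in>C. arr F M M (\<lambda>x\<in>carrier M. x) = (\<lambda>y\<in>carrier (obj F M). y)) \<and>
    (\<forall>L\<in>C. \<forall>M\<in>C. \<forall>N\<in>C. \<forall>f\<in>mod_hom R L M. \<forall>g\<in>mod_hom R M N.
      arr F L N (compose (carrier L) g f)
        = compose (carrier (obj F L)) (arr F M N g) (arr F L M f))"

definition nat_isomorphic :: "'r ring \<Rightarrow> ('r, 'm) module set \<Rightarrow> 's ring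
    \<Rightarrow> ('r, 'm, 's, 'k) mod_functor \<Rightarrow> ('r, 'm, 's, 'l) mod_functor \<Rightarrow> bool"
  where "nat_isomorphic R C S F G \<longleftrightarrow>
    (\<exists>\<eta>. (\<forall>M\<in>C. \<eta> M \<in> mod_iso S (obj F M) (obj G M)) \<and>
      (\<forall>M\<in>C. \<forall>N\<in>C. \<forall>f\<in>mod_hom R M N. \<forall>x\<in>carrier (obj F M).
        \<eta> N (arr F M N f x) = arr G M N f (\<eta> M x)))"

definition id_functor :: "('r, 'm, 'r, 'm) mod_functor"
  where "id_functor = \<lparr>obj = (\<lambda>M. M), arr = (\<lambda>M N f. f)\<rparr>"

definition comp_functor :: "('s, 'n, 'a, 'k) mod_functor \<Rightarrow> ('r, 'm, 's, 'n) mod_functor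
    \<Rightarrow> ('r, 'm, 'a, 'k) mod_functor"  (infixr \<open>\<circ>\<^sub>F\<close> 55)
  where "G \<circ>\<^sub>F F = \<lparr>obj = (\<lambda>M. obj G (obj F M)),
    arr = (\<lambda>M N f. arr G (obj F M) (obj F N) (arr F M N f))\<rparr>"

definition tensor_functor :: "'s ring \<Rightarrow> ('a, 't, 's) bimodule
    \<Rightarrow> ('s, 'm, 'a, ('t \<times> 'm \<Rightarrow>\<^sub>0 int) set) mod_functor"
  where "tensor_functor S T = \<lparr>obj = tensor_mod S T,
    arr = (\<lambda>M N f. tensor_map S (right_mod T) M (right_mod T) N (\<lambda>t. t) f)\<rparr>"

definition hom_functor :: "'r ring \<Rightarrow> ('r, 't, 's) bimodule \<Rightarrow> ('r, 'n, 's, 't \<Rightarrow> 'n) mod_functor"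
  where "hom_functor R T = \<lparr>obj = hom_mod R T,
    arr = (\<lambda>M N f. \<lambda>g\<in>mod_hom R T M. compose (carrier T) f g)\<rparr>"

definition res_functor :: "('r \<Rightarrow> 'a) \<Rightarrow> ('a, 'm, 'r, 'm) mod_functor"
  where "res_functor \<phi> = \<lparr>obj = res \<phi>, arr = (\<lambda>M N f. f)\<rparr>"

end

theory Submission
  imports Defs
begin

text \<open>
  A Frobenius extension is given by an additive \<open>E : A \<rightarrow> R\<close> and finitely many \<open>x\<^sub>k, y\<^sub>k\<close> in \<open>A\<close> with
  \<open>a = \<Sum> \<iota> (E (a y\<^sub>k)) x\<^sub>k = \<Sum> y\<^sub>k \<iota> (E (x\<^sub>k a))\<close>.  Hence induction is both left and right adjoint to
  restriction, and \<open>U\<close> comes with a unit \<open>h : T \<rightarrow> U\<close> and a counit \<open>e : U \<rightarrow> T\<close>, \<open>R\<close>-linear maps for which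
  \<open>f \<mapsto> \<Sum> y\<^sub>k f (x\<^sub>k -)\<close> turns \<open>R\<close>-linear maps into \<open>A\<close>-linear ones.  Inducing and restricting
  resolutions and coresolutions transfers the vanishing of Ext and Tor and the Wakamatsu property.  A splitting of
  \<open>U\<close> off a power of \<open>T\<close> provides the dual bases that make \<open>b \<mapsto> e b h\<close> a Frobenius system for \<open>\<rho> : S \<rightarrow> B\<close>,
  and with respect to it the right module \<open>U\<^sub>B\<close> is induced from \<open>T\<^sub>S\<close>.

  The equivalence itself is obtained from the maps \<open>Hom(P, T) \<otimes> M \<rightarrow> Hom(P, T \<otimes> M)\<close> for finitely generated
  projective \<open>P\<close> and \<open>Hom(C, T) \<otimes> Hom(T, N) \<rightarrow> Hom(C, N)\<close> for \<open>C\<close> in \<open>add T\<close>, which are isomorphisms: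
  applied to a projective resolution of \<open>T\<close> and to the coresolution of \<open>R\<close>, they compare complexes whose
  exactness follows by dimension shifting from the finite projective dimensions.
\<close>

text \<open>Only the vanishing of Ext and Tor matters, so both are used as solvability statements
  about one resolution (\<open>extv\<close>, \<open>torv\<close>); a homotopy comparison makes them
  independent of the resolution and at the same time covers additive closures. The obstacle in the
  equivalence: \<open>Hom(C, T)\<close> is exact by hypothesis, but exactness of
  \<open>Hom(C, N)\<close> is wanted. Here finite projective dimension enters:
  \<open>Hom(C, T)\<close> is a projective resolution of T as a right S-module, so it splits from
  some degree on. As \<open>Hom(-, T)\<close> is a duality between add T and finitely generated
  projective right S-modules, a late cosyzygy of R is then a summand of a term of C, and vanishing
  of Ext descends from it. The unit is treated alike, with cocycles in \<open>Hom(P, T)\<close> and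
  Tor. Compatibility rests on uniqueness: a module with a unit and a counit as in \<open>ind\<close>
  is determined by T up to isomorphism, so it suffices to exhibit such data on the composite
  functors. Right modules are covered by opposite rings, which exchange the x and the y.\<close>

abbreviation (input) elem_carrier :: "'m => ('m, 'd) partial_object_scheme => bool"  (infix "el" 50)
  where "x el M \<equiv> x : carrier M"
abbreviation (input) add_in  ("(_ +[_] _)" [65, 0, 66] 65) where "x +[M] y \<equiv> ring.add M x y"
abbreviation (input) mult_in  ("(_ *[_] _)" [70, 0, 71] 70) where "x *[M] y \<equiv> monoid.mult M x y"
abbreviation (input) smult_in  ("(_ .[_] _)" [70, 0, 71] 70) where "r .[M] x \<equiv> module.smult M r x"
abbreviation (input) zero_in  ("0[_]" [0] 1000) where "0[M] \<equiv> ring.zero M"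
abbreviation (input) one_in  ("1[_]" [0] 1000) where "1[M] \<equiv> monoid.one M"
abbreviation (input) minus_in  ("-[_] _" [0, 81] 80) where "-[M] x \<equiv> a_inv M x"

section \<open>Additive and linear maps\<close>

definition addm :: "('m, 'd) ring_scheme => ('n, 'e) ring_scheme => ('m => 'n) => bool"
  where "addm M N f \<longleftrightarrow> abelian_group M & abelian_group N & f : carrier M \<rightarrow> carrier N &
    (ALL x:carrier M. ALL y:carrier M. f (x +[M] y) = f x +[N] f y)"

text \<open>Both module structures are bundled in, so that a single fact supplies every rewrite rule
  about a map. Unlike in \<open>mod_hom\<close>, nothing is asked of the values off the carrier:
  composites and sums of maps are plain lambda terms.\<close>

definition lin :: "('r, 'c) ring_scheme => ('r, 'm, 'd) module_scheme => ('r, 'n, 'e) module_scheme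
    => ('m => 'n) => bool"
  where "lin R M N f \<longleftrightarrow> left_module R M & left_module R N & addm M N f &
    (ALL r:carrier R. ALL x:carrier M. f (r .[M] x) = r .[N] f x)"

text \<open>The recursion looks only at the zero and the addition of \<open>M\<close>. Hence a sum
  is literally the same in \<open>M\<close>, in \<open>res\<close> of it and in its one-sided
  versions, which \<open>finsum\<close> over a record would not give by rewriting.\<close>

primrec lsum :: "('m, 'd) ring_scheme => nat => (nat => 'm) => 'm" where
  "lsum M 0 f = 0[M]"
| "lsum M (Suc n) f = lsum M n f +[M] f n"

lemma ag_simps:
  assumes "abelian_group M"
  shows "0[M] el M"
    and "[| x el M; y el M |] ==> x +[M] y el M"
    and "x el M ==> -[M] x el M"
    and "x el M ==> 0[M] +[M] x = x"
    and "x el M ==> x +[M] 0[M] = x"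
    and "x el M ==> x +[M] -[M] x = 0[M]"
    and "x el M ==> -[M] x +[M] x = 0[M]"
    and "x el M ==> -[M] (-[M] x) = x"
    and "-[M] 0[M] = 0[M]"
    and "[| x el M; y el M |] ==> -[M] (x +[M] y) = -[M] x +[M] -[M] y"
    and "[| x el M; y el M |] ==> x +[M] (-[M] x +[M] y) = y"
    and "[| x el M; y el M |] ==> -[M] x +[M] (x +[M] y) = y"
proof -
  interpret abelian_group M by fact
  show "0[M] el M"
    and "[| x el M; y el M |] ==> x +[M] y el M"
    and "x el M ==> -[M] x el M"
    and "x el M ==> 0[M] +[M] x = x"
    and "x el M ==> x +[M] 0[M] = x"
    and "x el M ==> x +[M] -[M] x = 0[M]"
    and "x el M ==> -[M] x +[M] x = 0[M]"
    and "x el M ==> -[M] (-[M] x) = x"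
    and "-[M] 0[M] = 0[M]"
    and "[| x el M; y el M |] ==> -[M] (x +[M] y) = -[M] x +[M] -[M] y"
    by (simp_all add: l_neg r_neg minus_add)
  show "[| x el M; y el M |] ==> x +[M] (-[M] x +[M] y) = y"
    and "[| x el M; y el M |] ==> -[M] x +[M] (x +[M] y) = y"
    by (simp_all add: a_assoc[symmetric] l_neg r_neg)
qed

lemma ag_ac:
  assumes "abelian_group M"
  shows "[| x el M; y el M; z el M |] ==> (x +[M] y) +[M] z = x +[M] (y +[M] z)"
    and "[| x el M; y el M |] ==> x +[M] y = y +[M] x"
    and "[| x el M; y el M; z el M |] ==> x +[M] (y +[M] z) = y +[M] (x +[M] z)"
proof -
  interpret abelian_group M by fact
  show "[| x el M; y el M; z el M |] ==> (x +[M] y) +[M] z = x +[M] (y +[M] z)"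
    and "[| x el M; y el M |] ==> x +[M] y = y +[M] x"
    and "[| x el M; y el M; z el M |] ==> x +[M] (y +[M] z) = y +[M] (x +[M] z)"
    by (simp_all add: a_ac)
qed

lemma ag_cancel:
  assumes "abelian_group M" "x el M" "y el M"
  shows "x +[M] -[M] y = 0[M] \<longleftrightarrow> x = y"
proof
  assume "x +[M] -[M] y = 0[M]"
  then have "(x +[M] -[M] y) +[M] y = y" using ag_simps[OF assms(1)] assms by simp
  then show "x = y" using assms by (simp add: ag_simps[OF assms(1)] ag_ac(1)[OF assms(1)])
qed (use assms in "simp add: ag_simps[OF assms(1)]")

lemma lmod_ag: "left_module R M ==> abelian_group M"
  and lmod_ring: "left_module R M ==> ring R"
  by (auto simp: left_module_def)

lemma ring_ag: "ring R ==> abelian_group R"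
  by (simp add: ring.is_abelian_group)

lemma lmod_simps0:
  assumes "left_module R M"
  shows "[| r el R; x el M |] ==> r .[M] x el M"
    and "[| r el R; s el R; x el M |]
          ==> (r +[R] s) .[M] x = r .[M] x +[M] s .[M] x"
    and "[| r el R; x el M; y el M |]
          ==> r .[M] (x +[M] y) = r .[M] x +[M] r .[M] y"
    and "[| r el R; s el R; x el M |]
          ==> (r *[R] s) .[M] x = r .[M] (s .[M] x)"
    and "x el M ==> 1[R] .[M] x = x"
  using left_module.smult_closed[OF assms] left_module.smult_l_distr[OF assms]
    left_module.smult_r_distr[OF assms] left_module.smult_assoc1[OF assms] left_module.smult_one[OF assms]
  by auto

lemma addmI:
  assumes "abelian_group M" "abelian_group N" "!!x. x el M ==> f x el N"
    "!!x y. [| x el M; y el M |] ==> f (x +[M] y) = f x +[N] f y"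
  shows "addm M N f"
  using assms by (auto simp: addm_def)

lemma addm_ag: "addm M N f ==> abelian_group M" "addm M N f ==> abelian_group N"
  by (simp_all add: addm_def)

lemma addm_simps:
  assumes f: "addm M N f"
  shows "x el M ==> f x el N"
    and "[| x el M; y el M |] ==> f (x +[M] y) = f x +[N] f y"
    and "f 0[M] = 0[N]"
    and "x el M ==> f (-[M] x) = -[N] f x"
proof -
  note [simp] = ag_simps[OF addm_ag(1)[OF f]] ag_simps[OF addm_ag(2)[OF f]]
  interpret N: abelian_group N by (rule addm_ag(2)[OF f])
  show cl: "x el M ==> f x el N" for x
    using f by (auto simp: addm_def)
  show ad: "[| x el M; y el M |] ==> f (x +[M] y) = f x +[N] f y" for x y
    using f by (auto simp: addm_def)
  have "f 0[M] +[N] f 0[M] = f 0[M]" using ad[of "0[M]" "0[M]"] by simp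
  then show z: "f 0[M] = 0[N]" using cl[of "0[M]"] by simp
  assume x: "x el M"
  have "f (-[M] x) +[N] f x = 0[N]" using ad[of "-[M] x" x] x z by simp
  then show "f (-[M] x) = -[N] f x" using cl x by (simp add: N.minus_equality)
qed

lemma addm_comp: "[| addm M N f; addm N L g |] ==> addm M L (%x. g (f x))"
  by (auto simp: addm_def Pi_iff)

lemma addm_id: "abelian_group M ==> addm M M (%x. x)"
  by (auto simp: addm_def)

lemma smult_addm:
  assumes "left_module R M" "r el R"
  shows "addm M M (%x. r .[M] x)"
  using assms by (auto intro!: addmI lmod_ag simp: lmod_simps0)

lemma smult_addm2:
  assumes "left_module R M" "x el M"
  shows "addm R M (%r. r .[M] x)"
  using assms by (auto intro!: addmI simp: lmod_simps0 lmod_ag ring_ag[OF lmod_ring])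

lemma lmod_simps1:
  assumes "left_module R M"
  shows "x el M ==> 0[R] .[M] x = 0[M]"
    and "r el R ==> r .[M] 0[M] = 0[M]"
    and "[| r el R; x el M |] ==> r .[M] (-[M] x) = -[M] (r .[M] x)"
    and "[| r el R; x el M |] ==> (-[R] r) .[M] x = -[M] (r .[M] x)"
  using addm_simps(3)[OF smult_addm2[OF assms, of x]] addm_simps(3)[OF smult_addm[OF assms, of r]]
    addm_simps(4)[OF smult_addm[OF assms, of r]] addm_simps(4)[OF smult_addm2[OF assms, of x]]
  by simp_all

lemmas lmod_simps = ag_simps[OF lmod_ag] lmod_simps0 lmod_simps1
lemmas lmod_ac = ag_ac[OF lmod_ag]

lemma ring_simps0:
  assumes "ring R"
  shows "1[R] el R"
    and "[| x el R; y el R |] ==> x *[R] y el R"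
    and "x el R ==> 1[R] *[R] x = x"
    and "x el R ==> x *[R] 1[R] = x"
    and "x el R ==> 0[R] *[R] x = 0[R]"
    and "x el R ==> x *[R] 0[R] = 0[R]"
    and "[| x el R; y el R; z el R |] ==> (x *[R] y) *[R] z = x *[R] (y *[R] z)"
    and "[| x el R; y el R; z el R |] ==> (x +[R] y) *[R] z = x *[R] z +[R] y *[R] z"
    and "[| x el R; y el R; z el R |] ==> x *[R] (y +[R] z) = x *[R] y +[R] x *[R] z"
proof -
  interpret ring R by fact
  show "1[R] el R"
    and "[| x el R; y el R |] ==> x *[R] y el R"
    and "x el R ==> 1[R] *[R] x = x"
    and "x el R ==> x *[R] 1[R] = x"
    and "x el R ==> 0[R] *[R] x = 0[R]"
    and "x el R ==> x *[R] 0[R] = 0[R]"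
    and "[| x el R; y el R; z el R |] ==> (x *[R] y) *[R] z = x *[R] (y *[R] z)"
    and "[| x el R; y el R; z el R |] ==> (x +[R] y) *[R] z = x *[R] z +[R] y *[R] z"
    and "[| x el R; y el R; z el R |] ==> x *[R] (y +[R] z) = x *[R] y +[R] x *[R] z"
    by (simp_all add: m_assoc l_distr r_distr)
qed

lemmas ring_rules = ag_simps[OF ring_ag] ring_simps0

lemma lmodI:
  assumes "ring R" "abelian_group M"
    "!!r x. [| r el R; x el M |] ==> r .[M] x el M"
    "!!r s x. [| r el R; s el R; x el M |]
          ==> (r +[R] s) .[M] x = r .[M] x +[M] s .[M] x"
    "!!r x y. [| r el R; x el M; y el M |]
          ==> r .[M] (x +[M] y) = r .[M] x +[M] r .[M] y"
    "!!r s x. [| r el R; s el R; x el M |]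
          ==> (r *[R] s) .[M] x = r .[M] (s .[M] x)"
    "!!x. x el M ==> 1[R] .[M] x = x"
  shows "left_module R M"
  using assms by (simp add: left_module_def left_module_axioms_def)

subsection \<open>Linear maps\<close>

lemma linI:
  assumes "left_module R M" "left_module R N" "!!x. x el M ==> f x el N"
    "!!x y. [| x el M; y el M |] ==> f (x +[M] y) = f x +[N] f y"
    "!!r x. [| r el R; x el M |] ==> f (r .[M] x) = r .[N] f x"
  shows "lin R M N f"
  using assms by (auto simp: lin_def intro!: addmI lmod_ag)

lemma lin_mod: "lin R M N f ==> left_module R M" "lin R M N f ==> left_module R N"
  and lin_addm: "lin R M N f ==> addm M N f"
  by (auto simp: lin_def)

lemma lin_smult: "[| lin R M N f; r el R; x el M |] ==> f (r .[M] x) = r .[N] f x"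
  by (auto simp: lin_def)

lemmas lin_simps = addm_simps[OF lin_addm] lin_smult
lemmas lin_closed = addm_simps(1)[OF lin_addm]

lemma lin_comp: "[| lin R M N f; lin R N L g |] ==> lin R M L (%x. g (f x))"
  by (auto simp: lin_def intro: addm_comp dest: addm_simps(1))

lemma lin_id: "left_module R M ==> lin R M M (%x. x)"
  by (auto simp: lin_def addm_id lmod_ag)

lemma lin_zero: "[| left_module R M; left_module R N |] ==> lin R M N (%x. 0[N])"
  by (auto intro!: linI simp: lmod_simps)

lemma lin_add:
  assumes "lin R M N f" "lin R M N g"
  shows "lin R M N (%x. f x +[N] g x)"
proof -
  note [simp] = lmod_simps[OF lin_mod(1)[OF assms(1)]] lmod_simps[OF lin_mod(2)[OF assms(1)]]
    lin_simps[OF assms(1)] lin_simps[OF assms(2)] lmod_ac[OF lin_mod(2)[OF assms(1)]]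
  show ?thesis
    by (rule linI) (auto simp: lin_mod[OF assms(1)])
qed

lemma lin_neg:
  assumes "lin R M N f"
  shows "lin R M N (%x. -[N] f x)"
proof -
  note [simp] = lmod_simps[OF lin_mod(1)[OF assms(1)]] lmod_simps[OF lin_mod(2)[OF assms(1)]]
    lin_simps[OF assms(1)]
  show ?thesis
    by (rule linI) (auto simp: lin_mod[OF assms(1)])
qed

lemma lin_cong:
  assumes "lin R M N f" "!!x. x el M ==> f x = g x"
  shows "lin R M N g"
proof -
  note [simp] = lmod_simps[OF lin_mod(1)[OF assms(1)]] assms(2)[symmetric] lin_simps[OF assms(1)]
  show ?thesis
    by (rule linI) (auto simp: lin_mod[OF assms(1)])
qed

lemma mod_hom_lin: "[| f : mod_hom R M N; left_module R M; left_module R N |] ==> lin R M N f"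
  by (auto simp: mod_hom_def intro!: linI)

lemma mod_homD: "f : mod_hom R M N ==> f : extensional (carrier M)"
  by (auto simp: mod_hom_def PiE_def)

lemma mod_homI: "[| lin R M N f; f : extensional (carrier M) |] ==> f : mod_hom R M N"
  by (auto simp: mod_hom_def PiE_def lin_simps)

lemma restrict_mod_hom: "lin R M N f ==> restrict f (carrier M) : mod_hom R M N"
  by (frule lin_mod) (auto simp: mod_hom_def lin_simps lmod_simps)

subsection \<open>Finite sums\<close>

text \<open>As a congruence rule it lets the simplifier use the bound on the index inside the
  summand; retraction data such as \<open>p k\<close> and \<open>q k\<close> is linear only below
  that bound.\<close>

lemma lsum_cong [cong]:
  "[| M = M'; n = m; !!k. k < m =simp=> f k = g k |] ==> lsum M n f = lsum M' m g"
  unfolding simp_implies_def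
  by (induction n arbitrary: M' m) auto

lemma lsum_closed:
  assumes "abelian_group M" "!!k. k < n ==> f k el M"
  shows "lsum M n f el M"
  using assms(2) by (induction n) (auto simp: ag_simps[OF assms(1)])

lemma lsum_zero: "abelian_group M ==> lsum M n (%k. 0[M]) = 0[M]"
  by (induction n) (auto simp: ag_simps)

lemma lsum_add:
  assumes "abelian_group M" "!!k. k < n ==> f k el M" "!!k. k < n ==> g k el M"
  shows "lsum M n (%k. f k +[M] g k) = lsum M n f +[M] lsum M n g"
  using assms(2,3)
  by (induction n) (simp_all add: ag_simps[OF assms(1)] ag_ac[OF assms(1)] lsum_closed[OF assms(1)])

lemma addm_lsum:
  assumes "addm M N f" "!!k. k < n ==> x k el M"
  shows "f (lsum M n x) = lsum N n (%k. f (x k))"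
  using assms(2)
  by (induction n) (simp_all add: addm_simps[OF assms(1)] lsum_closed addm_ag[OF assms(1)])

lemmas lin_lsum_apply = addm_lsum[OF lin_addm]
lemmas lsum_smult = addm_lsum[OF smult_addm2]

lemma lsum_swap:
  assumes "abelian_group M" "!!i j. [| i < m; j < n |] ==> f i j el M"
  shows "lsum M m (%i. lsum M n (%j. f i j)) = lsum M n (%j. lsum M m (%i. f i j))"
  using assms(2)
  by (induction m)
    (simp_all add: lsum_zero[OF assms(1)] lsum_add[OF assms(1)] lsum_closed[OF assms(1)])

lemma lsum_delta:
  assumes "abelian_group M" "j < n" "x el M" "!!k. [| k < n; k ~= j |] ==> f k = 0[M]" "f j = x"
  shows "lsum M n f = x"
  using assms(2-)
proof (induction n)
  case (Suc n)
  show ?case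
  proof (cases "j = n")
    case True
    then have "lsum M n f = lsum M n (%k. 0[M])" using Suc by (intro lsum_cong) (auto simp: simp_implies_def)
    then show ?thesis using True Suc by (simp add: lsum_zero[OF assms(1)] ag_simps[OF assms(1)])
  next
    case False
    then show ?thesis using Suc by (simp add: ag_simps[OF assms(1)])
  qed
qed simp

lemma lin_lsum:
  assumes "left_module R M" "left_module R N" "!!k. k < n ==> lin R M N (f k)"
  shows "lin R M N (%x. lsum N n (%k. f k x))"
  using assms(3) by (induction n) (auto intro: lin_zero lin_add assms)

section \<open>Basic modules\<close>

lemma reg_mod_simps [simp]:
  "carrier (reg_mod R) = carrier R" "ring.zero (reg_mod R) = 0[R]" "ring.add (reg_mod R) = ring.add R"
  "module.smult (reg_mod R) = monoid.mult R"
  by (simp_all add: reg_mod_def)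

lemma res_simps [simp]:
  "carrier (res \<phi> M) = carrier M" "ring.zero (res \<phi> M) = 0[M]" "ring.add (res \<phi> M) = ring.add M"
  "module.smult (res \<phi> M) = (%r x. \<phi> r .[M] x)"
  by (simp_all add: res_def)

lemma left_mod_simps [simp]:
  "carrier (left_mod M) = carrier M" "ring.zero (left_mod M) = 0[M]" "ring.add (left_mod M) = ring.add M"
  "module.smult (left_mod M) = module.smult M"
  by (simp_all add: left_mod_def)

lemma right_mod_simps [simp]:
  "carrier (right_mod M) = carrier M" "ring.zero (right_mod M) = 0[M]" "ring.add (right_mod M) = ring.add M"
  "module.smult (right_mod M) = (%s t. rsmult M t s)"
  by (simp_all add: right_mod_def)

lemma opp_ring_simps [simp]:
  "carrier (opp_ring S) = carrier S" "ring.zero (opp_ring S) = 0[S]" "ring.add (opp_ring S) = ring.add S"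
  "monoid.one (opp_ring S) = 1[S]" "monoid.mult (opp_ring S) = (%x y. y *[S] x)"
  by (simp_all add: opp_ring_def)

text \<open>The axioms of an abelian group see only carrier, zero and addition, so they pass between
  the many records (regular, restricted, one-sided modules) that share these fields.\<close>

lemma ag_same:
  assumes "abelian_group M" "carrier N = carrier M" "ring.zero N = 0[M]" "ring.add N = ring.add M"
  shows "abelian_group N"
  using abelian_groupE[OF assms(1)] by (auto intro!: abelian_groupI simp: assms(2-4))

lemma lsum_same: "[| ring.zero N = 0[M]; ring.add N = ring.add M |] ==> lsum N n f = lsum M n f"
  by (induction n) auto

lemma reg_mod_lmod:
  assumes R: "ring R" shows "left_module R (reg_mod R)"
  by (rule lmodI[OF R ag_same[OF ring_ag[OF R]]]) (auto simp: ring_rules[OF R])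

lemma a_inv_same:
  assumes "carrier N = carrier M" "ring.zero N = 0[M]" "ring.add N = ring.add M"
  shows "-[N] x = -[M] x"
  by (simp add: a_inv_def m_inv_def assms)

lemma same_simps [simp]:
  "lsum (reg_mod R) n f = lsum R n f" "lsum (res \<phi> M) n g = lsum M n g"
  "-[res \<phi> M] y = -[M] y" "-[reg_mod R] x = -[R] x"
  by (rule lsum_same a_inv_same; simp)+

lemma res_lmod:
  assumes "ring R" "\<phi> : ring_hom R A" "left_module A M"
  shows "left_module R (res \<phi> M)"
proof -
  note [simp] = lmod_simps[OF assms(3)] ring_hom_closed[OF assms(2)] ring_hom_mult[OF assms(2)]
    ring_hom_add[OF assms(2)] ring_hom_one[OF assms(2)]
  show ?thesis
    by (rule lmodI) (auto simp: assms(1) intro: ag_same[OF lmod_ag[OF assms(3)]])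
qed

lemma res_lin:
  assumes "ring R" "\<phi> : ring_hom R A" "lin A M N f"
  shows "lin R (res \<phi> M) (res \<phi> N) f"
  by (intro linI)
    (simp_all add: lin_simps[OF assms(3)] ring_hom_closed[OF assms(2)]
      res_lmod[OF assms(1,2) lin_mod(1)[OF assms(3)]] res_lmod[OF assms(1,2) lin_mod(2)[OF assms(3)]])

lemma opp_ring: "ring S ==> ring (opp_ring S)"
proof -
  assume S: "ring S"
  interpret ring S by fact
  show ?thesis
    by (rule ringI) (auto simp: l_distr r_distr m_assoc intro: ag_same[OF ring_ag[OF S]] intro!: monoidI)
qed

lemma opp_opp [simp]: "opp_ring (opp_ring S) = S"
  by (simp add: opp_ring_def)

lemma ring_hom_opp: "\<phi> : ring_hom R A ==> \<phi> : ring_hom (opp_ring R) (opp_ring A)"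
  by (auto simp: ring_hom_def)

subsection \<open>Submodules\<close>

lemma submod_lmod:
  assumes M: "left_module R M" and K: "K \<subseteq> carrier M" "0[M] : K"
    "!!x y. [| x : K; y : K |] ==> x +[M] y : K" "!!r x. [| r el R; x : K |] ==> r .[M] x : K"
  shows "left_module R (M\<lparr>carrier := K\<rparr>)"
proof -
  note [simp] = lmod_simps[OF M]
  have KM: "x : K ==> x el M" for x using K by auto
  \<comment> \<open>Closure under negatives is not a hypothesis: it comes from the action of the
    scalar -1.\<close>
  have neg: "-[M] x : K" if "x : K" for x
    using K(4)[of "-[R] 1[R]" x] that KM by (simp add: ring_rules[OF lmod_ring[OF M]])
  have "abelian_group (M\<lparr>carrier := K\<rparr>)"
  proof (rule abelian_groupI)
    show "EX y:carrier (M\<lparr>carrier := K\<rparr>). y +[M\<lparr>carrier := K\<rparr>] x = 0[M\<lparr>carrier := K\<rparr>]"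
      if "x el (M\<lparr>carrier := K\<rparr>)" for x
      using that KM neg by (intro bexI[of _ "-[M] x"]) auto
  qed (auto simp: K KM lmod_ac[OF M])
  then show ?thesis
    by (rule lmodI[OF lmod_ring[OF M]]) (auto simp: K KM)
qed

lemma lin_sub_into: "[| lin R L M f; left_module R (M\<lparr>carrier := K\<rparr>); !!x. x el L ==> f x : K |]
    ==> lin R L (M\<lparr>carrier := K\<rparr>) f"
  by (intro linI) (auto simp: lin_simps dest: lin_mod)

lemma lin_sub_from: "[| lin R M N f; left_module R (M\<lparr>carrier := K\<rparr>); K \<subseteq> carrier M |]
    ==> lin R (M\<lparr>carrier := K\<rparr>) N f"
  by (intro linI) (auto simp: lin_simps subset_iff dest: lin_mod)

lemma ker_lmod:
  assumes f: "lin R M N f" shows "left_module R (M\<lparr>carrier := {x : carrier M. f x = 0[N]}\<rparr>)"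
  by (rule submod_lmod)
    (auto simp: lin_simps[OF f] lmod_simps[OF lin_mod(1)[OF f]] lmod_simps[OF lin_mod(2)[OF f]] lin_mod[OF f])

lemma img_lmod:
  assumes "lin R M N f" shows "left_module R (N\<lparr>carrier := f ` carrier M\<rparr>)"
proof (rule submod_lmod)
  note [simp] = lin_simps[OF assms] lmod_simps[OF lin_mod(1)[OF assms]]
  show "left_module R N" by (rule lin_mod(2)[OF assms])
  show "f ` carrier M \<subseteq> carrier N" by auto
  show "0[N] : f ` carrier M" by (rule image_eqI[of _ _ "0[M]"]) auto
  show "x +[N] y : f ` carrier M" if "x : f ` carrier M" "y : f ` carrier M" for x y
  proof -
    from that obtain a b where "a el M" "b el M" "x = f a" "y = f b" by auto
    then show ?thesis by (intro image_eqI[of _ _ "a +[M] b"]) auto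
  qed
  show "r .[N] x : f ` carrier M" if "r el R" "x : f ` carrier M" for r x
  proof -
    from that obtain a where "a el M" "x = f a" by auto
    then show ?thesis using that by (intro image_eqI[of _ _ "r .[M] a"]) auto
  qed
qed

text \<open>The value of \<open>g\<close> is that of \<open>f\<close> at an arbitrarily chosen
  preimage under \<open>p\<close>; two preimages differ by an element killed by \<open>p\<close>,
  hence by \<open>f\<close>, so the choice does not matter.\<close>

lemma lin_factor:
  assumes p: "lin R M L p" and f: "lin R M N f" and surj: "p ` carrier M = carrier L"
    and ker: "!!x. [| x el M; p x = 0[L] |] ==> f x = 0[N]"
  shows "EX g. lin R L N g & (ALL x:carrier M. g (p x) = f x)"
proof -
  note M = lin_mod(1)[OF p] and L = lin_mod(2)[OF p] and N = lin_mod(2)[OF f]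
  note [simp] = lmod_simps[OF M] lmod_simps[OF L] lmod_simps[OF N] lin_simps[OF p] lin_simps[OF f]
  have wd: "f x = f y" if "x el M" "y el M" "p x = p y" for x y
  proof -
    have "f (x +[M] -[M] y) = 0[N]" by (rule ker) (use that in auto)
    then show ?thesis using that by (simp add: ag_cancel[OF lmod_ag[OF N]])
  qed
  define g where "g = (%y. f (SOME x. x el M & p x = y))"
  have g: "g (p x) = f x" if "x el M" for x
  proof -
    have "(SOME z. z el M & p z = p x) el M & p (SOME z. z el M & p z = p x) = p x"
      by (rule someI[of _ x]) (simp add: that)
    then show ?thesis unfolding g_def by (intro wd that) simp_all
  qed
  have ex: "EX x:carrier M. p x = y" if "y el L" for y using that unfolding surj[symmetric] by auto
  have "lin R L N g"
  proof (rule linI[OF L N])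
    show "g x el N" if "x el L" for x using ex[OF that] g by auto
    show "g (x +[L] y) = g x +[N] g y" if "x el L" "y el L" for x y
    proof -
      from ex that obtain a b where ab: "a el M" "b el M" "p a = x" "p b = y" by metis
      then have "g (p (a +[M] b)) = f (a +[M] b)" by (intro g) auto
      then show ?thesis using ab g by auto
    qed
    show "g (r .[L] x) = r .[N] g x" if "r el R" "x el L" for r x
    proof -
      from ex that obtain a where ab: "a el M" "p a = x" by metis
      then have "g (p (r .[M] a)) = f (r .[M] a)" using that by (intro g) auto
      then show ?thesis using ab g that by auto
    qed
  qed
  then show ?thesis using g by auto
qed

section \<open>Direct sums and free modules\<close>

lemma dsum_simps [simp]:
  "carrier (dsum M N) = carrier M \<times> carrier N" "ring.zero (dsum M N) = (0[M], 0[N])"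
  "ring.add (dsum M N) (x, y) (x', y') = (x +[M] x', y +[N] y')"
  "module.smult (dsum M N) r (x, y) = (r .[M] x, r .[N] y)"
  by (simp_all add: dsum_def)

lemma dsum_lmod:
  assumes M: "left_module R M" and N: "left_module R N"
  shows "left_module R (dsum M N)"
proof -
  note [simp] = lmod_simps[OF M] lmod_simps[OF N] lmod_ac[OF M] lmod_ac[OF N]
  have "abelian_group (dsum M N)"
  proof (rule abelian_groupI)
    show "EX y:carrier (dsum M N). y +[dsum M N] x = 0[dsum M N]" if "x el (dsum M N)" for x
      using that by (intro bexI[of _ "(-[M] fst x, -[N] snd x)"]) auto
  qed auto
  then show ?thesis by (intro lmodI lmod_ring[OF M]) auto
qed

lemma lin_fst: "[| left_module R M; left_module R N |] ==> lin R (dsum M N) M fst"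
  and lin_snd: "[| left_module R M; left_module R N |] ==> lin R (dsum M N) N snd"
  and lin_inl: "[| left_module R M; left_module R N |] ==> lin R M (dsum M N) (%x. (x, 0[N]))"
  and lin_inr: "[| left_module R M; left_module R N |] ==> lin R N (dsum M N) (%y. (0[M], y))"
  by (rule linI; auto simp: dsum_lmod lmod_simps)+

lemma copies_carrier:
  "carrier (copies I M) = {f. (ALL x. f x el M) & (ALL x. x \<notin> I --> f x = 0[M]) & finite {x. f x ~= 0[M]}}"
  by (simp add: copies_def)

lemma copies_simps [simp]:
  "ring.zero (copies I M) = (%x. 0[M])"
  "ring.add (copies I M) = (%f g x. f x +[M] g x)"
  "module.smult (copies I M) = (%r f x. r .[M] f x)"
  by (simp_all add: copies_def)

lemma copies_lmod:
  fixes I :: "'x set"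
  assumes M: "left_module R M"
  shows "left_module R (copies I M)"
proof -
  note [simp] = lmod_simps[OF M] lmod_ac[OF M] copies_carrier
  have fin: "finite {x. f x +[M] g x ~= 0[M]}"
    if "finite {x. f x ~= 0[M]}" "finite {x. g x ~= 0[M]}" for f g :: "'x => _"
    by (rule finite_subset[of _ "{x. f x ~= 0[M]} \<union> {x. g x ~= 0[M]}"]) (use that in auto)
  have fin2: "finite {x. -[M] f x ~= 0[M]}" "r el R ==> finite {x. r .[M] f x ~= 0[M]}"
    if "finite {x. f x ~= 0[M]}" for f :: "'x => _" and r
    by (rule finite_subset[of _ "{x. f x ~= 0[M]}"]; use that in auto)+
  have "abelian_group (copies I M)"
  proof (rule abelian_groupI)
    show "EX g:carrier (copies I M). g +[copies I M] f = 0[copies I M]" if "f el (copies I M)" for f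
      using that by (intro bexI[of _ "%x. -[M] f x"]) (auto simp: fin2)
  qed (auto simp: fin)
  then show ?thesis
    by (intro lmodI lmod_ring[OF M]) (auto simp: fin fin2)
qed

lemma lin_coord: "left_module R M ==> lin R (copies I M) M (%f. f i)"
  by (rule linI) (auto simp: copies_lmod copies_carrier)

section \<open>Unit vectors, induction on the support, maps out of free modules\<close>

definition dlt :: "('m, 'd) ring_scheme => 'x => 'm => 'x => 'm"
  where "dlt M i x = (%j. if j = i then x else 0[M])"

lemma dlt_same [simp]: "dlt M i x i = x" and dlt_other: "j ~= i ==> dlt M i x j = 0[M]"
  by (simp_all add: dlt_def)

lemma lin_dlt:
  assumes M: "left_module R M" and "i : I"
  shows "lin R M (copies I M) (dlt M i)"
proof -
  note [simp] = lmod_simps[OF M]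
  have "finite {j. dlt M i x j ~= 0[M]}" for x
    by (rule finite_subset[of _ "{i}"]) (auto simp: dlt_def)
  then show ?thesis using assms
    by (intro linI copies_lmod) (auto simp: dlt_def fun_eq_iff copies_carrier)
qed

abbreviation free_mod :: "'x set => 'r ring => ('r, 'x => 'r) module"
  where "free_mod I R \<equiv> copies I (reg_mod R)"

lemma free_lmod: "ring R ==> left_module R (free_mod I R)"
  by (intro copies_lmod reg_mod_lmod)

lemma dlt_reg: "dlt (reg_mod R) i = dlt R i"
  by (simp add: dlt_def fun_eq_iff)

lemma dlt_free: "[| ring R; i : I; r el R |] ==> dlt R i r el (free_mod I R)"
  using lin_closed[OF lin_dlt[OF reg_mod_lmod, of R i I], of r]
  by (simp add: dlt_reg)

text \<open>Induction on the size of the support. Peeling off the coordinate \<open>b\<close> leaves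
  a vector that vanishes at \<open>b\<close>.\<close>

lemma free_induct [consumes 2, case_names zero add]:
  assumes R: "ring R" and "x el (free_mod I R)" and z: "P (%_. 0[R])"
    and step: "!!b r y. [| b : I; r el R; y el (free_mod I R); P y; y b = 0[R] |]
      ==> P (%c. r *[R] dlt R b 1[R] c +[R] y c)"
  shows "P x"
proof -
  note [simp] = ring_rules[OF R] copies_carrier
  have "finite A ==> x el (free_mod I R) ==> {b. x b ~= 0[R]} = A ==> P x" for A x
  proof (induction A arbitrary: x rule: finite_induct)
    case empty
    then have "x = (%_. 0[R])" by auto
    then show ?case using z by simp
  next
    case (insert b A)
    define y where "y = x(b := 0[R])"
    have bI: "b : I" "x b el R" using insert by auto
    have supp: "{c. y c ~= 0[R]} = A" using insert by (auto simp: y_def)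
    have y: "y el (free_mod I R)" using insert supp by (auto simp: y_def)
    have "x = (%c. x b *[R] dlt R b 1[R] c +[R] y c)"
      using bI insert.prems by (auto simp: fun_eq_iff y_def dlt_def)
    moreover have "P (%c. x b *[R] dlt R b 1[R] c +[R] y c)"
      by (rule step[OF bI y insert.IH[OF y supp]]) (simp add: y_def)
    ultimately show ?case by simp
  qed
  then show ?thesis using assms(2) by auto
qed

lemma free_eqI:
  assumes g: "lin R (free_mod I R) N g" and h: "lin R (free_mod I R) N h"
    and eq: "!!b. b : I ==> g (dlt R b 1[R]) = h (dlt R b 1[R])" and x: "x el (free_mod I R)"
  shows "g x = h x"
proof -
  note R = lmod_ring[OF lin_mod(1)[OF g]]
  show ?thesis using R x
  proof (induction x rule: free_induct)
    case zero
    show ?case using lin_simps(3)[OF g] lin_simps(3)[OF h] by simp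
  next
    case (add b r y)
    let ?d = "dlt R b 1[R]"
    have d: "?d el (free_mod I R)" by (rule dlt_free[OF R add(1)]) (simp add: ring_rules[OF R])
    have rd: "r .[free_mod I R] ?d el (free_mod I R)"
      by (rule lmod_simps(13)[OF lin_mod(1)[OF g] add(2) d])
    have "g ((r .[free_mod I R] ?d) +[free_mod I R] y) = h ((r .[free_mod I R] ?d) +[free_mod I R] y)"
      using lin_simps(2)[OF g rd add(3)] lin_simps(2)[OF h rd add(3)] lin_simps(5)[OF g add(2) d]
        lin_simps(5)[OF h add(2) d] add eq by simp
    then show ?case by simp
  qed
qed

text \<open>The map out of a free module that sends the basis vector at \<open>b\<close> to
  \<open>w b\<close>; \<open>std_aug\<close> is the instance with \<open>syz_elt\<close>.\<close>

definition ev :: "'r ring => ('r, 'm, 'd) module_scheme => ('x => 'm) => ('x => 'r) => 'm"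
  where "ev R M w f = (\<Oplus>\<^bsub>M\<^esub>b\<in>{b. f b ~= 0[R]}. f b .[M] w b)"

lemma addm_finsum:
  assumes f: "addm M N f" and "finite A" and "x : A \<rightarrow> carrier M"
  shows "f (finsum M x A) = finsum N (%a. f (x a)) A"
proof -
  interpret M: abelian_group M by (rule addm_ag[OF f])
  interpret N: abelian_group N by (rule addm_ag[OF f])
  show ?thesis using assms(2,3)
    by (induction A rule: finite_induct) (simp_all add: addm_simps[OF f] Pi_iff)
qed

lemma ev_lin:
  assumes M: "left_module R M" and w: "!!b. b : I ==> w b el M"
  shows "lin R (free_mod I R) M (ev R M w)"
    and "b : I ==> ev R M w (dlt R b 1[R]) = w b"
proof -
  let ?F = "free_mod I R"
  note R = lmod_ring[OF M]
  interpret M: abelian_group M by (rule lmod_ag[OF M])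
  note [simp] = ring_rules[OF R] lmod_simps[OF M] w copies_carrier
  \<comment> \<open>The support of a sum or of a multiple can shrink, so linearity is checked on
    sums over a common finite set that contains all supports involved.\<close>
  have sup: "ev R M w f = (\<Oplus>\<^bsub>M\<^esub>b\<in>B. f b .[M] w b)"
    if "f el ?F" "finite B" "B \<subseteq> I" "{b. f b ~= 0[R]} \<subseteq> B" for f B
    unfolding ev_def
  proof (rule M.add.finprod_mono_neutral_cong_left)
    show "f i .[M] w i = 0[M]" if "i : B - {b. f b ~= 0[R]}" for i
      using that \<open>B \<subseteq> I\<close> by auto
    show "(%b. f b .[M] w b) : B \<rightarrow> carrier M" using that by (auto simp: subset_iff)
  qed (use that in auto)
  have supI: "{b. f b ~= 0[R]} \<subseteq> I" "finite {b. f b ~= 0[R]}" if "f el ?F" for f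
    using that by auto
  show "lin R ?F M (ev R M w)"
  proof (rule linI[OF free_lmod[OF R] M])
    fix f assume f: "f el ?F"
    let ?B = "{b. f b ~= 0[R]}"
    show "ev R M w f el M"
      unfolding ev_def using f by (intro M.finsum_closed) (auto intro!: lmod_simps[OF M] w)
    {
      fix r assume r: "r el R"
      have rf: "r .[free_mod I R] f el ?F"
        using lmod_simps(13)[OF free_lmod[OF R] r f] .
      have "ev R M w (r .[free_mod I R] f) = (\<Oplus>\<^bsub>M\<^esub>b\<in>?B. (r *[R] f b) .[M] w b)"
        by (subst sup[OF rf supI(2,1)[OF f]]) (use r in auto)
      also have "\<dots> = (\<Oplus>\<^bsub>M\<^esub>b\<in>?B. r .[M] (f b .[M] w b))"
        using f r supI[OF f] by (intro M.finsum_cong') (auto intro!: w lmod_simps[OF M])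
      also have "\<dots> = r .[M] ev R M w f"
        unfolding ev_def using f supI[OF f] by (subst addm_finsum[OF smult_addm[OF M r]]) auto
      finally show "ev R M w (r .[free_mod I R] f) = r .[M] ev R M w f" .
    }
    fix g assume g: "g el ?F"
    let ?C = "?B \<union> {b. g b ~= 0[R]}"
    have C: "finite ?C" "?C \<subseteq> I" using f g by auto
    have fg: "f +[free_mod I R] g el ?F"
      using lmod_simps(2)[OF free_lmod[OF R] f g] .
    have cl: "(%b. f b .[M] w b) : ?C \<rightarrow> carrier M" "(%b. g b .[M] w b) : ?C \<rightarrow> carrier M"
      using f g C by (auto intro!: w lmod_simps[OF M])
    have "ev R M w (f +[free_mod I R] g) = (\<Oplus>\<^bsub>M\<^esub>b\<in>?C. (f b +[R] g b) .[M] w b)"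
      by (subst sup[OF fg C]) auto
    also have "\<dots> = (\<Oplus>\<^bsub>M\<^esub>b\<in>?C. f b .[M] w b +[M] g b .[M] w b)"
      using f g C by (intro M.finsum_cong') (auto intro!: w lmod_simps[OF M])
    also have "\<dots> = ev R M w f +[M] ev R M w g"
      using sup[OF f C] sup[OF g C] M.finsum_addf[OF cl] by auto
    finally show "ev R M w (f +[free_mod I R] g) = ev R M w f +[M] ev R M w g" .
  qed
  assume b: "b : I"
  have "ev R M w (dlt R b 1[R]) = (\<Oplus>\<^bsub>M\<^esub>c\<in>{b}. dlt R b 1[R] c .[M] w c)"
    by (rule sup) (use b dlt_free[OF R b] in "auto simp: dlt_def")
  then show "ev R M w (dlt R b 1[R]) = w b" using b by simp
qed

section \<open>Direct summands and projective modules\<close>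

lemma lin_inv:
  assumes f: "lin R M N f" and b: "bij_betw f (carrier M) (carrier N)"
  shows "lin R N M (inv_into (carrier M) f)"
proof -
  note [simp] = lin_simps[OF f] lmod_simps[OF lin_mod(1)[OF f]] lmod_simps[OF lin_mod(2)[OF f]]
  have inj: "inj_on f (carrier M)" and im: "f ` carrier M = carrier N" using b by (auto simp: bij_betw_def)
  have cl: "inv_into (carrier M) f x el M" if "x el N" for x
    using that inv_into_into[of x f "carrier M"] im by auto
  have fi: "f (inv_into (carrier M) f x) = x" if "x el N" for x
    using that f_inv_into_f[of x f "carrier M"] im by auto
  have eqI: "x = y" if "x el M" "y el M" "f x = f y" for x y
    using that inj by (auto simp: inj_on_def)
  show ?thesis
    by (intro linI lin_mod[OF f] cl eqI; simp add: cl fi)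
qed

lemma mod_isoI:
  assumes "lin R M N f" "!!x. [| x el M; f x = 0[N] |] ==> x = 0[M]"
    "!!y. y el N ==> EX x:carrier M. f x = y"
  shows "restrict f (carrier M) : mod_iso R M N"
proof -
  note M = lmod_simps[OF lin_mod(1)[OF assms(1)]] and N = lmod_simps[OF lin_mod(2)[OF assms(1)]]
  have "inj_on f (carrier M)"
  proof (rule inj_onI)
    fix x y assume xy: "x el M" "y el M" "f x = f y"
    then have "f (x +[M] -[M] y) = 0[N]" by (simp add: lin_simps[OF assms(1)] M N)
    then have "x +[M] -[M] y = 0[M]" using xy M assms(2) by simp
    then show "x = y" using xy ag_cancel[OF lmod_ag[OF lin_mod(1)[OF assms(1)]]] by blast
  qed
  then have "bij_betw f (carrier M) (carrier N)"
    using assms(3) by (auto simp: bij_betw_def lin_simps[OF assms(1)])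
  then show ?thesis using restrict_mod_hom[OF assms(1)] by (simp add: mod_iso_def bij_betw_restrict_eq)
qed

lemma mod_isoI_inv:
  assumes f: "lin R M N f" and "!!y. y el N ==> g y el M"
    "!!x. x el M ==> g (f x) = x" "!!y. y el N ==> f (g y) = y"
  shows "restrict f (carrier M) : mod_iso R M N"
proof -
  have "bij_betw f (carrier M) (carrier N)"
    by (rule bij_betwI[of _ _ _ g]) (use assms lin_simps[OF f] in auto)
  then show ?thesis using restrict_mod_hom[OF f] by (simp add: mod_iso_def bij_betw_restrict_eq)
qed

text \<open>The complement is the kernel of \<open>p\<close>, which lives in the type of
  \<open>M\<close> as \<open>direct_summand\<close> demands; \<open>y\<close> splits into
  \<open>i (p y)\<close> and the rest.\<close>

lemma direct_summandI:
  fixes N :: "('r, 'n) module" and M :: "('r, 'm) module"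
  assumes i: "lin R N M i" and p: "lin R M N p" and pi: "!!x. x el N ==> p (i x) = x"
  shows "direct_summand R N M"
proof -
  note M = lin_mod(2)[OF i] and N = lin_mod(1)[OF i]
  define K where "K = M\<lparr>carrier := {x : carrier M. p x = 0[N]}\<rparr>"
  have K: "left_module R K" unfolding K_def by (rule ker_lmod[OF p])
  note [simp] = lmod_simps[OF M] lmod_simps[OF N] lin_simps[OF i] lin_simps[OF p] lmod_ac[OF M] lmod_ac[OF N] pi
  have l: "lin R (dsum N K) M (%x. i (fst x) +[M] snd x)"
    by (rule linI) (auto simp: dsum_lmod[OF N K] M, auto simp: K_def)
  have "restrict (%x. i (fst x) +[M] snd x) (carrier (dsum N K)) : mod_iso R (dsum N K) M"
    by (rule mod_isoI_inv[OF l, where g = "%y. (p y, y +[M] -[M] i (p y))"]) (auto simp: K_def)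
  then show ?thesis unfolding direct_summand_def using M N K by blast
qed

lemma direct_summandE:
  assumes "direct_summand R N M"
  obtains i p where "lin R N M i" "lin R M N p" "!!x. x el N ==> p (i x) = x"
proof -
  from assms obtain K :: "('a, 'c) module" and t where N: "left_module R N" and M: "left_module R M"
    and K: "left_module R K" and t: "t : mod_iso R (dsum N K) M" by (auto simp: direct_summand_def)
  have tl: "lin R (dsum N K) M t" and b: "bij_betw t (carrier (dsum N K)) (carrier M)"
    using t mod_hom_lin[OF _ dsum_lmod[OF N K] M] by (auto simp: mod_iso_def)
  show thesis
  proof
    show "lin R N M (%x. t (x, 0[K]))" by (rule lin_comp[OF lin_inl[OF N K] tl])
    show "lin R M N (%y. fst (inv_into (carrier (dsum N K)) t y))"
      by (rule lin_comp[OF lin_inv[OF tl b] lin_fst[OF N K]])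
    show "fst (inv_into (carrier (dsum N K)) t (t (x, 0[K]))) = x" if "x el N" for x
      using that bij_betw_inv_into_left[OF b] by (auto simp: lmod_simps[OF K])
  qed
qed

lemma proj_lmod: "projective R P ==> left_module R P"
  by (simp add: projective_def)

lemma free_lift:
  assumes f: "lin R (free_mod I R) N f" and g: "lin R E N g"
    and im: "!!x. x el (free_mod I R) ==> f x : g ` carrier E"
  shows "EX h. lin R (free_mod I R) E h & (ALL x:carrier (free_mod I R). g (h x) = f x)"
proof -
  note E = lin_mod(1)[OF g]
  note R = lmod_ring[OF E]
  have "ALL b:I. EX e:carrier E. g e = f (dlt R b 1[R])"
  proof
    fix b assume "b : I"
    then have "f (dlt R b 1[R]) : g ` carrier E" by (intro im dlt_free[OF R]) (simp_all add: ring_rules[OF R])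
    then show "EX e:carrier E. g e = f (dlt R b 1[R])" by auto
  qed
  then obtain w where w: "!!b. b : I ==> w b el E" "!!b. b : I ==> g (w b) = f (dlt R b 1[R])"
    by metis
  have "g (ev R E w x) = f x" if "x el (free_mod I R)" for x
    by (rule free_eqI[OF lin_comp[OF ev_lin(1)[OF E, of I w, OF w(1)] g] f _ that]) (simp_all add: w ev_lin(2)[OF E, of I w])
  then show ?thesis by (intro exI[of _ "ev R E w"] conjI ballI ev_lin(1)[OF E w(1)])
qed

text \<open>A condition on the image of \<open>f\<close> replaces surjectivity of \<open>g\<close>:
  in a resolution a differential is onto only the kernel of the next one, and this form avoids
  passing to that kernel.\<close>

lemma proj_lift:
  fixes P :: "('r, 'p) module"
  assumes P: "projective R P" and f: "lin R P N f" and g: "lin R E N g"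
    and im: "!!x. x el P ==> f x : g ` carrier E"
  shows "EX h. lin R P E h & (ALL x:carrier P. g (h x) = f x)"
proof -
  from P obtain I :: "'p set" where "direct_summand R P (free_mod I R)" by (auto simp: projective_def)
  then obtain i p where i: "lin R P (free_mod I R) i" and p: "lin R (free_mod I R) P p"
    and pi: "!!x. x el P ==> p (i x) = x" by (rule direct_summandE) blast
  obtain h where h: "lin R (free_mod I R) E h" "!!x. x el (free_mod I R) ==> g (h x) = f (p x)"
    using free_lift[OF lin_comp[OF p f] g im[OF lin_closed[OF p]]] by auto
  show ?thesis using lin_comp[OF i h(1)] h(2) pi lin_closed[OF i] by (intro exI[of _ "%x. h (i x)"]) simp
qed

text \<open>\<open>projective\<close> asks for an index set in the type of \<open>P\<close>. The
  carrier of \<open>P\<close> serves: the free module on it maps onto \<open>P\<close> by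
  evaluation, and a section of that map exhibits the summand.\<close>

lemma projI:
  fixes P :: "('r, 'p) module"
  assumes P: "left_module R P"
    and split: "!!g. [| lin R (free_mod (carrier P) R) P g; g ` carrier (free_mod (carrier P) R) = carrier P |]
      ==> EX s. lin R P (free_mod (carrier P) R) s & (ALL x:carrier P. g (s x) = x)"
  shows "projective R P"
proof -
  let ?F = "free_mod (carrier P) R"
  let ?g = "ev R P (%x. x)"
  note R = lmod_ring[OF P]
  have g: "lin R ?F P ?g" by (rule ev_lin(1)[OF P])
  have "x : ?g ` carrier ?F" if "x el P" for x
  proof (rule image_eqI[of _ _ "dlt R x 1[R]"])
    show "x = ?g (dlt R x 1[R])" by (rule ev_lin(2)[OF P, of "carrier P", symmetric]) (simp_all add: that)
    show "dlt R x 1[R] el ?F"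
      by (rule dlt_free[OF R that]) (simp add: ring_rules[OF R])
  qed
  then have "?g ` carrier ?F = carrier P"
    by (intro equalityI subsetI) (auto simp: lin_closed[OF g])
  from split[OF g this] obtain s where s: "lin R P ?F s"
    "!!x. x el P ==> ?g (s x) = x" by auto
  have "direct_summand R P ?F" by (rule direct_summandI[OF s(1) g]) (rule s(2))
  then show ?thesis unfolding projective_def using P by auto
qed

lemma proj_free: "ring R ==> projective R (free_mod I R)"
  by (rule projI[OF free_lmod], assumption, rule free_lift[OF lin_id[OF free_lmod]]) auto

lemma proj_retract:
  assumes Q: "projective R Q" and i: "lin R P Q i" and p: "lin R Q P p"
    and pi: "!!x. x el P ==> p (i x) = x"
  shows "projective R P"
proof (rule projI[OF lin_mod(1)[OF i]])
  let ?F = "free_mod (carrier P) R"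
  fix g assume g: "lin R ?F P g" "g ` carrier ?F = carrier P"
  obtain h where h: "lin R Q ?F h" "!!x. x el Q ==> g (h x) = p x"
    using proj_lift[OF Q p g(1)] unfolding g(2) by (auto simp: lin_closed[OF p])
  show "EX s. lin R P ?F s & (ALL x:carrier P. g (s x) = x)"
    using lin_comp[OF i h(1)] h(2) pi lin_closed[OF i] by (intro exI[of _ "%x. h (i x)"]) simp
qed

lemma proj_dsum:
  assumes P: "projective R P" and Q: "projective R Q"
  shows "projective R (dsum P Q)"
proof (rule projI)
  note p = proj_lmod[OF P] and q = proj_lmod[OF Q]
  show PQ: "left_module R (dsum P Q)" by (rule dsum_lmod[OF p q])
  let ?F = "free_mod (carrier (dsum P Q)) R"
  fix g assume g: "lin R ?F (dsum P Q) g" "g ` carrier ?F = carrier (dsum P Q)"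
  obtain h where h: "lin R P ?F h" "!!x. x el P ==> g (h x) = (x, 0[Q])"
    using proj_lift[OF P lin_inl[OF p q] g(1)] unfolding g(2) by (auto simp: lmod_simps[OF q])
  obtain k where k: "lin R Q ?F k" "!!x. x el Q ==> g (k x) = (0[P], x)"
    using proj_lift[OF Q lin_inr[OF p q] g(1)] unfolding g(2) by (auto simp: lmod_simps[OF p])
  let ?s = "%x. h (fst x) +[?F] k (snd x)"
  have "lin R (dsum P Q) ?F ?s"
    by (rule lin_add[OF lin_comp[OF lin_fst[OF p q] h(1)] lin_comp[OF lin_snd[OF p q] k(1)]])
  moreover have "g (?s x) = x" if "x el (dsum P Q)" for x
  proof -
    from that have x: "fst x el P" "snd x el Q" by auto
    have "g (?s x) = g (h (fst x)) +[dsum P Q] g (k (snd x))"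
      by (rule lin_simps(2)[OF g(1) lin_closed[OF h(1) x(1)] lin_closed[OF k(1) x(2)]])
    also have "\<dots> = x" using x by (simp add: h(2) k(2) lmod_simps[OF p] lmod_simps[OF q])
    finally show ?thesis .
  qed
  ultimately show "EX s. lin R (dsum P Q) ?F s & (ALL x:carrier (dsum P Q). g (s x) = x)" by blast
qed

lemma proj_zero:
  assumes "left_module R P" "carrier P = {0[P]}"
  shows "projective R P"
proof (rule projI[OF assms(1)])
  let ?F = "free_mod (carrier P) R"
  fix g assume g: "lin R ?F P g"
  have "lin R P ?F (%_. 0[?F])" by (rule lin_zero[OF assms(1) lin_mod(1)[OF g]])
  moreover have "g 0[?F] = 0[P]" by (rule lin_simps(3)[OF g])
  ultimately show "EX s. lin R P ?F s & (ALL x:carrier P. g (s x) = x)"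
    using assms(2) by (metis singletonD)
qed

section \<open>The additive closure of a module\<close>

text \<open>A direct summand of the n-fold power of \<open>M\<close>, presented by coordinates. The
  power itself is never formed, the types of \<open>M\<close> and \<open>N\<close> are independent,
  and every additive functor visibly carries such data to data of the same kind.\<close>

definition retr :: "'r ring => ('r, 'm, 'd) module_scheme => ('r, 'n, 'e) module_scheme
    => nat => (nat => 'n => 'm) => (nat => 'm => 'n) => bool"
  where "retr R M N n p q \<longleftrightarrow> left_module R M & left_module R N &
    (ALL k<n. lin R N M (p k) & lin R M N (q k)) & (ALL x:carrier N. lsum N n (%k. q k (p k x)) = x)"

definition addr :: "'r ring => ('r, 'm, 'd) module_scheme => ('r, 'n, 'e) module_scheme => bool"
  where "addr R M N \<longleftrightarrow> (EX n p q. retr R M N n p q)"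

lemma retrD:
  assumes "retr R M N n p q"
  shows "left_module R M" "left_module R N" "k < n ==> lin R N M (p k)" "k < n ==> lin R M N (q k)"
    "x el N ==> lsum N n (%k. q k (p k x)) = x"
  using assms by (auto simp: retr_def)

lemma addrE:
  assumes "addr R M N" obtains n p q where "retr R M N n p q"
  using assms by (auto simp: addr_def)

lemma addr_lmod: "addr R M N ==> left_module R M" "addr R M N ==> left_module R N"
  by (auto simp: addr_def retr_def)

lemma addr_retract:
  assumes "lin R N M p" "lin R M N q" "!!x. x el N ==> q (p x) = x"
  shows "addr R M N"
proof -
  have "retr R M N 1 (%_. p) (%_. q)"
    using assms by (auto simp: retr_def lin_mod lmod_simps[OF lin_mod(1)[OF assms(1)]])
  then show ?thesis by (auto simp: addr_def)
qed

lemma addr_refl: "left_module R M ==> addr R M M"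
  by (rule addr_retract[OF lin_id lin_id]) auto

lemma lsum_copies: "lsum (copies I M) n f = (%i. lsum M n (%k. f k i))"
  by (induction n) auto

lemma add_mod_addr:
  fixes M :: "('r, 'm) module" and N :: "('r, 'n) module"
  assumes M: "left_module R M"
  shows "N : add_mod R M \<longleftrightarrow> addr R M N"
proof
  assume "N : add_mod R M"
  then obtain n :: nat where "direct_summand R N (copies {..<n} M)" by (auto simp: add_mod_def)
  then obtain i p where i: "lin R N (copies {..<n} M) i" and p: "lin R (copies {..<n} M) N p"
    and pi: "!!x. x el N ==> p (i x) = x" by (rule direct_summandE) blast
  have "lsum N n (%k. p (dlt M k (i x k))) = x" if x: "x el N" for x
  proof -
    have ix: "i x el (copies {..<n} M)" by (rule lin_closed[OF i x])
    have cl: "dlt M k (i x k) el (copies {..<n} M)" if "k < n" for k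
      by (rule lin_closed[OF lin_dlt[OF M]]) (use that ix in "auto simp: copies_carrier")
    have "lsum (copies {..<n} M) n (%k. dlt M k (i x k)) = i x"
    proof
      fix j
      show "lsum (copies {..<n} M) n (%k. dlt M k (i x k)) j = i x j"
      proof (cases "j < n")
        case True
        then show ?thesis unfolding lsum_copies using ix
          by (intro lsum_delta[OF lmod_ag[OF M]]) (auto simp: dlt_def copies_carrier)
      next
        case False
        then have "lsum M n (%k. dlt M k (i x k) j) = lsum M n (%k. 0[M])"
          by (intro lsum_cong) (auto simp: dlt_def simp_implies_def)
        then show ?thesis unfolding lsum_copies using ix False
          by (simp add: lsum_zero[OF lmod_ag[OF M]] copies_carrier)
      qed
    qed
    then show ?thesis using lin_lsum_apply[OF p cl, symmetric] pi[OF x] by simp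
  qed
  then have "retr R M N n (%k x. i x k) (%k y. p (dlt M k y))"
    unfolding retr_def using M lin_mod[OF i] lin_comp[OF i lin_coord[OF M]] lin_comp[OF lin_dlt[OF M] p]
    by auto
  then show "addr R M N" by (auto simp: addr_def)
next
  assume "addr R M N"
  then obtain n p q where r: "retr R M N n p q" by (rule addrE)
  have N: "left_module R N" by (rule retrD[OF r])
  note [simp] = lmod_simps[OF M] lmod_simps[OF N]
  let ?i = "%x k. if k < n then p k x else 0[M]"
  have "lin R N (copies {..<n} M) ?i"
  proof (rule linI[OF N copies_lmod[OF M]])
    show "?i x el (copies {..<n} M)" if "x el N" for x
    proof -
      have "finite {k. ?i x k ~= 0[M]}" by (rule finite_subset[of _ "{..<n}"]) auto
      then show ?thesis using that by (auto simp: copies_carrier lin_closed[OF retrD(3)[OF r]])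
    qed
  qed (auto simp: fun_eq_iff lin_simps[OF retrD(3)[OF r]])
  moreover have "lin R (copies {..<n} M) N (%v. lsum N n (%k. q k (v k)))"
    by (intro lin_lsum copies_lmod[OF M] N lin_comp[OF lin_coord[OF M] retrD(4)[OF r]])
  ultimately have "direct_summand R N (copies {..<n} M)"
    by (rule direct_summandI) (use retrD(5)[OF r] in simp)
  then show "N : add_mod R M" by (auto simp: add_mod_def)
qed

lemma addr_reg_proj:
  assumes "addr R (reg_mod R) P"
  shows "projective R P"
proof -
  have R: "ring R" using addr_lmod(1)[OF assms] by (rule lmod_ring)
  have "P : add_mod R (reg_mod R)" using add_mod_addr[OF addr_lmod(1)[OF assms]] assms by blast
  then obtain n :: nat where "direct_summand R P (free_mod {..<n} R)" by (auto simp: add_mod_def)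
  then obtain i p where "lin R P (free_mod {..<n} R) i" "lin R (free_mod {..<n} R) P p"
    "!!x. x el P ==> p (i x) = x" by (rule direct_summandE) blast
  then show ?thesis by (rule proj_retract[OF proj_free[OF R]])
qed

lemma lin_reg: "[| left_module R M; x el M |] ==> lin R (reg_mod R) M (%r. r .[M] x)"
  by (rule linI) (auto simp: reg_mod_lmod lmod_ring lmod_simps)

lemma finsum_lsum:
  assumes M: "abelian_group M" and fin: "finite G"
  shows "EX (n::nat) e. e ` {..<n} = G & (ALL g:G \<rightarrow> carrier M. finsum M g G = lsum M n (%k. g (e k)))"
  using fin
proof (induction G rule: finite_induct)
  case empty
  interpret abelian_group M by fact
  show ?case by (intro exI[of _ 0]) simp
next
  case (insert a G)
  interpret abelian_group M by fact
  obtain n e where ne: "e ` {..<n} = G" "!!g. g : G \<rightarrow> carrier M ==> finsum M g G = lsum M n (%k. g (e k))"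
    using insert by auto
  have "finsum M g (insert a G) = lsum M (Suc n) (%k. g ((e(n := a)) k))" if g: "g : insert a G \<rightarrow> carrier M" for g
  proof -
    have eG: "e k : G" if "k < n" for k using that ne by auto
    have gG: "g : G \<rightarrow> carrier M" "g a el M" using g by auto
    have c: "lsum M n (%k. g (e k)) el M" using gG eG by (intro lsum_closed[OF M]) auto
    have "finsum M g (insert a G) = g a +[M] lsum M n (%k. g (e k))"
      using insert gG ne(2)[OF gG(1)] by simp
    also have "\<dots> = lsum M (Suc n) (%k. g ((e(n := a)) k))"
      using gG c by (simp add: a_comm)
    finally show ?thesis .
  qed
  moreover have "(e(n := a)) ` {..<Suc n} = insert a G" using ne(1) by (auto simp: lessThan_Suc)
  ultimately show ?case by blast
qed

text \<open>\<open>fin_gen\<close> sums over a set of generators, whereas the family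
  \<open>g\<close> may repeat values; the coefficients of equal values have to be merged.\<close>

lemma lsum_finsum:
  assumes M: "left_module R M" and c: "!!k. k < n ==> c k el R" and g: "!!k. k < n ==> g k el M"
  shows "EX d:g ` {..<n} \<rightarrow> carrier R. lsum M n (%k. c k .[M] g k) = (\<Oplus>\<^bsub>M\<^esub>y\<in>g ` {..<n}. d y .[M] y)"
  using c g
proof (induction n)
  case 0
  interpret abelian_group M by (rule lmod_ag[OF M])
  show ?case by simp
next
  case (Suc n)
  interpret abelian_group M by (rule lmod_ag[OF M])
  note [simp] = lmod_simps[OF M] ring_rules[OF lmod_ring[OF M]]
  let ?G = "g ` {..<n}"
  obtain d where d: "d : ?G \<rightarrow> carrier R" "lsum M n (%k. c k .[M] g k) = (\<Oplus>\<^bsub>M\<^esub>y\<in>?G. d y .[M] y)"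
    using Suc by auto
  \<comment> \<open>The new coefficient is added to the one already attached to \<open>g n\<close>,
    or to 0 when this value has not occurred before.\<close>
  define d' where "d' = d(g n := (if g n : ?G then d (g n) else 0[R]) +[R] c n)"
  have S: "g ` {..<Suc n} = insert (g n) (?G - {g n})" by (auto simp: lessThan_Suc)
  have gM: "!!y. y : ?G ==> y el M" using Suc.prems by auto
  have dG: "!!y. y : ?G ==> d y el R" using d(1) by (rule Pi_mem)
  have dG': "!!y. y : ?G ==> d' y el R" using dG Suc.prems by (auto simp: d'_def)
  have cl: "d' : g ` {..<Suc n} \<rightarrow> carrier R" using d(1) Suc.prems by (auto simp: d'_def Pi_iff lessThan_Suc)
  let ?z = "\<Oplus>\<^bsub>M\<^esub>y\<in>?G - {g n}. d y .[M] y"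
  have z: "?z el M" by (intro finsum_closed Pi_I lmod_simps(13)[OF M] dG gM) auto
  have "(\<Oplus>\<^bsub>M\<^esub>y\<in>g ` {..<Suc n}. d' y .[M] y) = d' (g n) .[M] g n +[M] (\<Oplus>\<^bsub>M\<^esub>y\<in>?G - {g n}. d' y .[M] y)"
    unfolding S using cl gM dG' Suc.prems by (subst finsum_insert) (auto simp: S)
  also have "(\<Oplus>\<^bsub>M\<^esub>y\<in>?G - {g n}. d' y .[M] y) = ?z"
    using dG gM by (intro finsum_cong') (auto simp: d'_def)
  finally have 1: "(\<Oplus>\<^bsub>M\<^esub>y\<in>g ` {..<Suc n}. d' y .[M] y) = d' (g n) .[M] g n +[M] ?z" .
  have 2: "(\<Oplus>\<^bsub>M\<^esub>y\<in>?G. d y .[M] y) = (if g n : ?G then d (g n) else 0[R]) .[M] g n +[M] ?z"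
  proof (cases "g n : ?G")
    case True
    then have "?G = insert (g n) (?G - {g n})" by auto
    then have "(\<Oplus>\<^bsub>M\<^esub>y\<in>?G. d y .[M] y) = (\<Oplus>\<^bsub>M\<^esub>y\<in>insert (g n) (?G - {g n}). d y .[M] y)" by (rule arg_cong)
    also have "\<dots> = d (g n) .[M] g n +[M] ?z"
      using True dG gM by (subst finsum_insert) auto
    finally show ?thesis using True by simp
  next
    case False
    then have "?G - {g n} = ?G" by auto
    then show ?thesis using False z Suc.prems by simp
  qed
  have e: "(if g n : ?G then d (g n) else 0[R]) el R" using d(1) by auto
  have "lsum M (Suc n) (%k. c k .[M] g k) = (\<Oplus>\<^bsub>M\<^esub>y\<in>g ` {..<Suc n}. d' y .[M] y)"
    unfolding 1 using d(2) 2 Suc.prems z e by (simp add: d'_def lmod_ac[OF M] del: if_split)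
  then show ?case using cl by blast
qed

text \<open>The dual basis lemma: a splitting of a surjection from a finite free module has
  coordinate functionals \<open>p k\<close>, and the elements dual to them are the values
  \<open>q k\<close> at 1.\<close>

lemma fg_proj_iff: "fin_gen R P & projective R P \<longleftrightarrow> addr R (reg_mod R) P"
proof
  assume fp: "fin_gen R P & projective R P"
  then obtain G where P: "left_module R P" and G: "G \<subseteq> carrier P" "finite G"
    and gen: "!!x. x el P ==> EX c:G \<rightarrow> carrier R. x = (\<Oplus>\<^bsub>P\<^esub>g\<in>G. c g .[P] g)"
    by (auto simp: fin_gen_def)
  note R = lmod_ring[OF P]
  let ?F = "free_mod G R"
  have w: "!!b. b : G ==> b el P" using G by auto
  have e: "lin R ?F P (ev R P (%b. b))" by (rule ev_lin(1)[OF P w])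
  interpret P: abelian_group P by (rule lmod_ag[OF P])
  have surj: "x : ev R P (%b. b) ` carrier ?F" if "x el P" for x
  proof -
    obtain c where c: "c : G \<rightarrow> carrier R" "x = (\<Oplus>\<^bsub>P\<^esub>g\<in>G. c g .[P] g)" using gen \<open>x el P\<close> by blast
    have cG: "!!b. b : G ==> c b el R" using c(1) by (rule Pi_mem)
    let ?d = "%b. if b : G then c b else 0[R]"
    have "finite {b. ?d b ~= 0[R]}" by (rule finite_subset[of _ G]) (use G in auto)
    then have d: "?d el ?F" using c ring_rules[OF R] by (auto simp: copies_carrier)
    have "ev R P (%b. b) ?d = (\<Oplus>\<^bsub>P\<^esub>g\<in>G. c g .[P] g)"
      unfolding ev_def using G cG w
      by (intro P.add.finprod_mono_neutral_cong_left) (auto simp: lmod_simps[OF P] split: if_splits)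
    then show ?thesis unfolding c(2) by (intro image_eqI[OF _ d]) (rule sym)
  qed
  obtain s where s: "lin R P ?F s" "!!x. x el P ==> ev R P (%b. b) (s x) = x"
    using proj_lift[of R P P "%x. x", OF _ lin_id[OF P] e surj] fp by blast
  obtain n :: nat and g where g: "g ` {..<n} = G"
    "!!f. f : G \<rightarrow> carrier P ==> finsum P f G = lsum P n (%k. f (g k))"
    using finsum_lsum[OF lmod_ag[OF P] G(2)] by blast
  have gG: "g k : G" if "k < n" for k using that g by auto
  have "lsum P n (%k. s x (g k) .[P] g k) = x" if x: "x el P" for x
  proof -
    have sx: "s x el ?F" by (rule lin_closed[OF s(1) x])
    have "ev R P (%b. b) (s x) = (\<Oplus>\<^bsub>P\<^esub>b\<in>G. s x b .[P] b)"
      unfolding ev_def using G w sx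
      by (intro P.add.finprod_mono_neutral_cong_left) (auto simp: lmod_simps[OF P] copies_carrier)
    also have "\<dots> = lsum P n (%k. s x (g k) .[P] g k)"
      using sx w by (intro g(2)) (auto simp: lmod_simps[OF P] copies_carrier)
    finally show ?thesis using s(2)[OF x] by simp
  qed
  moreover have "lin R P (reg_mod R) (%x. s x (g k))" for k
    by (rule lin_comp[OF s(1) lin_coord[OF reg_mod_lmod[OF R]]])
  ultimately have "retr R (reg_mod R) P n (%k x. s x (g k)) (%k r. r .[P] g k)"
    using P reg_mod_lmod[OF R] lin_reg[OF P w[OF gG]] by (auto simp: retr_def)
  then show "addr R (reg_mod R) P" by (auto simp: addr_def)
next
  assume a: "addr R (reg_mod R) P"
  then obtain n p q where r: "retr R (reg_mod R) P n p q" by (rule addrE)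
  note P = addr_lmod(2)[OF a]
  note R = lmod_ring[OF P]
  have c: "p k x el R" if "k < n" "x el P" for k x
    using lin_closed[OF retrD(3)[OF r that(1)] that(2)] by simp
  have qk: "q k 1[R] el P" if "k < n" for k
    using lin_closed[OF retrD(4)[OF r that]] ring_rules[OF R] by simp
  have eq: "x = lsum P n (%k. p k x .[P] q k 1[R])" if x: "x el P" for x
  proof -
    have "q k (p k x) = p k x .[P] q k 1[R]" if "k < n" for k
      using lin_smult[OF retrD(4)[OF r that], of "p k x" "1[R]"] c[OF that x] ring_rules[OF R] by simp
    then show ?thesis using retrD(5)[OF r x] by simp
  qed
  have "fin_gen R P" unfolding fin_gen_def
  proof (intro conjI P exI[of _ "(%k. q k 1[R]) ` {..<n}"] ballI)
    show "EX d:(%k. q k 1[R]) ` {..<n} \<rightarrow> carrier R.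
        x = (\<Oplus>\<^bsub>P\<^esub>y\<in>(%k. q k 1[R]) ` {..<n}. d y .[P] y)" if x: "x el P" for x
      using lsum_finsum[OF P, of n "%k. p k x" "%k. q k 1[R]", OF c[OF _ x] qk] eq[OF x] by simp
  qed (use qk in auto)
  then show "fin_gen R P & projective R P" using addr_reg_proj[OF a] by simp
qed

section \<open>Projective resolutions and the comparison theorem\<close>

text \<open>\<open>projective_resolution\<close> for maps that need not be extensional, so that
  differentials such as \<open>std_bd\<close> can be used without restricting them.\<close>

definition pres :: "'r ring => ('r, 'm, 'd) module_scheme => (nat => ('r, 'p) module) => (nat => 'p => 'p)
    => ('p => 'm) => bool"
  where "pres R V P d e \<longleftrightarrow> (ALL i. projective R (P i)) & (ALL i. lin R (P (Suc i)) (P i) (d i)) &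
    lin R (P 0) V e & e ` carrier (P 0) = carrier V &
    (ALL x:carrier (P 0). e x = 0[V] \<longleftrightarrow> x : d 0 ` carrier (P 1)) &
    (ALL i. ALL x:carrier (P (Suc i)). d i x = 0[P i] \<longleftrightarrow> x : d (Suc i) ` carrier (P (Suc (Suc i))))"

lemma presD:
  assumes "pres R V P d e"
  shows "projective R (P i)" "lin R (P (Suc i)) (P i) (d i)" "lin R (P 0) V e"
    "e ` carrier (P 0) = carrier V"
    "[| x el (P 0); e x = 0[V] |] ==> x : d 0 ` carrier (P (Suc 0))"
    "[| y el (P (Suc i)); d i y = 0[P i] |] ==> y : d (Suc i) ` carrier (P (Suc (Suc i)))"
    "x' el (P (Suc 0)) ==> e (d 0 x') = 0[V]"
    "y' el (P (Suc (Suc i))) ==> d i (d (Suc i) y') = 0[P i]"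
proof -
  show l: "projective R (P i)" "lin R (P (Suc i)) (P i) (d i)" "lin R (P 0) V e"
    "e ` carrier (P 0) = carrier V" for i
    using assms by (auto simp: pres_def)
  show "[| x el (P 0); e x = 0[V] |] ==> x : d 0 ` carrier (P (Suc 0))"
    "[| y el (P (Suc i)); d i y = 0[P i] |] ==> y : d (Suc i) ` carrier (P (Suc (Suc i)))"
    using assms by (auto simp: pres_def)
  show "x' el (P (Suc 0)) ==> e (d 0 x') = 0[V]"
    using assms lin_closed[OF l(2)[of 0], of x'] by (auto simp: pres_def)
  show "y' el (P (Suc (Suc i))) ==> d i (d (Suc i) y') = 0[P i]"
    using assms lin_closed[OF l(2)[of "Suc i"], of y'] by (auto simp: pres_def)
qed

lemmas pres_lmod = proj_lmod[OF presD(1)]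

lemma projective_resolution_pres:
  assumes "projective_resolution R M P d e"
  shows "pres R M P d e"
proof -
  have M: "left_module R M" and P: "!!i. projective R (P i)" and d: "!!i. d i : mod_hom R (P (Suc i)) (P i)"
    and e: "e : mod_hom R (P 0) M" using assms by (auto simp: projective_resolution_def)
  have dl: "!!i. lin R (P (Suc i)) (P i) (d i)" and el: "lin R (P 0) M e"
    using mod_hom_lin[OF d] mod_hom_lin[OF e _ M] proj_lmod[OF P] by auto
  show ?thesis unfolding pres_def using P dl el assms
    by (auto simp: projective_resolution_def exact_at_def)
qed

lemma pres_projective_resolution:
  assumes r: "pres R M P d e"
  shows "projective_resolution R M P (%i. restrict (d i) (carrier (P (Suc i)))) (restrict e (carrier (P 0)))"
proof -
  note D = presD[OF r]
  have "exact_at (P 1) (restrict (d 0) (carrier (P (Suc 0)))) (P 0) (restrict e (carrier (P 0))) M"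
    using D(5,7) lin_closed[OF D(2)[of 0]] by (auto simp: exact_at_def)
  moreover have "exact_at (P (Suc (Suc i))) (restrict (d (Suc i)) (carrier (P (Suc (Suc i))))) (P (Suc i))
      (restrict (d i) (carrier (P (Suc i)))) (P i)" for i
    using D(6,8) lin_closed[OF D(2)[of "Suc i"]] by (auto simp: exact_at_def)
  ultimately show ?thesis unfolding projective_resolution_def
    using D(1,4) restrict_mod_hom[OF D(2)] restrict_mod_hom[OF D(3)] lin_mod(2)[OF D(3)] by auto
qed

lemma chain_map:
  assumes P: "pres R V P d e" and Q: "pres R Y Q d' e'" and t: "lin R V Y t"
  shows "EX f. (ALL i. lin R (P i) (Q i) (f i)) & (ALL x:carrier (P 0). e' (f 0 x) = t (e x)) &
    (ALL i. ALL x:carrier (P (Suc i)). d' i (f (Suc i) x) = f i (d i x))"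
proof -
  note PD = presD[OF P] and QD = presD[OF Q]
  \<comment> \<open>The invariant of the recursion. Its last clause, that the lift carries
    boundaries into the image of the next differential, is exactly what the next lift needs;
    \<open>B\<close> ties consecutive lifts together.\<close>
  define A where "A n f \<longleftrightarrow> lin R (P n) (Q n) f & (n = 0 --> (ALL x:carrier (P 0). e' (f x) = t (e x))) &
    (ALL x:carrier (P (Suc n)). f (d n x) : d' n ` carrier (Q (Suc n)))" for n f
  define B where "B n f g \<longleftrightarrow> (ALL x:carrier (P (Suc n)). d' n (g x) = f (d n x))" for n f g
  have "EX f. ALL n. A n (f n) & B n (f n) (f (Suc n))"
  proof (rule dependent_nat_choice)
    obtain f where f: "lin R (P 0) (Q 0) f" "!!x. x el (P 0) ==> e' (f x) = t (e x)"
      using proj_lift[OF PD(1) lin_comp[OF PD(3) t] QD(3)] lin_closed[OF PD(3)] lin_closed[OF t]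
      unfolding QD(4) by auto
    have "f (d 0 x) : d' 0 ` carrier (Q (Suc 0))" if x: "x el (P (Suc 0))" for x
    proof (rule QD(5))
      have dx: "d 0 x el (P 0)" by (rule lin_closed[OF PD(2) x])
      show "f (d 0 x) el (Q 0)" by (rule lin_closed[OF f(1) dx])
      show "e' (f (d 0 x)) = 0[Y]" using f(2)[OF dx] PD(7)[OF x] lin_simps(3)[OF t] by simp
    qed
    then show "EX f. A 0 f" using f by (auto simp: A_def)
  next
    fix f n assume A: "A n f"
    then have f: "lin R (P n) (Q n) f"
      and im: "!!x. x el (P (Suc n)) ==> f (d n x) : d' n ` carrier (Q (Suc n))" by (auto simp: A_def)
    obtain g where g: "lin R (P (Suc n)) (Q (Suc n)) g" "!!x. x el (P (Suc n)) ==> d' n (g x) = f (d n x)"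
      using proj_lift[OF PD(1) lin_comp[OF PD(2) f] QD(2) im] by auto
    have "g (d (Suc n) x) : d' (Suc n) ` carrier (Q (Suc (Suc n)))" if x: "x el (P (Suc (Suc n)))" for x
    proof (rule QD(6))
      have dx: "d (Suc n) x el (P (Suc n))" by (rule lin_closed[OF PD(2) x])
      show "g (d (Suc n) x) el (Q (Suc n))" by (rule lin_closed[OF g(1) dx])
      show "d' n (g (d (Suc n) x)) = 0[Q n]" using g(2)[OF dx] PD(8)[OF x] lin_simps(3)[OF f] by simp
    qed
    then show "EX g. A (Suc n) g & B n f g" using g by (auto simp: A_def B_def)
  qed
  then obtain f where "!!n. A n (f n)" "!!n. B n (f n) (f (Suc n))" by auto
  then show ?thesis by (intro exI[of _ f]) (auto simp: A_def B_def)
qed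

lemma null_homotopy:
  assumes P: "pres R V P d e" and Q: "pres R Y Q d' e'" and F: "!!i. lin R (P i) (Q i) (F i)"
    and F0: "!!x. x el (P 0) ==> e' (F 0 x) = 0[Y]"
    and Fd: "!!i x. x el (P (Suc i)) ==> d' i (F (Suc i) x) = F i (d i x)"
  shows "EX h. (ALL i. lin R (P i) (Q (Suc i)) (h i)) & (ALL x:carrier (P 0). F 0 x = d' 0 (h 0 x)) &
    (ALL i. ALL x:carrier (P (Suc i)). F (Suc i) x = d' (Suc i) (h (Suc i) x) +[Q (Suc i)] h i (d i x))"
proof -
  note PD = presD[OF P] and QD = presD[OF Q]
  \<comment> \<open>The last clause says that \<open>F (Suc n)\<close> minus \<open>h\<close> after
    the differential consists of cycles, so that this difference can be lifted once more.\<close>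
  define A where "A n h \<longleftrightarrow> lin R (P n) (Q (Suc n)) h & (n = 0 --> (ALL x:carrier (P 0). d' 0 (h x) = F 0 x)) &
    (ALL x:carrier (P (Suc n)). d' n (h (d n x)) = d' n (F (Suc n) x))" for n h
  define B where "B n h h' \<longleftrightarrow> (ALL x:carrier (P (Suc n)). F (Suc n) x = d' (Suc n) (h' x) +[Q (Suc n)] h (d n x))" for n h h'
  have "EX f. ALL n. A n (f n) & B n (f n) (f (Suc n))"
  proof (rule dependent_nat_choice)
    obtain f where f: "lin R (P 0) (Q (Suc 0)) f" "!!x. x el (P 0) ==> d' 0 (f x) = F 0 x"
      using proj_lift[OF PD(1) F QD(2)[of 0] QD(5)[OF lin_closed[OF F] F0]] by auto
    then show "EX f. A 0 f" using lin_closed[OF PD(2)] Fd by (auto simp: A_def)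
  next
    fix h n assume A: "A n h"
    then have h: "lin R (P n) (Q (Suc n)) h"
      and hd: "!!x. x el (P (Suc n)) ==> d' n (h (d n x)) = d' n (F (Suc n) x)" by (auto simp: A_def)
    let ?G = "%x. F (Suc n) x +[Q (Suc n)] -[Q (Suc n)] h (d n x)"
    note Qn = lmod_simps[OF pres_lmod[OF Q, of n]] and Qs = lmod_simps[OF pres_lmod[OF Q, of "Suc n"]]
    have G: "lin R (P (Suc n)) (Q (Suc n)) ?G" by (rule lin_add[OF F lin_neg[OF lin_comp[OF PD(2) h]]])
    have im: "?G x : d' (Suc n) ` carrier (Q (Suc (Suc n)))" if x: "x el (P (Suc n))" for x
    proof (rule QD(6)[OF lin_closed[OF G x]])
      have dx: "d n x el (P n)" by (rule lin_closed[OF PD(2) x])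
      show "d' n (?G x) = 0[Q n]"
        using lin_closed[OF F x] lin_closed[OF h dx] hd[OF x] by (simp add: lin_simps[OF QD(2)] Qn Qs)
    qed
    obtain g where g: "lin R (P (Suc n)) (Q (Suc (Suc n))) g" "!!x. x el (P (Suc n)) ==> d' (Suc n) (g x) = ?G x"
      using proj_lift[OF PD(1) G QD(2) im] by auto
    have "B n h g"
      unfolding B_def using g(2) lin_closed[OF F] lin_closed[OF h] lin_closed[OF PD(2)]
      by (auto simp: Qs lmod_ac(1)[OF pres_lmod[OF Q]])
    moreover have "d' (Suc n) (g (d (Suc n) x)) = d' (Suc n) (F (Suc (Suc n)) x)" if x: "x el (P (Suc (Suc n)))" for x
    proof -
      have dx: "d (Suc n) x el (P (Suc n))" by (rule lin_closed[OF PD(2) x])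
      show ?thesis
        using g(2)[OF dx] PD(8)[OF x] Fd[OF x] lin_closed[OF F dx] by (simp add: lin_simps(3)[OF h] Qs)
    qed
    ultimately show "EX g. A (Suc n) g & B n h g" using g by (auto simp: A_def)
  qed
  then obtain f where "!!n. A n (f n)" "!!n. B n (f n) (f (Suc n))" by auto
  then show ?thesis by (intro exI[of _ f]) (auto simp: A_def B_def)
qed

text \<open>A chain-level version, in positive degrees, of a presentation of a module as a direct summand of \<open>n\<close>
  copies of another one.\<close>

definition hretr :: "'r ring => nat => (nat => ('r, 'p) module) => (nat => 'p => 'p) => (nat => ('r, 'q) module) =>
    (nat => 'q => 'q) => (nat => nat => 'p => 'q) => (nat => nat => 'q => 'p) => (nat => 'q => 'q) => bool"
  where "hretr R n P dP Q dQ f g h \<longleftrightarrow>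
    (ALL k<n. ALL i. lin R (Q i) (P i) (g k i) & lin R (P i) (Q i) (f k i) &
      (ALL x:carrier (Q (Suc i)). dP i (g k (Suc i) x) = g k i (dQ i x)) &
      (ALL x:carrier (P (Suc i)). dQ i (f k (Suc i) x) = f k i (dP i x))) &
    (ALL i. lin R (Q i) (Q (Suc i)) (h i)) &
    (ALL i. ALL x:carrier (Q (Suc i)). x = lsum (Q (Suc i)) n (%k. f k (Suc i) (g k (Suc i) x)) +[Q (Suc i)]
        (dQ (Suc i) (h (Suc i) x) +[Q (Suc i)] h i (dQ i x)))"

lemma hretrD:
  assumes "hretr R n P dP Q dQ f g h"
  shows "k < n ==> lin R (Q i) (P i) (g k i)" "k < n ==> lin R (P i) (Q i) (f k i)"
    "lin R (Q i) (Q (Suc i)) (h i)"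
    "[| k < n; x el (Q (Suc i)) |] ==> dP i (g k (Suc i) x) = g k i (dQ i x)"
    "[| k < n; y el (P (Suc i)) |] ==> dQ i (f k (Suc i) y) = f k i (dP i y)"
    "x el (Q (Suc i)) ==> x = lsum (Q (Suc i)) n (%k. f k (Suc i) (g k (Suc i) x)) +[Q (Suc i)]
        (dQ (Suc i) (h (Suc i) x) +[Q (Suc i)] h i (dQ i x))"
proof -
  show "x el (Q (Suc i)) ==> x = lsum (Q (Suc i)) n (%k. f k (Suc i) (g k (Suc i) x)) +[Q (Suc i)]
        (dQ (Suc i) (h (Suc i) x) +[Q (Suc i)] h i (dQ i x))"
    using assms unfolding hretr_def by blast
qed (use assms in "simp_all add: hretr_def")

lemma ag_split:
  assumes M: "abelian_group M" and "x el M" "l el M"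
  shows "l +[M] (x +[M] -[M] l) = x"
  using assms(2,3) by (subst ag_ac(3)[OF M]) (simp_all add: ag_simps[OF M])

text \<open>Lift each \<open>p k\<close> and \<open>q k\<close> to chain maps \<open>g k\<close> and
  \<open>f k\<close>. The identity minus the sum of the \<open>f k\<close> after \<open>g k\<close>
  covers the zero map of \<open>V\<close>, because the \<open>q k\<close> after \<open>p k\<close>
  sum to the identity, so it is null homotopic. For a single pair of identities this is uniqueness
  of projective resolutions.\<close>

lemma comparison:
  assumes P: "pres R T P dP eP" and Q: "pres R V Q dQ eQ" and r: "retr R T V n p q"
  shows "EX f g h. hretr R n P dP Q dQ f g h"
proof -
  note PD = presD[OF P] and QD = presD[OF Q]
  have "ALL k:{..<n}. EX g. (ALL i. lin R (Q i) (P i) (g i)) & (ALL x:carrier (Q 0). eP (g 0 x) = p k (eQ x)) &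
    (ALL i. ALL x:carrier (Q (Suc i)). dP i (g (Suc i) x) = g i (dQ i x))"
    using chain_map[OF Q P retrD(3)[OF r]] by auto
  then obtain g where "ALL k:{..<n}. (ALL i. lin R (Q i) (P i) (g k i)) & (ALL x:carrier (Q 0). eP (g k 0 x) = p k (eQ x)) &
    (ALL i. ALL x:carrier (Q (Suc i)). dP i (g k (Suc i) x) = g k i (dQ i x))" by (rule bchoice[THEN exE])
  then have g: "!!k i. k < n ==> lin R (Q i) (P i) (g k i)"
    "!!k x. [| k < n; x el (Q 0) |] ==> eP (g k 0 x) = p k (eQ x)"
    "!!k i x. [| k < n; x el (Q (Suc i)) |] ==> dP i (g k (Suc i) x) = g k i (dQ i x)" by auto
  have "ALL k:{..<n}. EX f. (ALL i. lin R (P i) (Q i) (f i)) & (ALL x:carrier (P 0). eQ (f 0 x) = q k (eP x)) &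
    (ALL i. ALL x:carrier (P (Suc i)). dQ i (f (Suc i) x) = f i (dP i x))"
    using chain_map[OF P Q retrD(4)[OF r]] by auto
  then obtain f where "ALL k:{..<n}. (ALL i. lin R (P i) (Q i) (f k i)) & (ALL x:carrier (P 0). eQ (f k 0 x) = q k (eP x)) &
    (ALL i. ALL x:carrier (P (Suc i)). dQ i (f k (Suc i) x) = f k i (dP i x))" by (rule bchoice[THEN exE])
  then have f: "!!k i. k < n ==> lin R (P i) (Q i) (f k i)"
    "!!k x. [| k < n; x el (P 0) |] ==> eQ (f k 0 x) = q k (eP x)"
    "!!k i x. [| k < n; x el (P (Suc i)) |] ==> dQ i (f k (Suc i) x) = f k i (dP i x)" by auto
  let ?L = "%i x. lsum (Q i) n (%k. f k i (g k i x))"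
  let ?F = "%i x. x +[Q i] -[Q i] ?L i x"
  note Qm = pres_lmod[OF Q]
  have L: "lin R (Q i) (Q i) (?L i)" for i
    by (intro lin_lsum Qm lin_comp[OF g(1) f(1)])
  have F: "lin R (Q i) (Q i) (?F i)" for i
    by (rule lin_add[OF lin_id[OF Qm] lin_neg[OF L]])
  have F0: "eQ (?F 0 x) = 0[V]" if x: "x el (Q 0)" for x
  proof -
    note gx = lin_closed[OF g(1) x] and ex = lin_closed[OF QD(3) x]
    have "eQ (?L 0 x) = lsum V n (%k. eQ (f k 0 (g k 0 x)))"
      by (rule lin_lsum_apply[OF QD(3)]) (rule lin_closed[OF f(1) gx])
    also have "\<dots> = lsum V n (%k. q k (p k (eQ x)))" using f(2)[OF _ gx] g(2)[OF _ x] by simp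
    also have "\<dots> = eQ x" by (rule retrD(5)[OF r ex])
    finally show ?thesis
      using x lin_closed[OF L x] ex by (simp add: lin_simps[OF QD(3)] lmod_simps[OF Qm] lmod_simps[OF retrD(2)[OF r]])
  qed
  have Fd: "dQ i (?F (Suc i) x) = ?F i (dQ i x)" if x: "x el (Q (Suc i))" for i x
  proof -
    note gx = lin_closed[OF g(1) x] and dx = lin_closed[OF QD(2) x]
    have "dQ i (?L (Suc i) x) = lsum (Q i) n (%k. dQ i (f k (Suc i) (g k (Suc i) x)))"
      by (rule lin_lsum_apply[OF QD(2)]) (rule lin_closed[OF f(1) gx])
    also have "\<dots> = ?L i (dQ i x)" using f(3)[OF _ gx] g(3)[OF _ x] by simp
    finally show ?thesis
      using x lin_closed[OF L x] dx by (simp add: lin_simps[OF QD(2)] lmod_simps[OF Qm])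
  qed
  obtain h where h0: "ALL i. lin R (Q i) (Q (Suc i)) (h i)" and
    h1: "ALL i. ALL x:carrier (Q (Suc i)). ?F (Suc i) x = dQ (Suc i) (h (Suc i) x) +[Q (Suc i)] h i (dQ i x)"
    using null_homotopy[where F = ?F, OF Q Q F F0 Fd] by blast
  have h: "?F (Suc i) x = dQ (Suc i) (h (Suc i) x) +[Q (Suc i)] h i (dQ i x)" if "x el (Q (Suc i))" for i x
    using h1 that by blast
  have dec: "x = ?L i x +[Q i] ?F i x" if x: "x el (Q i)" for i x
    by (rule ag_split[symmetric, OF lmod_ag[OF Qm] x lin_closed[OF L x]])
  have "x = ?L (Suc i) x +[Q (Suc i)] (dQ (Suc i) (h (Suc i) x) +[Q (Suc i)] h i (dQ i x))"
    if "x el (Q (Suc i))" for i x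
    using dec[OF that] unfolding h[OF that] .
  then show ?thesis unfolding hretr_def
    using g(1,3) f(1,3) h0 by (intro exI[of _ f] exI[of _ g] exI[of _ h]) blast
qed

text \<open>\<open>Hom(P, N)\<close> has no cohomology in positive degrees. No group is formed, so
  the statement transfers along maps in whatever types they live.\<close>

definition extv :: "'r ring => (nat => ('r, 'p) module) => (nat => 'p => 'p) => ('r, 'n, 'e) module_scheme => bool"
  where "extv R P d N \<longleftrightarrow> (ALL i c. lin R (P (Suc i)) N c & (ALL x:carrier (P (Suc (Suc i))). c (d (Suc i) x) = 0[N])
    --> (EX b. lin R (P i) N b & (ALL x:carrier (P (Suc i)). c x = b (d i x))))"

lemma extvD:
  assumes "extv R P d N" "lin R (P (Suc i)) N c" "!!x. x el (P (Suc (Suc i))) ==> c (d (Suc i) x) = 0[N]"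
  obtains b where "lin R (P i) N b" "!!x. x el (P (Suc i)) ==> c x = b (d i x)"
  using assms unfolding extv_def by blast

text \<open>A cocycle \<open>c\<close> on \<open>Q\<close> becomes a cocycle on \<open>P\<close>
  after each \<open>f k\<close>, hence a coboundary of some \<open>b k\<close>; then
  \<open>c\<close> is the coboundary of the sum of the \<open>b k\<close> after \<open>g k\<close>,
  plus \<open>c\<close> after the homotopy.\<close>

lemma extv_transfer:
  assumes P: "pres R T P dP eP" and Q: "pres R V Q dQ eQ" and a: "addr R T V" and v: "extv R P dP N"
  shows "extv R Q dQ N"
  unfolding extv_def
proof (intro allI impI, elim conjE)
  fix i c assume c: "lin R (Q (Suc i)) N c" and "ALL x:carrier (Q (Suc (Suc i))). c (dQ (Suc i) x) = 0[N]"
  then have cd: "!!x. x el (Q (Suc (Suc i))) ==> c (dQ (Suc i) x) = 0[N]" by auto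
  from a obtain n p q where r: "retr R T V n p q" by (rule addrE)
  obtain f g h where "hretr R n P dP Q dQ f g h" using comparison[OF P Q r] by auto
  note D = hretrD[OF this]
  note g = D(1) and f = D(2) and h = D(3) and gd = D(4) and fd = D(5) and dec = D(6)
  note PD = presD[OF P] and QD = presD[OF Q] and N = lin_mod(2)[OF c]
  have "ALL k:{..<n}. EX b. lin R (P i) N b & (ALL x:carrier (P (Suc i)). c (f k (Suc i) x) = b (dP i x))"
  proof
    fix k assume "k : {..<n}"
    then have k: "k < n" by simp
    have "c (f k (Suc i) (dP (Suc i) x)) = 0[N]" if x: "x el (P (Suc (Suc i)))" for x
      using fd[OF k x] cd[OF lin_closed[OF f[OF k] x]] by simp
    then show "EX b. lin R (P i) N b & (ALL x:carrier (P (Suc i)). c (f k (Suc i) x) = b (dP i x))"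
      using extvD[OF v lin_comp[OF f[OF k] c]] by metis
  qed
  then obtain b where "ALL k:{..<n}. lin R (P i) N (b k) & (ALL x:carrier (P (Suc i)). c (f k (Suc i) x) = b k (dP i x))"
    by (rule bchoice[THEN exE])
  then have b: "!!k. k < n ==> lin R (P i) N (b k)"
    "!!k x. [| k < n; x el (P (Suc i)) |] ==> c (f k (Suc i) x) = b k (dP i x)" by auto
  let ?b = "%x. lsum N n (%k. b k (g k i x)) +[N] c (h i x)"
  have "lin R (Q i) N ?b"
    by (intro lin_add lin_lsum pres_lmod[OF Q] N lin_comp[OF g b(1)] lin_comp[OF h c])
  moreover have "c x = ?b (dQ i x)" if x: "x el (Q (Suc i))" for x
  proof -
    note gx = lin_closed[OF g x] and hx = lin_closed[OF h x] and dx = lin_closed[OF QD(2) x]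
    note fgx = lin_closed[OF f gx] and hdx = lin_closed[OF h dx] and dhx = lin_closed[OF QD(2) hx]
    have Lx: "lsum (Q (Suc i)) n (%k. f k (Suc i) (g k (Suc i) x)) el (Q (Suc i))"
      by (rule lsum_closed[OF lmod_ag[OF pres_lmod[OF Q]] fgx])
    have "c x = c (lsum (Q (Suc i)) n (%k. f k (Suc i) (g k (Suc i) x))) +[N] c (h i (dQ i x))"
      by (subst dec[OF x]) (simp add: Lx hdx dhx lin_simps[OF c] lmod_simps[OF pres_lmod[OF Q]] cd[OF hx] lmod_simps[OF N])
    also have "c (lsum (Q (Suc i)) n (%k. f k (Suc i) (g k (Suc i) x))) = lsum N n (%k. c (f k (Suc i) (g k (Suc i) x)))"
      by (rule lin_lsum_apply[OF c fgx])
    also have "\<dots> = lsum N n (%k. b k (g k i (dQ i x)))" using b(2)[OF _ gx] gd[OF _ x] by simp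
    finally show ?thesis .
  qed
  ultimately show "EX b. lin R (Q i) N b & (ALL x:carrier (Q (Suc i)). c x = b (dQ i x))" by blast
qed

text \<open>The module has projective dimension at most \<open>n + 1\<close>: the map \<open>s\<close> is a section of \<open>d n\<close> onto its image,
  preceded by \<open>d n\<close>.\<close>

definition sct :: "'r ring => (nat => ('r, 'p) module) => (nat => 'p => 'p) => nat => bool"
  where "sct R P d n \<longleftrightarrow> (EX s. lin R (P (Suc n)) (P (Suc n)) s &
    (ALL x:carrier (P (Suc (Suc n))). s (d (Suc n) x) = 0[P (Suc n)]) & (ALL x:carrier (P (Suc n)). d n (s x) = d n x))"

text \<open>The new map is the sum of \<open>f k\<close>, \<open>s\<close>, \<open>g k\<close>
  composed, plus the homotopy after the differential; the homotopy formula turns the second defining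
  property for \<open>s\<close> into the one for this map.\<close>

lemma sct_transfer:
  assumes P: "pres R T P dP eP" and Q: "pres R V Q dQ eQ" and a: "addr R T V" and v: "sct R P dP i"
  shows "sct R Q dQ i"
proof -
  let ?S = "Suc i"
  from v obtain s where s: "lin R (P ?S) (P ?S) s"
    and sd: "!!x. x el (P (Suc ?S)) ==> s (dP ?S x) = 0[P ?S]"
    and ds: "!!x. x el (P ?S) ==> dP i (s x) = dP i x" by (auto simp: sct_def)
  from a obtain n p q where r: "retr R T V n p q" by (rule addrE)
  obtain f g h where "hretr R n P dP Q dQ f g h" using comparison[OF P Q r] by auto
  note D = hretrD[OF this]
  note g = D(1) and f = D(2) and h = D(3) and gd = D(4) and fd = D(5) and dec = D(6)
  note PD = presD[OF P] and QD = presD[OF Q] and Qm = pres_lmod[OF Q]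
  let ?Q = "Q ?S"
  let ?s = "%x. lsum ?Q n (%k. f k ?S (s (g k ?S x))) +[?Q] h i (dQ i x)"
  have "lin R ?Q ?Q ?s"
    by (intro lin_add lin_lsum Qm lin_comp[OF QD(2) h] lin_comp[OF lin_comp[OF g s] f])
  moreover have "?s (dQ ?S x) = 0[?Q]" if x: "x el (Q (Suc ?S))" for x
  proof -
    have "f k ?S (s (g k ?S (dQ ?S x))) = 0[?Q]" if k: "k < n" for k
      using gd[OF k x, symmetric] sd[OF lin_closed[OF g[OF k] x]] lin_simps(3)[OF f[OF k]] by simp
    then show ?thesis using QD(8)[OF x] lin_simps(3)[OF h]
      by (simp add: lsum_zero[OF lmod_ag[OF Qm]] lmod_simps[OF Qm])
  qed
  moreover have "dQ i (?s x) = dQ i x" if x: "x el ?Q" for x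
  proof -
    note gx = lin_closed[OF g x] and dx = lin_closed[OF QD(2) x] and hx = lin_closed[OF h x]
    note sgx = lin_closed[OF s gx] and hdx = lin_closed[OF h dx] and dhx = lin_closed[OF QD(2) hx]
    note fgx = lin_closed[OF f gx] and fsgx = lin_closed[OF f sgx]
    note Lc = lsum_closed[OF lmod_ag[OF Qm] fgx] lsum_closed[OF lmod_ag[OF Qm] fsgx]
    have e: "dQ i (f k ?S (s (g k ?S x))) = dQ i (f k ?S (g k ?S x))" if k: "k < n" for k
      using fd[OF k sgx[OF k]] fd[OF k gx[OF k]] ds[OF gx[OF k]] by simp
    have "dQ i (?s x) = dQ i (lsum ?Q n (%k. f k ?S (s (g k ?S x)))) +[Q i] dQ i (h i (dQ i x))"
      by (rule lin_simps(2)[OF QD(2) Lc(2) hdx])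
    also have "dQ i (lsum ?Q n (%k. f k ?S (s (g k ?S x)))) = dQ i (lsum ?Q n (%k. f k ?S (g k ?S x)))"
      using e lin_lsum_apply[OF QD(2) fsgx] lin_lsum_apply[OF QD(2) fgx] by simp
    also have "\<dots> +[Q i] dQ i (h i (dQ i x)) = dQ i x"
      by (subst (3) dec[OF x]) (simp add: Lc hdx dhx lin_simps[OF QD(2)] lmod_simps[OF Qm] QD(8)[OF hx])
    finally show ?thesis .
  qed
  ultimately show ?thesis unfolding sct_def by (intro exI[of _ ?s]) blast
qed

text \<open>The identity minus \<open>s\<close> takes values in the kernel of \<open>d n\<close>, so
  it lifts through the next differential to some \<open>t\<close>. Since \<open>s\<close> kills
  boundaries, \<open>t\<close> after that differential does the job one degree higher.\<close>

lemma sct_Suc: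
  assumes P: "pres R V P d e" and v: "sct R P d n"
  shows "sct R P d (Suc n)"
proof -
  let ?S = "Suc n"
  from v obtain s where s: "lin R (P ?S) (P ?S) s"
    and sd: "!!x. x el (P (Suc ?S)) ==> s (d ?S x) = 0[P ?S]"
    and ds: "!!x. x el (P ?S) ==> d n (s x) = d n x" by (auto simp: sct_def)
  note PD = presD[OF P] and Pm = pres_lmod[OF P]
  note [simp] = lmod_simps[OF Pm] lin_simps[OF s] lin_simps[OF PD(2)] PD(8) sd ds
  let ?g = "%x. x +[P ?S] -[P ?S] s x"
  have g: "lin R (P ?S) (P ?S) ?g" by (rule lin_add[OF lin_id[OF Pm] lin_neg[OF s]])
  obtain t where t: "lin R (P ?S) (P (Suc ?S)) t" "!!x. x el (P ?S) ==> d ?S (t x) = ?g x"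
    using proj_lift[OF PD(1) g PD(2)] PD(6) by auto
  show ?thesis unfolding sct_def
    by (intro exI[of _ "%x. t (d ?S x)"]) (auto intro: lin_comp[OF PD(2) t(1)] simp: t(2) lin_simps(3)[OF t(1)])
qed

lemma sct_mono:
  assumes "n <= m" "pres R V P d e" "sct R P d n"
  shows "sct R P d m"
  using assms by (induction m rule: dec_induct) (auto intro: sct_Suc)

section \<open>The standard resolution\<close>

lemma formal_sum_Cons:
  assumes "ring R" "r el R" "formal_sum R xs el (free_mod I R)"
  shows "formal_sum R ((r, b) # xs) = (%c. r *[R] dlt R b 1[R] c +[R] formal_sum R xs c)"
  using assms by (auto simp: formal_sum_def dlt_def fun_eq_iff ring_rules copies_carrier)

lemma formal_sum_free:
  assumes R: "ring R" and "set xs \<subseteq> carrier R \<times> I"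
  shows "formal_sum R xs el (free_mod I R)"
  using assms(2)
proof (induction xs)
  case Nil
  then show ?case by (simp add: formal_sum_def copies_carrier ring_rules[OF R])
next
  case (Cons a xs)
  obtain r b where a: "a = (r, b)" "r el R" "b : I" using Cons by auto
  have xs: "formal_sum R xs el (free_mod I R)" using Cons by auto
  note F = free_lmod[OF R, of I]
  have "dlt R b 1[R] el (free_mod I R)" using a R by (intro dlt_free) (simp_all add: ring_rules)
  then have "r .[free_mod I R] dlt R b 1[R] +[free_mod I R] formal_sum R xs el (free_mod I R)"
    using xs a(2) by (intro lmod_simps(2)[OF F] lmod_simps(13)[OF F])
  then show ?case using formal_sum_Cons[OF R a(2) xs] a(1) by simp
qed

text \<open>This surjectivity makes the standard resolution exact: a cycle can be written as a list,
  and that list is itself a basis element of the next degree.\<close>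

lemma free_formal_sum:
  assumes R: "ring R" and "x el (free_mod I R)"
  shows "EX xs. set xs \<subseteq> carrier R \<times> I & formal_sum R xs = x"
  using assms
proof (induction x rule: free_induct)
  case zero
  show ?case by (intro exI[of _ "[]"]) (simp add: formal_sum_def fun_eq_iff)
next
  case (add b r y)
  then obtain xs where xs: "set xs \<subseteq> carrier R \<times> I" "formal_sum R xs = y" by auto
  then show ?case using add formal_sum_Cons[OF R, of r xs I b]
    by (intro exI[of _ "(r, b) # xs"]) auto
qed

context
  fixes R :: "'r ring" and M :: "('r, 'm) module"
  assumes M: "left_module R M"
begin

lemma std_aug_lin: "lin R (std_res R M 0) M (std_aug R M)"
  and std_aug_dlt: "b : std_basis R M 0 ==> std_aug R M (dlt R b 1[R]) = syz_elt b"
proof -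
  have "std_aug R M = ev R M syz_elt" by (simp add: fun_eq_iff std_aug_def ev_def)
  moreover have "!!b. b : std_basis R M 0 ==> syz_elt b el M" by auto
  ultimately show "lin R (std_res R M 0) M (std_aug R M)"
    "b : std_basis R M 0 ==> std_aug R M (dlt R b 1[R]) = syz_elt b"
    using ev_lin[OF M, of "std_basis R M 0" syz_elt] by (simp_all add: std_res_def)
qed

lemma syz_vec_free: "b : std_basis R M (Suc n) ==> syz_vec R b el (std_res R M n)"
  using formal_sum_free[OF lmod_ring[OF M]] by (auto simp: std_res_def)

lemma std_bd_lin: "lin R (std_res R M (Suc n)) (std_res R M n) (std_bd R)"
  and std_bd_dlt: "b : std_basis R M (Suc n) ==> std_bd R (dlt R b 1[R]) = syz_vec R b"
proof -
  note R = lmod_ring[OF M]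
  let ?I = "std_basis R M (Suc n)"
  let ?F = "std_res R M n"
  have F: "left_module R ?F" by (simp add: std_res_def free_lmod[OF R])
  \<comment> \<open>\<open>std_bd\<close> sums coordinates in \<open>R\<close>, \<open>ev\<close>
    sums vectors in the free module; applying a coordinate map, which is additive, compares
    them.\<close>
  have eq: "std_bd R f = ev R ?F (syz_vec R) f" if f: "f el (free_mod ?I R)" for f
  proof
    fix c
    have sv: "f b *[R] syz_vec R b c el R" if "f b ~= 0[R]" for b
    proof -
      have "b : std_basis R M (Suc n)" "f b el R"
        using f that by (auto simp: copies_carrier simp del: std_basis.simps)
      then show ?thesis using syz_vec_free[of b n] by (simp add: copies_carrier std_res_def ring_rules[OF R] del: std_basis.simps)
    qed
    have "(%b. f b .[?F] syz_vec R b) : {b. f b ~= 0[R]} \<rightarrow> carrier ?F"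
      using f by (intro Pi_I lmod_simps(13)[OF F] syz_vec_free) (auto simp: copies_carrier simp del: std_basis.simps)
    then have "ev R ?F (syz_vec R) f c = (\<Oplus>\<^bsub>reg_mod R\<^esub>b\<in>{b. f b ~= 0[R]}. (f b .[?F] syz_vec R b) c)"
      unfolding ev_def using f
      by (intro addm_finsum[OF lin_addm[OF lin_coord[OF reg_mod_lmod[OF R], of "std_basis R M n"]], folded std_res_def])
        (auto simp: copies_carrier)
    also have "\<dots> = std_bd R f c"
      unfolding std_bd_def
    proof (subst addm_finsum[symmetric, where f = "%x. x" and N = R and M = "reg_mod R"])
      show "addm (reg_mod R) R (%x. x)"
        by (rule addmI) (simp_all add: lmod_ag[OF reg_mod_lmod[OF R]] ring_ag[OF R] ring_rules[OF R])
    qed (use f sv in "auto simp: std_res_def copies_carrier")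
    finally show "std_bd R f c = ev R ?F (syz_vec R) f c" by simp
  qed
  show "lin R (std_res R M (Suc n)) ?F (std_bd R)"
    unfolding std_res_def[of R M "Suc n"]
    by (rule lin_cong[OF ev_lin(1)[OF F, of ?I, OF syz_vec_free] eq[symmetric]])
  show "std_bd R (dlt R b 1[R]) = syz_vec R b" if b: "b : ?I"
    using eq[OF dlt_free[OF R b]] ev_lin(2)[OF F syz_vec_free b] ring_rules[OF R] by simp
qed

text \<open>A cycle is the vector of a list \<open>xs\<close>; being a cycle is the condition for
  \<open>Syz xs\<close> to be a basis element, and its boundary is the given cycle. That boundaries
  are cycles is checked on basis vectors.\<close>

lemma std_pres: "pres R M (std_res R M) (%i. std_bd R) (std_aug R M)"
proof -
  note R = lmod_ring[OF M]
  have proj: "projective R (std_res R M i)" for i by (simp add: std_res_def proj_free[OF R])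
  have d1: "dlt R b 1[R] el (std_res R M n)" if "b : std_basis R M n" for b n
    unfolding std_res_def using that by (intro dlt_free[OF R]) (simp_all add: ring_rules[OF R])
  have "std_aug R M ` carrier (std_res R M 0) = carrier M"
  proof (intro equalityI subsetI)
    fix x assume "x el M"
    then have "Elt x : std_basis R M 0" by simp
    then show "x : std_aug R M ` carrier (std_res R M 0)"
      using std_aug_dlt[of "Elt x"] d1[of "Elt x" 0] by (intro image_eqI[of _ _ "dlt R (Elt x) 1[R]"]) auto
  qed (auto simp: lin_closed[OF std_aug_lin])
  moreover have "std_aug R M x = 0[M] \<longleftrightarrow> x : std_bd R ` carrier (std_res R M 1)" if x: "x el (std_res R M 0)" for x
  proof
    assume z: "std_aug R M x = 0[M]"
    obtain xs where xs: "set xs \<subseteq> carrier R \<times> std_basis R M 0" "formal_sum R xs = x"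
      using free_formal_sum[OF R] x by (auto simp: std_res_def simp del: std_basis.simps)
    then have b: "Syz xs : std_basis R M (Suc 0)" using z by auto
    show "x : std_bd R ` carrier (std_res R M 1)"
      using std_bd_dlt[OF b] xs d1[OF b] by (intro image_eqI[of _ _ "dlt R (Syz xs) 1[R]"]) auto
  next
    assume "x : std_bd R ` carrier (std_res R M 1)"
    then obtain y where y: "y el (free_mod (std_basis R M 1) R)" "x = std_bd R y" by (auto simp: std_res_def)
    have "std_aug R M (std_bd R y) = 0[M]"
    proof (rule free_eqI[OF _ _ _ y(1)])
      show "lin R (free_mod (std_basis R M 1) R) M (%y. std_aug R M (std_bd R y))"
        using lin_comp[OF std_bd_lin std_aug_lin] by (simp add: std_res_def)
      show "lin R (free_mod (std_basis R M 1) R) M (%y. 0[M])" by (rule lin_zero[OF free_lmod[OF R] M])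
    qed (use std_bd_dlt[of _ 0] in auto)
    then show "std_aug R M x = 0[M]" using y by simp
  qed
  moreover have "std_bd R x = 0[std_res R M n] \<longleftrightarrow> x : std_bd R ` carrier (std_res R M (Suc (Suc n)))"
    if x: "x el (std_res R M (Suc n))" for x n
  proof
    assume z: "std_bd R x = 0[std_res R M n]"
    obtain xs where xs: "set xs \<subseteq> carrier R \<times> std_basis R M (Suc n)" "formal_sum R xs = x"
      using free_formal_sum[OF R] x by (auto simp: std_res_def simp del: std_basis.simps)
    then have b: "Syz xs : std_basis R M (Suc (Suc n))" using z by (subst std_basis.simps) (auto simp: std_res_def)
    show "x : std_bd R ` carrier (std_res R M (Suc (Suc n)))"
      using std_bd_dlt[OF b] xs d1[OF b] by (intro image_eqI[of _ _ "dlt R (Syz xs) 1[R]"]) auto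
  next
    assume "x : std_bd R ` carrier (std_res R M (Suc (Suc n)))"
    then obtain y where y: "y el (free_mod (std_basis R M (Suc (Suc n))) R)" "x = std_bd R y"
      by (auto simp: std_res_def simp del: std_basis.simps)
    have "std_bd R (std_bd R y) = 0[std_res R M n]"
    proof (rule free_eqI[OF _ _ _ y(1)])
      show "lin R (free_mod (std_basis R M (Suc (Suc n))) R) (std_res R M n) (%y. std_bd R (std_bd R y))"
        using lin_comp[OF std_bd_lin std_bd_lin] by (simp add: std_res_def del: std_basis.simps)
      show "lin R (free_mod (std_basis R M (Suc (Suc n))) R) (std_res R M n) (%y. 0[std_res R M n])"
        by (rule lin_zero[OF free_lmod[OF R] proj_lmod[OF proj]])
      fix b assume b: "b : std_basis R M (Suc (Suc n))"
      then show "std_bd R (std_bd R (dlt R b 1[R])) = 0[std_res R M n]"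
        unfolding std_bd_dlt[OF b] by (subst (asm) std_basis.simps) (auto simp: std_res_def)
    qed
    then show "std_bd R x = 0[std_res R M n]" using y by simp
  qed
  ultimately show ?thesis
    unfolding pres_def using std_bd_lin std_aug_lin proj by blast
qed

end

section \<open>Vanishing of Ext\<close>

text \<open>The bridge from the quotient groups \<open>Ext\<close> and \<open>Tor\<close> to
  inclusions of cycles in boundaries; beyond it only the latter are used.\<close>

lemma trivial_quotient_iff:
  assumes G: "comm_group G" and K: "subgroup K G" and H: "subgroup H G" and HK: "H \<subseteq> K"
  shows "trivial_group (G\<lparr>carrier := K\<rparr> Mod H) \<longleftrightarrow> K \<subseteq> H"
proof -
  interpret G: comm_group G by fact
  let ?K = "G\<lparr>carrier := K\<rparr>"
  have K': "comm_group ?K" using G.subgroup_imp_group[OF K] subgroup.subset[OF K]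
    by (intro group.group_comm_groupI) (auto intro: G.m_comm)
  interpret K: comm_group ?K by (rule K')
  have HK': "subgroup H ?K" by (rule G.subgroup_incl[OF H K HK])
  interpret Q: comm_group "?K Mod H" by (rule K.abelian_FactGroup[OF HK'])
  show ?thesis
  proof
    assume t: "trivial_group (?K Mod H)"
    show "K \<subseteq> H"
    proof
      fix x assume x: "x : K"
      have "H #>\<^bsub>?K\<^esub> x el (?K Mod H)" unfolding carrier_FactGroup using x by auto
      then have "H #>\<^bsub>?K\<^esub> x = H" using t by (simp add: trivial_group_def)
      then show "x : H" using K.coset_join1[OF _ _ HK'] x by auto
    qed
  next
    assume "K \<subseteq> H"
    then have "carrier (?K Mod H) \<subseteq> {H}" unfolding carrier_FactGroup using K.coset_join2[OF _ HK'] by auto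
    then show "trivial_group (?K Mod H)" by (simp add: Q.trivial_group_subset)
  qed
qed

lemma hom_grp_simps [simp]:
  "carrier (hom_grp R M N) = mod_hom R M N" "one (hom_grp R M N) = (\<lambda>x\<in>carrier M. 0[N])"
  "monoid.mult (hom_grp R M N) f g = (\<lambda>x\<in>carrier M. f x +[N] g x)"
  by (simp_all add: hom_grp_def)

lemma mod_hom_eqI: "[| f : mod_hom R M N; g : mod_hom R M N; !!x. x el M ==> f x = g x |] ==> f = g"
  using extensionalityI[OF mod_homD mod_homD] by blast

lemma hom_grp_comm_group:
  assumes M: "left_module R M" and N: "left_module R N"
  shows "comm_group (hom_grp R M N)"
proof -
  let ?H = "hom_grp R M N"
  note [simp] = lmod_simps[OF M] lmod_simps[OF N] and l = mod_hom_lin[OF _ M N]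
  have add: "(\<lambda>x\<in>carrier M. f x +[N] g x) : mod_hom R M N" if "f : mod_hom R M N" "g : mod_hom R M N" for f g
    using restrict_mod_hom[OF lin_add[OF l l]] that by blast
  have zero: "(\<lambda>x\<in>carrier M. 0[N]) : mod_hom R M N" by (rule restrict_mod_hom[OF lin_zero[OF M N]])
  have cl: "f x el N" if "f : mod_hom R M N" "x el M" for f x
    by (rule lin_closed[OF l[OF that(1)] that(2)])
  show ?thesis
  proof (rule comm_groupI)
    show "EX g:carrier ?H. g *[hom_grp R M N] f = 1[hom_grp R M N]"
      if "f el ?H" for f
      using that restrict_mod_hom[OF lin_neg[OF l]] cl
      by (intro bexI[of _ "\<lambda>x\<in>carrier M. -[N] f x"]) auto
    show "1[hom_grp R M N] *[hom_grp R M N] f = f" if "f el ?H" for f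
      using that cl mod_homD[of f R M N] by (auto simp: extensional_restrict fun_eq_iff extensional_def)
    show "f *[hom_grp R M N] g = g *[hom_grp R M N] f"
      if "f el ?H" "g el ?H" for f g
      using that cl by (auto simp: fun_eq_iff lmod_ac(2)[OF N])
    show "f *[hom_grp R M N] g *[hom_grp R M N] h = f *[hom_grp R M N] (g *[hom_grp R M N] h)"
      if "f el ?H" "g el ?H" "h el ?H" for f g h
      using that cl by (auto simp: fun_eq_iff lmod_ac(1)[OF N])
  qed (use add zero in auto)
qed

lemma compose_group_hom:
  assumes d: "lin R P Q d" and N: "left_module R N"
  shows "group_hom (hom_grp R Q N) (hom_grp R P N) (%g. compose (carrier P) g d)"
proof -
  note P = lin_mod(1)[OF d] and Q = lin_mod(2)[OF d]
  have "compose (carrier P) g d : mod_hom R P N" if "g : mod_hom R Q N" for g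
    using restrict_mod_hom[OF lin_comp[OF d mod_hom_lin[OF that Q N]]] by (simp add: compose_def)
  then have "(%g. compose (carrier P) g d) : hom (hom_grp R Q N) (hom_grp R P N)"
    using lin_closed[OF d] by (intro homI) (auto simp: compose_def fun_eq_iff)
  then show ?thesis
    using hom_grp_comm_group[OF P N] hom_grp_comm_group[OF Q N]
    by (simp add: group_hom_def group_hom_axioms_def comm_group_def)
qed

text \<open>All Ext groups in positive degrees at once. The standard resolution serves as the
  reference; \<open>ext0_extv\<close> and \<open>extv_ext0\<close> exchange it for any
  other.\<close>

definition ext0 :: "'r ring => ('r, 'm) module => ('r, 'n) module => bool"
  where "ext0 R M N \<longleftrightarrow> extv R (std_res R M) (%i. std_bd R) N"

lemma Ext_trivial_iff:
  assumes M: "left_module R M" and N: "left_module R N"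
  shows "(ALL i>0. trivial_group (Ext R i M N)) \<longleftrightarrow> ext0 R M N"
proof -
  let ?P = "std_res R M" and ?d = "std_bd R"
  let ?D = "%i g. compose (carrier (?P (Suc i))) g ?d"
  note r = std_pres[OF M]
  note D = presD[OF r] and Pm = pres_lmod[OF r]
  have gh: "group_hom (hom_grp R (?P i) N) (hom_grp R (?P (Suc i)) N) (?D i)" for i
    by (rule compose_group_hom[OF D(2) N])
  have "trivial_group (Ext R (Suc i) M N) \<longleftrightarrow>
    (ALL c. lin R (?P (Suc i)) N c & (ALL x:carrier (?P (Suc (Suc i))). c (?d x) = 0[N])
    --> (EX b. lin R (?P i) N b & (ALL x:carrier (?P (Suc i)). c x = b (?d x))))" (is "_ \<longleftrightarrow> ?R") for i
  proof -
    let ?K = "kernel (hom_grp R (?P (Suc i)) N) (hom_grp R (?P (Suc (Suc i))) N) (?D (Suc i))"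
    let ?H = "?D i ` mod_hom R (?P i) N"
    interpret f: group_hom "hom_grp R (?P i) N" "hom_grp R (?P (Suc i)) N" "?D i" by (rule gh)
    interpret g: group_hom "hom_grp R (?P (Suc i)) N" "hom_grp R (?P (Suc (Suc i))) N" "?D (Suc i)" by (rule gh)
    have Kiff: "c : ?K \<longleftrightarrow> c : mod_hom R (?P (Suc i)) N & (ALL x:carrier (?P (Suc (Suc i))). c (?d x) = 0[N])" for c
      by (auto simp: kernel_def compose_def fun_eq_iff)
    have Hiff: "c : ?H \<longleftrightarrow> c : mod_hom R (?P (Suc i)) N &
        (EX b. lin R (?P i) N b & (ALL x:carrier (?P (Suc i)). c x = b (?d x)))" for c
    proof
      assume "c : ?H"
      then obtain b where b: "b : mod_hom R (?P i) N" "c = ?D i b" by auto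
      have "?D i b : mod_hom R (?P (Suc i)) N" using f.hom_closed[of b] b by simp
      then show "c : mod_hom R (?P (Suc i)) N & (EX b. lin R (?P i) N b & (ALL x:carrier (?P (Suc i)). c x = b (?d x)))"
        using b mod_hom_lin[OF b(1) Pm N] by (auto simp: compose_def)
    next
      assume c: "c : mod_hom R (?P (Suc i)) N & (EX b. lin R (?P i) N b & (ALL x:carrier (?P (Suc i)). c x = b (?d x)))"
      then obtain b where b: "lin R (?P i) N b" "!!x. x el (?P (Suc i)) ==> c x = b (?d x)" by auto
      have "c = ?D i (restrict b (carrier (?P i)))"
        using b(2) mod_homD[OF conjunct1[OF c]] lin_closed[OF D(2)] by (auto simp: compose_def fun_eq_iff extensional_def)
      then show "c : ?H" using restrict_mod_hom[OF b(1)] by blast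
    qed
    have "subgroup ?H (hom_grp R (?P (Suc i)) N)" using f.img_is_subgroup by simp
    moreover have "?H \<subseteq> ?K"
    proof
      fix c assume "c : ?H"
      then obtain b where c: "c : mod_hom R (?P (Suc i)) N" and b: "lin R (?P i) N b"
        "!!x. x el (?P (Suc i)) ==> c x = b (?d x)" by (auto simp: Hiff)
      have "c (?d x) = 0[N]" if "x el (?P (Suc (Suc i)))" for x
        using b(2)[OF lin_closed[OF D(2) that]] D(8)[OF that] lin_simps(3)[OF b(1)] by simp
      then show "c : ?K" using c by (simp add: Kiff)
    qed
    ultimately have "trivial_group ((hom_grp R (?P (Suc i)) N)\<lparr>carrier := ?K\<rparr> Mod ?H) \<longleftrightarrow> ?K \<subseteq> ?H"
      by (intro trivial_quotient_iff hom_grp_comm_group Pm N g.subgroup_kernel)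
    also have "?K \<subseteq> ?H \<longleftrightarrow> ?R"
    proof
      assume KH: "?K \<subseteq> ?H"
      show ?R
      proof (intro allI impI, elim conjE)
        fix c assume c: "lin R (?P (Suc i)) N c" "ALL x:carrier (?P (Suc (Suc i))). c (?d x) = 0[N]"
        then have "restrict c (carrier (?P (Suc i))) : ?K"
          using restrict_mod_hom[OF c(1)] lin_closed[OF D(2)] by (simp add: Kiff)
        then have "restrict c (carrier (?P (Suc i))) : ?H" using KH by blast
        then show "EX b. lin R (?P i) N b & (ALL x:carrier (?P (Suc i)). c x = b (?d x))" by (simp add: Hiff)
      qed
    next
      assume R: ?R
      show "?K \<subseteq> ?H"
      proof
        fix c assume "c : ?K"
        then show "c : ?H" using R mod_hom_lin[OF _ Pm N, of c] by (simp add: Kiff Hiff)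
      qed
    qed
    finally show ?thesis by (simp add: Ext_def cohomology_def)
  qed
  then show ?thesis unfolding ext0_def extv_def
    by (metis gr0_conv_Suc zero_less_Suc)
qed

lemma extv_ext0: "pres R M P d e ==> extv R P d N ==> ext0 R M N"
  unfolding ext0_def using extv_transfer[OF _ std_pres addr_refl] lin_mod(2)[OF presD(3)] by blast

lemma ext0_extv: "pres R M P d e ==> ext0 R M N ==> extv R P d N"
  unfolding ext0_def using extv_transfer[OF std_pres _ addr_refl] lin_mod(2)[OF presD(3)] by blast

lemma ext0_addr: "[| addr R M L; ext0 R M N |] ==> ext0 R L N"
  unfolding ext0_def using extv_transfer[OF std_pres std_pres] addr_lmod by blast

section \<open>Short exact sequences and mapping cones\<close>

definition ses :: "'r ring => ('r, 'l) module => ('r, 'm) module => ('r, 'n) module => ('l => 'm) => ('m => 'n) => bool"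
  where "ses R L M N j p \<longleftrightarrow> lin R L M j & lin R M N p & (ALL x:carrier L. j x = 0[M] --> x = 0[L]) &
    (ALL x:carrier M. p x = 0[N] \<longleftrightarrow> x : j ` carrier L) & p ` carrier M = carrier N"

text \<open>The second complex is shifted up by one. Degree 0 has no shifted part, and the zero
  submodule of \<open>L 0\<close> stands in for it so that all degrees share one type.\<close>

definition cone :: "(nat => ('r, 'm) module) => (nat => ('r, 'l) module) => nat => ('r, 'm \<times> 'l) module"
  where "cone H L n = dsum (H n) (case n of 0 => (L 0)\<lparr>carrier := {0[L 0]}\<rparr> | Suc k => L k)"

text \<open>The sign on the shifted part makes consecutive differentials compose to zero for a chain
  map \<open>f\<close>. In degree 0 the second component is the only element available.\<close>

definition cone_d :: "(nat => ('r, 'm) module) => (nat => ('r, 'l) module) => (nat => 'm => 'm) => (nat => 'l => 'l) =>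
    (nat => 'l => 'm) => nat => 'm \<times> 'l => 'm \<times> 'l"
  where "cone_d H L dH dL f n = (%(h, l). (dH n h +[H n] f n l, case n of 0 => 0[L 0] | Suc k => -[L k] dL k l))"

lemma zero_lmod: "left_module R M ==> left_module R (M\<lparr>carrier := {0[M]}\<rparr>)"
  by (rule submod_lmod) (auto simp: lmod_simps)

text \<open>If \<open>f\<close> lifts the injection \<open>j\<close>, the mapping cone resolves its
  cokernel. This replaces the long exact sequences: all information on \<open>N\<close> is read off
  from the resolutions of \<open>L\<close> and \<open>M\<close>.\<close>

lemma pres_cone:
  assumes s: "ses R L M N j p" and PH: "pres R M H dH eH" and PL: "pres R L Q dQ eQ"
    and f: "!!i. lin R (Q i) (H i) (f i)" and ef: "!!x. x el (Q 0) ==> eH (f 0 x) = j (eQ x)"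
    and fd: "!!i x. x el (Q (Suc i)) ==> dH i (f (Suc i) x) = f i (dQ i x)"
  shows "pres R N (cone H Q) (cone_d H Q dH dQ f) (%(h, l). p (eH h))"
proof -
  note HD = presD[OF PH] and QD = presD[OF PL] and Hm = pres_lmod[OF PH] and Qm = pres_lmod[OF PL]
  from s have j: "lin R L M j" and p: "lin R M N p" and jinj: "!!x. [| x el L; j x = 0[M] |] ==> x = 0[L]"
    and ex: "!!x. x el M ==> p x = 0[N] \<longleftrightarrow> x : j ` carrier L" and psurj: "p ` carrier M = carrier N"
    by (auto simp: ses_def)
  note simps = lmod_simps[OF Hm] lmod_simps[OF Qm] lin_simps[OF HD(2)] lin_simps[OF QD(2)] lin_simps[OF f]
    lin_simps[OF j] lin_simps[OF p] lin_simps[OF HD(3)] lin_simps[OF QD(3)] lmod_simps[OF lin_mod(1)[OF j]]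
    lmod_simps[OF lin_mod(2)[OF j]] lmod_simps[OF lin_mod(2)[OF p]] HD(7,8) QD(7,8) ef fd
  note [simp] = simps
  note Z = zero_lmod[OF Qm[of 0]]
  have proj: "projective R (cone H Q i)" for i
  proof (cases i)
    case 0
    then show ?thesis unfolding cone_def using proj_zero[OF Z] by (auto intro!: proj_dsum HD(1))
  next
    case (Suc k)
    then show ?thesis unfolding cone_def by (auto intro!: proj_dsum HD(1) QD(1))
  qed
  have dl: "lin R (cone H Q (Suc i)) (cone H Q i) (cone_d H Q dH dQ f i)" for i
    by (rule linI) (auto simp: proj_lmod[OF proj], auto simp: cone_def cone_d_def lmod_ac[OF Hm] lmod_ac[OF Qm] split: nat.splits)
  have el: "lin R (cone H Q 0) N (%(h, l). p (eH h))"
    by (rule linI) (auto simp: proj_lmod[OF proj] lin_mod[OF p], auto simp: cone_def)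
  have surj: "(%(h, l). p (eH h)) ` carrier (cone H Q 0) = carrier N"
  proof (intro equalityI subsetI)
    fix y assume "y el N"
    then obtain x h where "h el (H 0)" "y = p (eH h)" unfolding psurj[symmetric] HD(4)[symmetric] by auto
    then show "y : (%(h, l). p (eH h)) ` carrier (cone H Q 0)"
      by (intro image_eqI[of _ _ "(h, 0[Q 0])"]) (auto simp: cone_def)
  qed (auto simp: cone_def)
  have ex0: "(%(h, l). p (eH h)) x = 0[N] \<longleftrightarrow> x : cone_d H Q dH dQ f 0 ` carrier (cone H Q 1)"
    if x: "x el (cone H Q 0)" for x
  proof
    assume z: "(%(h, l). p (eH h)) x = 0[N]"
    obtain h where h: "x = (h, 0[Q 0])" "h el (H 0)" using x by (auto simp: cone_def)
    then have "eH h : j ` eQ ` carrier (Q 0)" using z ex[of "eH h"] QD(4) by simp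
    then obtain l where l: "l el (Q 0)" "eH h = j (eQ l)" by auto
    have "h +[H 0] -[H 0] f 0 l : dH 0 ` carrier (H (Suc 0))" using h l by (intro HD(5)) auto
    then obtain k where k: "k el (H (Suc 0))" "dH 0 k = h +[H 0] -[H 0] f 0 l" by auto
    have "dH 0 k +[H 0] f 0 l = h" using h l k by (simp add: lmod_ac(1)[OF Hm])
    then show "x : cone_d H Q dH dQ f 0 ` carrier (cone H Q 1)" using h k l
      by (intro image_eqI[of _ _ "(k, l)"]) (auto simp: cone_def cone_d_def)
  next
    assume "x : cone_d H Q dH dQ f 0 ` carrier (cone H Q 1)"
    then obtain h l where hl: "h el (H (Suc 0))" "l el (Q 0)" "x = cone_d H Q dH dQ f 0 (h, l)"
      by (auto simp: cone_def)
    then show "(%(h, l). p (eH h)) x = 0[N]" using ex[of "j (eQ l)"] by (simp add: cone_d_def)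
  qed
  have exS: "cone_d H Q dH dQ f i x = 0[cone H Q i] \<longleftrightarrow> x : cone_d H Q dH dQ f (Suc i) ` carrier (cone H Q (Suc (Suc i)))"
    if x: "x el (cone H Q (Suc i))" for i x
  proof
    assume z: "cone_d H Q dH dQ f i x = 0[cone H Q i]"
    obtain h l where hl: "x = (h, l)" "h el (H (Suc i))" "l el (Q i)" using x by (auto simp: cone_def)
    then have z1: "dH i h +[H i] f i l = 0[H i]" using z by (simp add: cone_d_def cone_def)
    have "-[Q i] l : dQ i ` carrier (Q (Suc i))"
    proof (cases i)
      \<comment> \<open>Injectivity of \<open>j\<close> enters here, at the bottom of the shifted
        complex: it shows that \<open>eQ l\<close> is zero. In higher degrees \<open>l\<close> is a
        cycle because the second component of the differential vanishes.\<close>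
      case 0
      have "eH (dH 0 h +[H 0] f 0 l) = 0[M]" using z1 0 by simp
      then have "j (eQ l) = 0[M]" using hl 0 by simp
      then have "eQ l = 0[L]" using hl 0 by (intro jinj) auto
      then show ?thesis unfolding 0 using hl 0 by (intro QD(5)) auto
    next
      case (Suc k)
      have "-[Q k] dQ k l = 0[Q k]" using z hl Suc by (simp add: cone_d_def cone_def)
      then show ?thesis unfolding Suc using hl Suc by (intro QD(6)) auto
    qed
    then obtain m where m: "m el (Q (Suc i))" "dQ i m = -[Q i] l" by auto
    have "h +[H (Suc i)] -[H (Suc i)] f (Suc i) m : dH (Suc i) ` carrier (H (Suc (Suc i)))"
      using hl m z1 by (intro HD(6)) auto
    then obtain k where k: "k el (H (Suc (Suc i)))" "dH (Suc i) k = h +[H (Suc i)] -[H (Suc i)] f (Suc i) m" by auto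
    have "dH (Suc i) k +[H (Suc i)] f (Suc i) m = h" using hl k m by (simp add: lmod_ac(1)[OF Hm])
    then show "x : cone_d H Q dH dQ f (Suc i) ` carrier (cone H Q (Suc (Suc i)))" using hl k m
      by (intro image_eqI[of _ _ "(k, m)"]) (auto simp: cone_def cone_d_def)
  next
    assume "x : cone_d H Q dH dQ f (Suc i) ` carrier (cone H Q (Suc (Suc i)))"
    then obtain h l where hl: "h el (H (Suc (Suc i)))" "l el (Q (Suc i))" "x = cone_d H Q dH dQ f (Suc i) (h, l)"
      by (auto simp: cone_def)
    then show "cone_d H Q dH dQ f i x = 0[cone H Q i]" by (auto simp: cone_d_def cone_def split: nat.splits)
  qed
  show ?thesis unfolding pres_def using proj dl el surj ex0 exS by blast
qed

lemma ses_lift: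
  assumes s: "ses R L M N j p" and PH: "pres R M H dH eH" and PL: "pres R L Q dQ eQ"
  shows "EX f. (ALL i. lin R (Q i) (H i) (f i)) & (ALL x:carrier (Q 0). eH (f 0 x) = j (eQ x)) &
    (ALL i. ALL x:carrier (Q (Suc i)). dH i (f (Suc i) x) = f i (dQ i x)) &
    pres R N (cone H Q) (cone_d H Q dH dQ f) (%(h, l). p (eH h))"
proof -
  have j: "lin R L M j" using s by (simp add: ses_def)
  obtain f where f: "(ALL i. lin R (Q i) (H i) (f i)) & (ALL x:carrier (Q 0). eH (f 0 x) = j (eQ x)) &
    (ALL i. ALL x:carrier (Q (Suc i)). dH i (f (Suc i) x) = f i (dQ i x))"
    using chain_map[OF PL PH j] ..
  then have "pres R N (cone H Q) (cone_d H Q dH dQ f) (%(h, l). p (eH h))"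
    by (intro pres_cone[OF s PH PL]) auto
  with f show ?thesis by blast
qed

text \<open>A cocycle \<open>c\<close> on the resolution of \<open>L\<close>, composed with the
  projection, is a cocycle on the cone one degree higher and bounds there by some \<open>b\<close>.
  The restriction of \<open>b\<close> to \<open>H\<close> is a cocycle, hence bounds by some
  \<open>a'\<close>, and \<open>a'\<close> after \<open>f\<close> minus the other restriction of
  \<open>b\<close> bounds \<open>c\<close>. The same argument in the lowest degree extends maps
  along \<open>j\<close>, which is what vanishing of the first Ext of \<open>N\<close>
  means.\<close>

lemma ext0_ses:
  assumes s: "ses R L M N j p" and M: "ext0 R M V" and N: "ext0 R N V"
  shows "ext0 R L V" and "lin R L V t ==> EX u. lin R M V u & (ALL x:carrier L. u (j x) = t x)"
proof -
  from s have j: "lin R L M j" and p: "lin R M N p" by (auto simp: ses_def)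
  let ?H = "std_res R M" and ?Q = "std_res R L" and ?d = "std_bd R"
  note PH = std_pres[OF lin_mod(2)[OF j]] and PL = std_pres[OF lin_mod(1)[OF j]]
  note HD = presD[OF PH] and QD = presD[OF PL] and Hm = pres_lmod[OF PH] and Qm = pres_lmod[OF PL]
  obtain f where "ALL i. lin R (?Q i) (?H i) (f i)" "ALL x:carrier (?Q 0). std_aug R M (f 0 x) = j (std_aug R L x)"
    "ALL i. ALL x:carrier (?Q (Suc i)). ?d (f (Suc i) x) = f i (?d x)"
    and C: "pres R N (cone ?H ?Q) (cone_d ?H ?Q (%_. ?d) (%_. ?d) f) (%(h, l). p (std_aug R M h))"
    using ses_lift[OF s PH PL] by blast
  then have f: "!!i. lin R (?Q i) (?H i) (f i)" and ef: "!!x. x el (?Q 0) ==> std_aug R M (f 0 x) = j (std_aug R L x)"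
    and fd: "!!i x. x el (?Q (Suc i)) ==> ?d (f (Suc i) x) = f i (?d x)"
    by blast+
  let ?C = "cone ?H ?Q" and ?D = "cone_d ?H ?Q (%_. ?d) (%_. ?d) f"
  have vC: "extv R ?C ?D V" by (rule ext0_extv[OF C N])
  have vH: "extv R ?H (%_. ?d) V" using M by (simp add: ext0_def)
  note [simp] = lmod_simps[OF Hm] lmod_simps[OF Qm] lin_simps[OF HD(2)] lin_simps[OF QD(2)] lin_simps[OF f]
    lin_simps[OF HD(3)] lin_simps[OF QD(3)] HD(7,8) QD(7,8)
  have Csnd: "lin R (?C (Suc i)) (?Q i) snd" for i
    unfolding cone_def using lin_snd[OF Hm Qm] by simp
  \<comment> \<open>The truncated subtraction is intended: for \<open>i = 0\<close> the second
    component is the zero of \<open>?Q 0\<close>, which is the one element of the degenerate part of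
    the cone.\<close>
  have Cinl: "lin R (?H i) (?C i) (%h. (h, 0[?Q (i - 1)]))" for i
    unfolding cone_def using lin_inl[OF Hm Qm] lin_inl[OF Hm zero_lmod[OF Qm]] by (cases i) auto
  have Cinr: "lin R (?Q i) (?C (Suc i)) (%l. (0[?H (Suc i)], l))" for i
    unfolding cone_def using lin_inr[OF Hm Qm] by simp
  show "ext0 R L V" unfolding ext0_def extv_def
  proof (intro allI impI, elim conjE)
    fix i c assume c: "lin R (?Q (Suc i)) V c" and cd: "ALL x:carrier (?Q (Suc (Suc i))). c (?d x) = 0[V]"
    note [simp] = lmod_simps[OF lin_mod(2)[OF c]] lin_simps[OF c]
    obtain b where b: "lin R (?C (Suc i)) V b"
      and bd: "!!x. x el (?C (Suc (Suc i))) ==> c (snd x) = b (?D (Suc i) x)"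
    proof (rule extvD[OF vC lin_comp[OF Csnd c]])
      show "c (snd (?D (Suc (Suc i)) x)) = 0[V]" if "x el (?C (Suc (Suc (Suc i))))" for x
        using that cd by (auto simp: cone_d_def cone_def)
    qed blast
    let ?a = "%h. b (h, 0[?Q i])" and ?b = "%l. b (0[?H (Suc i)], l)"
    have la: "lin R (?H (Suc i)) V ?a" using lin_comp[OF Cinl b] by simp
    have lb: "lin R (?Q i) V ?b" by (rule lin_comp[OF Cinr b])
    have split: "b (h, l) = ?a h +[V] ?b l" if "h el (?H (Suc i))" "l el (?Q i)" for h l
      using lin_simps(2)[OF b, of "(h, 0[?Q i])" "(0[?H (Suc i)], l)"] that by (simp add: cone_def)
    obtain a' where a': "lin R (?H i) V a'" "!!h. h el (?H (Suc i)) ==> ?a h = a' (?d h)"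
    proof (rule extvD[OF vH la])
      show "?a (?d h) = 0[V]" if "h el (?H (Suc (Suc i)))" for h
        using bd[of "(h, 0[?Q (Suc i)])"] that by (simp add: cone_d_def cone_def)
    qed blast
    have "lin R (?Q i) V (%l. a' (f i l) +[V] -[V] ?b l)"
      by (rule lin_add[OF lin_comp[OF f a'(1)] lin_neg[OF lb]])
    moreover have "c l = a' (f i (?d l)) +[V] -[V] ?b (?d l)" if l: "l el (?Q (Suc i))" for l
    proof -
      have "c l = b (f (Suc i) l, -[?Q i] ?d l)"
        using bd[of "(0[?H (Suc (Suc i))], l)"] l by (simp add: cone_d_def cone_def)
      also have "\<dots> = a' (?d (f (Suc i) l)) +[V] ?b (-[?Q i] ?d l)" using l by (subst split) (auto simp: a'(2))
      also have "\<dots> = a' (f i (?d l)) +[V] -[V] ?b (?d l)" using l by (simp add: fd lin_simps(4)[OF lb])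
      finally show ?thesis .
    qed
    ultimately show "EX b. lin R (?Q i) V b & (ALL x:carrier (?Q (Suc i)). c x = b (?d x))" by blast
  qed
  assume t: "lin R L V t"
  note [simp] = lmod_simps[OF lin_mod(1)[OF t]] lmod_simps[OF lin_mod(2)[OF t]] lin_simps[OF t]
  obtain b where b: "lin R (?C 0) V b"
    and bd: "!!x. x el (?C (Suc 0)) ==> t (std_aug R L (snd x)) = b (?D 0 x)"
  proof (rule extvD[OF vC lin_comp[OF Csnd lin_comp[OF QD(3) t]]])
    show "t (std_aug R L (snd (?D (Suc 0) x))) = 0[V]" if "x el (?C (Suc (Suc 0)))" for x
      using that by (auto simp: cone_d_def cone_def)
  qed blast
  \<comment> \<open>In degree 0 the cone is just \<open>?H 0\<close>, so \<open>b\<close> is a map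
    on it; it kills boundaries and therefore descends to the extension on \<open>M\<close>.\<close>
  let ?a = "%h. b (h, 0[?Q 0])"
  have la: "lin R (?H 0) V ?a" using lin_comp[OF Cinl b] by simp
  have "?a h = 0[V]" if h: "h el (?H 0)" "std_aug R M h = 0[M]" for h
  proof -
    obtain k where k: "k el (?H (Suc 0))" "h = ?d k" using HD(5)[OF h] by auto
    then show ?thesis using bd[of "(k, 0[?Q 0])"] by (simp add: cone_d_def cone_def)
  qed
  then obtain u where u: "lin R M V u" "!!h. h el (?H 0) ==> u (std_aug R M h) = ?a h"
    using lin_factor[OF HD(3) la HD(4)] by auto
  have "u (j x) = t x" if "x el L" for x
  proof -
    obtain l where l: "l el (?Q 0)" "x = std_aug R L l" using \<open>x el L\<close> QD(4) by (metis imageE)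
    have "u (j x) = ?a (f 0 l)" using l ef[OF l(1)] u(2)[of "f 0 l"] by simp
    also have "\<dots> = t x" using bd[of "(0[?H (Suc 0)], l)"] l by (simp add: cone_d_def cone_def)
    finally show ?thesis .
  qed
  then show "EX u. lin R M V u & (ALL x:carrier L. u (j x) = t x)" using u by blast
qed

section \<open>Tensor products\<close>

lemma mk_module_simps [simp]:
  "carrier (mk_module G act) = carrier G" "ring.zero (mk_module G act) = 1[G]"
  "ring.add (mk_module G act) = monoid.mult G" "module.smult (mk_module G act) = act"
  by (simp_all add: mk_module_def)

lemma mk_module_ag:
  assumes "comm_group G"
  shows "abelian_group (mk_module G act)"
proof -
  interpret comm_group G by fact
  show ?thesis
    by (rule abelian_groupI) (auto simp: m_ac intro: bexI[of _ "inv\<^bsub>G\<^esub> _"])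
qed

definition ten :: "'s ring => ('s, 't) module => ('s, 'm) module => 't => 'm => ('t \<times> 'm \<Rightarrow>\<^sub>0 int) set"
  where "ten S T M t m = tensor_rel S T M #>\<^bsub>free_Abelian_group (carrier T \<times> carrier M)\<^esub> frag_of (t, m)"

text \<open>The tensor group in additive dress. The dummy scalars in \<open>unit\<close> serve only
  to obtain a record with a ring-style addition, to which the rules for abelian groups and for
  \<open>addm\<close> apply.\<close>

definition tgr :: "'s ring => ('s, 't) module => ('s, 'm) module => (unit, ('t \<times> 'm \<Rightarrow>\<^sub>0 int) set) module"
  where "tgr S T M = mk_module (tensor_grp S T M) (%_ z. z)"

lemma tgr_simps: "carrier (tgr S T M) = carrier (tensor_grp S T M)" "0[tgr S T M] = 1[tensor_grp S T M]"
  "ring.add (tgr S T M) = monoid.mult (tensor_grp S T M)"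
  by (simp_all add: tgr_def)

lemma add_monoid_tgr: "comm_group (tensor_grp S T M) ==> abelian_group (tgr S T M)"
  by (simp add: tgr_def mk_module_ag)

context
  fixes S :: "'s ring" and T :: "('s, 't) module" and M :: "('s, 'm) module"
  assumes T: "left_module (opp_ring S) T" and M: "left_module S M"
begin

private abbreviation (input) "F \<equiv> free_Abelian_group (carrier T \<times> carrier M)"
private abbreviation (input) "rel \<equiv> tensor_rel S T M"
private abbreviation (input) "cs x \<equiv> rel #>\<^bsub>F\<^esub> x"

lemma rel_subgroup: "subgroup rel F"
  unfolding tensor_rel_def
proof (rule group.generate_is_subgroup[OF group_free_Abelian_group])
  have k: "Poly_Mapping.keys (frag_of a - frag_of b - frag_of c) \<subseteq> {a, b, c}" for a b c :: "'t \<times> 'm"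
    by (rule order_trans[OF keys_diff]) (use keys_diff[of "frag_of a" "frag_of b"] in auto)
  have k2: "Poly_Mapping.keys (frag_of a - frag_of b) \<subseteq> {a, b}" for a b :: "'t \<times> 'm"
    using keys_diff[of "frag_of a" "frag_of b"] by auto
  show "{frag_of (t +[T] t', m) - frag_of (t, m) - frag_of (t', m) | t t' m.
        t el T & t' el T & m el M} \<union>
     {frag_of (t, m +[M] m') - frag_of (t, m) - frag_of (t, m') | t m m'.
        t el T & m el M & m' el M} \<union>
     {frag_of (s .[T] t, m) - frag_of (t, s .[M] m) | s t m.
        s el S & t el T & m el M} \<subseteq> carrier F"
    using lmod_simps[OF T] lmod_simps[OF M]
    by (auto dest!: subsetD[OF k] subsetD[OF k2])
qed

lemma tensor_comm_group: "comm_group (tensor_grp S T M)"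
  unfolding tensor_grp_def by (rule comm_group.abelian_FactGroup[OF abelian_free_Abelian_group rel_subgroup])

lemma tgr_ag: "abelian_group (tgr S T M)"
  by (rule add_monoid_tgr[OF tensor_comm_group])

lemma rel_normal: "rel \<lhd> F"
  using comm_group.normal_iff_subgroup[OF abelian_free_Abelian_group] rel_subgroup by blast

lemma cs_carrier: "x el F ==> cs x el (tgr S T M)"
  by (auto simp: tgr_simps tensor_grp_def carrier_FactGroup)

lemma cs_add: "[| x el F; y el F |] ==> cs (x + y) = cs x +[tgr S T M] cs y"
  using normal.rcos_sum[OF rel_normal, of x y] by (simp add: tgr_simps tensor_grp_def)

lemma cs_zero: "cs 0 = 0[tgr S T M]"
  using group.coset_join2[OF group_free_Abelian_group _ rel_subgroup, of 0] subgroup.one_closed[OF rel_subgroup]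
  by (simp add: tgr_simps tensor_grp_def)

lemma cs_minus: "x el F ==> cs (- x) = -[tgr S T M] cs x"
proof -
  assume x: "x el F"
  interpret A: abelian_group "tgr S T M" by (rule tgr_ag)
  have "cs (- x) +[tgr S T M] cs x = 0[tgr S T M]" using cs_add[of "- x" x] x cs_zero by simp
  then show ?thesis using x by (intro A.minus_equality[symmetric] cs_carrier) simp_all
qed

lemma cs_diff: "[| x el F; y el F |] ==> cs (x - y) = cs x +[tgr S T M] -[tgr S T M] cs y"
  using cs_add[of x "- y"] cs_minus[of y] by simp

lemma cs_eq_zero: "x : rel ==> cs x = 0[tgr S T M]"
  using group.coset_join2[OF group_free_Abelian_group _ rel_subgroup, of x] subgroup.mem_carrier[OF rel_subgroup]
  by (simp add: tgr_simps tensor_grp_def)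

lemma tgrE:
  assumes "Z el (tgr S T M)" obtains x where "x el F" "Z = cs x"
  using assms by (auto simp: tgr_simps tensor_grp_def carrier_FactGroup)

lemma ten_closed: "[| t el T; m el M |] ==> ten S T M t m el (tgr S T M)"
  unfolding ten_def by (rule cs_carrier) simp

lemma ten_add_l: "[| t el T; t' el T; m el M |]
    ==> ten S T M (t +[T] t') m = ten S T M t m +[tgr S T M] ten S T M t' m"
  and ten_add_r: "[| t el T; m el M; m' el M |]
    ==> ten S T M t (m +[M] m') = ten S T M t m +[tgr S T M] ten S T M t m'"
  and ten_balanced: "[| s el S; t el T; m el M |]
    ==> ten S T M (s .[T] t) m = ten S T M t (s .[M] m)"
proof -
  note [simp] = lmod_simps[OF T] lmod_simps[OF M] ag_simps[OF tgr_ag]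
  have eq3: "cs (frag_of a) = cs (frag_of b) +[tgr S T M] cs (frag_of c)"
    if "frag_of a - frag_of b - frag_of c : rel" "a : carrier T \<times> carrier M" "b : carrier T \<times> carrier M"
      "c : carrier T \<times> carrier M" for a b c
  proof -
    have "frag_of a = (frag_of a - frag_of b - frag_of c) + (frag_of b + frag_of c)" by simp
    then have "cs (frag_of a) = cs (frag_of a - frag_of b - frag_of c) +[tgr S T M] cs (frag_of b + frag_of c)"
      using cs_add[OF subgroup.mem_carrier[OF rel_subgroup that(1)], of "frag_of b + frag_of c"] that
        keys_add[of "frag_of b" "frag_of c"] by auto
    then show ?thesis using cs_eq_zero[OF that(1)] cs_add[of "frag_of b" "frag_of c"] that cs_carrier by simp
  qed
  show "ten S T M (t +[T] t') m = ten S T M t m +[tgr S T M] ten S T M t' m"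
    if "t el T" "t' el T" "m el M" for t t' m
    unfolding ten_def
  proof (rule eq3)
    show "frag_of (t +[T] t', m) - frag_of (t, m) - frag_of (t', m) : rel"
      unfolding tensor_rel_def using that by (intro generate.incl) blast
  qed (use that in auto)
  show "ten S T M t (m +[M] m') = ten S T M t m +[tgr S T M] ten S T M t m'"
    if "t el T" "m el M" "m' el M" for t m m'
    unfolding ten_def
  proof (rule eq3)
    show "frag_of (t, m +[M] m') - frag_of (t, m) - frag_of (t, m') : rel"
      unfolding tensor_rel_def using that by (intro generate.incl) blast
  qed (use that in auto)
  show "ten S T M (s .[T] t) m = ten S T M t (s .[M] m)" if "s el S" "t el T" "m el M" for s t m
  proof -
    let ?a = "frag_of (s .[T] t, m)" and ?b = "frag_of (t, s .[M] m)"
    have c: "?a el F" "?b el F" using that by auto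
    have r: "?a - ?b : rel" unfolding tensor_rel_def using that by (intro generate.incl) blast
    have "cs ?a +[tgr S T M] -[tgr S T M] cs ?b = 0[tgr S T M]"
      using cs_diff[OF c] cs_eq_zero[OF r] by simp
    then show ?thesis unfolding ten_def using ag_cancel[OF tgr_ag cs_carrier[OF c(1)] cs_carrier[OF c(2)]] by blast
  qed
qed

lemma ten_addm_l: "m el M ==> addm T (tgr S T M) (%t. ten S T M t m)"
  by (rule addmI) (auto simp: lmod_ag[OF T] tgr_ag ten_closed ten_add_l)

lemma ten_addm_r: "t el T ==> addm M (tgr S T M) (ten S T M t)"
  by (rule addmI) (auto simp: lmod_ag[OF M] tgr_ag ten_closed ten_add_r)

lemma ten_induct [consumes 1, case_names zero ten add]:
  assumes "Z el (tgr S T M)" and z: "P 0[tgr S T M]"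
    and t: "!!t m. [| t el T; m el M |] ==> P (ten S T M t m)"
    and a: "!!u v. [| u el (tgr S T M); v el (tgr S T M); P u; P v |] ==> P (u +[tgr S T M] v)"
  shows "P Z"
proof -
  obtain x where x: "x el F" "Z = cs x" using assms(1) by (rule tgrE)
  \<comment> \<open>The induction principle for free abelian groups proceeds by differences, so the
    property is carried for \<open>x\<close> and for its negative together. The negative of a pure
    tensor is again pure.\<close>
  have "P (cs x) & P (cs (- x))"
  proof (rule free_Abelian_group_induct[OF x(1)[unfolded carrier_free_Abelian_group_iff]])
    show "P (cs 0) & P (cs (- 0))" using z cs_zero by simp
  next
    fix x y assume 2: "Poly_Mapping.keys x \<subseteq> carrier T \<times> carrier M" "Poly_Mapping.keys y \<subseteq> carrier T \<times> carrier M"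
      "P (cs x) & P (cs (- x))" "P (cs y) & P (cs (- y))"
    then have "cs (x - y) = cs x +[tgr S T M] cs (- y)" "cs (- (x - y)) = cs y +[tgr S T M] cs (- x)"
      using cs_add[of x "- y"] cs_add[of y "- x"] by simp_all
    then show "P (cs (x - y)) & P (cs (- (x - y)))" using 2 a[OF cs_carrier cs_carrier] by simp
  next
    fix p assume "p : carrier T \<times> carrier M"
    then obtain t m where p: "p = (t, m)" "t el T" "m el M" by auto
    have "cs (- frag_of p) = ten S T M (-[T] t) m"
      using addm_simps(4)[OF ten_addm_l[OF p(3)] p(2)] cs_minus[of "frag_of p"] p by (simp add: ten_def)
    then show "P (cs (frag_of p)) & P (cs (- frag_of p))"
      using p t[of t m] t[of "-[T] t" m] lmod_simps(3)[OF T] by (simp add: ten_def)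
  qed
  then show ?thesis using x by simp
qed

lemma ten_eqI:
  assumes f: "addm (tgr S T M) W f" and g: "addm (tgr S T M) W g"
    and "!!t m. [| t el T; m el M |] ==> f (ten S T M t m) = g (ten S T M t m)"
    and "z el (tgr S T M)"
  shows "f z = g z"
  using assms(4) by (induction z rule: ten_induct) (simp_all add: addm_simps[OF f] addm_simps[OF g] assms(3))

lemma ten_lift:
  assumes W: "abelian_group W" and c: "!!t m. [| t el T; m el M |] ==> f t m el W"
    and al: "!!t t' m. [| t el T; t' el T; m el M |] ==> f (t +[T] t') m = f t m +[W] f t' m"
    and ar: "!!t m m'. [| t el T; m el M; m' el M |] ==> f t (m +[M] m') = f t m +[W] f t m'"
    and bal: "!!s t m. [| s el S; t el T; m el M |] ==> f (s .[T] t) m = f t (s .[M] m)"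
  shows "EX h. addm (tgr S T M) W h & (ALL t:carrier T. ALL m:carrier M. h (ten S T M t m) = f t m)"
proof -
  note [simp] = lmod_simps[OF T] lmod_simps[OF M] ag_simps[OF W]
  interpret W: abelian_group W by fact
  let ?W = "add_monoid W"
  obtain h where h: "h : hom F ?W" and hf: "!!x. x : carrier T \<times> carrier M ==> h (frag_of x) = (%(t, m). f t m) x"
  proof (rule comm_group.free_Abelian_group_universal[OF W.a_comm_group])
    show "(%(t, m). f t m) ` (carrier T \<times> carrier M) \<subseteq> carrier ?W" using c by auto
  qed blast
  interpret h: group_hom F ?W h
    using h W.a_group by (simp add: group_hom_def group_hom_axioms_def)
  have hd: "h (x - y) = h x +[W] -[W] h y" if "x el F" "y el F" for x y
    using h.hom_mult[of x "- y"] h.hom_inv[of y] that by (simp add: a_inv_def)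
  have hc: "h x el W" if "x el F" for x using h.hom_closed[OF that] by simp
  have d3: "h (frag_of a - frag_of b - frag_of e) = 0[W]"
    if "a : carrier T \<times> carrier M" "b : carrier T \<times> carrier M" "e : carrier T \<times> carrier M"
      "h (frag_of a) = h (frag_of b) +[W] h (frag_of e)" for a b e
  proof -
    have k: "frag_of a - frag_of b el F" using that keys_diff[of "frag_of a" "frag_of b"] by auto
    have c1: "h (frag_of b) el W" "h (frag_of e) el W" using that by (auto intro!: hc)
    have "h (frag_of a - frag_of b - frag_of e) = (h (frag_of a) +[W] -[W] h (frag_of b)) +[W] -[W] h (frag_of e)"
      using hd[OF k, of "frag_of e"] hd[of "frag_of a" "frag_of b"] that by simp
    also have "\<dots> = 0[W]" using c1 unfolding that(4)
      by (simp add: ag_ac(1,2)[OF W] ag_simps[OF W])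
    finally show ?thesis .
  qed
  have "rel \<subseteq> kernel F ?W h"
    unfolding tensor_rel_def
  proof (rule group.generate_subgroup_incl[OF group_free_Abelian_group _ h.subgroup_kernel], intro Un_least subsetI)
    fix x assume "x : {frag_of (t +[T] t', m) - frag_of (t, m) - frag_of (t', m) | t t' m.
        t el T & t' el T & m el M}"
    then obtain t t' m where x: "x = frag_of (t +[T] t', m) - frag_of (t, m) - frag_of (t', m)"
      "t el T" "t' el T" "m el M" by auto
    then have "x : rel" unfolding tensor_rel_def by (intro generate.incl) blast
    moreover have "h x = 0[W]" unfolding x(1) by (rule d3) (use x al in "auto simp: hf")
    ultimately show "x : kernel F ?W h" using subgroup.mem_carrier[OF rel_subgroup] by (simp add: kernel_def)
  next
    fix x assume "x : {frag_of (t, m +[M] m') - frag_of (t, m) - frag_of (t, m') | t m m'.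
        t el T & m el M & m' el M}"
    then obtain t m m' where x: "x = frag_of (t, m +[M] m') - frag_of (t, m) - frag_of (t, m')"
      "t el T" "m el M" "m' el M" by auto
    then have "x : rel" unfolding tensor_rel_def by (intro generate.incl) blast
    moreover have "h x = 0[W]" unfolding x(1) by (rule d3) (use x ar in "auto simp: hf")
    ultimately show "x : kernel F ?W h" using subgroup.mem_carrier[OF rel_subgroup] by (simp add: kernel_def)
  next
    fix x assume "x : {frag_of (s .[T] t, m) - frag_of (t, s .[M] m) | s t m.
        s el S & t el T & m el M}"
    then obtain s t m where x: "x = frag_of (s .[T] t, m) - frag_of (t, s .[M] m)"
      "s el S" "t el T" "m el M" by auto
    then have "x : rel" unfolding tensor_rel_def by (intro generate.incl) blast
    moreover have "h x = 0[W]" unfolding x(1) using x c bal by (subst hd) (auto simp: hf ag_simps[OF W])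
    ultimately show "x : kernel F ?W h" using subgroup.mem_carrier[OF rel_subgroup] by (simp add: kernel_def)
  qed
  then obtain g where g: "g : hom (F Mod rel) ?W" "!!x. x el F ==> g (cs x) = h x"
    using h.FactGroup_universal_kernel[OF rel_normal] by blast
  have "addm (tgr S T M) W g"
    using g(1) by (intro addmI tgr_ag W) (auto simp: hom_def tgr_simps tensor_grp_def)
  moreover have "g (ten S T M t m) = f t m" if "t el T" "m el M" for t m
    unfolding ten_def using that by (simp add: g(2) hf)
  ultimately show ?thesis by blast
qed

end

text \<open>The union defining \<open>tensor_map\<close> runs over all representatives of a coset;
  each of them yields the value of the map \<open>h\<close> from the universal property, so the
  union collapses to that value.\<close>

lemma tensor_map_addm:
  assumes f: "lin (opp_ring S) T T' f" and g: "lin S M M' g"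
  shows "addm (tgr S T M) (tgr S T' M') (tensor_map S T M T' M' f g)"
    and "[| t el T; m el M |] ==> tensor_map S T M T' M' f g (ten S T M t m) = ten S T' M' (f t) (g m)"
proof -
  note T = lin_mod(1)[OF f] and T' = lin_mod(2)[OF f] and M = lin_mod(1)[OF g] and M' = lin_mod(2)[OF g]
  let ?F = "free_Abelian_group (carrier T \<times> carrier M)" and ?F' = "free_Abelian_group (carrier T' \<times> carrier M')"
  let ?cs = "%x. tensor_rel S T M #>\<^bsub>?F\<^esub> x" and ?cs' = "%x. tensor_rel S T' M' #>\<^bsub>?F'\<^esub> x"
  let ?E = "frag_extend (%(t, m). frag_of (f t, g m))"
  have "EX h. addm (tgr S T M) (tgr S T' M') h & (ALL t:carrier T. ALL m:carrier M. h (ten S T M t m) = ten S T' M' (f t) (g m))"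
    by (rule ten_lift[OF T M tgr_ag[OF T' M']])
      (simp_all add: lin_simps[OF f] lin_simps[OF g] ten_closed[OF T' M'] ten_add_l[OF T' M'] ten_add_r[OF T' M']
        ten_balanced[OF T' M'])
  then obtain h where h: "addm (tgr S T M) (tgr S T' M') h"
    and ht: "!!t m. [| t el T; m el M |] ==> h (ten S T M t m) = ten S T' M' (f t) (g m)" by blast
  have E: "?E x el ?F' & ?cs' (?E x) = h (?cs x)" if "Poly_Mapping.keys x \<subseteq> carrier T \<times> carrier M" for x
  proof (rule free_Abelian_group_induct[OF that])
    show "?E 0 el ?F' & ?cs' (?E 0) = h (?cs 0)"
      using addm_simps(3)[OF h] cs_zero[OF T M] cs_zero[OF T' M'] by simp
  next
    fix x y assume 2: "Poly_Mapping.keys x \<subseteq> carrier T \<times> carrier M" "Poly_Mapping.keys y \<subseteq> carrier T \<times> carrier M"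
      "?E x el ?F' & ?cs' (?E x) = h (?cs x)" "?E y el ?F' & ?cs' (?E y) = h (?cs y)"
    then have c: "x el ?F" "y el ?F" "?E x el ?F'" "?E y el ?F'" by auto
    have "?E (x - y) el ?F'"
      using c keys_diff[of "?E x" "?E y"] by (auto simp: frag_extend_diff)
    moreover have "?cs' (?E (x - y)) = h (?cs (x - y))"
      using 2 addm_simps[OF h] cs_carrier[OF T M] ag_simps[OF tgr_ag[OF T M]] c
      by (simp add: frag_extend_diff cs_diff[OF T' M' c(3,4)] cs_diff[OF T M c(1,2)])
    ultimately show "?E (x - y) el ?F' & ?cs' (?E (x - y)) = h (?cs (x - y))" ..
  next
    fix p assume "p : carrier T \<times> carrier M"
    then show "?E (frag_of p) el ?F' & ?cs' (?E (frag_of p)) = h (?cs (frag_of p))"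
      using ht lin_closed[OF f] lin_closed[OF g] by (auto simp: ten_def)
  qed
  have eq: "tensor_map S T M T' M' f g Z = h Z" if Z: "Z el (tgr S T M)" for Z
  proof -
    obtain x where x: "x el ?F" "Z = ?cs x" using tgrE[OF T M Z] by blast
    have c: "?cs' (?E z) = h Z" if z: "z : Z" for z
    proof -
      have zF: "z el ?F"
        using subgroup.elemrcos_carrier[OF rel_subgroup[OF T M] group_free_Abelian_group x(1)] z x(2) by blast
      have "?cs z = Z"
        using group.repr_independence[OF group_free_Abelian_group _ x(1) rel_subgroup[OF T M], of z] z x(2) by simp
      then show ?thesis using E[of z] zF by simp
    qed
    have "x : Z" unfolding x(2) by (rule group.rcos_self[OF group_free_Abelian_group x(1) rel_subgroup[OF T M]])
    then have "(\<Union>z\<in>Z. ?cs' (?E z)) = h Z" using c by auto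
    then show ?thesis using Z by (simp add: tensor_map_def tgr_simps)
  qed
  show "addm (tgr S T M) (tgr S T' M') (tensor_map S T M T' M' f g)"
    using h eq by (auto simp: addm_def ag_simps[OF tgr_ag[OF T M]])
  show "tensor_map S T M T' M' f g (ten S T M t m) = ten S T' M' (f t) (g m)" if "t el T" "m el M"
    using eq[OF ten_closed[OF T M that]] ht[OF that] by simp
qed

lemma tensor_map_extensional: "tensor_map S T M T' M' f g : extensional (carrier (tgr S T M))"
  by (simp add: tensor_map_def tgr_simps)

lemma addm_add:
  assumes "addm M N f" "addm M N g"
  shows "addm M N (%x. f x +[N] g x)"
  using addm_ag[OF assms(1)]
  by (intro addmI) (simp_all add: addm_simps[OF assms(1)] addm_simps[OF assms(2)] ag_simps ag_ac)

lemma addm_zero: "[| abelian_group M; abelian_group N |] ==> addm M N (%x. 0[N])"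
  by (rule addmI) (auto simp: ag_simps)

lemma addm_neg:
  assumes "addm M N f"
  shows "addm M N (%x. -[N] f x)"
  using addm_ag[OF assms] by (intro addmI) (simp_all add: addm_simps[OF assms] ag_simps)

lemma addm_lsum_maps:
  assumes "abelian_group M" "abelian_group N" "!!k. k < n ==> addm M N (f k)"
  shows "addm M N (%x. lsum N n (%k. f k x))"
  using assms(3) by (induction n) (auto intro: addm_zero addm_add assms)

section \<open>Tensoring with a fixed left module: functoriality and right exactness\<close>

abbreviation tmp :: "'s ring => ('s, 'm) module => ('s, 't) module => ('s, 'u) module => ('t => 'u)
    => ('t \<times> 'm \<Rightarrow>\<^sub>0 int) set => ('u \<times> 'm \<Rightarrow>\<^sub>0 int) set"
  where "tmp S M T T' f \<equiv> tensor_map S T M T' M f (%m. m)"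

context
  fixes S :: "'s ring" and M :: "('s, 'm) module"
  assumes M: "left_module S M"
begin

lemma tmp_addm: "lin (opp_ring S) T T' f ==> addm (tgr S T M) (tgr S T' M) (tmp S M T T' f)"
  by (rule tensor_map_addm(1)[OF _ lin_id[OF M]])

lemma tmp_ten: "[| lin (opp_ring S) T T' f; t el T; m el M |]
    ==> tmp S M T T' f (ten S T M t m) = ten S T' M (f t) m"
  by (rule tensor_map_addm(2)[OF _ lin_id[OF M]])

lemma tmp_comp:
  assumes f: "lin (opp_ring S) T T' f" and g: "lin (opp_ring S) T' T'' g" and z: "z el (tgr S T M)"
  shows "tmp S M T' T'' g (tmp S M T T' f z) = tmp S M T T'' (%x. g (f x)) z"
  by (rule ten_eqI[OF lin_mod(1)[OF f] M addm_comp[OF tmp_addm[OF f] tmp_addm[OF g]] tmp_addm[OF lin_comp[OF f g]] _ z])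
    (simp add: tmp_ten[OF f] tmp_ten[OF g] tmp_ten[OF lin_comp[OF f g]] lin_closed[OF f])

lemma tmp_cong:
  assumes f: "lin (opp_ring S) T T' f" and e: "!!x. x el T ==> f x = g x" and z: "z el (tgr S T M)"
  shows "tmp S M T T' f z = tmp S M T T' g z"
  by (rule ten_eqI[OF lin_mod(1)[OF f] M tmp_addm[OF f] tmp_addm[OF lin_cong[OF f e]] _ z])
    (simp_all add: tmp_ten[OF f] tmp_ten[OF lin_cong[OF f e]] e)

lemma tmp_id:
  assumes T: "left_module (opp_ring S) T" and e: "!!x. x el T ==> f x = x" and z: "z el (tgr S T M)"
  shows "tmp S M T T f z = z"
proof -
  have f: "lin (opp_ring S) T T f" by (rule lin_cong[OF lin_id[OF T]]) (simp add: e)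
  show ?thesis
    by (rule ten_eqI[OF T M tmp_addm[OF f] addm_id[OF tgr_ag[OF T M]] _ z]) (simp add: tmp_ten[OF f] e)
qed

lemma tmp_add:
  assumes f: "lin (opp_ring S) T T' f" and g: "lin (opp_ring S) T T' g" and z: "z el (tgr S T M)"
  shows "tmp S M T T' (%x. f x +[T'] g x) z = tmp S M T T' f z +[tgr S T' M] tmp S M T T' g z"
  by (rule ten_eqI[OF lin_mod(1)[OF f] M tmp_addm[OF lin_add[OF f g]] addm_add[OF tmp_addm[OF f] tmp_addm[OF g]] _ z])
    (simp add: tmp_ten[OF f] tmp_ten[OF g] tmp_ten[OF lin_add[OF f g]] lin_closed[OF f] lin_closed[OF g]
      ten_add_l[OF lin_mod(2)[OF f] M])

lemma tmp_zero:
  assumes T: "left_module (opp_ring S) T" and T': "left_module (opp_ring S) T'"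
    and e: "!!x. x el T ==> f x = 0[T']" and z: "z el (tgr S T M)"
  shows "tmp S M T T' f z = 0[tgr S T' M]"
proof -
  have f: "lin (opp_ring S) T T' f" by (rule lin_cong[OF lin_zero[OF T T']]) (simp add: e)
  show ?thesis
    by (rule ten_eqI[OF T M tmp_addm[OF f] addm_zero[OF tgr_ag[OF T M] tgr_ag[OF T' M]] _ z])
      (simp add: tmp_ten[OF f] e addm_simps(3)[OF ten_addm_l[OF T' M]])
qed

lemma tmp_neg:
  assumes f: "lin (opp_ring S) T T' f" and z: "z el (tgr S T M)"
  shows "tmp S M T T' (%x. -[T'] f x) z = -[tgr S T' M] tmp S M T T' f z"
  by (rule ten_eqI[OF lin_mod(1)[OF f] M tmp_addm[OF lin_neg[OF f]] addm_neg[OF tmp_addm[OF f]] _ z])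
    (simp add: tmp_ten[OF f] tmp_ten[OF lin_neg[OF f]] lin_closed[OF f] addm_simps(4)[OF ten_addm_l[OF lin_mod(2)[OF f] M]])

lemma tmp_lsum:
  assumes T: "left_module (opp_ring S) T" and T': "left_module (opp_ring S) T'"
    and f: "!!k. k < n ==> lin (opp_ring S) T T' (f k)" and z: "z el (tgr S T M)"
  shows "tmp S M T T' (%x. lsum T' n (%k. f k x)) z = lsum (tgr S T' M) n (%k. tmp S M T T' (f k) z)"
  using f
proof (induction n)
  case 0
  then show ?case using tmp_zero[OF T T' _ z] by simp
next
  case (Suc n)
  have l: "lin (opp_ring S) T T' (%x. lsum T' n (%k. f k x))" by (rule lin_lsum[OF T T']) (use Suc in auto)
  show ?case using Suc tmp_add[OF l Suc.prems[of n] z] by simp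
qed

lemma tmp_surj:
  assumes f: "lin (opp_ring S) T T' f" and s: "f ` carrier T = carrier T'" and z: "z el (tgr S T' M)"
  shows "EX w:carrier (tgr S T M). tmp S M T T' f w = z"
proof (rule ten_induct[OF lin_mod(2)[OF f] M z])
  note T = lin_mod(1)[OF f] and a = tmp_addm[OF f]
  show "EX w:carrier (tgr S T M). tmp S M T T' f w = 0[tgr S T' M]"
    using addm_simps(3)[OF a] ag_simps(1)[OF tgr_ag[OF T M]] by blast
  show "EX w:carrier (tgr S T M). tmp S M T T' f w = ten S T' M t m" if "t el T'" "m el M" for t m
  proof -
    obtain x where x: "x el T" "f x = t" using \<open>t el T'\<close> unfolding s[symmetric] by auto
    show ?thesis using tmp_ten[OF f x(1) that(2)] ten_closed[OF T M x(1) that(2)] x(2) by blast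
  qed
  fix u v assume "EX w:carrier (tgr S T M). tmp S M T T' f w = u" "EX w:carrier (tgr S T M). tmp S M T T' f w = v"
  then obtain b c where "b el (tgr S T M)" "c el (tgr S T M)" "tmp S M T T' f b = u" "tmp S M T T' f c = v"
    by blast
  then show "EX w:carrier (tgr S T M). tmp S M T T' f w = u +[tgr S T' M] v"
    using addm_simps(2)[OF a] ag_simps(2)[OF tgr_ag[OF T M]] by metis
qed

text \<open>Let \<open>W\<close> be the quotient of the middle tensor group by the image of the left
  one. The quotient map factors through the right tensor group, by sending a pure tensor to the
  class obtained from any preimage under \<open>g\<close>; so an element with zero image on the
  right has zero class.\<close>

lemma tmp_exact:
  assumes f: "lin (opp_ring S) T1 T2 f" and g: "lin (opp_ring S) T2 T3 g" and surj: "g ` carrier T2 = carrier T3"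
    and ex: "!!x. [| x el T2; g x = 0[T3] |] ==> x : f ` carrier T1" and gf: "!!x. x el T1 ==> g (f x) = 0[T3]"
    and w: "w el (tgr S T2 M)" and z: "tmp S M T2 T3 g w = 0[tgr S T3 M]"
  shows "EX v:carrier (tgr S T1 M). tmp S M T1 T2 f v = w"
proof -
  note T1 = lin_mod(1)[OF f] and T2 = lin_mod(2)[OF f] and T3 = lin_mod(2)[OF g]
  let ?G = "tensor_grp S T2 M"
  let ?I = "tmp S M T1 T2 f ` carrier (tgr S T1 M)"
  note fa = tmp_addm[OF f]
  interpret G: comm_group ?G by (rule tensor_comm_group[OF T2 M])
  have "tmp S M T1 T2 f : hom (tensor_grp S T1 M) ?G"
    using fa by (auto simp: hom_def addm_def tgr_simps)
  then interpret f: group_hom "tensor_grp S T1 M" ?G "tmp S M T1 T2 f"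
    using tensor_comm_group[OF T1 M] by (simp add: group_hom_def group_hom_axioms_def comm_group_def)
  have I: "subgroup ?I ?G" using f.img_is_subgroup by (simp add: tgr_simps)
  interpret Q: comm_group "?G Mod ?I" by (rule G.abelian_FactGroup[OF I])
  have N: "?I \<lhd> ?G" using G.normal_iff_subgroup I by blast
  define W where "W = (mk_module (?G Mod ?I) (%_ z. z) :: (unit, _) module)"
  have W: "abelian_group W" unfolding W_def by (rule mk_module_ag) (rule Q.comm_group_axioms)
  let ?c = "%x. ?I #>\<^bsub>?G\<^esub> x"
  have ca: "addm (tgr S T2 M) W ?c"
  proof (rule addmI[OF tgr_ag[OF T2 M] W])
    show "?c x el W" if "x el (tgr S T2 M)" for x
      using that by (auto simp: W_def carrier_FactGroup tgr_simps)
    show "?c (x +[tgr S T2 M] y) = ?c x +[W] ?c y" if "x el (tgr S T2 M)" "y el (tgr S T2 M)" for x y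
      using that normal.rcos_sum[OF N, of x y] by (simp add: W_def tgr_simps)
  qed
  have cf: "?c x = 0[W]" if "x : ?I" for x
    using G.coset_join2[OF subgroup.mem_carrier[OF I that] I that] by (simp add: W_def)
  \<comment> \<open>Two preimages of the same element differ by a value of \<open>f\<close>, and
    pure tensors with such a first factor vanish in \<open>W\<close>.\<close>
  have wd: "?c (ten S T2 M y m) = ?c (ten S T2 M y' m)"
    if y: "y el T2" "y' el T2" "g y = g y'" "m el M" for y y' m
  proof -
    have "g (y +[T2] -[T2] y') = 0[T3]"
      using y lin_closed[OF g] by (simp add: lin_simps[OF g] lmod_simps[OF T2] lmod_simps[OF T3])
    then obtain x where x: "x el T1" "y +[T2] -[T2] y' = f x"
      using ex[of "y +[T2] -[T2] y'"] y by (auto simp: lmod_simps[OF T2])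
    have "ten S T2 M y m = ten S T2 M ((y +[T2] -[T2] y') +[T2] y') m"
      using y by (simp add: lmod_simps[OF T2] lmod_ac(1)[OF T2])
    also have "\<dots> = ten S T2 M (f x) m +[tgr S T2 M] ten S T2 M y' m"
      unfolding x(2) using y x lin_closed[OF f x(1)] by (intro ten_add_l[OF T2 M])
    finally have "?c (ten S T2 M y m) = ?c (ten S T2 M (f x) m) +[W] ?c (ten S T2 M y' m)"
      using y lin_closed[OF f x(1)] by (simp add: addm_simps(2)[OF ca] ten_closed[OF T2 M])
    moreover have "ten S T2 M (f x) m : ?I"
      using tmp_ten[OF f x(1) y(4)] ten_closed[OF T1 M x(1) y(4)] by (intro image_eqI) auto
    ultimately show ?thesis
      using cf addm_simps(1)[OF ca] ten_closed[OF T2 M y(2,4)] by (simp add: ag_simps[OF W])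
  qed
  define k where "k = (%y. SOME x. x el T2 & g x = y)"
  have k: "k y el T2 & g (k y) = y" if "y el T3" for y
    unfolding k_def by (rule someI_ex) (use that in "unfold surj[symmetric], blast")
  have tw: "?c (ten S T2 M (k t) m) = ?c (ten S T2 M y m)" if "t el T3" "m el M" "y el T2" "g y = t" for t m y
    using that k by (intro wd) auto
  have "EX h. addm (tgr S T3 M) W h & (ALL t:carrier T3. ALL m:carrier M. h (ten S T3 M t m) = ?c (ten S T2 M (k t) m))"
  proof (rule ten_lift[OF T3 M W])
    show "?c (ten S T2 M (k t) m) el W" if "t el T3" "m el M" for t m
      using k that by (intro addm_simps(1)[OF ca] ten_closed[OF T2 M]) auto
    show "?c (ten S T2 M (k (t +[T3] t')) m) = ?c (ten S T2 M (k t) m) +[W] ?c (ten S T2 M (k t') m)"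
      if "t el T3" "t' el T3" "m el M" for t t' m
      using that k tw[of "t +[T3] t'" m "k t +[T2] k t'"]
      by (simp add: lmod_simps[OF T2] lmod_simps[OF T3] lin_simps[OF g] ten_add_l[OF T2 M] addm_simps(2)[OF ca] ten_closed[OF T2 M])
    show "?c (ten S T2 M (k t) (m +[M] m')) = ?c (ten S T2 M (k t) m) +[W] ?c (ten S T2 M (k t) m')"
      if "t el T3" "m el M" "m' el M" for t m m'
      using that k by (simp add: ten_add_r[OF T2 M] addm_simps(2)[OF ca] ten_closed[OF T2 M])
    show "?c (ten S T2 M (k (s .[T3] t)) m) = ?c (ten S T2 M (k t) (s .[M] m))"
      if "s el S" "t el T3" "m el M" for s t m
      using that k tw[of "s .[T3] t" m "s .[T2] k t"]
      by (simp add: lmod_simps[OF T2] lmod_simps[OF T3] lin_simps[OF g] ten_balanced[OF T2 M, symmetric])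
  qed
  then obtain h where h: "addm (tgr S T3 M) W h"
    and ht: "!!t m. [| t el T3; m el M |] ==> h (ten S T3 M t m) = ?c (ten S T2 M (k t) m)" by blast
  have hw: "h (tmp S M T2 T3 g w) = ?c w"
  proof (rule ten_eqI[OF T2 M addm_comp[OF tmp_addm[OF g] h] ca _ w])
    show "h (tmp S M T2 T3 g (ten S T2 M t m)) = ?c (ten S T2 M t m)" if "t el T2" "m el M" for t m
      using that lin_closed[OF g that(1)] tw[of "g t" m t] by (simp add: tmp_ten[OF g] ht)
  qed
  have "?c w = 0[W]" unfolding hw[symmetric] z by (rule addm_simps(3)[OF h])
  then have "?c w = ?I" by (simp only: W_def mk_module_simps one_FactGroup)
  then have "w : ?I" by (rule G.coset_join1[OF _ _ I]) (use w in "simp only: tgr_simps")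
  then show ?thesis by blast
qed

end

section \<open>Vanishing of Tor\<close>

lemma tmp_comp_eq:
  assumes M: "left_module S M" and f: "lin (opp_ring S) T T' f" and g: "lin (opp_ring S) T' T'' g"
    and z: "z el (tgr S T M)" and e: "!!x. x el T ==> g (f x) = k x"
  shows "tmp S M T' T'' g (tmp S M T T' f z) = tmp S M T T'' k z"
  unfolding tmp_comp[OF M f g z] by (rule tmp_cong[OF M lin_comp[OF f g] e z])

definition torv :: "'s ring => (nat => ('s, 'p) module) => (nat => 'p => 'p) => ('s, 'm) module => bool"
  where "torv S P d M \<longleftrightarrow> (ALL i. ALL z:carrier (tgr S (P (Suc i)) M).
    tmp S M (P (Suc i)) (P i) (d i) z = 0[tgr S (P i) M] -->
    (EX w:carrier (tgr S (P (Suc (Suc i))) M). tmp S M (P (Suc (Suc i))) (P (Suc i)) (d (Suc i)) w = z))"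

lemma torvD:
  assumes "torv S P d M" "z el (tgr S (P (Suc i)) M)" "tmp S M (P (Suc i)) (P i) (d i) z = 0[tgr S (P i) M]"
  obtains w where "w el (tgr S (P (Suc (Suc i))) M)" "tmp S M (P (Suc (Suc i))) (P (Suc i)) (d (Suc i)) w = z"
  using assms unfolding torv_def by blast

lemma tmp_d_d:
  assumes M: "left_module S M" and P: "pres (opp_ring S) V P d e" and z: "z el (tgr S (P (Suc (Suc i))) M)"
  shows "tmp S M (P (Suc i)) (P i) (d i) (tmp S M (P (Suc (Suc i))) (P (Suc i)) (d (Suc i)) z) = 0[tgr S (P i) M]"
  using presD[OF P] by (simp add: tmp_comp[OF M presD(2)[OF P] presD(2)[OF P] z] tmp_zero[OF M pres_lmod[OF P] pres_lmod[OF P] presD(8)[OF P] z])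

text \<open>As for Ext, but pushing forward: the images of a cycle under the \<open>g k\<close>
  bound in \<open>P\<close>, the bounding elements are carried back by the \<open>f k\<close>, and
  the homotopy applied to the cycle supplies the rest.\<close>

lemma torv_transfer:
  assumes M: "left_module S M" and P: "pres (opp_ring S) T P dP eP" and Q: "pres (opp_ring S) V Q dQ eQ"
    and a: "addr (opp_ring S) T V" and v: "torv S P dP M"
  shows "torv S Q dQ M"
  unfolding torv_def
proof (intro allI ballI impI)
  fix i z assume z: "z el (tgr S (Q (Suc i)) M)" and dz: "tmp S M (Q (Suc i)) (Q i) (dQ i) z = 0[tgr S (Q i) M]"
  from a obtain n p q where r: "retr (opp_ring S) T V n p q" by (rule addrE)
  obtain f g h where "hretr (opp_ring S) n P dP Q dQ f g h" using comparison[OF P Q r] by auto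
  note D = hretrD[OF this]
  note g = D(1) and f = D(2) and h = D(3) and gd = D(4) and fd = D(5) and dec = D(6)
  note PD = presD[OF P] and QD = presD[OF Q] and Pm = pres_lmod[OF P] and Qm = pres_lmod[OF Q]
  let ?P = "%i. tgr S (P i) M" and ?Q = "%i. tgr S (Q i) M"
  have ag: "abelian_group (?Q i)" "abelian_group (?P i)" for i by (rule tgr_ag[OF Qm M] tgr_ag[OF Pm M])+
  let ?g = "%k i. tmp S M (Q i) (P i) (g k i)" and ?f = "%k i. tmp S M (P i) (Q i) (f k i)"
    and ?dP = "%i. tmp S M (P (Suc i)) (P i) (dP i)" and ?dQ = "%i. tmp S M (Q (Suc i)) (Q i) (dQ i)"
    and ?h = "%i. tmp S M (Q i) (Q (Suc i)) (h i)"
  note ga = tmp_addm[OF M g] and fa = tmp_addm[OF M f] and ha = tmp_addm[OF M h]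
    and dQa = tmp_addm[OF M QD(2)]
  have "EX w. w el (?P (Suc (Suc i))) & ?dP (Suc i) w = ?g k (Suc i) z" if k: "k < n" for k
  proof -
    have "?dP i (?g k (Suc i) z) = tmp S M (Q (Suc i)) (P i) (%x. dP i (g k (Suc i) x)) z"
      by (rule tmp_comp[OF M g[OF k] PD(2) z])
    also have "\<dots> = tmp S M (Q (Suc i)) (P i) (%x. g k i (dQ i x)) z"
      by (rule tmp_cong[OF M lin_comp[OF g[OF k] PD(2)] gd[OF k] z])
    also have "\<dots> = ?g k i (?dQ i z)" by (rule tmp_comp[OF M QD(2) g[OF k] z, symmetric])
    also have "\<dots> = 0[?P i]" unfolding dz by (rule addm_simps(3)[OF ga[OF k]])
    finally show ?thesis using torvD[OF v addm_simps(1)[OF ga[OF k] z]] by blast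
  qed
  then obtain w where w: "!!k. k < n ==> w k el (?P (Suc (Suc i)))" "!!k. k < n ==> ?dP (Suc i) (w k) = ?g k (Suc i) z"
    by metis
  let ?w = "lsum (?Q (Suc (Suc i))) n (%k. ?f k (Suc (Suc i)) (w k)) +[?Q (Suc (Suc i))] ?h (Suc i) z"
  have fw: "!!k. k < n ==> ?f k (Suc (Suc i)) (w k) el (?Q (Suc (Suc i)))" by (rule addm_simps(1)[OF fa w(1)])
  have c: "lsum (?Q (Suc (Suc i))) n (%k. ?f k (Suc (Suc i)) (w k)) el (?Q (Suc (Suc i)))"
    "?h (Suc i) z el (?Q (Suc (Suc i)))"
    using lsum_closed[OF ag(1) fw] addm_simps(1)[OF ha z] by auto
  have fd': "?dQ (Suc i) (?f k (Suc (Suc i)) (w k)) = ?f k (Suc i) (?g k (Suc i) z)" if k: "k < n" for k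
  proof -
    have "?dQ (Suc i) (?f k (Suc (Suc i)) (w k)) = tmp S M (P (Suc (Suc i))) (Q (Suc i)) (%x. dQ (Suc i) (f k (Suc (Suc i)) x)) (w k)"
      by (rule tmp_comp[OF M f[OF k] QD(2) w(1)[OF k]])
    also have "\<dots> = tmp S M (P (Suc (Suc i))) (Q (Suc i)) (%x. f k (Suc i) (dP (Suc i) x)) (w k)"
      by (rule tmp_cong[OF M lin_comp[OF f[OF k] QD(2)] fd[OF k] w(1)[OF k]])
    also have "\<dots> = ?f k (Suc i) (?dP (Suc i) (w k))" by (rule tmp_comp[OF M PD(2) f[OF k] w(1)[OF k], symmetric])
    finally show ?thesis using w(2)[OF k] by simp
  qed
  have dw: "?dQ (Suc i) ?w = lsum (?Q (Suc i)) n (%k. ?f k (Suc i) (?g k (Suc i) z)) +[?Q (Suc i)] ?dQ (Suc i) (?h (Suc i) z)"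
    using addm_simps(2)[OF dQa c] addm_lsum[OF dQa fw] fd' by simp
  let ?s = "%x. lsum (Q (Suc i)) n (%k. f k (Suc i) (g k (Suc i) x))"
    and ?a = "%x. dQ (Suc i) (h (Suc i) x)" and ?b = "%x. h i (dQ i x)"
  note sl = lin_lsum[OF Qm Qm lin_comp[OF g f]] and al = lin_comp[OF h QD(2)] and bl = lin_comp[OF QD(2) h]
  have "z = tmp S M (Q (Suc i)) (Q (Suc i)) (%x. ?s x +[Q (Suc i)] (?a x +[Q (Suc i)] ?b x)) z"
    by (rule tmp_id[OF M Qm _ z, symmetric]) (rule dec[symmetric])
  also have "\<dots> = tmp S M (Q (Suc i)) (Q (Suc i)) ?s z +[?Q (Suc i)] tmp S M (Q (Suc i)) (Q (Suc i)) (%x. ?a x +[Q (Suc i)] ?b x) z"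
    by (rule tmp_add[OF M sl lin_add[OF al bl] z])
  also have "tmp S M (Q (Suc i)) (Q (Suc i)) (%x. ?a x +[Q (Suc i)] ?b x) z =
      tmp S M (Q (Suc i)) (Q (Suc i)) ?a z +[?Q (Suc i)] tmp S M (Q (Suc i)) (Q (Suc i)) ?b z"
    by (rule tmp_add[OF M al bl z])
  also have "tmp S M (Q (Suc i)) (Q (Suc i)) ?b z = 0[?Q (Suc i)]"
    using tmp_comp[OF M QD(2) h z] dz addm_simps(3)[OF ha] by metis
  also have "tmp S M (Q (Suc i)) (Q (Suc i)) ?a z = ?dQ (Suc i) (?h (Suc i) z)"
    by (rule tmp_comp[OF M h QD(2) z, symmetric])
  also have "tmp S M (Q (Suc i)) (Q (Suc i)) ?s z = lsum (?Q (Suc i)) n (%k. tmp S M (Q (Suc i)) (Q (Suc i)) (%x. f k (Suc i) (g k (Suc i) x)) z)"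
    by (rule tmp_lsum[OF M Qm Qm lin_comp[OF g f] z])
  also have "\<dots> = lsum (?Q (Suc i)) n (%k. ?f k (Suc i) (?g k (Suc i) z))"
    using tmp_comp[OF M g f z] by simp
  also have "lsum (?Q (Suc i)) n (%k. ?f k (Suc i) (?g k (Suc i) z)) +[?Q (Suc i)]
      (?dQ (Suc i) (?h (Suc i) z) +[?Q (Suc i)] 0[?Q (Suc i)]) = ?dQ (Suc i) ?w"
    unfolding dw using addm_simps(1)[OF dQa c(2)] by (simp add: ag_simps[OF ag(1)])
  finally have zw: "z = ?dQ (Suc i) ?w" .
  show "EX w:carrier (?Q (Suc (Suc i))). ?dQ (Suc i) w = z"
    by (rule bexI[of _ ?w]) (rule zw[symmetric], rule ag_simps(2)[OF ag(1) c])
qed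

definition tor0 :: "'s ring => ('s, 't) module => ('s, 'm) module => bool"
  where "tor0 S T M \<longleftrightarrow> torv S (std_res (opp_ring S) T) (%i. std_bd (opp_ring S)) M"

lemma addm_tensor_hom:
  "addm (tgr S T M) (tgr S T' M') f ==> f : hom (tensor_grp S T M) (tensor_grp S T' M')"
  by (auto simp: hom_def addm_def tgr_simps)

lemma kernel_subset_image:
  "kernel G H f \<subseteq> g ` C \<longleftrightarrow> (ALL z:carrier G. f z = 1[H] --> (EX w:C. g w = z))"
  by (auto simp: kernel_def)

lemma Tor_trivial_iff:
  assumes T: "left_module (opp_ring S) T" and M: "left_module S M"
  shows "(ALL i>0. trivial_group (Tor S i T M)) \<longleftrightarrow> tor0 S T M"
proof -
  let ?P = "std_res (opp_ring S) T" and ?d = "std_bd (opp_ring S)"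
  let ?C = "%i. tensor_grp S (?P i) M" and ?D = "%i. tmp S M (?P (Suc i)) (?P i) ?d"
  note r = std_pres[OF T]
  note D = presD[OF r] and Pm = pres_lmod[OF r]
  have cg: "comm_group (?C i)" for i by (rule tensor_comm_group[OF Pm M])
  have gh: "group_hom (?C (Suc i)) (?C i) (?D i)" for i
    using cg addm_tensor_hom[OF tmp_addm[OF M D(2)]] by (simp add: group_hom_def group_hom_axioms_def comm_group_def)
  have "trivial_group (Tor S (Suc i) T M) \<longleftrightarrow> kernel (?C (Suc i)) (?C i) (?D i) \<subseteq> ?D (Suc i) ` carrier (?C (Suc (Suc i)))" for i
  proof -
    interpret f: group_hom "?C (Suc i)" "?C i" "?D i" by (rule gh)
    interpret g: group_hom "?C (Suc (Suc i))" "?C (Suc i)" "?D (Suc i)" by (rule gh)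
    have "?D (Suc i) ` carrier (?C (Suc (Suc i))) \<subseteq> kernel (?C (Suc i)) (?C i) (?D i)"
      using tmp_d_d[OF M r, of _ i] g.hom_closed by (auto simp: kernel_def tgr_simps)
    then show ?thesis unfolding Tor_def homology_def
      by (simp add: trivial_quotient_iff[OF cg f.subgroup_kernel g.img_is_subgroup])
  qed
  moreover have "(ALL i>0. Q i) \<longleftrightarrow> (ALL i. Q (Suc i))" for Q :: "nat => bool"
    using gr0_conv_Suc by auto
  ultimately show ?thesis unfolding tor0_def torv_def by (simp only: kernel_subset_image tgr_simps)
qed

lemma torv_tor0: "[| left_module S M; pres (opp_ring S) T P d e; torv S P d M |] ==> tor0 S T M"
  unfolding tor0_def using torv_transfer[OF _ _ std_pres addr_refl] lin_mod(2)[OF presD(3)] by blast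

lemma tor0_torv: "[| left_module S M; pres (opp_ring S) T P d e; tor0 S T M |] ==> torv S P d M"
  unfolding tor0_def using torv_transfer[OF _ std_pres _ addr_refl] lin_mod(2)[OF presD(3)] by blast

lemma tor0_addr: "[| left_module S M; addr (opp_ring S) T T'; tor0 S T M |] ==> tor0 S T' M"
  unfolding tor0_def using torv_transfer[OF _ std_pres std_pres] addr_lmod by blast

text \<open>The cone argument again. An element that dies in the tensor product with
  \<open>K\<close> is lifted to degree 0 of the resolution of \<open>L\<close> and shown to bound
  there; this is the injectivity that vanishing of the first Tor of \<open>N\<close>
  provides.\<close>

lemma tor0_ses:
  assumes Mod: "left_module S M" and s: "ses (opp_ring S) L K N j p" and K: "tor0 S K M" and N: "tor0 S N M"
  shows "tor0 S L M" and "[| z el (tgr S L M); tmp S M L K j z = 0[tgr S K M] |] ==> z = 0[tgr S L M]"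
proof -
  let ?R = "opp_ring S"
  from s have j: "lin ?R L K j" and p: "lin ?R K N p" by (auto simp: ses_def)
  let ?H = "std_res ?R K" and ?Q = "std_res ?R L" and ?d = "std_bd ?R"
  note PH = std_pres[OF lin_mod(2)[OF j]] and PL = std_pres[OF lin_mod(1)[OF j]]
  note HD = presD[OF PH] and QD = presD[OF PL] and Hm = pres_lmod[OF PH] and Qm = pres_lmod[OF PL]
  obtain f where "ALL i. lin ?R (?Q i) (?H i) (f i)" "ALL x:carrier (?Q 0). std_aug ?R K (f 0 x) = j (std_aug ?R L x)"
    "ALL i. ALL x:carrier (?Q (Suc i)). ?d (f (Suc i) x) = f i (?d x)"
    and C: "pres ?R N (cone ?H ?Q) (cone_d ?H ?Q (%_. ?d) (%_. ?d) f) (%(h, l). p (std_aug ?R K h))"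
    using ses_lift[OF s PH PL] by blast
  then have f: "!!i. lin ?R (?Q i) (?H i) (f i)" and ef: "!!x. x el (?Q 0) ==> std_aug ?R K (f 0 x) = j (std_aug ?R L x)"
    and fd: "!!i x. x el (?Q (Suc i)) ==> ?d (f (Suc i) x) = f i (?d x)"
    by blast+
  let ?C = "cone ?H ?Q" and ?D = "cone_d ?H ?Q (%_. ?d) (%_. ?d) f"
  note CD = presD[OF C] and Cm = pres_lmod[OF C]
  have vC: "torv S ?C ?D M" by (rule tor0_torv[OF Mod C N])
  have vH: "torv S ?H (%_. ?d) M" using K by (simp add: tor0_def)
  note sl = lmod_simps[OF Hm] lmod_simps[OF Qm] lin_simps[OF HD(2)] lin_simps[OF QD(2)] lin_simps[OF f]
  have sn: "lin ?R (?C (Suc i)) (?Q i) snd" for i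
    unfolding cone_def using lin_snd[OF Hm Qm] by simp
  let ?l = "%i h. (h, 0[?Q (i - 1)])" and ?r = "%i l. (0[?H (Suc i)], l)"
  have inl: "lin ?R (?H i) (?C i) (?l i)" for i
    unfolding cone_def using lin_inl[OF Hm Qm] lin_inl[OF Hm zero_lmod[OF Qm]] by (cases i) auto
  have inr: "lin ?R (?Q i) (?C (Suc i)) (?r i)" for i
    unfolding cone_def using lin_inr[OF Hm Qm] by simp
  let ?tH = "%i. tgr S (?H i) M" and ?tQ = "%i. tgr S (?Q i) M" and ?tC = "%i. tgr S (?C i) M"
  have agH: "abelian_group (?tH i)" and agQ: "abelian_group (?tQ i)" and agC: "abelian_group (?tC i)" for i
    by (rule tgr_ag[OF Hm Mod] tgr_ag[OF Qm Mod] tgr_ag[OF Cm Mod])+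
  let ?T = "tmp S M"
  let ?inl = "%i. ?T (?H i) (?C i) (?l i)" and ?inr = "%i. ?T (?Q i) (?C (Suc i)) (?r i)"
    and ?snd = "%i. ?T (?C (Suc i)) (?Q i) snd"
    and ?dH = "%i. ?T (?H (Suc i)) (?H i) ?d" and ?dQ = "%i. ?T (?Q (Suc i)) (?Q i) ?d"
    and ?dC = "%i. ?T (?C (Suc i)) (?C i) (?D i)" and ?f = "%i. ?T (?Q i) (?H i) (f i)"
  note inla = tmp_addm[OF Mod inl] and inra = tmp_addm[OF Mod inr] and snda = tmp_addm[OF Mod sn]
    and dQa = tmp_addm[OF Mod QD(2)] and dCa = tmp_addm[OF Mod CD(2)] and fa = tmp_addm[OF Mod f]
  have D_inl: "?dC i (?inl (Suc i) h) = ?inl i (?dH i h)" if h: "h el (?tH (Suc i))" for i h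
  proof -
    have "?D i (?l (Suc i) x) = ?l i (?d x)" if "x el (?H (Suc i))" for x
      using that by (cases i) (simp_all add: cone_d_def sl)
    then show ?thesis
      unfolding tmp_comp[OF Mod HD(2) inl h] by (rule tmp_comp_eq[OF Mod inl CD(2) h])
  qed
  have snd_D: "?snd i (?dC (Suc i) v) = -[?tQ i] ?dQ i (?snd (Suc i) v)" if v: "v el (?tC (Suc (Suc i)))" for i v
  proof -
    have "snd (?D (Suc i) x) = -[?Q i] ?d (snd x)" for x
      by (cases x) (simp add: cone_d_def)
    then have "?snd i (?dC (Suc i) v) = ?T (?C (Suc (Suc i))) (?Q i) (%x. -[?Q i] ?d (snd x)) v"
      using tmp_comp[OF Mod CD(2) sn v] by simp
    also have "\<dots> = -[?tQ i] ?T (?C (Suc (Suc i))) (?Q i) (%x. ?d (snd x)) v"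
      by (rule tmp_neg[OF Mod lin_comp[OF sn QD(2)] v])
    finally show ?thesis using tmp_comp[OF Mod sn QD(2) v] by simp
  qed
  have snd_inl: "?snd i (?inl (Suc i) h) = 0[?tQ i]" if h: "h el (?tH (Suc i))" for i h
  proof -
    have "?snd i (?inl (Suc i) h) = ?T (?H (Suc i)) (?Q i) (%x. snd (?l (Suc i) x)) h"
      by (rule tmp_comp[OF Mod inl sn h])
    also have "\<dots> = 0[?tQ i]" by (rule tmp_zero[OF Mod Hm Qm _ h]) simp
    finally show ?thesis .
  qed
  have snd_inr: "?snd i (?inr i l) = l" if l: "l el (?tQ i)" for i l
    using tmp_comp[OF Mod inr sn l] tmp_id[OF Mod Qm _ l] by simp
  text \<open>A cycle whose image in the middle complex bounds comes from a cycle of the cone, hence is a boundary.\<close>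
  have key: "EX w:carrier (?tQ (Suc i)). ?dQ i w = z"
    if z: "z el (?tQ i)" and h: "h el (?tH (Suc i))" and dh: "?dH i h = ?f i z"
      and cyc: "?dC i (?inr i z) = ?inl i (?f i z)" for i z h
  proof -
    let ?u = "?inl (Suc i) h +[?tC (Suc i)] -[?tC (Suc i)] ?inr i z"
    note c = addm_simps(1)[OF inla h] addm_simps(1)[OF inra z] addm_simps(1)[OF fa z]
    have "?dC i ?u = 0[?tC i]"
      unfolding addm_simps(2)[OF dCa c(1) ag_simps(3)[OF agC c(2)]] addm_simps(4)[OF dCa c(2)] D_inl[OF h] dh cyc
      by (rule ag_simps(6)[OF agC addm_simps(1)[OF inla c(3)]])
    then obtain v where v: "v el (?tC (Suc (Suc i)))" "?dC (Suc i) v = ?u"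
      by (rule torvD[OF vC ag_simps(2)[OF agC c(1) ag_simps(3)[OF agC c(2)]]])
    have "-[?tQ i] ?dQ i (?snd (Suc i) v) = -[?tQ i] z"
      unfolding snd_D[OF v(1), symmetric] v(2) addm_simps(2)[OF snda c(1) ag_simps(3)[OF agC c(2)]]
        addm_simps(4)[OF snda c(2)] snd_inl[OF h] snd_inr[OF z]
      by (rule ag_simps(4)[OF agQ ag_simps(3)[OF agQ z]])
    moreover have "?snd (Suc i) v el (?tQ (Suc i))" by (rule addm_simps(1)[OF snda v(1)])
    ultimately show ?thesis using z addm_simps(1)[OF dQa] ag_simps(8)[OF agQ] by metis
  qed
  show "tor0 S L M" unfolding tor0_def torv_def
  proof (intro allI ballI impI)
    fix i z assume z: "z el (?tQ (Suc i))" and dz: "?dQ i z = 0[?tQ i]"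
    have "?dH i (?f (Suc i) z) = ?f i (?dQ i z)"
      unfolding tmp_comp[OF Mod QD(2) f z] by (rule tmp_comp_eq[OF Mod f HD(2) z]) (rule fd)
    then have "?dH i (?f (Suc i) z) = 0[?tH i]" using dz addm_simps(3)[OF fa] by simp
    then obtain h where h: "h el (?tH (Suc (Suc i)))" "?dH (Suc i) h = ?f (Suc i) z"
      by (rule torvD[OF vH addm_simps(1)[OF fa z]])
    have "?D (Suc i) (?r (Suc i) x) = ?l (Suc i) (f (Suc i) x) +[?C (Suc i)] -[?C (Suc i)] ?r i (?d x)"
      if x: "x el (?Q (Suc i))" for x
    proof -
      have "-[?C (Suc i)] ?r i (?d x) = ?r i (-[?Q i] ?d x)"
        using lin_simps(4)[OF inr, of "?d x" i] x by (simp add: sl)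
      then show ?thesis using x by (simp add: cone_d_def cone_def sl)
    qed
    from tmp_comp_eq[OF Mod inr CD(2) z this] have "?dC (Suc i) (?inr (Suc i) z) =
        ?T (?Q (Suc i)) (?C (Suc i)) (%x. ?l (Suc i) (f (Suc i) x) +[?C (Suc i)] -[?C (Suc i)] ?r i (?d x)) z" .
    also have "\<dots> = ?inl (Suc i) (?f (Suc i) z) +[?tC (Suc i)] -[?tC (Suc i)] ?inr i (?dQ i z)"
      using tmp_add[OF Mod lin_comp[OF f inl] lin_neg[OF lin_comp[OF QD(2) inr]] z] tmp_neg[OF Mod lin_comp[OF QD(2) inr] z]
        tmp_comp[OF Mod f inl z] tmp_comp[OF Mod QD(2) inr z] by simp
    also have "\<dots> = ?inl (Suc i) (?f (Suc i) z)"
      unfolding dz using addm_simps(1)[OF inla addm_simps(1)[OF fa z]]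
      by (simp add: addm_simps(3)[OF inra] ag_simps[OF agC])
    finally show "EX w:carrier (?tQ (Suc (Suc i))). ?dQ (Suc i) w = z" by (rule key[OF z h])
  qed
  assume z: "z el (tgr S L M)" and jz: "?T L K j z = 0[tgr S K M]"
  let ?eH = "?T (?H 0) K (std_aug ?R K)" and ?eQ = "?T (?Q 0) L (std_aug ?R L)"
  \<comment> \<open>The lowest degree: the lift \<open>y\<close> of \<open>z\<close> becomes a
    boundary in the resolution of \<open>K\<close>, since \<open>z\<close> maps to zero there, so
    that \<open>key\<close> applies with \<open>i = 0\<close>.\<close>
  obtain y where y: "y el (?tQ 0)" "?eQ y = z" using tmp_surj[OF Mod QD(3,4) z] by blast
  have "?eH (?f 0 y) = ?T L K j (?eQ y)"
    unfolding tmp_comp[OF Mod QD(3) j y(1)] by (rule tmp_comp_eq[OF Mod f HD(3) y(1)]) (rule ef)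
  then have "?eH (?f 0 y) = 0[tgr S K M]" using y jz by simp
  then obtain h where h: "h el (?tH (Suc 0))" "?dH 0 h = ?f 0 y"
    using tmp_exact[OF Mod HD(2) HD(3,4,5,7) addm_simps(1)[OF fa y(1)]] by blast
  have "?D 0 (?r 0 x) = ?l 0 (f 0 x)" if "x el (?Q 0)" for x
    using that by (simp add: cone_d_def sl)
  then have "?dC 0 (?inr 0 y) = ?inl 0 (?f 0 y)"
    unfolding tmp_comp[OF Mod f inl y(1)] by (rule tmp_comp_eq[OF Mod inr CD(2) y(1)])
  from key[OF y(1) h this] obtain w where w: "w el (?tQ (Suc 0))" "?dQ 0 w = y" by blast
  have "z = ?T (?Q (Suc 0)) L (%x. std_aug ?R L (?d x)) w"
    using tmp_comp[OF Mod QD(2) QD(3) w(1)] w y by simp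
  also have "\<dots> = 0[tgr S L M]" by (rule tmp_zero[OF Mod Qm lin_mod(1)[OF j] QD(7) w(1)])
  finally show "z = 0[tgr S L M]" .
qed

section \<open>Finite projective dimension\<close>

text \<open>If the terms above \<open>n\<close> vanish, the identity in degree \<open>n + 1\<close>
  is a section as required by \<open>sct\<close>, which transfers to the standard resolution.
  Conversely \<open>s\<close> splits the standard differential onto its image, so that image is
  projective and the resolution can be cut there.\<close>

lemma finite_proj_dim_iff:
  fixes R :: "'r ring" and M :: "('r, 'm) module"
  shows "finite_proj_dim R M \<longleftrightarrow> left_module R M & (EX n. sct R (std_res R M) (%i. std_bd R) n)"
proof
  assume "finite_proj_dim R M"
  then obtain P :: "nat => ('r, ('r, 'm) syz => 'r) module" and d e n
    where "projective_resolution R M P d e" and z: "!!i. i > n ==> carrier (P i) = {0[P i]}"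
    unfolding finite_proj_dim_def by blast
  then have P: "pres R M P d e" by (intro projective_resolution_pres)
  note M = lin_mod(2)[OF presD(3)[OF P]]
  have "d (Suc n) x = 0[P (Suc n)]" if "x el (P (Suc (Suc n)))" for x
    using lin_closed[OF presD(2)[OF P] that] z[of "Suc n"] by simp
  then have "sct R P d n" unfolding sct_def
    by (intro exI[of _ "%x. x"] conjI lin_id[OF pres_lmod[OF P]]) auto
  then show "left_module R M & (EX n. sct R (std_res R M) (%i. std_bd R) n)"
    using sct_transfer[OF P std_pres[OF M] addr_refl[OF M]] M by blast
next
  assume "left_module R M & (EX n. sct R (std_res R M) (%i. std_bd R) n)"
  then obtain n where M: "left_module R M" and "sct R (std_res R M) (%i. std_bd R) n" by auto
  let ?P = "std_res R M" and ?d = "std_bd R"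
  obtain s where s: "lin R (?P (Suc n)) (?P (Suc n)) s"
    and sd: "!!x. x el (?P (Suc (Suc n))) ==> s (?d x) = 0[?P (Suc n)]"
    and ds: "!!x. x el (?P (Suc n)) ==> ?d (s x) = ?d x"
    using \<open>sct R ?P (%i. ?d) n\<close> by (auto simp: sct_def)
  note r = std_pres[OF M]
  note D = presD[OF r] and Pm = pres_lmod[OF r]
  \<comment> \<open>The syzygy to be kept as the last term: the image of the differential inside
    \<open>?P n\<close>. Factoring \<open>s\<close> through it gives \<open>t\<close>, a section of
    the differential onto \<open>K\<close>.\<close>
  define K where "K = (?P n)\<lparr>carrier := ?d ` carrier (?P (Suc n))\<rparr>"
  have Km: "left_module R K" unfolding K_def by (rule img_lmod[OF D(2)])
  have dK: "lin R (?P (Suc n)) K ?d" unfolding K_def by (rule lin_sub_into[OF D(2) Km[unfolded K_def]]) simp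
  have Ki: "lin R K (?P n) (%x. x)"
    unfolding K_def by (rule lin_sub_from[OF lin_id[OF Pm] Km[unfolded K_def]]) (auto simp: lin_closed[OF D(2)])
  have im: "?d ` carrier (?P (Suc n)) = carrier K" by (simp add: K_def)
  have "s x = 0[?P (Suc n)]" if x: "x el (?P (Suc n))" "?d x = 0[K]" for x
    using D(6)[OF x(1)] x(2) sd by (auto simp: K_def)
  from lin_factor[OF dK s im this] obtain t where t: "lin R K (?P (Suc n)) t"
    "!!x. x el (?P (Suc n)) ==> t (?d x) = s x" by blast
  have Kp: "projective R K"
    by (rule proj_retract[OF D(1) t(1) dK]) (auto simp: K_def t(2) ds)
  define Z where "Z = K\<lparr>carrier := {0[K]}\<rparr>"
  have Zm: "left_module R Z" unfolding Z_def by (rule zero_lmod[OF Km])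
  have Zp: "projective R Z" by (rule proj_zero[OF Zm]) (simp add: Z_def)
  have ZK: "lin R Z K (%x. x)" "lin R Z Z (%x. x)"
    unfolding Z_def by (rule lin_sub_from[OF lin_id[OF Km] Zm[unfolded Z_def]], simp add: lmod_simps[OF Km])
      (rule lin_id[OF Zm[unfolded Z_def]])
  \<comment> \<open>Degrees up to \<open>n\<close> are unchanged, \<open>K\<close> sits in degree
    \<open>n + 1\<close> and the zero module above. From \<open>n\<close> on the differential is the
    inclusion, so the identity function serves.\<close>
  define P where "P i = (if i <= n then ?P i else if i = Suc n then K else Z)" for i
  define d :: "nat => (('r, 'm) syz => 'r) => ('r, 'm) syz => 'r" where "d i = (if i < n then ?d else (%x. x))" for i
  have K0: "0[K] = 0[?P n]" and Z0: "0[Z] = 0[K]" "carrier Z = {0[K]}" and Kc: "carrier K = ?d ` carrier (?P (Suc n))"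
    by (auto simp: K_def Z_def)
  have "pres R M P d (std_aug R M)" unfolding pres_def
  proof (intro conjI allI ballI)
    show "projective R (P i)" for i using D(1) Kp Zp by (simp add: P_def)
    show "lin R (P (Suc i)) (P i) (d i)" for i
      using D(2) Ki ZK by (cases "i < n"; cases "i = n"; cases "i = Suc n") (auto simp: P_def d_def)
    show "lin R (P 0) M (std_aug R M)" using D(3) by (simp add: P_def)
    show "std_aug R M ` carrier (P 0) = carrier M" using D(4) by (simp add: P_def)
    show "std_aug R M x = 0[M] \<longleftrightarrow> x : d 0 ` carrier (P 1)" if "x el (P 0)" for x
      using that D(5)[of x] D(7) by (cases "n = 0") (auto simp: P_def d_def Kc)
    show "d i x = 0[P i] \<longleftrightarrow> x : d (Suc i) ` carrier (P (Suc (Suc i)))" if x: "x el (P (Suc i))" for i x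
    proof -
      consider "Suc i < n" | "Suc i = n" | "i = n" | "i > n" by linarith
      then show ?thesis
        using x D(6)[of x i] D(8)[of _ i] by cases (auto simp: P_def d_def Kc Z0 K0)
    qed
  qed
  from pres_projective_resolution[OF this] show "finite_proj_dim R M"
    unfolding finite_proj_dim_def
    by (intro exI[of _ P] exI[of _ "Suc n"] exI) (auto simp: P_def Z0)
qed

section \<open>Endomorphism rings and bimodules\<close>

lemma end_ring_simps [simp]:
  "carrier (end_ring R T) = mod_hom R T T" "0[end_ring R T] = (\<lambda>t\<in>carrier T. 0[T])"
  "1[end_ring R T] = (\<lambda>t\<in>carrier T. t)"
  "a *[end_ring R T] b = compose (carrier T) b a"
  "a +[end_ring R T] b = (\<lambda>t\<in>carrier T. a t +[T] b t)"
  by (simp_all add: end_ring_def)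

lemma end_bimod_simps [simp]:
  "carrier (end_bimod T) = carrier T" "0[end_bimod T] = 0[T]" "ring.add (end_bimod T) = ring.add T"
  "module.smult (end_bimod T) = module.smult T" "rsmult (end_bimod T) = (%t s. s t)"
  by (simp_all add: end_bimod_def)

lemma mod_hom_arb: "[| f : mod_hom R M N; x \<notin> carrier M |] ==> f x = undefined"
  by (rule extensional_arb[OF mod_homD])

lemma compose_mod_hom:
  assumes "f : mod_hom R L M" "g : mod_hom R M N" "left_module R L" "left_module R M" "left_module R N"
  shows "compose (carrier L) g f : mod_hom R L N"
  using restrict_mod_hom[OF lin_comp[OF mod_hom_lin[OF assms(1,3,4)] mod_hom_lin[OF assms(2,4,5)]]]
  by (simp add: compose_def)

context
  fixes R :: "'r ring" and T :: "('r, 't) module"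
  assumes T: "left_module R T"
begin

lemma end_lin: "s : mod_hom R T T ==> lin R T T s"
  by (rule mod_hom_lin[OF _ T T])

lemma end_ring_ring: "ring (end_ring R T)"
proof (rule ringI)
  note [simp] = lmod_simps[OF T] lin_simps[OF end_lin]
  have cl: "(\<lambda>t\<in>carrier T. a t +[T] b t) : mod_hom R T T" if "a : mod_hom R T T" "b : mod_hom R T T" for a b
    by (rule restrict_mod_hom[OF lin_add[OF end_lin[OF that(1)] end_lin[OF that(2)]]])
  have cc: "compose (carrier T) b a : mod_hom R T T" if "a : mod_hom R T T" "b : mod_hom R T T" for a b
    by (rule compose_mod_hom[OF that T T T])
  show "abelian_group (end_ring R T)"
    by (rule ag_same[OF mk_module_ag[OF hom_grp_comm_group[OF T T], of "%_ z. z"]]) (auto simp: fun_eq_iff)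
  show "monoid (end_ring R T)"
  proof (rule monoidI)
    show "1[end_ring R T] el (end_ring R T)" using restrict_mod_hom[OF lin_id[OF T]] by simp
  qed (auto simp: cc, auto simp: fun_eq_iff compose_def mod_hom_arb[of _ R T T])
  show "(a +[end_ring R T] b) *[end_ring R T] c = a *[end_ring R T] c +[end_ring R T] b *[end_ring R T] c"
    "c *[end_ring R T] (a +[end_ring R T] b) = c *[end_ring R T] a +[end_ring R T] c *[end_ring R T] b"
    if "a el (end_ring R T)" "b el (end_ring R T)" "c el (end_ring R T)" for a b c
    using that by (auto simp: fun_eq_iff compose_def)
qed

lemma right_mod_end: "left_module (opp_ring (end_ring R T)) (right_mod (end_bimod T))"
proof (rule lmodI)
  show "ring (opp_ring (end_ring R T))" by (rule opp_ring[OF end_ring_ring])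
  show "abelian_group (right_mod (end_bimod T))" by (rule ag_same[OF lmod_ag[OF T]]) simp_all
qed (auto simp: compose_def lin_simps[OF end_lin] lmod_simps[OF T])

lemma left_mod_end: "left_module R (left_mod (end_bimod T))"
  by (rule lmodI) (auto simp: lmod_ring[OF T] lmod_simps[OF T] intro: ag_same[OF lmod_ag[OF T]])

lemma addr_left_mod_end: "addr R T (left_mod (end_bimod T))" "addr R (left_mod (end_bimod T)) T"
proof -
  have "lin R T (left_mod (end_bimod T)) (%x. x)" "lin R (left_mod (end_bimod T)) T (%x. x)"
    by (rule linI; simp add: T left_mod_end)+
  then show "addr R T (left_mod (end_bimod T))" "addr R (left_mod (end_bimod T)) T"
    by (auto intro: addr_retract)
qed

lemma mod_hom_end_bimod [simp]: "mod_hom R (end_bimod T) N = mod_hom R T N"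
  by (simp add: mod_hom_def)

lemma hom_mod_simps:
  "carrier (hom_mod R (end_bimod T) N) = mod_hom R T N"
  "ring.zero (hom_mod R (end_bimod T) N) = (\<lambda>t\<in>carrier T. 0[N])"
  "ring.add (hom_mod R (end_bimod T) N) f g = (\<lambda>t\<in>carrier T. f t +[N] g t)"
  "module.smult (hom_mod R (end_bimod T) N) s f = (\<lambda>t\<in>carrier T. f (s t))"
  by (simp_all add: hom_mod_def)

lemma hom_mod_lmod:
  assumes N: "left_module R N"
  shows "left_module (end_ring R T) (hom_mod R (end_bimod T) N)"
proof (rule lmodI)
  note [simp] = lmod_simps[OF T] lin_simps[OF end_lin] hom_mod_simps lin_simps[OF mod_hom_lin[OF _ T N]]
  show "ring (end_ring R T)" by (rule end_ring_ring)
  show "abelian_group (hom_mod R (end_bimod T) N)"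
    by (rule ag_same[OF mk_module_ag[OF hom_grp_comm_group[OF T N], of "%_ z. z"]]) (auto simp: fun_eq_iff)
  show "s .[hom_mod R (end_bimod T) N] f el (hom_mod R (end_bimod T) N)"
    if "s el (end_ring R T)" "f el (hom_mod R (end_bimod T) N)" for s f
    using that restrict_mod_hom[OF lin_comp[OF end_lin mod_hom_lin[OF _ T N]]] by simp
qed (auto simp: fun_eq_iff compose_def hom_mod_simps lin_simps[OF end_lin] lin_simps[OF mod_hom_lin[OF _ T N]]
      lmod_simps[OF T] mod_hom_arb[of _ R T N])

section \<open>Hom into the tilting module as a functor to right modules\<close>

text \<open>A right module over the endomorphism ring. With the reversed product of
  \<open>end_ring\<close>, postcomposition is a right action, hence a left action of the opposite
  ring.\<close>

definition homr :: "('r, 'c) module => ('t => 't, 'c => 't) module"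
  where "homr C = mk_module (hom_grp R C T) (%s f. compose (carrier C) s f)"

lemma homr_simps [simp]:
  "carrier (homr C) = mod_hom R C T" "ring.zero (homr C) = (\<lambda>t\<in>carrier C. 0[T])"
  "ring.add (homr C) f g = (\<lambda>t\<in>carrier C. f t +[T] g t)"
  "module.smult (homr C) s f = compose (carrier C) s f"
  by (simp_all add: homr_def)

lemma homr_lmod:
  assumes C: "left_module R C"
  shows "left_module (opp_ring (end_ring R T)) (homr C)"
proof (rule lmodI)
  note [simp] = lmod_simps[OF T] lmod_simps[OF C] lin_simps[OF end_lin] lin_simps[OF mod_hom_lin[OF _ C T]]
  show "ring (opp_ring (end_ring R T))" by (rule opp_ring[OF end_ring_ring])
  show "abelian_group (homr C)" unfolding homr_def by (rule mk_module_ag[OF hom_grp_comm_group[OF C T]])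
  show "s .[homr C] f el (homr C)"
    if "s el (opp_ring (end_ring R T))" "f el (homr C)" for s f
    using that compose_mod_hom[of f R C T s T, OF _ _ C T T] by simp
qed (auto simp: fun_eq_iff compose_def lin_simps[OF end_lin] lin_simps[OF mod_hom_lin[OF _ C T]]
      mod_hom_arb[of _ R C T])

lemma homr_map:
  assumes f: "lin R C D f"
  shows "lin (opp_ring (end_ring R T)) (homr D) (homr C) (%g. compose (carrier C) g f)"
proof (rule linI)
  note C = lin_mod(1)[OF f] and D = lin_mod(2)[OF f]
  show "left_module (opp_ring (end_ring R T)) (homr D)" "left_module (opp_ring (end_ring R T)) (homr C)"
    by (rule homr_lmod[OF D] homr_lmod[OF C])+
  show "compose (carrier C) g f el (homr C)" if "g el (homr D)" for g
    using that restrict_mod_hom[OF lin_comp[OF f mod_hom_lin[OF _ D T]]] by (simp add: compose_def)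
qed (auto simp: fun_eq_iff compose_def lin_closed[OF f])

lemma lin_to_homr:
  assumes C: "left_module R C" and "!!x. x el M ==> h x : mod_hom R C T"
    and "left_module (opp_ring (end_ring R T)) M"
    and "!!x y t. [| x el M; y el M; t el C |] ==> h (x +[M] y) t = h x t +[T] h y t"
    and "!!s x t. [| s : mod_hom R T T; x el M; t el C |] ==> h (s .[M] x) t = s (h x t)"
  shows "lin (opp_ring (end_ring R T)) M (homr C) h"
proof (rule linI[OF assms(3) homr_lmod[OF C]])
  note M = lmod_simps[OF assms(3)]
  show "h (x +[M] y) = h x +[homr C] h y" if "x el M" "y el M" for x y
    using that M(2)[OF that] assms(2,4) mod_hom_arb[OF assms(2)] by (auto simp: fun_eq_iff)
  show "h (s .[M] x) = s .[homr C] h x" if "s el (opp_ring (end_ring R T))" "x el M" for s x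
    using that M(13)[OF that] assms(2,5) mod_hom_arb[OF assms(2)] by (auto simp: fun_eq_iff compose_def)
qed (use assms in auto)

lemma lin_eval:
  assumes C: "left_module R C" and c: "c el C"
  shows "lin (opp_ring (end_ring R T)) (homr C) (right_mod (end_bimod T)) (%f. f c)"
  by (rule linI[OF homr_lmod[OF C] right_mod_end])
    (use c in "auto simp: compose_def lin_closed[OF mod_hom_lin[OF _ C T]]")

lemma lsum_homr: "t el C ==> lsum (homr C) n f t = lsum T n (%k. f k t)"
  by (induction n) auto

text \<open>\<open>Hom(-, T)\<close> is contravariant and takes \<open>T\<close> to the regular
  right module, so retraction data of \<open>C\<close> over \<open>T\<close> becomes retraction data
  over the ring, with \<open>p\<close> and \<open>q\<close> exchanging their roles.\<close>

lemma homr_retr_end: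
  assumes r: "retr R T C n p q"
  shows "retr (opp_ring (end_ring R T)) (reg_mod (opp_ring (end_ring R T))) (homr C) n
    (%k f. compose (carrier T) f (q k)) (%k s. compose (carrier C) s (p k))"
proof -
  let ?S = "opp_ring (end_ring R T)"
  note C = retrD(2)[OF r] and p = retrD(3)[OF r] and q = retrD(4)[OF r] and S = opp_ring[OF end_ring_ring]
  have i: "lin ?S (homr T) (reg_mod ?S) (%s. s)" "lin ?S (reg_mod ?S) (homr T) (%s. s)"
    by (rule linI; simp add: homr_lmod[OF T] reg_mod_lmod[OF S])+
  show ?thesis
    unfolding retr_def
  proof (intro conjI allI impI ballI reg_mod_lmod[OF S] homr_lmod[OF C])
    show "lin ?S (homr C) (reg_mod ?S) (%f. compose (carrier T) f (q k))" if "k < n" for k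
      using lin_comp[OF homr_map[OF q[OF that]] i(1)] .
    show "lin ?S (reg_mod ?S) (homr C) (%s. compose (carrier C) s (p k))" if "k < n" for k
      using lin_comp[OF i(2) homr_map[OF p[OF that]]] .
    show "lsum (homr C) n (%k. compose (carrier C) (compose (carrier T) f (q k)) (p k)) = f" if f: "f el (homr C)" for f
    proof (rule mod_hom_eqI)
      have fl: "lin R C T f" using f mod_hom_lin[OF _ C T] by simp
      have "compose (carrier C) (compose (carrier T) f (q k)) (p k) : mod_hom R C T" if "k < n" for k
        using restrict_mod_hom[OF lin_comp[OF lin_comp[OF p[OF that] q[OF that]] fl]] lin_closed[OF p[OF that]]
        by (simp add: compose_def cong: restrict_cong)
      then show "lsum (homr C) n (%k. compose (carrier C) (compose (carrier T) f (q k)) (p k)) : mod_hom R C T"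
        using lsum_closed[OF lmod_ag[OF homr_lmod[OF C]], of n] by simp
      show "lsum (homr C) n (%k. compose (carrier C) (compose (carrier T) f (q k)) (p k)) x = f x" if x: "x el C" for x
      proof -
        have "lsum (homr C) n (%k. compose (carrier C) (compose (carrier T) f (q k)) (p k)) x = lsum T n (%k. f (q k (p k x)))"
          unfolding lsum_homr[OF x] using x lin_closed[OF p x] by (simp add: compose_def)
        also have "\<dots> = f (lsum C n (%k. q k (p k x)))"
          by (rule lin_lsum_apply[OF fl, symmetric]) (rule lin_closed[OF q lin_closed[OF p x]])
        finally show ?thesis using retrD(5)[OF r x] by simp
      qed
    qed (use f in simp)
  qed
qed

lemma homr_addr_end: "addr R T C ==> addr (opp_ring (end_ring R T)) (reg_mod (opp_ring (end_ring R T))) (homr C)"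
  using homr_retr_end by (force simp: addr_def)

text \<open>The same mechanism with \<open>Hom(R, T)\<close> identified with \<open>T\<close>: the
  map belonging to \<open>q k\<close> is evaluation at the dual basis element \<open>q k\<close> of
  1, the one belonging to \<open>p k\<close> multiplies by the functional.\<close>

lemma homr_retr_right:
  assumes r: "retr R (reg_mod R) P n p q"
  shows "retr (opp_ring (end_ring R T)) (right_mod (end_bimod T)) (homr P) n
    (%k f. f (q k 1[R])) (%k t. \<lambda>x\<in>carrier P. p k x .[T] t)"
proof -
  let ?S = "opp_ring (end_ring R T)" and ?T = "right_mod (end_bimod T)"
  note P = retrD(2)[OF r] and p = retrD(3)[OF r] and q = retrD(4)[OF r] and R = lmod_ring[OF T]
  note [simp] = lmod_simps[OF T]
  have pc: "p k x el R" if "k < n" "x el P" for k x using lin_closed[OF p that(2)] that by simp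
  have qc: "q k 1[R] el P" if "k < n" for k using lin_closed[OF q[OF that]] ring_rules[OF R] by simp
  have ql: "(\<lambda>x\<in>carrier P. p k x .[T] t) : mod_hom R P T" if "k < n" "t el T" for k t
    by (rule restrict_mod_hom[OF lin_comp[OF p[OF that(1)] lin_reg[OF T that(2)]]])
  show ?thesis
    unfolding retr_def
  proof (intro conjI allI impI ballI right_mod_end homr_lmod[OF P])
    show "lin ?S (homr P) ?T (%f. f (q k 1[R]))" if "k < n" for k by (rule lin_eval[OF P qc[OF that]])
    show "lin ?S ?T (homr P) (%t. \<lambda>x\<in>carrier P. p k x .[T] t)" if k: "k < n" for k
      by (rule lin_to_homr[OF P _ right_mod_end]) (auto simp: ql[OF k] pc[OF k] lin_simps[OF end_lin])
    show "lsum (homr P) n (%k. \<lambda>x\<in>carrier P. p k x .[T] f (q k 1[R])) = f" if f: "f el (homr P)" for f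
    proof (rule mod_hom_eqI)
      have fl: "lin R P T f" using f mod_hom_lin[OF _ P T] by simp
      have fq: "f (q k 1[R]) el T" if "k < n" for k by (rule lin_closed[OF fl qc[OF that]])
      show "lsum (homr P) n (%k. \<lambda>x\<in>carrier P. p k x .[T] f (q k 1[R])) : mod_hom R P T"
        using lsum_closed[OF lmod_ag[OF homr_lmod[OF P]], of n] ql fq by simp
      show "lsum (homr P) n (%k. \<lambda>x\<in>carrier P. p k x .[T] f (q k 1[R])) x = f x" if x: "x el P" for x
      proof -
        have e: "p k x .[T] f (q k 1[R]) = f (q k (p k x))" if k: "k < n" for k
          using lin_smult[OF lin_comp[OF q[OF k] fl], of "p k x" "1[R]"] pc[OF k x] ring_rules[OF R] by simp
        have "lsum (homr P) n (%k. \<lambda>x\<in>carrier P. p k x .[T] f (q k 1[R])) x = lsum T n (%k. f (q k (p k x)))"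
          unfolding lsum_homr[OF x] using x e by simp
        also have "\<dots> = f (lsum P n (%k. q k (p k x)))"
          by (rule lin_lsum_apply[OF fl, symmetric]) (rule lin_closed[OF q lin_closed[OF p x]])
        finally show ?thesis using retrD(5)[OF r x] by simp
      qed
    qed (use f in simp)
  qed
qed

lemma homr_addr_right: "addr R (reg_mod R) P ==> addr (opp_ring (end_ring R T)) (right_mod (end_bimod T)) (homr P)"
  using homr_retr_right by (force simp: addr_def)

end

section \<open>Wakamatsu tilting modules\<close>

text \<open>From the clause on \<open>t\<close> on: exactness under \<open>Hom(-, T)\<close>, with \<open>Hom(R, T)\<close> identified with \<open>T\<close>.\<close>

definition corres :: "'r ring => ('r, 't) module => (nat => ('r, 'c) module) => ('r => 'c) => (nat => 'c => 'c) => bool"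
  where "corres R T C e d \<longleftrightarrow> (ALL j. addr R T (C j)) & lin R (reg_mod R) (C 0) e &
    (ALL j. lin R (C j) (C (Suc j)) (d j)) & (ALL r:carrier R. e r = 0[C 0] --> r = 0[R]) &
    (ALL x:carrier (C 0). d 0 x = 0[C (Suc 0)] \<longleftrightarrow> x : e ` carrier R) &
    (ALL j. ALL x:carrier (C (Suc j)). d (Suc j) x = 0[C (Suc (Suc j))] \<longleftrightarrow> x : d j ` carrier (C j)) &
    (ALL t:carrier T. EX g. lin R (C 0) T g & g (e 1[R]) = t) &
    (ALL g. lin R (C 0) T g & g (e 1[R]) = 0[T] --> (EX g'. lin R (C (Suc 0)) T g' & (ALL x:carrier (C 0). g x = g' (d 0 x)))) &
    (ALL j g. lin R (C (Suc j)) T g & (ALL x:carrier (C j). g (d j x) = 0[T]) -->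
      (EX g'. lin R (C (Suc (Suc j))) T g' & (ALL x:carrier (C (Suc j)). g x = g' (d (Suc j) x))))"

lemma corresD:
  assumes "corres R T C e d"
  shows "addr R T (C j)" "lin R (reg_mod R) (C 0) e" "lin R (C j) (C (Suc j)) (d j)"
    "[| r el R; e r = 0[C 0] |] ==> r = 0[R]"
    "x0 el (C 0) ==> d 0 x0 = 0[C (Suc 0)] \<longleftrightarrow> x0 : e ` carrier R"
    "x el (C (Suc j)) ==> d (Suc j) x = 0[C (Suc (Suc j))] \<longleftrightarrow> x : d j ` carrier (C j)"
    "t el T ==> EX g. lin R (C 0) T g & g (e 1[R]) = t"
    "[| lin R (C 0) T g; g (e 1[R]) = 0[T] |] ==> EX g'. lin R (C (Suc 0)) T g' & (ALL x:carrier (C 0). g x = g' (d 0 x))"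
    "[| lin R (C (Suc j)) T g; !!x. x el (C j) ==> g (d j x) = 0[T] |] ==>
      EX g'. lin R (C (Suc (Suc j))) T g' & (ALL x:carrier (C (Suc j)). g x = g' (d (Suc j) x))"
  using assms unfolding corres_def by blast+

text \<open>Exactness after \<open>Hom(-, T)\<close>, an equation of sets of extensional maps in
  \<open>wakamatsu_tilting\<close>, is split into the complex condition and the solvability clause
  that \<open>corres\<close> uses.\<close>

lemma image_compose_eq_kernel:
  assumes f: "lin R L M f" and g: "lin R M N g" and T: "left_module R T"
  shows "(%h. compose (carrier M) h g) ` mod_hom R N T
      = kernel (hom_grp R M T) (hom_grp R L T) (%h. compose (carrier L) h f)
    \<longleftrightarrow> (ALL x:carrier L. ALL h. lin R N T h --> h (g (f x)) = 0[T]) &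
      (ALL h. lin R M T h & (ALL x:carrier L. h (f x) = 0[T]) --> (EX k. lin R N T k & (ALL x:carrier M. h x = k (g x))))"
    (is "?I = ?K \<longleftrightarrow> ?A & ?B")
proof -
  note L = lin_mod(1)[OF f] and M = lin_mod(1)[OF g] and N = lin_mod(2)[OF g]
  have K: "h : ?K \<longleftrightarrow> h : mod_hom R M T & (ALL x:carrier L. h (f x) = 0[T])" for h
    by (auto simp: kernel_def compose_def fun_eq_iff)
  have I: "h : ?I \<longleftrightarrow> h : mod_hom R M T & (EX k. lin R N T k & (ALL x:carrier M. h x = k (g x)))" for h
  proof
    assume "h : ?I"
    then obtain k where k: "k : mod_hom R N T" "h = compose (carrier M) k g" by auto
    then show "h : mod_hom R M T & (EX k. lin R N T k & (ALL x:carrier M. h x = k (g x)))"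
      using restrict_mod_hom[OF lin_comp[OF g mod_hom_lin[OF k(1) N T]]] mod_hom_lin[OF k(1) N T]
      by (auto simp: compose_def)
  next
    assume h: "h : mod_hom R M T & (EX k. lin R N T k & (ALL x:carrier M. h x = k (g x)))"
    then obtain k where k: "lin R N T k" "!!x. x el M ==> h x = k (g x)" by auto
    have "h = compose (carrier M) (restrict k (carrier N)) g"
      using mod_homD[OF conjunct1[OF h]] k(2) lin_closed[OF g] by (auto simp: compose_def fun_eq_iff extensional_def)
    then show "h : ?I" using restrict_mod_hom[OF k(1)] by blast
  qed
  show ?thesis
  proof
    assume eq: "?I = ?K"
    have "h (g (f x)) = 0[T]" if "lin R N T h" "x el L" for h x
    proof -
      have "restrict (%x. h (g x)) (carrier M) : ?I"
        using restrict_mod_hom[OF lin_comp[OF g that(1)]] that(1) by (auto simp: I)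
      then show ?thesis using that(2) lin_closed[OF f that(2)] unfolding eq K by auto
    qed
    moreover have ?B
    proof (intro allI impI, elim conjE)
      fix h assume h: "lin R M T h" "ALL x:carrier L. h (f x) = 0[T]"
      then have "restrict h (carrier M) : ?K" using restrict_mod_hom[OF h(1)] lin_closed[OF f] by (simp add: K)
      then show "EX k. lin R N T k & (ALL x:carrier M. h x = k (g x))" unfolding eq[symmetric] I by auto
    qed
    ultimately show "?A & ?B" by blast
  next
    assume AB: "?A & ?B"
    show "?I = ?K"
    proof (intro equalityI subsetI)
      fix h assume "h : ?I"
      then show "h : ?K" using AB lin_closed[OF f] unfolding I K by auto
    next
      fix h assume "h : ?K"
      then show "h : ?I" using AB mod_hom_lin[OF _ M T] unfolding I K by blast
    qed
  qed
qed

lemma lin_reg_eq: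
  assumes "lin R (reg_mod R) M f" "r el R"
  shows "f r = r .[M] f 1[R]"
  using lin_smult[OF assms(1), of r "1[R]"] assms ring_rules[OF lmod_ring[OF lin_mod(1)[OF assms(1)]]] by simp

lemma addm_inj:
  assumes f: "addm M N f" and k: "!!x. [| x el M; f x = 0[N] |] ==> x = 0[M]"
  shows "inj_on f (carrier M)"
proof (rule inj_onI)
  note M = addm_ag(1)[OF f] and N = addm_ag(2)[OF f]
  fix x y assume xy: "x el M" "y el M" "f x = f y"
  then have "f (x +[M] -[M] y) = 0[N]" by (simp add: addm_simps[OF f] ag_simps[OF M] ag_simps[OF N])
  then have "x +[M] -[M] y = 0[M]" using xy by (intro k) (simp_all add: ag_simps[OF M])
  then show "x = y" using xy ag_cancel[OF M] by blast
qed

lemma wakamatsu_iff: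
  fixes R :: "'r ring" and T :: "('r, 't) module"
  shows "wakamatsu_tilting R T \<longleftrightarrow> left_module R T &
    (EX (P :: nat => ('r, nat => 'r) module) d e. pres R T P d e & (ALL i. addr R (reg_mod R) (P i))) &
    ext0 R T T & (EX (C :: nat => ('r, nat => 't) module) e d. corres R T C e d)"
proof -
  let ?C = "carrier R"
  let ?G = "reg_mod R"
  have 1: "(EX (P :: nat => ('r, nat => 'r) module) d e. projective_resolution R T P d e & (ALL i. fin_gen R (P i))) \<longleftrightarrow>
    (EX (P :: nat => ('r, nat => 'r) module) d e. pres R T P d e & (ALL i. addr R ?G (P i)))" (is "?L \<longleftrightarrow> ?R")
  proof
    assume ?L
    then obtain P :: "nat => ('r, nat => 'r) module" and d e
      where P: "projective_resolution R T P d e" and "!!i. fin_gen R (P i)" by auto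
    then have "!!i. addr R ?G (P i)"
      using fg_proj_iff presD(1)[OF projective_resolution_pres[OF P]] by blast
    then show ?R using projective_resolution_pres[OF P] by blast
  next
    assume ?R
    then obtain P :: "nat => ('r, nat => 'r) module" and d e
      where P: "pres R T P d e" and a: "!!i. addr R ?G (P i)" by auto
    then have "!!i. fin_gen R (P i)" using fg_proj_iff by blast
    then show ?L using pres_projective_resolution[OF P] by blast
  qed
  have 2: "(ALL i>0. trivial_group (Ext R i T T)) \<longleftrightarrow> ext0 R T T" if "left_module R T" by (rule Ext_trivial_iff[OF that that])
  have 3: "(EX (C :: nat => ('r, nat => 't) module) e d.
      (ALL j. C j : add_mod R T) &
      e : mod_hom R ?G (C 0) & (ALL j. d j : mod_hom R (C j) (C (Suc j))) &
      inj_on e ?C &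
      exact_at ?G e (C 0) (d 0) (C 1) &
      (ALL j. exact_at (C j) (d j) (C (Suc j)) (d (Suc j)) (C (Suc (Suc j)))) &
      (%g. compose ?C g e) ` mod_hom R (C 0) T = mod_hom R ?G T &
      (%g. compose (carrier (C 0)) g (d 0)) ` mod_hom R (C 1) T
        = kernel (hom_grp R (C 0) T) (hom_grp R ?G T) (%g. compose ?C g e) &
      (ALL j. (%g. compose (carrier (C (Suc j))) g (d (Suc j))) ` mod_hom R (C (Suc (Suc j))) T
        = kernel (hom_grp R (C (Suc j)) T) (hom_grp R (C j) T)
            (%g. compose (carrier (C j)) g (d j)))) \<longleftrightarrow>
    (EX (C :: nat => ('r, nat => 't) module) e d. corres R T C e d)" (is "?L \<longleftrightarrow> ?R") if T: "left_module R T"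
  proof
    note R = lmod_ring[OF T]
    note Rm = reg_mod_lmod[OF R]
    assume ?L
    then obtain C :: "nat => ('r, nat => 't) module" and e d where
      C: "ALL j. C j : add_mod R T" and e: "e : mod_hom R ?G (C 0)"
      and d: "ALL j. d j : mod_hom R (C j) (C (Suc j))" and inj: "inj_on e ?C"
      and ex0: "exact_at ?G e (C 0) (d 0) (C 1)"
      and exS: "ALL j. exact_at (C j) (d j) (C (Suc j)) (d (Suc j)) (C (Suc (Suc j)))"
      and h0: "(%g. compose ?C g e) ` mod_hom R (C 0) T = mod_hom R ?G T"
      and h1: "(%g. compose (carrier (C 0)) g (d 0)) ` mod_hom R (C 1) T
        = kernel (hom_grp R (C 0) T) (hom_grp R ?G T) (%g. compose ?C g e)"
      and hS: "ALL j. (%g. compose (carrier (C (Suc j))) g (d (Suc j))) ` mod_hom R (C (Suc (Suc j))) T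
        = kernel (hom_grp R (C (Suc j)) T) (hom_grp R (C j) T) (%g. compose (carrier (C j)) g (d j))"
      by (elim exE conjE) (rule that; assumption)
    have a: "addr R T (C j)" for j using C add_mod_addr[OF T] by blast
    note Cm = addr_lmod(2)[OF a]
    have el: "lin R ?G (C 0) e" by (rule mod_hom_lin[OF e Rm Cm])
    have dl: "lin R (C j) (C (Suc j)) (d j)" for j by (rule mod_hom_lin[OF d[rule_format] Cm Cm])
    note H1 = h1[unfolded One_nat_def, unfolded image_compose_eq_kernel[OF el dl T, simplified], simplified]
    note HS = hS[rule_format, unfolded image_compose_eq_kernel[OF dl dl T]]
    have ez: "r = 0[R]" if "r el R" "e r = 0[C 0]" for r
      using inj_onD[OF inj, of r "0[R]"] that lin_simps(3)[OF el] ring_rules[OF R] by simp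
    have t: "EX g. lin R (C 0) T g & g (e 1[R]) = t" if t: "t el T" for t
    proof -
      have "(\<lambda>r\<in>carrier R. r .[T] t) : mod_hom R ?G T" using restrict_mod_hom[OF lin_reg[OF T t]] by simp
      then obtain g where g: "g : mod_hom R (C 0) T" "(\<lambda>r\<in>carrier R. r .[T] t) = compose ?C g e"
        unfolding h0[symmetric] by auto
      from fun_cong[OF g(2), of "1[R]"] have "g (e 1[R]) = t"
        using t lmod_simps[OF T] ring_rules[OF R] by (simp add: compose_def)
      then show ?thesis using mod_hom_lin[OF g(1) Cm T] by blast
    qed
    have g1: "EX g'. lin R (C (Suc 0)) T g' & (ALL x:carrier (C 0). g x = g' (d 0 x))"
      if g: "lin R (C 0) T g" "g (e 1[R]) = 0[T]" for g
    proof -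
      have "g (e x) = 0[T]" if "x el R" for x
        using lin_reg_eq[OF lin_comp[OF el g(1)] that] g(2) lmod_simps[OF T] that by simp
      then show ?thesis using H1 g(1) by auto
    qed
    have "corres R T C e d" unfolding corres_def
      using a el dl ez ex0 exS t g1 HS by (auto simp: exact_at_def)
    then show ?R by blast
  next
    note R = lmod_ring[OF T]
    note Rm = reg_mod_lmod[OF R]
    assume ?R
    then obtain C :: "nat => ('r, nat => 't) module" and e d where c: "corres R T C e d" by blast
    note D = corresD[OF c]
    let ?e = "restrict e ?C" and ?d = "%j. restrict (d j) (carrier (C j))"
    note el = lin_cong[OF D(2), of ?e, simplified] and dl = lin_cong[OF D(3), of _ "?d _", simplified]
    note RT = ring_rules[OF R] lmod_simps[OF T]
    have C: "C j : add_mod R T" for j using D(1) add_mod_addr[OF T] by blast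
    note Cm = addr_lmod(2)[OF D(1)]
    have em: "?e : mod_hom R ?G (C 0)" using restrict_mod_hom[OF D(2)] by simp
    have dm: "?d j : mod_hom R (C j) (C (Suc j))" for j by (rule restrict_mod_hom[OF D(3)])
    have dd: "d (Suc j) (d j x) = 0[C (Suc (Suc j))]" if "x el (C j)" for j x
      using D(6)[OF lin_closed[OF D(3) that]] that by blast
    have de: "d 0 (e r) = 0[C (Suc 0)]" if "r el R" for r
      using D(5)[OF lin_closed[OF D(2), of r]] that by simp
    have "inj_on e (carrier ?G)" by (rule addm_inj[OF lin_addm[OF D(2)]]) (simp add: D(4))
    then have inj: "inj_on ?e ?C" by simp
    have ex0: "exact_at ?G ?e (C 0) (?d 0) (C 1)"
      using D(5) lin_closed[OF D(2)] by (auto simp: exact_at_def)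
    have exS: "exact_at (C j) (?d j) (C (Suc j)) (?d (Suc j)) (C (Suc (Suc j)))" for j
      using D(6) lin_closed[OF D(3)] by (auto simp: exact_at_def)
    have h0: "(%g. compose ?C g ?e) ` mod_hom R (C 0) T = mod_hom R ?G T"
    proof (intro equalityI subsetI)
      fix h assume "h : (%g. compose ?C g ?e) ` mod_hom R (C 0) T"
      then show "h : mod_hom R ?G T" using compose_mod_hom[OF em _ Rm Cm T] by auto
    next
      fix h assume h: "h : mod_hom R ?G T"
      note hl = mod_hom_lin[OF h Rm T]
      obtain g where g: "lin R (C 0) T g" "g (e 1[R]) = h 1[R]" using D(7)[of "h 1[R]"] lin_closed[OF hl] RT by auto
      have "h = compose ?C (restrict g (carrier (C 0))) ?e"
      proof
        fix r show "h r = compose ?C (restrict g (carrier (C 0))) ?e r"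
          using lin_reg_eq[OF hl, of r] lin_reg_eq[OF lin_comp[OF D(2) g(1)], of r] g(2) lin_closed[OF D(2), of r] mod_homD[OF h]
          by (cases "r el R") (auto simp: compose_def extensional_def)
      qed
      then show "h : (%g. compose ?C g ?e) ` mod_hom R (C 0) T" using restrict_mod_hom[OF g(1)] by blast
    qed
    have h1: "(%g. compose (carrier (C 0)) g (?d 0)) ` mod_hom R (C 1) T
        = kernel (hom_grp R (C 0) T) (hom_grp R ?G T) (%g. compose ?C g ?e)"
      using image_compose_eq_kernel[OF el dl T, THEN iffD2] D(8) de lin_closed[OF D(2)] RT
      by (simp add: lin_simps(3))
    have hS: "(%g. compose (carrier (C (Suc j))) g (?d (Suc j))) ` mod_hom R (C (Suc (Suc j))) T
        = kernel (hom_grp R (C (Suc j)) T) (hom_grp R (C j) T) (%g. compose (carrier (C j)) g (?d j))" for j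
      using image_compose_eq_kernel[OF dl dl T, THEN iffD2] D(9) dd lin_closed[OF D(3)]
      by (simp add: lin_simps(3))
    show ?L by (intro exI[of _ C] exI[of _ ?e] exI[of _ ?d] conjI allI C em dm inj ex0 exS h0 h1 hS)
  qed
  show ?thesis
  proof (cases "left_module R T")
    case True
    show ?thesis unfolding wakamatsu_tilting_def 1 2[OF True] 3[OF True] ..
  qed (simp add: wakamatsu_tilting_def)
qed

section \<open>Tensor products with bimodules\<close>

definition bimod :: "'a ring => 's ring => ('a, 't, 's) bimodule => bool"
  where "bimod A S T \<longleftrightarrow> left_module A (left_mod T) & left_module (opp_ring S) (right_mod T) &
    (ALL a:carrier A. ALL s:carrier S. ALL t:carrier T. rsmult T (a .[T] t) s = a .[T] rsmult T t s)"

lemma tensor_mod_simps: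
  "carrier (tensor_mod S T M) = carrier (tgr S (right_mod T) M)"
  "0[tensor_mod S T M] = 0[tgr S (right_mod T) M]"
  "ring.add (tensor_mod S T M) = ring.add (tgr S (right_mod T) M)"
  by (simp_all add: tensor_mod_def tgr_def)

lemma tensor_mod_smult:
  "module.smult (tensor_mod S T M) a = tensor_map S (right_mod T) M (right_mod T) M (%t. a .[T] t) (%m. m)"
  by (simp add: tensor_mod_def)

lemma addm_tensor_mod:
  "addm (tensor_mod S T M) W h \<longleftrightarrow> addm (tgr S (right_mod T) M) W h"
  "addm W (tensor_mod S T M) k \<longleftrightarrow> addm W (tgr S (right_mod T) M) k"
proof -
  have "abelian_group (tensor_mod S T M) \<longleftrightarrow> abelian_group (tgr S (right_mod T) M)"
    using ag_same[of "tensor_mod S T M" "tgr S (right_mod T) M"] ag_same[of "tgr S (right_mod T) M" "tensor_mod S T M"]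
    by (auto simp: tensor_mod_simps)
  then show "addm (tensor_mod S T M) W h \<longleftrightarrow> addm (tgr S (right_mod T) M) W h"
    "addm W (tensor_mod S T M) k \<longleftrightarrow> addm W (tgr S (right_mod T) M) k"
    by (simp_all add: addm_def tensor_mod_simps)
qed

lemma lsum_tensor_mod: "lsum (tensor_mod S T M) n f = lsum (tgr S (right_mod T) M) n f"
  by (rule lsum_same) (simp_all add: tensor_mod_simps)

context
  fixes A :: "'a ring" and S :: "'s ring" and T :: "('a, 't, 's) bimodule"
  assumes T: "bimod A S T"
begin

lemma bimod_right: "left_module (opp_ring S) (right_mod T)"
  and bimod_left: "left_module A (left_mod T)"
  using T by (simp_all add: bimod_def)

lemma bimod_smult_lin: "a el A ==> lin (opp_ring S) (right_mod T) (right_mod T) (%t. a .[T] t)"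
  using T lmod_simps[OF bimod_left] by (intro linI bimod_right) (auto simp: bimod_def)

context
  fixes M :: "('s, 'm) module"
  assumes M: "left_module S M"
begin

lemma tensor_mod_smult_ten: "[| a el A; t el T; m el M |]
    ==> a .[tensor_mod S T M] ten S (right_mod T) M t m = ten S (right_mod T) M (a .[T] t) m"
  unfolding tensor_mod_smult by (rule tmp_ten[OF M bimod_smult_lin]) simp_all

lemma tensor_mod_lmod: "left_module A (tensor_mod S T M)"
proof (rule lmodI)
  note sm = bimod_smult_lin and Tr = bimod_right
  note [simp] = lmod_simps[OF bimod_left, simplified]
  show A: "ring A" by (rule lmod_ring[OF bimod_left])
  note [simp] = ring_rules[OF A]
  let ?T = "tensor_mod S T M" and ?t = "tgr S (right_mod T) M"
  show "abelian_group ?T" by (rule ag_same[OF tgr_ag[OF Tr M]]) (simp_all add: tensor_mod_simps)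
  show "a .[?T] z el ?T" if "a el A" "z el ?T" for a z
    using addm_simps(1)[OF tmp_addm[OF M sm[OF that(1)]]] that(2) by (simp add: tensor_mod_simps tensor_mod_smult)
  show "a .[?T] (y +[?T] z) = a .[?T] y +[?T] a .[?T] z" if "a el A" "y el ?T" "z el ?T" for a y z
    using addm_simps(2)[OF tmp_addm[OF M sm[OF that(1)]]] that(2,3) by (simp add: tensor_mod_simps tensor_mod_smult)
  show "1[A] .[?T] z = z" if "z el ?T" for z
    unfolding tensor_mod_smult by (rule tmp_id[OF M Tr]) (use that in "simp_all add: tensor_mod_simps")
  show "(a *[A] b) .[?T] z = a .[?T] (b .[?T] z)" if ab: "a el A" "b el A" "z el ?T" for a b z
    unfolding tensor_mod_smult
    by (rule tmp_comp_eq[OF M sm[OF ab(2)] sm[OF ab(1)], symmetric]) (use ab in "simp_all add: tensor_mod_simps")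
  show "(a +[A] b) .[?T] z = a .[?T] z +[?T] b .[?T] z" if ab: "a el A" "b el A" "z el ?T" for a b z
  proof -
    have z: "z el ?t" using ab by (simp add: tensor_mod_simps)
    have "(a +[A] b) .[?T] z = tmp S M (right_mod T) (right_mod T) (%t. a .[T] t +[right_mod T] b .[T] t) z"
      unfolding tensor_mod_smult by (rule tmp_cong[OF M sm _ z]) (use ab in simp_all)
    then show ?thesis using tmp_add[OF M sm[OF ab(1)] sm[OF ab(2)] z] by (simp add: tensor_mod_simps tensor_mod_smult)
  qed
qed

lemma tensor_mod_eqI:
  assumes "lin A (tensor_mod S T M) W f" "lin A (tensor_mod S T M) W g"
    and "!!t m. [| t el T; m el M |] ==> f (ten S (right_mod T) M t m) = g (ten S (right_mod T) M t m)"
    and "z el (tensor_mod S T M)"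
  shows "f z = g z"
  by (rule ten_eqI[OF bimod_right M lin_addm[OF assms(1), unfolded addm_tensor_mod] lin_addm[OF assms(2), unfolded addm_tensor_mod]])
    (use assms(3,4) in "simp_all add: tensor_mod_simps")

lemma tensor_mod_linI:
  assumes W: "left_module A W" and h: "addm (tgr S (right_mod T) M) W h"
    and s: "!!a t m. [| a el A; t el T; m el M |]
      ==> h (ten S (right_mod T) M (a .[T] t) m) = a .[W] h (ten S (right_mod T) M t m)"
  shows "lin A (tensor_mod S T M) W h"
proof -
  have "h (a .[tensor_mod S T M] z) = a .[W] h z" if "a el A" "z el (tensor_mod S T M)" for a z
    unfolding tensor_mod_smult
    by (rule ten_eqI[OF bimod_right M addm_comp[OF tmp_addm[OF M bimod_smult_lin[OF that(1)]] h] addm_comp[OF h smult_addm[OF W that(1)]]])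
      (use that s in "simp_all add: tmp_ten[OF M bimod_smult_lin] tensor_mod_simps")
  then show ?thesis unfolding lin_def using tensor_mod_lmod W h by (simp add: addm_tensor_mod)
qed

lemma tensor_mod_lift:
  assumes W: "left_module A W" and c: "!!t m. [| t el T; m el M |] ==> f t m el W"
    and al: "!!t t' m. [| t el T; t' el T; m el M |] ==> f (t +[T] t') m = f t m +[W] f t' m"
    and ar: "!!t m m'. [| t el T; m el M; m' el M |] ==> f t (m +[M] m') = f t m +[W] f t m'"
    and bal: "!!s t m. [| s el S; t el T; m el M |] ==> f (rsmult T t s) m = f t (s .[M] m)"
    and sm: "!!a t m. [| a el A; t el T; m el M |] ==> f (a .[T] t) m = a .[W] f t m"
  shows "EX h. lin A (tensor_mod S T M) W h & (ALL t:carrier T. ALL m:carrier M. h (ten S (right_mod T) M t m) = f t m)"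
proof -
  have "EX h. addm (tgr S (right_mod T) M) W h &
    (ALL t:carrier (right_mod T). ALL m:carrier M. h (ten S (right_mod T) M t m) = f t m)"
    by (rule ten_lift[OF bimod_right M lmod_ag[OF W]]) (simp_all add: c al ar bal)
  then obtain h where h: "addm (tgr S (right_mod T) M) W h"
    and ht: "!!t m. [| t el T; m el M |] ==> h (ten S (right_mod T) M t m) = f t m" by auto
  have "lin A (tensor_mod S T M) W h"
    by (rule tensor_mod_linI[OF W h]) (use lmod_simps[OF bimod_left] in "simp add: ht sm")
  then show ?thesis using ht by blast
qed

end

lemma tensor_mod_map:
  assumes f: "lin S M N f"
  shows "lin A (tensor_mod S T M) (tensor_mod S T N) (tensor_map S (right_mod T) M (right_mod T) N (%t. t) f)"
    (is "lin _ _ _ ?f")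
proof -
  note M = lin_mod(1)[OF f] and N = lin_mod(2)[OF f]
  note a = tensor_map_addm[OF lin_id[OF bimod_right] f]
  show ?thesis
    by (rule tensor_mod_linI[OF M tensor_mod_lmod[OF N]])
      (use lmod_simps[OF bimod_left] lin_closed[OF f] in "simp_all add: a addm_tensor_mod tensor_mod_smult_ten[OF N]")
qed

lemma tensor_is_functor:
  assumes C: "!!M. M : C ==> left_module S M" and D: "!!M. M : C ==> tensor_mod S T M : D"
  shows "is_functor S C A D (tensor_functor S T)"
proof -
  let ?F = "%M N f. tensor_map S (right_mod T) M (right_mod T) N (%t. t) f"
  have ext: "?F M N f : extensional (carrier (tensor_mod S T M))" for M N f
    using tensor_map_extensional by (simp add: tensor_mod_simps)
  have hom: "?F M N f : mod_hom A (tensor_mod S T M) (tensor_mod S T N)" if "lin S M N f" for M N f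
    by (rule mod_homI[OF tensor_mod_map[OF that] ext])
  have id: "?F M M (\<lambda>x\<in>carrier M. x) = (\<lambda>y\<in>carrier (tensor_mod S T M). y)" if M: "left_module S M" for M
  proof -
    have i: "lin S M M (\<lambda>x\<in>carrier M. x)" by (rule lin_cong[OF lin_id[OF M]]) simp
    show ?thesis
    proof (rule mod_hom_eqI[OF hom[OF i]])
      show "(\<lambda>y\<in>carrier (tensor_mod S T M). y) : mod_hom A (tensor_mod S T M) (tensor_mod S T M)"
        by (rule restrict_mod_hom[OF lin_id[OF tensor_mod_lmod[OF M]]])
      show "?F M M (\<lambda>x\<in>carrier M. x) z = (\<lambda>y\<in>carrier (tensor_mod S T M). y) z" if "z el (tensor_mod S T M)" for z
        using tensor_mod_eqI[OF M tensor_mod_map[OF i] lin_id[OF tensor_mod_lmod[OF M]] _ that]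
          tensor_map_addm(2)[OF lin_id[OF bimod_right] i] that by simp
    qed
  qed
  have comp: "?F L N (compose (carrier L) g f) = compose (carrier (tensor_mod S T L)) (?F M N g) (?F L M f)"
    if f: "lin S L M f" and g: "lin S M N g" for L M N f g
  proof -
    have gf: "lin S L N (compose (carrier L) g f)" by (rule lin_cong[OF lin_comp[OF f g]]) (simp add: compose_def)
    note c = lin_comp[OF tensor_mod_map[OF f] tensor_mod_map[OF g]]
    show ?thesis
    proof (rule mod_hom_eqI[OF hom[OF gf]])
      show "compose (carrier (tensor_mod S T L)) (?F M N g) (?F L M f) : mod_hom A (tensor_mod S T L) (tensor_mod S T N)"
        using restrict_mod_hom[OF c] by (simp add: compose_def)
      show "?F L N (compose (carrier L) g f) z = compose (carrier (tensor_mod S T L)) (?F M N g) (?F L M f) z"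
        if "z el (tensor_mod S T L)" for z
        using tensor_mod_eqI[OF lin_mod(1)[OF f] tensor_mod_map[OF gf] c _ that]
          tensor_map_addm(2)[OF lin_id[OF bimod_right] f] tensor_map_addm(2)[OF lin_id[OF bimod_right] g]
          tensor_map_addm(2)[OF lin_id[OF bimod_right] gf] lin_closed[OF f] that by (simp add: compose_def)
    qed
  qed
  have l: "lin S M N f" if "M : C" "N : C" "f : mod_hom S M N" for M N f
    by (rule mod_hom_lin[OF that(3) C[OF that(1)] C[OF that(2)]])
  show ?thesis unfolding is_functor_def tensor_functor_def mod_functor.simps
    by (intro conjI ballI D) (simp_all add: hom l id C comp)
qed

end

lemma bimod_end: "left_module R T ==> bimod R (end_ring R T) (end_bimod T)"
  unfolding bimod_def using left_mod_end right_mod_end by (auto simp: lin_smult[OF end_lin])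

lemma hom_is_functor:
  fixes R :: "'a ring" and T :: "('a, 'b) module" and C :: "('a, 'c) module set"
  assumes T: "left_module R T" and C: "!!N. N : C ==> left_module R N"
    and D: "!!N. N : C ==> hom_mod R (end_bimod T) N : D"
  shows "is_functor R C (end_ring R T) D (hom_functor R (end_bimod T))"
proof -
  let ?C = "carrier T"
  have hom: "(\<lambda>g\<in>mod_hom R T M. compose ?C f g)
      : mod_hom (end_ring R T) (hom_mod R (end_bimod T) M) (hom_mod R (end_bimod T) N)"
    if f: "lin R M N f" for M N f
  proof -
    note M = lin_mod(1)[OF f] and N = lin_mod(2)[OF f]
    have c: "compose ?C f g : mod_hom R T N" if "g : mod_hom R T M" for g
      using restrict_mod_hom[OF lin_comp[OF mod_hom_lin[OF that T M] f]] by (simp add: compose_def)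
    have "lin (end_ring R T) (hom_mod R (end_bimod T) M) (hom_mod R (end_bimod T) N) (compose ?C f)"
      by (rule linI[OF hom_mod_lmod[OF T M] hom_mod_lmod[OF T N]])
        (auto simp: hom_mod_simps[OF T] c[unfolded compose_def] fun_eq_iff compose_def lin_simps[OF f] lin_closed[OF mod_hom_lin[OF _ T M]]
          lin_closed[OF end_lin[OF T]])
    from restrict_mod_hom[OF this] show ?thesis by (simp add: hom_mod_simps[OF T])
  qed
  have l: "lin R M N f" if "M : C" "N : C" "f : mod_hom R M N" for M N f
    by (rule mod_hom_lin[OF that(3) C[OF that(1)] C[OF that(2)]])
  have cl: "g x el M" if "g : mod_hom R T M" "x el T" for g x and M :: "('a, 'c) module"
    using that by (auto simp: mod_hom_def)
  have id: "(\<lambda>g\<in>mod_hom R T M. compose ?C (\<lambda>x\<in>carrier M. x) g) = (\<lambda>y\<in>mod_hom R T M. y)" for M :: "('a, 'c) module"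
  proof (rule restrict_ext)
    fix g assume g: "g : mod_hom R T M"
    show "compose ?C (\<lambda>x\<in>carrier M. x) g = g"
      using mod_hom_arb[OF g] cl[OF g] by (auto simp: fun_eq_iff compose_def)
  qed
  have comp: "(\<lambda>h\<in>mod_hom R T L. compose ?C (compose (carrier L) g f) h) =
      compose (mod_hom R T L) (\<lambda>h\<in>mod_hom R T M. compose ?C g h) (\<lambda>h\<in>mod_hom R T L. compose ?C f h)"
    if f: "lin R L M f" for L M :: "('a, 'c) module" and f g
    unfolding compose_def[of "mod_hom R T L"]
  proof (rule restrict_ext)
    fix h assume h: "h : mod_hom R T L"
    have "compose ?C f h : mod_hom R T M"
      using restrict_mod_hom[OF lin_comp[OF mod_hom_lin[OF h T lin_mod(1)[OF f]] f]] by (simp add: compose_def)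
    then show "compose ?C (compose (carrier L) g f) h =
        (\<lambda>h\<in>mod_hom R T M. compose ?C g h) ((\<lambda>h\<in>mod_hom R T L. compose ?C f h) h)"
      using h cl[OF h] by (auto simp: fun_eq_iff compose_def)
  qed
  show ?thesis unfolding is_functor_def hom_functor_def mod_functor.simps mod_hom_end_bimod[OF T] end_bimod_simps hom_mod_simps[OF T]
    by (intro conjI ballI D hom id comp l; assumption?)
qed

section \<open>The Brenner--Butler--Miyashita equivalence\<close>

text \<open>Exactness under \<open>Hom(-, T)\<close> says that the groups \<open>Hom(C j, T)\<close>
  form an exact complex ending in \<open>Hom(R, T)\<close>, which is \<open>T\<close> by evaluation
  at \<open>e\<close> of 1. Membership of the \<open>C j\<close> in add T makes the terms
  projective. A coresolution of R thus turns into a resolution of the right module T.\<close>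

lemma homr_pres:
  assumes T: "left_module R T" and c: "corres R T C e d"
  shows "pres (opp_ring (end_ring R T)) (right_mod (end_bimod T)) (%j. homr R T (C j))
    (%j g. compose (carrier (C j)) g (d j)) (%g. g (e 1[R]))"
proof -
  let ?E = "e 1[R]"
  note D = corresD[OF c] and R = lmod_ring[OF T]
  note Cm = addr_lmod(2)[OF D(1)]
  note [simp] = homr_simps[OF T] ring_rules[OF R]
  have e1: "e 1[R] el (C 0)" using lin_closed[OF D(2)] by simp
  have comp: "compose (carrier (C j)) g (d j) : mod_hom R (C j) T" if "g : mod_hom R (C (Suc j)) T" for g j
    using restrict_mod_hom[OF lin_comp[OF D(3) mod_hom_lin[OF that Cm T]]] by (simp add: compose_def)
  have ch: "g = compose (carrier (C j)) (restrict k (carrier (C (Suc j)))) (d j)"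
    if "g : mod_hom R (C j) T" "!!x. x el (C j) ==> g x = k (d j x)" for g j k
    using that mod_hom_arb[OF that(1)] lin_closed[OF D(3)] by (auto simp: fun_eq_iff compose_def)
  have zero: "(\<lambda>t\<in>carrier (C j). 0[T]) = g \<longleftrightarrow> (ALL x:carrier (C j). g x = 0[T])" if "g : extensional (carrier (C j))" for g j
    using that by (auto simp: fun_eq_iff extensional_def)
  show ?thesis unfolding pres_def
  proof (intro conjI allI ballI)
    show "projective (opp_ring (end_ring R T)) (homr R T (C j))" for j
      by (rule addr_reg_proj[OF homr_addr_end[OF T D(1)]])
    show "lin (opp_ring (end_ring R T)) (homr R T (C (Suc j))) (homr R T (C j)) (%g. compose (carrier (C j)) g (d j))" for j
      by (rule homr_map[OF T D(3)])
    show "lin (opp_ring (end_ring R T)) (homr R T (C 0)) (right_mod (end_bimod T)) (%g. g ?E)"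
      by (rule lin_eval[OF T Cm e1])
    show "(%g. g ?E) ` carrier (homr R T (C 0)) = carrier (right_mod (end_bimod T))"
    proof (intro equalityI subsetI)
      fix t assume "t el (right_mod (end_bimod T))"
      then obtain g where "lin R (C 0) T g" "g ?E = t" using D(7)[of t] by auto
      then show "t : (%g. g ?E) ` carrier (homr R T (C 0))"
        using e1 restrict_mod_hom by (intro image_eqI[of _ _ "restrict g (carrier (C 0))"]) auto
    qed (use e1 lin_closed[OF mod_hom_lin[OF _ Cm T]] in auto)
    show "g ?E = 0[right_mod (end_bimod T)] \<longleftrightarrow>
        g : (%g. compose (carrier (C 0)) g (d 0)) ` carrier (homr R T (C 1))" if g: "g el (homr R T (C 0))" for g
    proof
      assume z: "g ?E = 0[right_mod (end_bimod T)]"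
      have gl: "lin R (C 0) T g" using g mod_hom_lin[OF _ Cm T] by simp
      from D(8)[OF gl] z obtain k where k: "lin R (C (Suc 0)) T k" "!!x. x el (C 0) ==> g x = k (d 0 x)" by auto
      show "g : (%g. compose (carrier (C 0)) g (d 0)) ` carrier (homr R T (C 1))"
      proof (rule image_eqI[of _ _ "restrict k (carrier (C (Suc 0)))"])
        show "g = compose (carrier (C 0)) (restrict k (carrier (C (Suc 0)))) (d 0)" by (rule ch) (use g k(2) in simp_all)
      qed (use restrict_mod_hom[OF k(1)] in simp)
    next
      assume "g : (%g. compose (carrier (C 0)) g (d 0)) ` carrier (homr R T (C 1))"
      then obtain k where k: "k : mod_hom R (C (Suc 0)) T" "g = compose (carrier (C 0)) k (d 0)" by auto
      have "d 0 ?E = 0[C (Suc 0)]" using D(5)[OF e1] by simp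
      then show "g ?E = 0[right_mod (end_bimod T)]"
        using k e1 lin_simps(3)[OF mod_hom_lin[OF k(1) Cm T]] by (simp add: compose_def)
    qed
    show "compose (carrier (C j)) g (d j) = 0[homr R T (C j)] \<longleftrightarrow>
        g : (%g. compose (carrier (C (Suc j))) g (d (Suc j))) ` carrier (homr R T (C (Suc (Suc j))))"
      if g: "g el (homr R T (C (Suc j)))" for g j
    proof
      assume z: "compose (carrier (C j)) g (d j) = 0[homr R T (C j)]"
      have gl: "lin R (C (Suc j)) T g" using g mod_hom_lin[OF _ Cm T] by simp
      have "g (d j x) = 0[T]" if "x el (C j)" for x
        using fun_cong[OF z, of x] that by (simp add: compose_def)
      from D(9)[OF gl this] obtain k where k: "lin R (C (Suc (Suc j))) T k"
        "!!x. x el (C (Suc j)) ==> g x = k (d (Suc j) x)" by auto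
      show "g : (%g. compose (carrier (C (Suc j))) g (d (Suc j))) ` carrier (homr R T (C (Suc (Suc j))))"
      proof (rule image_eqI[of _ _ "restrict k (carrier (C (Suc (Suc j))))"])
        show "g = compose (carrier (C (Suc j))) (restrict k (carrier (C (Suc (Suc j))))) (d (Suc j))"
          by (rule ch) (use g k(2) in simp_all)
      qed (use restrict_mod_hom[OF k(1)] in simp)
    next
      assume "g : (%g. compose (carrier (C (Suc j))) g (d (Suc j))) ` carrier (homr R T (C (Suc (Suc j))))"
      then obtain k where k: "k : mod_hom R (C (Suc (Suc j))) T" "g = compose (carrier (C (Suc j))) k (d (Suc j))" by auto
      have "d (Suc j) (d j x) = 0[C (Suc (Suc j))]" if "x el (C j)" for x
        using D(6)[OF lin_closed[OF D(3) that]] that by blast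
      then show "compose (carrier (C j)) g (d j) = 0[homr R T (C j)]"
        using k lin_simps(3)[OF mod_hom_lin[OF k(1) Cm T]] lin_closed[OF D(3)] by (auto simp: compose_def fun_eq_iff)
    qed
  qed
qed

section \<open>Evaluation maps from tensor products to groups of homomorphisms\<close>

definition hg :: "'r ring => ('r, 'c) module => ('r, 'n) module => (unit, 'c => 'n) module"
  where "hg R C N = mk_module (hom_grp R C N) (%_ z. z)"

lemma hg_simps [simp]:
  "carrier (hg R C N) = mod_hom R C N" "0[hg R C N] = (\<lambda>x\<in>carrier C. 0[N])"
  "f +[hg R C N] g = (\<lambda>x\<in>carrier C. f x +[N] g x)"
  by (simp_all add: hg_def)

lemma hg_ag: "[| left_module R C; left_module R N |] ==> abelian_group (hg R C N)"
  unfolding hg_def by (rule mk_module_ag[OF hom_grp_comm_group])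

lemma lsum_hg: "x el C ==> lsum (hg R C N) n f x = lsum N n (%k. f k x)"
  by (induction n) auto

lemma addm_to_hg:
  assumes "abelian_group M" "left_module R C" "left_module R N"
    "!!x. x el M ==> h x : mod_hom R C N"
    "!!x y c. [| x el M; y el M; c el C |] ==> h (x +[M] y) c = h x c +[N] h y c"
  shows "addm M (hg R C N) h"
proof (rule addmI[OF assms(1) hg_ag[OF assms(2,3)]])
  show "h (x +[M] y) = h x +[hg R C N] h y" if "x el M" "y el M" for x y
    using that assms(5) mod_hom_arb[OF assms(4)] ag_simps(2)[OF assms(1) that] by (auto simp: fun_eq_iff)
qed (use assms(4) in simp)

text \<open>\<open>u\<close> forms pure tensors and \<open>v\<close> prescribes their images. The
  map \<open>k\<close> exists in general; the flag \<open>p\<close> carries the finiteness condition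
  under which it is bijective.\<close>

definition eval_iso :: "bool => ('z, 'd) ring_scheme => ('g, 'e) ring_scheme => 'x set => 'y set
    => ('x => 'y => 'z) => ('x => 'y => 'g) => ('z => 'g) => bool"
  where "eval_iso p G H V W u v k \<longleftrightarrow> addm G H k & (ALL f:V. ALL h:W. k (u f h) = v f h) &
    (p --> (ALL g:carrier H. EX z:carrier G. k z = g) & (ALL z:carrier G. ALL z':carrier G. k z = k z' --> z = z'))"

lemma eval_isoD:
  assumes "eval_iso p G H V W u v k" p
  shows "addm G H k" "[| f : V; h : W |] ==> k (u f h) = v f h" "g el H ==> EX z:carrier G. k z = g"
    "[| z el G; z' el G; k z = k z' |] ==> z = z'"
  using assms by (auto simp: eval_iso_def)

text \<open>The map is composition. For \<open>C\<close> in add T its inverse sends \<open>g\<close>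
  to the sum of the tensors of \<open>p k\<close> with \<open>g\<close> after
  \<open>q k\<close>.\<close>

lemma hom_tensor_hom:
  fixes R :: "'r ring" and T :: "('r, 't) module" and C :: "('r, 'c) module" and N :: "('r, 'n) module"
  defines "S \<equiv> end_ring R T" and "H \<equiv> hom_mod R (end_bimod T) N"
  assumes T: "left_module R T" and C: "left_module R C" and N: "left_module R N"
  shows "EX k. eval_iso (addr R T C) (tgr S (homr R T C) H) (hg R C N) (mod_hom R C T) (mod_hom R T N)
    (ten S (homr R T C) H) (%f h. compose (carrier C) h f) k"
proof -
  let ?G = "carrier T"
  let ?C = "carrier C"
  let ?H = "homr R T C"
  note Q = homr_lmod[OF T C, folded S_def] and Hm = hom_mod_lmod[OF T N, folded S_def H_def]
  note [simp] = homr_simps[OF T] hom_mod_simps[OF T, of N, folded H_def]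
  note fl = mod_hom_lin[OF _ C T] and hl = mod_hom_lin[OF _ T N] and el = end_lin[OF T]
  have cm: "compose ?C h f : mod_hom R C N" if "f : mod_hom R C T" "h : mod_hom R T N" for f h
    by (rule compose_mod_hom[OF that C T N])
  have "EX k. addm (tgr S ?H H) (hg R C N) k &
    (ALL f:carrier ?H. ALL h:carrier H. k (ten S ?H H f h) = compose ?C h f)"
    by (rule ten_lift[OF Q Hm hg_ag[OF C N]])
      (auto simp: cm[unfolded compose_def] fun_eq_iff S_def compose_def lin_simps[OF hl] lin_simps[OF fl] lin_simps[OF el])
  then obtain k where k: "addm (tgr S ?H H) (hg R C N) k"
    and kt: "!!f h. [| f : mod_hom R C T; h : mod_hom R T N |] ==> k (ten S ?H H f h) = compose ?C h f" by auto
  have "(ALL g:mod_hom R C N. EX z:carrier (tgr S ?H H). k z = g) &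
    (ALL z:carrier (tgr S ?H H). ALL z':carrier (tgr S ?H H). k z = k z' --> z = z')" if a: "addr R T C"
  proof -
    obtain n p q where r: "retr R T C n p q" using a by (rule addrE)
    note p = retrD(3)[OF r] and q = retrD(4)[OF r]
    let ?p = "%k. restrict (p k) ?C" and ?q = "%g k. compose ?G g (q k)"
    have pm: "?p k : mod_hom R C T" if "k < n" for k by (rule restrict_mod_hom[OF p[OF that]])
    have qa: "addm (hg R C N) H (%g. ?q g k)" if "k < n" for k
    proof (rule addmI[OF hg_ag[OF C N] lmod_ag[OF Hm]])
      show "?q g k el H" if "g el (hg R C N)" for g
        using that restrict_mod_hom[OF lin_comp[OF q[OF \<open>k < n\<close>] mod_hom_lin[OF _ C N]]] by (simp add: compose_def)
    qed (use lin_closed[OF q[OF that]] in "auto simp: fun_eq_iff compose_def")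
    let ?k = "%g. lsum (tgr S ?H H) n (%k. ten S ?H H (?p k) (?q g k))"
    have ka: "addm (hg R C N) (tgr S ?H H) ?k"
      by (intro addm_lsum_maps hg_ag[OF C N] tgr_ag[OF Q Hm] addm_comp[OF qa ten_addm_r[OF Q Hm]]) (simp_all add: pm)
    have kk: "k (?k g) = g" if g: "g : mod_hom R C N" for g
    proof -
      have qg: "?q g k : mod_hom R T N" if "k < n" for k using addm_simps(1)[OF qa[OF that]] g by simp
      have "k (?k g) = lsum (hg R C N) n (%k. compose ?C (?q g k) (?p k))"
        using addm_lsum[OF k, of n "%k. ten S ?H H (?p k) (?q g k)"] ten_closed[OF Q Hm] pm qg kt by simp
      also have "\<dots> = g"
      proof (rule mod_hom_eqI[OF _ g])
        show "lsum (hg R C N) n (%k. compose ?C (?q g k) (?p k)) : mod_hom R C N"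
          using lsum_closed[OF hg_ag[OF C N], of n] cm[OF pm qg] by simp
        fix x assume x: "x el C"
        have "lsum (hg R C N) n (%k. compose ?C (?q g k) (?p k)) x = lsum N n (%k. g (q k (p k x)))"
          unfolding lsum_hg[OF x] using x lin_closed[OF p x] by (simp add: compose_def)
        also have "\<dots> = g (lsum C n (%k. q k (p k x)))"
          by (rule lin_lsum_apply[OF mod_hom_lin[OF g C N], symmetric]) (rule lin_closed[OF q lin_closed[OF p x]])
        finally show "lsum (hg R C N) n (%k. compose ?C (?q g k) (?p k)) x = g x" using retrD(5)[OF r x] by simp
      qed
      finally show ?thesis .
    qed
    have kk2: "?k (k z) = z" if z: "z el (tgr S ?H H)" for z
    proof (rule ten_eqI[OF Q Hm addm_comp[OF k ka] addm_id[OF tgr_ag[OF Q Hm]] _ z])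
      fix f h assume "f el ?H" "h el H"
      then have f: "f : mod_hom R C T" and h: "h : mod_hom R T N" by simp_all
      \<comment> \<open>These composites are endomorphisms of \<open>T\<close>, hence scalars that
        may cross the tensor sign; on the left they recombine to \<open>f\<close>.\<close>
      have s: "compose ?G f (q k) : mod_hom R T T" if "k < n" for k
        using restrict_mod_hom[OF lin_comp[OF q[OF that] fl[OF f]]] by (simp add: compose_def)
      have pf: "compose ?C (compose ?G f (q k)) (p k) : mod_hom R C T" if "k < n" for k
        using compose_mod_hom[OF pm[OF that] s[OF that] C T T] by (simp add: compose_def cong: restrict_cong)
      have "?q (compose ?C h f) k = compose ?G f (q k) .[H] h" if "k < n" for k
        using lin_closed[OF q[OF that]] lin_closed[OF fl[OF f]] by (auto simp: fun_eq_iff compose_def)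
      moreover have "compose ?G f (q k) .[homr R T C] ?p k = compose ?C (compose ?G f (q k)) (p k)" for k
        by (auto simp: fun_eq_iff compose_def)
      ultimately have e: "ten S ?H H (?p k) (?q (compose ?C h f) k) =
          ten S ?H H (compose ?C (compose ?G f (q k)) (p k)) h" if "k < n" for k
        using ten_balanced[OF Q Hm, of "compose ?G f (q k)" "?p k" h] s[OF that] pm[OF that] h that
        by (simp add: S_def)
      have "?k (k (ten S ?H H f h)) =
          lsum (tgr S ?H H) n (%k. ten S ?H H (compose ?C (compose ?G f (q k)) (p k)) h)"
        using kt[OF f h] e by simp
      also have "\<dots> = ten S ?H H (lsum ?H n (%k. compose ?C (compose ?G f (q k)) (p k))) h"
        by (rule addm_lsum[OF ten_addm_l[OF Q Hm], symmetric]) (use h pf in simp_all)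
      also have "lsum ?H n (%k. compose ?C (compose ?G f (q k)) (p k)) = f"
        using retrD(5)[OF homr_retr_end[OF T r]] f by simp
      finally show "?k (k (ten S ?H H f h)) = ten S ?H H f h" .
    qed
    show ?thesis
    proof (intro conjI ballI impI)
      show "EX z:carrier (tgr S ?H H). k z = g" if "g : mod_hom R C N" for g
        using kk[OF that] addm_simps(1)[OF ka] that by (intro bexI[of _ "?k g"]) simp_all
      show "z = z'" if "z el (tgr S ?H H)" "z' el (tgr S ?H H)" "k z = k z'" for z z'
        using kk2[OF that(1)] kk2[OF that(2)] that(3) by metis
    qed
  qed
  then show ?thesis unfolding eval_iso_def hg_simps(1) by (intro exI[of _ k] conjI[OF k conjI] ballI impI kt)
qed

text \<open>Numbered by the map that produces it, so it is a submodule of \<open>C (Suc j)\<close>.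
  By exactness it is also the kernel of \<open>d (Suc j)\<close>.\<close>

definition cosyz :: "(nat => ('r, 'c) module) => (nat => 'c => 'c) => nat => ('r, 'c) module"
  where "cosyz C d j = (C (Suc j))\<lparr>carrier := d j ` carrier (C j)\<rparr>"

text \<open>A homomorphism and an element \<open>m\<close> give the map into tensors with
  \<open>m\<close>. For finitely generated projective \<open>P\<close> the inverse is built from a
  dual basis: the value of \<open>g\<close> at the k-th basis element is pushed into the tensor
  product by \<open>p k\<close> acting on the first factor.\<close>

lemma homr_tensor:
  fixes R :: "'r ring" and T :: "('r, 't) module" and P :: "('r, 'p) module" and M :: "('t => 't, 'm) module"
    and S :: "('t => 't) ring"
  defines "S \<equiv> end_ring R T" and "Tr \<equiv> right_mod (end_bimod T)" and "G \<equiv> tensor_mod S (end_bimod T) M"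
  assumes T: "left_module R T" and P: "left_module R P" and M: "left_module S M"
  shows "EX k. eval_iso (addr R (reg_mod R) P) (tgr S (homr R T P) M) (hg R P G) (mod_hom R P T) (carrier M)
    (ten S (homr R T P) M) (%f m. \<lambda>x\<in>carrier P. ten S Tr M (f x) m) k"
proof -
  let ?H = "homr R T P"
  let ?T = "tgr S ?H M"
  note Q = homr_lmod[OF T P, folded S_def] and Tw = right_mod_end[OF T, folded S_def Tr_def] and b = bimod_end[OF T, folded S_def]
  note G = tensor_mod_lmod[OF b M, folded G_def] and R = lmod_ring[OF T]
  note [simp] = homr_simps[OF T]
  note fl = mod_hom_lin[OF _ P T] and el = end_lin[OF T]
  have Gs: "carrier G = carrier (tgr S Tr M)" "0[G] = 0[tgr S Tr M]" "ring.add G = ring.add (tgr S Tr M)"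
    by (simp_all add: G_def Tr_def tensor_mod_simps)
  have tc: "ten S Tr M t m el G" if "t el T" "m el M" for t m
    using ten_closed[OF Tw M, of t m] that by (simp add: Gs Tr_def)
  have tal: "ten S Tr M (t +[T] t') m = ten S Tr M t m +[G] ten S Tr M t' m" if "t el T" "t' el T" "m el M" for t t' m
    using ten_add_l[OF Tw M, of t t' m] that by (simp add: Gs Tr_def)
  have tar: "ten S Tr M t (m +[M] m') = ten S Tr M t m +[G] ten S Tr M t m'" if "t el T" "m el M" "m' el M" for t m m'
    using ten_add_r[OF Tw M, of t m m'] that by (simp add: Gs Tr_def)
  have tb: "ten S Tr M (s t) m = ten S Tr M t (s .[M] m)" if "t el T" "s : mod_hom R T T" "m el M" for t m s
    using ten_balanced[OF Tw M, of s t m] that by (simp add: S_def Tr_def)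
  have ts: "r .[G] ten S Tr M t m = ten S Tr M (r .[T] t) m" if "t el T" "r el R" "m el M" for t m r
    using tensor_mod_smult_ten[OF b M that(2), of t m] that by (simp add: G_def Tr_def)
  have tl: "(\<lambda>x\<in>carrier P. ten S Tr M (f x) m) : mod_hom R P G" if "f : mod_hom R P T" "m el M" for f m
    by (rule restrict_mod_hom, rule linI[OF P G])
      (use that lin_closed[OF fl[OF that(1)]] in "simp_all add: tc tal ts lin_simps[OF fl]")
  have "EX k. addm ?T (hg R P G) k &
    (ALL f:carrier ?H. ALL m:carrier M. k (ten S ?H M f m) = (\<lambda>x\<in>carrier P. ten S Tr M (f x) m))"
    by (rule ten_lift[OF Q M hg_ag[OF P G]])
      (use tl[unfolded S_def] tal[unfolded S_def] tar[unfolded S_def] tb[unfolded S_def] lin_closed[OF fl] in "auto simp: S_def fun_eq_iff compose_def")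
  then obtain k where k: "addm ?T (hg R P G) k"
    and kt: "!!f m. [| f : mod_hom R P T; m el M |] ==> k (ten S ?H M f m) = (\<lambda>x\<in>carrier P. ten S Tr M (f x) m)"
    by auto
  have "(ALL g:mod_hom R P G. EX z:carrier ?T. k z = g) &
    (ALL z:carrier ?T. ALL z':carrier ?T. k z = k z' --> z = z')" if a: "addr R (reg_mod R) P"
  proof -
    obtain n p q where r: "retr R (reg_mod R) P n p q" using a by (rule addrE)
    note p = retrD(3)[OF r] and q = retrD(4)[OF r]
    note rr = homr_retr_right[OF T r, folded S_def Tr_def]
    have pc: "p k x el R" if "k < n" "x el P" for k x using lin_closed[OF p that(2)] that by simp
    have q1: "q k 1[R] el P" if "k < n" for k using lin_closed[OF q[OF that]] ring_rules[OF R] by simp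
    let ?j = "%k t. \<lambda>x\<in>carrier P. p k x .[T] t"
    note jl = retrD(4)[OF rr]
    let ?J = "%k. tmp S M Tr ?H (?j k)"
    have Ja: "addm (tgr S Tr M) ?T (?J k)" if "k < n" for k by (rule tmp_addm[OF M jl[OF that]])
    let ?k = "%g. lsum ?T n (%k. ?J k (g (q k 1[R])))"
    have ev: "addm (hg R P G) (tgr S Tr M) (%g. g (q k 1[R]))" if "k < n" for k
      by (rule addmI[OF hg_ag[OF P G] tgr_ag[OF Tw M]])
        (use q1[OF that] lin_closed[OF mod_hom_lin[OF _ P G]] in "auto simp: Gs")
    have ka: "addm (hg R P G) ?T ?k"
      by (intro addm_lsum_maps hg_ag[OF P G] tgr_ag[OF Q M] addm_comp[OF ev Ja])
    \<comment> \<open>For a fixed argument \<open>x\<close> both sides are additive in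
      \<open>z\<close>, so pure tensors suffice.\<close>
    have jj: "k (?J i z) x = p i x .[G] z" if i: "i < n" and z: "z el (tgr S Tr M)" and x: "x el P" for i z x
    proof -
      have e: "addm (hg R P G) G (%g. g x)"
        by (rule addmI[OF hg_ag[OF P G] lmod_ag[OF G]]) (use x lin_closed[OF mod_hom_lin[OF _ P G]] in auto)
      have "addm (tgr S Tr M) G (%z. p i x .[G] z)"
        using smult_addm[OF G pc[OF i x]] unfolding G_def Tr_def addm_tensor_mod .
      from ten_eqI[OF Tw M addm_comp[OF addm_comp[OF Ja[OF i] k] e] this _ z] show ?thesis
      proof -
        assume *: "(!!t m. [| t el Tr; m el M |] ==>
          k (?J i (ten S Tr M t m)) x = p i x .[G] ten S Tr M t m) ==> k (?J i z) x = p i x .[G] z"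
        show ?thesis
        proof (rule *)
          fix t m assume tm: "t el Tr" "m el M"
          have "?j i t : mod_hom R P T" using lin_closed[OF jl[OF i] tm(1)] by simp
          then show "k (?J i (ten S Tr M t m)) x = p i x .[G] ten S Tr M t m"
            using tm x pc[OF i x] by (simp add: tmp_ten[OF M jl[OF i] tm] kt ts Tr_def[symmetric])
              (simp add: Tr_def ts[unfolded Tr_def])
        qed
      qed
    qed
    have kk: "k (?k g) = g" if g: "g : mod_hom R P G" for g
    proof -
      note gl = mod_hom_lin[OF g P G]
      have gq: "g (q k 1[R]) el (tgr S Tr M)" if "k < n" for k using lin_closed[OF gl q1[OF that]] by (simp add: Gs)
      note Jc = addm_simps(1)[OF Ja gq]
      have eq: "k (?k g) = lsum (hg R P G) n (%i. k (?J i (g (q i 1[R]))))" by (rule addm_lsum[OF k Jc])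
      show ?thesis
      proof (rule mod_hom_eqI[OF _ g])
        show "k (?k g) : mod_hom R P G" using addm_simps(1)[OF k addm_simps(1)[OF ka]] g by simp
        fix x assume x: "x el P"
        have "k (?k g) x = lsum G n (%i. p i x .[G] g (q i 1[R]))"
          unfolding eq lsum_hg[OF x] using jj[OF _ gq x] by simp
        also have "\<dots> = lsum G n (%i. g (q i (p i x)))"
        proof (rule lsum_cong[OF refl refl], unfold simp_implies_def)
          fix i assume i: "i < n"
          show "p i x .[G] g (q i 1[R]) = g (q i (p i x))"
            using lin_reg_eq[OF lin_comp[OF q[OF i] gl] pc[OF i x]] by simp
        qed
        also have "\<dots> = g (lsum P n (%i. q i (p i x)))"
          by (rule lin_lsum_apply[OF gl, symmetric]) (rule lin_closed[OF q lin_closed[OF p x]])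
        finally show "k (?k g) x = g x" using retrD(5)[OF r x] by simp
      qed
    qed
    have kk2: "?k (k z) = z" if z: "z el ?T" for z
    proof (rule ten_eqI[OF Q M addm_comp[OF k ka] addm_id[OF tgr_ag[OF Q M]] _ z])
      fix f m assume "f el ?H" and m: "m el M"
      then have f: "f : mod_hom R P T" by simp
      have fq: "f (q i 1[R]) el Tr" if "i < n" for i using lin_closed[OF fl[OF f] q1[OF that]] by (simp add: Tr_def)
      have "?k (k (ten S ?H M f m)) = lsum ?T n (%i. ten S ?H M (?j i (f (q i 1[R]))) m)"
        unfolding kt[OF f m] using q1 tmp_ten[OF M jl fq m] by simp
      also have "\<dots> = ten S ?H M (lsum ?H n (%i. ?j i (f (q i 1[R])))) m"
        by (rule addm_lsum[OF ten_addm_l[OF Q M m], symmetric]) (rule lin_closed[OF jl fq])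
      also have "lsum ?H n (%i. ?j i (f (q i 1[R]))) = f" using retrD(5)[OF rr] f by simp
      finally show "?k (k (ten S ?H M f m)) = ten S ?H M f m" .
    qed
    show ?thesis
    proof (intro conjI ballI impI)
      show "EX z:carrier ?T. k z = g" if "g : mod_hom R P G" for g
        using kk[OF that] addm_simps(1)[OF ka] that by (intro bexI[of _ "?k g"]) simp_all
      show "z = z'" if "z el ?T" "z' el ?T" "k z = k z'" for z z'
        using kk2[OF that(1)] kk2[OF that(2)] that(3) by metis
    qed
  qed
  then show ?thesis unfolding eval_iso_def hg_simps(1) by (intro exI[of _ k] conjI[OF k conjI] ballI impI kt)
qed

text \<open>The cocycles of \<open>Hom(P, T)\<close> in degree \<open>i\<close>, as a right module.
  In degree 0 they are the maps factoring through \<open>T\<close>, that is, the endomorphism ring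
  itself.\<close>

definition homcoc :: "'r ring => ('r, 't) module => (nat => ('r, 'p) module) => (nat => 'p => 'p) => nat => ('t => 't, 'p => 't) module"
  where "homcoc R T P d i = (homr R T (P i))\<lparr>carrier := {f : mod_hom R (P i) T. ALL x:carrier (P (Suc i)). f (d i x) = 0[T]}\<rparr>"

lemma is_functor_arr:
  "[| is_functor R C S D F; M : C; N : C; f : mod_hom R M N |] ==> arr F M N f : mod_hom S (obj F M) (obj F N)"
  by (simp add: is_functor_def)

lemma nat_isomorphicI:
  assumes F: "is_functor R C S D F"
    and h: "!!M. M : C ==> lin S (obj F M) (obj G M) (h M)"
    and inj: "!!M x. [| M : C; x el (obj F M); h M x = 0[obj G M] |] ==> x = 0[obj F M]"
    and surj: "!!M y. [| M : C; y el (obj G M) |] ==> EX x:carrier (obj F M). h M x = y"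
    and nat: "!!M N f x. [| M : C; N : C; f : mod_hom R M N; x el (obj F M) |]
      ==> h N (arr F M N f x) = arr G M N f (h M x)"
  shows "nat_isomorphic R C S F G"
  unfolding nat_isomorphic_def
proof (intro exI[of _ "%M. restrict (h M) (carrier (obj F M))"] conjI ballI)
  show "restrict (h M) (carrier (obj F M)) : mod_iso S (obj F M) (obj G M)" if "M : C" for M
    by (rule mod_isoI[OF h[OF that] inj[OF that] surj[OF that]])
  fix M N f x assume a: "M : C" "N : C" "f : mod_hom R M N" "x el (obj F M)"
  have "arr F M N f x el (obj F N)" using is_functor_arr[OF F a(1-3)] a(4) by (auto simp: mod_hom_def)
  then show "restrict (h N) (carrier (obj F N)) (arr F M N f x) = arr G M N f (restrict (h M) (carrier (obj F M)) x)"
    using nat[OF a] a by simp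
qed

lemma is_functor_id: "is_functor R C R C id_functor"
  by (simp add: is_functor_def id_functor_def)

lemma is_functor_comp:
  assumes F: "is_functor R C S D F" and G: "is_functor S D A E G"
  shows "is_functor R C A E (G \<circ>\<^sub>F F)"
  using F G unfolding is_functor_def comp_functor_def by simp

lemma KT_lmod: "M : KT S T ==> left_module S M" and KE_lmod: "N : KE R T ==> left_module R N"
  by (simp_all add: KT_def KE_def)

lemma KT_iff:
  "left_module (opp_ring S) (right_mod T) ==> M : KT S T \<longleftrightarrow> left_module S M & tor0 S (right_mod T) M"
  using Tor_trivial_iff[of S "right_mod T" M] by (auto simp: KT_def)

lemma KE_end_iff:
  assumes T: "left_module R T"
  shows "N : KE R (end_bimod T) \<longleftrightarrow> left_module R N & ext0 R T N"
  using ext0_addr[OF addr_left_mod_end(1)[OF T], of N] ext0_addr[OF addr_left_mod_end(2)[OF T], of N]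
    Ext_trivial_iff[OF left_mod_end[OF T], of N] by (auto simp: KE_def)

section \<open>The counit on modules with vanishing Ext, then the unit on modules with vanishing
  Tor\<close>

context
  fixes R :: "'r ring" and T :: "('r, 't) module"
begin

private abbreviation (input) "ES \<equiv> end_ring R T"
private abbreviation (input) "TE \<equiv> end_bimod T"
private abbreviation (input) "Tr \<equiv> right_mod (end_bimod T)"

context
  fixes C :: "nat => ('r, 'c) module" and e d
  assumes T: "left_module R T" and cor: "corres R T C e d"
begin

private lemmas D = corresD[OF cor]
private lemmas Cm = addr_lmod(2)[OF D(1)]
private lemmas tr_pres = homr_pres[OF T cor]

lemma cosyz_lmod: "left_module R (cosyz C d j)"
  unfolding cosyz_def by (rule img_lmod[OF D(3)])

lemma cosyz_incl: "lin R (cosyz C d j) (C (Suc j)) (%x. x)"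
  unfolding cosyz_def
  by (rule lin_sub_from[OF lin_id[OF Cm] cosyz_lmod[unfolded cosyz_def]]) (auto simp: lin_closed[OF D(3)])

lemma cosyz_proj: "lin R (C j) (cosyz C d j) (d j)"
  unfolding cosyz_def by (rule lin_sub_into[OF D(3) cosyz_lmod[unfolded cosyz_def]]) simp

lemma cosyz_ses: "ses R (cosyz C d j) (C (Suc j)) (cosyz C d (Suc j)) (%x. x) (d (Suc j))"
  unfolding ses_def using cosyz_incl cosyz_proj D(6)[of _ j] by (auto simp: cosyz_def)

text \<open>By the duality between add T and projective right modules, \<open>s\<close> is
  precomposition with an endomorphism of \<open>C (Suc m)\<close>. That \<open>s\<close> kills
  coboundaries puts the image of this endomorphism inside the cosyzygy; that \<open>s\<close> is
  compatible with \<open>d m\<close> makes it the identity there. So it is a projection onto the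
  cosyzygy.\<close>

lemma cosyz_addr:
  assumes s: "sct (opp_ring (end_ring R T)) (%j. homr R T (C j)) (%j g. compose (carrier (C j)) g (d j)) m"
  shows "addr R (C (Suc m)) (cosyz C d m)"
proof -
  let ?S = "Suc (Suc m)"
  let ?ES = "opp_ring (end_ring R T)" and ?C = "C (Suc m)"
  note [simp] = homr_simps[OF T]
  obtain s where s: "lin ?ES (homr R T ?C) (homr R T ?C) s"
    and sd: "!!g. g : mod_hom R (C ?S) T ==> s (compose (carrier ?C) g (d (Suc m))) = (\<lambda>x\<in>carrier ?C. 0[T])"
    and ds: "!!f. f : mod_hom R ?C T ==> compose (carrier (C m)) (s f) (d m) = compose (carrier (C m)) f (d m)"
    using s by (auto simp: sct_def)
  have sm: "s f : mod_hom R ?C T" if "f : mod_hom R ?C T" for f using lin_closed[OF s] that by simp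
  obtain n p q where r: "retr R T ?C n p q" using D(1) by (rule addrE)
  note p = retrD(3)[OF r] and q = retrD(4)[OF r]
  let ?p = "%k. restrict (p k) (carrier ?C)"
  have pm: "?p k : mod_hom R ?C T" if "k < n" for k by (rule restrict_mod_hom[OF p[OF that]])
  note sp = mod_hom_lin[OF sm[OF pm] Cm T]
  \<comment> \<open>The endomorphism dual to \<open>s\<close>: expand the identity of
    \<open>?C\<close> through its coordinates \<open>p k\<close> and apply \<open>s\<close> to each
    coordinate. Linearity over the endomorphism ring then gives \<open>fe\<close> for every
    \<open>f\<close>.\<close>
  let ?e = "%x. lsum ?C n (%k. q k (s (?p k) x))"
  have el: "lin R ?C ?C ?e" by (intro lin_lsum Cm lin_comp[OF sp q])
  have fe: "f (?e x) = s f x" if f: "f : mod_hom R ?C T" and x: "x el ?C" for f x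
  proof -
    note fl = mod_hom_lin[OF f Cm T]
    have b: "compose (carrier T) f (q k) : mod_hom R T T" if "k < n" for k
      using restrict_mod_hom[OF lin_comp[OF q[OF that] fl]] by (simp add: compose_def)
    have c: "compose (carrier ?C) (compose (carrier T) f (q k)) (p k) = compose (carrier T) f (q k) .[homr R T ?C] ?p k" for k
      by (auto simp: fun_eq_iff compose_def)
    have "f = lsum (homr R T ?C) n (%k. compose (carrier T) f (q k) .[homr R T ?C] ?p k)"
      using retrD(5)[OF homr_retr_end[OF T r], of f] f unfolding c by simp
    then have "s f = s (lsum (homr R T ?C) n (%k. compose (carrier T) f (q k) .[homr R T ?C] ?p k))" by (rule arg_cong)
    also have "\<dots> = lsum (homr R T ?C) n (%k. s (compose (carrier T) f (q k) .[homr R T ?C] ?p k))"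
      by (rule lin_lsum_apply[OF s]) (use lmod_simps(13)[OF homr_lmod[OF T Cm]] b pm in simp)
    also have "\<dots> = lsum (homr R T ?C) n (%k. compose (carrier T) f (q k) .[homr R T ?C] s (?p k))"
      using lin_smult[OF s] b pm by simp
    finally have "s f x = lsum T n (%k. f (q k (s (?p k) x)))"
      using x lin_closed[OF sp x] by (simp add: lsum_homr[OF T x] compose_def)
    also have "\<dots> = f (?e x)"
      by (rule lin_lsum_apply[OF fl, symmetric]) (rule lin_closed[OF q lin_closed[OF sp x]])
    finally show ?thesis by simp
  qed
  have into: "?e x el (cosyz C d m)" if x: "x el ?C" for x
  proof -
    \<comment> \<open>Maps to \<open>T\<close> separate the points of \<open>C ?S\<close>, because
      it lies in add T; so vanishing of all coordinates \<open>p' k\<close> is enough.\<close>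
    obtain n' p' q' where r': "retr R T (C ?S) n' p' q'" using D(1) by (rule addrE)
    note ex = lin_closed[OF el x]
    have "p' k (d (Suc m) (?e x)) = 0[T]" if k: "k < n'" for k
    proof -
      have g: "restrict (p' k) (carrier (C ?S)) : mod_hom R (C ?S) T"
        by (rule restrict_mod_hom[OF retrD(3)[OF r' k]])
      have "compose (carrier ?C) (restrict (p' k) (carrier (C ?S))) (d (Suc m)) : mod_hom R ?C T"
        using restrict_mod_hom[OF lin_comp[OF D(3) retrD(3)[OF r' k]]] lin_closed[OF D(3)]
        by (simp add: compose_def cong: restrict_cong)
      from fe[OF this x] show ?thesis using sd[OF g] x ex lin_closed[OF D(3) ex] by (simp add: compose_def)
    qed
    then have "d (Suc m) (?e x) = lsum (C ?S) n' (%k. 0[C ?S])"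
      using retrD(5)[OF r' lin_closed[OF D(3) ex]] lin_simps(3)[OF retrD(4)[OF r']] by simp
    then have "d (Suc m) (?e x) = 0[C ?S]" by (simp add: lsum_zero[OF lmod_ag[OF Cm]])
    then show ?thesis using D(6)[OF ex] by (simp add: cosyz_def)
  qed
  have idz: "?e x = x" if x: "x el (cosyz C d m)" for x
  proof -
    obtain y where y: "y el (C m)" "x = d m y" using x by (auto simp: cosyz_def)
    note xC = lin_closed[OF cosyz_incl x]
    have "s (?p k) x = ?p k x" if "k < n" for k
      using fun_cong[OF ds[OF pm[OF that]], of y] y by (simp add: compose_def)
    then have "?e x = lsum ?C n (%k. q k (p k x))" using xC by simp
    then show ?thesis using retrD(5)[OF r xC] by simp
  qed
  have "lin R ?C (cosyz C d m) ?e"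
    unfolding cosyz_def by (rule lin_sub_into[OF el cosyz_lmod[unfolded cosyz_def]]) (use into in "simp add: cosyz_def")
  then show ?thesis by (rule addr_retract[OF cosyz_incl]) (rule idz)
qed

context
  fixes N :: "('r, 'n) module" and m
  assumes s: "sct (opp_ring (end_ring R T)) (%j. homr R T (C j)) (%j g. compose (carrier (C j)) g (d j)) m"
    and N: "left_module R N" and eN: "ext0 R T N"
begin

text \<open>Dimension shifting from above: at \<open>max j m\<close> the cosyzygy is a summand of a
  module in add T, where Ext into \<open>N\<close> vanishes, and each short exact sequence passes
  the vanishing to the preceding cosyzygy.\<close>

lemma ext_cosyz: "ext0 R (cosyz C d j) N"
proof -
  have eC: "ext0 R (C j) N" for j by (rule ext0_addr[OF D(1) eN])
  have "ext0 R (cosyz C d (max j m)) N"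
    by (rule ext0_addr[OF cosyz_addr eC]) (rule sct_mono[OF _ tr_pres s], simp)
  then show ?thesis
    by (rule inc_induct[OF max.cobounded1]) (rule ext0_ses(1)[OF cosyz_ses eC])
qed

lemma cosyz_extend: "lin R (cosyz C d j) N t ==> EX u. lin R (C (Suc j)) N u & (ALL x:carrier (cosyz C d j). u x = t x)"
  by (rule ext0_ses(2)[OF cosyz_ses ext0_addr[OF D(1) eN] ext_cosyz])

text \<open>Exactness of \<open>Hom(C, N)\<close>: the map descends to the cosyzygy and extends from
  there, the obstruction being the first Ext of the next cosyzygy.\<close>

lemma cosyz_factor:
  assumes g: "lin R (C j) N g" and z: "!!x. [| x el (C j); d j x = 0[C (Suc j)] |] ==> g x = 0[N]"
  shows "EX g'. lin R (C (Suc j)) N g' & (ALL x:carrier (C j). g x = g' (d j x))"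
proof -
  have im: "d j ` carrier (C j) = carrier (cosyz C d j)" by (simp add: cosyz_def)
  have "g x = 0[N]" if "x el (C j)" "d j x = 0[cosyz C d j]" for x
    using that by (intro z) (simp_all add: cosyz_def)
  from lin_factor[OF cosyz_proj g im this] obtain t where t: "lin R (cosyz C d j) N t"
    "!!x. x el (C j) ==> t (d j x) = g x" by blast
  obtain u where u: "lin R (C (Suc j)) N u" "!!x. x el (cosyz C d j) ==> u x = t x"
    using cosyz_extend[OF t(1)] by auto
  have "g x = u (d j x)" if "x el (C j)" for x
    using u(2)[of "d j x"] t(2)[OF that] that by (simp add: cosyz_def)
  then show ?thesis using u(1) by blast
qed

text \<open>R embeds into \<open>C 0\<close> with cokernel \<open>cosyz C d 0\<close>, whose Ext
  into \<open>N\<close> vanishes, so the map from R given by \<open>y\<close> extends.\<close>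

lemma unit_extend:
  assumes y: "y el N"
  shows "EX g. lin R (C 0) N g & g (e 1[R]) = y"
proof -
  note R = lmod_ring[OF T]
  have "ses R (reg_mod R) (C 0) (cosyz C d 0) e (d 0)"
    unfolding ses_def using D(2,4,5) cosyz_proj[of 0] by (auto simp: cosyz_def)
  from ext0_ses(2)[OF this ext0_addr[OF D(1) eN] ext_cosyz lin_reg[OF N y]]
  obtain u where "lin R (C 0) N u" "!!r. r el R ==> u (e r) = r .[N] y" by auto
  then show ?thesis using y by (intro exI[of _ u]) (simp add: ring_rules[OF R] lmod_simps[OF N])
qed

private abbreviation (input) "H \<equiv> hom_mod R (end_bimod T) N"

text \<open>The modules \<open>Hom(C j, T)\<close> resolve the right module \<open>T\<close>, and
  tensoring them with \<open>Hom(T, N)\<close> gives \<open>Hom(C, N)\<close> by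
  \<open>hom_tensor_hom\<close>. That complex is exact in positive degrees, whence the vanishing of
  Tor. In degree 0 its homology is the tensor product of \<open>T\<close> with
  \<open>Hom(T, N)\<close> on one side and \<open>N\<close> on the other, and the counit is the
  comparison.\<close>

lemma tor_hom_and_counit:
  "tor0 ES Tr H"
  "addm (tgr ES Tr H) N c ==> (!!t f. [| t el T; f : mod_hom R T N |] ==> c (ten ES Tr H t f) = f t) ==>
    (ALL y:carrier N. EX z:carrier (tgr ES Tr H). c z = y) & (ALL z:carrier (tgr ES Tr H). c z = 0[N] --> z = 0[tgr ES Tr H])"
proof -
  let ?Q = "%j. homr R T (C j)" and ?dm = "%j g. compose (carrier (C j)) g (d j)"
  note Hm = hom_mod_lmod[OF T N] and Qm = homr_lmod[OF T Cm] and QD = presD[OF tr_pres]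
  note [simp] = homr_simps[OF T] hom_mod_simps[OF T, of N]
  obtain k where k0: "ALL j. eval_iso (addr R T (C j)) (tgr ES (?Q j) H) (hg R (C j) N) (mod_hom R (C j) T) (mod_hom R T N)
      (ten ES (?Q j) H) (%f h. compose (carrier (C j)) h f) (k j)"
    by (rule exE[OF choice[OF allI]]) (rule hom_tensor_hom[OF T Cm N])
  note K = eval_isoD[OF spec[OF k0] D(1), unfolded hg_simps]
  note k = K(1) and kt = K(2) and ks = K(3) and ki = K(4)
  have km: "k j z : mod_hom R (C j) N" if "z el (tgr ES (?Q j) H)" for j z
    using addm_simps(1)[OF k that] by simp
  note kl = mod_hom_lin[OF km Cm N]
  let ?D = "%j. tmp ES H (?Q (Suc j)) (?Q j) (?dm j)"
  note Da = tmp_addm[OF Hm QD(2)]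
  have nat: "k j (?D j z) = compose (carrier (C j)) (k (Suc j) z) (d j)" if z: "z el (tgr ES (?Q (Suc j)) H)" for j z
  proof -
    have pc: "addm (hg R (C (Suc j)) N) (hg R (C j) N) (%g. compose (carrier (C j)) g (d j))"
      by (rule addm_to_hg[OF hg_ag[OF Cm N] Cm N])
        (use restrict_mod_hom[OF lin_comp[OF D(3) mod_hom_lin[OF _ Cm N]]] lin_closed[OF D(3)] in "auto simp: compose_def")
    show ?thesis
    proof (rule ten_eqI[OF Qm Hm addm_comp[OF Da k] addm_comp[OF k pc] _ z])
    show "k j (?D j (ten ES (?Q (Suc j)) H f h)) = compose (carrier (C j)) (k (Suc j) (ten ES (?Q (Suc j)) H f h)) (d j)"
      if "f el (?Q (Suc j))" "h el H" for f h
      using that lin_closed[OF QD(2)] by (simp add: tmp_ten[OF Hm QD(2)] kt) (auto simp: fun_eq_iff compose_def lin_closed[OF D(3)])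
    qed
  qed
  \<comment> \<open>Translates \<open>cosyz_factor\<close> into the tensor complex; both the
    vanishing of Tor and the injectivity of the counit rest on it.\<close>
  have lift: "EX w:carrier (tgr ES (?Q (Suc j)) H). ?D j w = z"
    if z: "z el (tgr ES (?Q j) H)" and v: "!!x. [| x el (C j); d j x = 0[C (Suc j)] |] ==> k j z x = 0[N]" for j z
  proof -
    obtain g where g: "lin R (C (Suc j)) N g" "!!x. x el (C j) ==> k j z x = g (d j x)"
      using cosyz_factor[OF kl[OF z] v] by auto
    obtain w where w: "w el (tgr ES (?Q (Suc j)) H)" "k (Suc j) w = restrict g (carrier (C (Suc j)))"
      using ks[OF restrict_mod_hom[OF g(1)]] by blast
    have "k j (?D j w) = k j z"
      unfolding nat[OF w(1)] w(2) using g(2) mod_hom_arb[OF km[OF z]] lin_closed[OF D(3)] by (auto simp: fun_eq_iff compose_def)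
    then show ?thesis using ki[OF addm_simps(1)[OF Da w(1)] z] w(1) by blast
  qed
  have "torv ES ?Q ?dm H"
    unfolding torv_def
  proof (intro allI ballI impI)
    fix i z assume z: "z el (tgr ES (?Q (Suc i)) H)" and dz: "?D i z = 0[tgr ES (?Q i) H]"
    have "compose (carrier (C i)) (k (Suc i) z) (d i) = (\<lambda>x\<in>carrier (C i). 0[N])"
      using nat[OF z] addm_simps(3)[OF k[of i]] unfolding dz by simp
    then have "k (Suc i) z (d i y) = 0[N]" if "y el (C i)" for y
      using that by (auto simp: compose_def fun_eq_iff dest: spec[of _ y])
    then show "EX w:carrier (tgr ES (?Q (Suc (Suc i))) H). ?D (Suc i) w = z"
      using D(6)[of _ i] by (intro lift[OF z]) auto
  qed
  then show "tor0 ES Tr H" by (rule torv_tor0[OF Hm tr_pres])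
  assume c: "addm (tgr ES Tr H) N c" and ct: "!!t f. [| t el T; f : mod_hom R T N |] ==> c (ten ES Tr H t f) = f t"
  let ?e = "tmp ES H (?Q 0) Tr (%g. g (e 1[R]))"
  note ea = tmp_addm[OF Hm QD(3)]
  have e1: "e 1[R] el (C 0)" using lin_closed[OF D(2)] ring_rules[OF lmod_ring[OF T]] by simp
  \<comment> \<open>Under \<open>k 0\<close> the augmentation followed by the counit is evaluation
    at \<open>e\<close> of 1. Surjectivity and injectivity of the counit are read off from
    this.\<close>
  have ce: "c (?e z) = k 0 z (e 1[R])" if z: "z el (tgr ES (?Q 0) H)" for z
  proof -
    have ev: "addm (hg R (C 0) N) N (%g. g (e 1[R]))"
      by (rule addmI[OF hg_ag[OF Cm N] lmod_ag[OF N]]) (use e1 lin_closed[OF mod_hom_lin[OF _ Cm N]] in auto)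
    show ?thesis
    proof (rule ten_eqI[OF Qm Hm addm_comp[OF ea c] addm_comp[OF k ev] _ z])
    show "c (?e (ten ES (?Q 0) H f h)) = k 0 (ten ES (?Q 0) H f h) (e 1[R])"
      if "f el (?Q 0)" "h el H" for f h
      using that e1 lin_closed[OF mod_hom_lin[OF _ Cm T] e1] by (simp add: tmp_ten[OF Hm QD(3)] ct kt compose_def)
    qed
  qed
  show "(ALL y:carrier N. EX z:carrier (tgr ES Tr H). c z = y) & (ALL z:carrier (tgr ES Tr H). c z = 0[N] --> z = 0[tgr ES Tr H])"
  proof (intro conjI ballI impI)
    fix y assume "y el N"
    then obtain g where g: "lin R (C 0) N g" "g (e 1[R]) = y" using unit_extend by blast
    obtain w where w: "w el (tgr ES (?Q 0) H)" "k 0 w = restrict g (carrier (C 0))"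
      using ks[OF restrict_mod_hom[OF g(1)]] by blast
    show "EX z:carrier (tgr ES Tr H). c z = y"
      using ce[OF w(1)] w(2) g(2) e1 addm_simps(1)[OF ea w(1)] by (intro bexI[of _ "?e w"]) simp_all
  next
    fix z assume z: "z el (tgr ES Tr H)" and cz: "c z = 0[N]"
    obtain w where w: "w el (tgr ES (?Q 0) H)" "?e w = z" using tmp_surj[OF Hm QD(3,4) z] by blast
    have k1: "k 0 w (e 1[R]) = 0[N]" using ce[OF w(1)] w(2) cz by simp
    have "k 0 w x = 0[N]" if x: "x el (C 0)" "d 0 x = 0[C (Suc 0)]" for x
    proof -
      obtain r where r: "r el R" "x = e r" using D(5)[of x] x by auto
      then show ?thesis using lin_reg_eq[OF lin_comp[OF D(2) kl[OF w(1)]] r(1)] k1 lmod_simps[OF N] by simp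
    qed
    then obtain v where v: "v el (tgr ES (?Q (Suc 0)) H)" "?D 0 v = w" using lift[OF w(1)] by blast
    have "z = tmp ES H (?Q (Suc 0)) Tr (%g. ?dm 0 g (e 1[R])) v"
      using tmp_comp[OF Hm QD(2) QD(3) v(1)] v(2) w(2) by simp
    also have "\<dots> = 0[tgr ES Tr H]"
      by (rule tmp_zero[OF Hm Qm right_mod_end[OF T] QD(7) v(1)])
    finally show "z = 0[tgr ES Tr H]" .
  qed
qed

end

end

context
  fixes P :: "nat => ('r, 'p) module" and d eP n
    and M :: "('t => 't, 'm) module"
  assumes T: "left_module R T" and P: "pres R T P d eP" and fg: "!!i. addr R (reg_mod R) (P i)"
    and eT: "ext0 R T T" and s: "sct R P d n" and M: "left_module (end_ring R T) M"
    and tM: "tor0 (end_ring R T) (right_mod (end_bimod T)) M"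
begin

private abbreviation (input) "Sop \<equiv> opp_ring (end_ring R T)"
private abbreviation (input) "G \<equiv> tensor_mod (end_ring R T) (end_bimod T) M"
private abbreviation (input) "Q i \<equiv> homr R T (P i)"
private abbreviation (input) "L i \<equiv> homcoc R T P d i"
private abbreviation (input) "dm i \<equiv> %g. compose (carrier (P (Suc i))) g (d i)"

private lemmas PD = presD[OF P]
private lemmas Pm = pres_lmod[OF P]
private lemmas Qm = homr_lmod[OF T Pm]
private lemmas Gm = tensor_mod_lmod[OF bimod_end[OF T] M]

lemma homcoc_lmod: "left_module Sop (L i)"
  unfolding homcoc_def
proof (rule submod_lmod[OF Qm])
  note q = lmod_simps[OF Qm[of i], unfolded homr_simps[OF T]] and [simp] = homr_simps[OF T] lmod_simps[OF T]
  show "{f : mod_hom R (P i) T. ALL x:carrier (P (Suc i)). f (d i x) = 0[T]} \<subseteq> carrier (Q i)" by auto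
  show "0[Q i] : {f : mod_hom R (P i) T. ALL x:carrier (P (Suc i)). f (d i x) = 0[T]}"
    using q(1) lin_closed[OF PD(2)] by simp
  show "f +[Q i] g : {f : mod_hom R (P i) T. ALL x:carrier (P (Suc i)). f (d i x) = 0[T]}"
    if "f : {f : mod_hom R (P i) T. ALL x:carrier (P (Suc i)). f (d i x) = 0[T]}"
      "g : {f : mod_hom R (P i) T. ALL x:carrier (P (Suc i)). f (d i x) = 0[T]}" for f g
    using that q(2)[of f g] lin_closed[OF PD(2)] by simp
  show "r .[Q i] f : {f : mod_hom R (P i) T. ALL x:carrier (P (Suc i)). f (d i x) = 0[T]}"
    if "r el Sop" "f : {f : mod_hom R (P i) T. ALL x:carrier (P (Suc i)). f (d i x) = 0[T]}" for r f
    using that q(13)[of r f] lin_closed[OF PD(2)] lin_simps(3)[OF end_lin[OF T]] by (simp add: compose_def)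
qed

lemma homcoc_iff: "f el (L i) \<longleftrightarrow> f : mod_hom R (P i) T & (ALL x:carrier (P (Suc i)). f (d i x) = 0[T])"
  by (simp add: homcoc_def)

lemma homcoc_incl: "lin Sop (L i) (Q i) (%f. f)"
  unfolding homcoc_def by (rule lin_sub_from[OF lin_id[OF Qm] homcoc_lmod[unfolded homcoc_def]]) (auto simp: homr_simps[OF T])

lemma homcoc_zero: "0[L i] = 0[Q i]"
  by (simp add: homcoc_def)

lemma dm_closed: "f : mod_hom R (P i) T ==> dm i f el (L (Suc i))"
  using restrict_mod_hom[OF lin_comp[OF PD(2) mod_hom_lin[OF _ Pm T]]] lin_closed[OF PD(2)] PD(8)
    lin_simps(3)[OF mod_hom_lin[OF _ Pm T]] by (simp add: homcoc_iff compose_def)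

lemma dm_lin: "lin Sop (Q i) (L (Suc i)) (dm i)"
  unfolding homcoc_def
  by (rule lin_sub_into[OF homr_map[OF T PD(2)] homcoc_lmod[unfolded homcoc_def]])
    (use dm_closed in "simp add: homcoc_def homr_simps[OF T]")

text \<open>Vanishing of the higher Ext of \<open>T\<close> with itself says that each cocycle in
  positive degree is a coboundary, which is surjectivity on the right.\<close>

lemma homcoc_ses: "ses Sop (L i) (Q i) (L (Suc i)) (%f. f) (dm i)"
proof -
  have v: "extv R P d T" by (rule ext0_extv[OF P eT])
  have "f : dm i ` carrier (Q i)" if f: "f el (L (Suc i))" for f
  proof -
    have fm: "f : mod_hom R (P (Suc i)) T" and z: "!!x. x el (P (Suc (Suc i))) ==> f (d (Suc i) x) = 0[T]"
      using f by (auto simp: homcoc_iff)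
    obtain b where b: "lin R (P i) T b" "!!x. x el (P (Suc i)) ==> f x = b (d i x)"
      by (rule extvD[OF v mod_hom_lin[OF fm Pm T]]) (rule z, assumption, rule that)
    have "f = dm i (restrict b (carrier (P i)))"
      using b(2) mod_hom_arb[OF fm] lin_closed[OF PD(2)] by (auto simp: fun_eq_iff compose_def)
    then show ?thesis using restrict_mod_hom[OF b(1)] by (auto simp: homr_simps[OF T])
  qed
  moreover have "dm i f = 0[L (Suc i)] \<longleftrightarrow> f : (%f. f) ` carrier (L i)" if "f el (Q i)" for f
    using that by (auto simp: homcoc_iff homcoc_zero homr_simps[OF T] compose_def fun_eq_iff)
  ultimately show ?thesis
    unfolding ses_def using homcoc_incl dm_lin dm_closed homcoc_zero by (auto simp: homr_simps[OF T])
qed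

lemma homr_tor: "tor0 ES (Q i) M"
  by (rule tor0_addr[OF M homr_addr_right[OF T fg] tM])

text \<open>Precomposition with \<open>s\<close> is a projection onto the cocycles:
  \<open>s x\<close> minus \<open>x\<close> is killed by \<open>d j\<close>, hence a boundary, and a
  cocycle vanishes on boundaries.\<close>

lemma homcoc_addr:
  assumes "sct R P d j"
  shows "addr Sop (Q (Suc j)) (L (Suc j))"
proof -
  let ?S = "Suc j"
  obtain s where s: "lin R (P ?S) (P ?S) s"
    and sd: "!!x. x el (P (Suc ?S)) ==> s (d ?S x) = 0[P ?S]"
    and ds: "!!x. x el (P ?S) ==> d j (s x) = d j x" using assms by (auto simp: sct_def)
  note [simp] = homr_simps[OF T] lmod_simps[OF Pm]
  have into: "compose (carrier (P ?S)) f s el (L ?S)" if f: "f : mod_hom R (P ?S) T" for f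
    using restrict_mod_hom[OF lin_comp[OF s mod_hom_lin[OF f Pm T]]] lin_simps(3)[OF mod_hom_lin[OF f Pm T]] sd lin_closed[OF PD(2)]
    by (simp add: homcoc_iff compose_def)
  have l: "lin Sop (Q ?S) (L ?S) (%f. compose (carrier (P ?S)) f s)"
    unfolding homcoc_def
    by (rule lin_sub_into[OF homr_map[OF T s] homcoc_lmod[unfolded homcoc_def]]) (use into in "simp add: homcoc_def")
  show ?thesis
  proof (rule addr_retract[OF homcoc_incl l])
    fix f assume "f el (L ?S)"
    then have f: "f : mod_hom R (P ?S) T" and z: "!!x. x el (P (Suc ?S)) ==> f (d ?S x) = 0[T]"
      by (auto simp: homcoc_iff)
    note fl = mod_hom_lin[OF f Pm T]
    have "f (s x) = f x" if x: "x el (P ?S)" for x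
    proof -
      note sx = lin_closed[OF s x]
      have "s x +[P ?S] -[P ?S] x : d ?S ` carrier (P (Suc ?S))"
        using x sx ds[OF x] lin_closed[OF PD(2) x] by (intro PD(6)) (simp_all add: lin_simps[OF PD(2)])
      then have "f (s x +[P ?S] -[P ?S] x) = 0[T]" using z by auto
      then show ?thesis using x sx lin_closed[OF fl] ag_cancel[OF lmod_ag[OF T]] by (simp add: lin_simps[OF fl])
    qed
    then show "compose (carrier (P ?S)) f s = f" using mod_hom_arb[OF f] by (auto simp: fun_eq_iff compose_def)
  qed
qed

text \<open>Descending induction. In a degree beyond \<open>n\<close> the cocycles are a summand of
  a term in add T; the short exact sequences carry the vanishing of Tor down.\<close>

lemma homcoc_tor: "tor0 ES (L i) M"
proof -
  have b: "tor0 ES (L (Suc (max i n))) M"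
    by (rule tor0_addr[OF M homcoc_addr homr_tor]) (rule sct_mono[OF _ P s], simp)
  have l: "i <= Suc (max i n)" by simp
  show ?thesis by (rule inc_induct[OF l, of "%i. tor0 ES (L i) M", OF b]) (rule tor0_ses(1)[OF M homcoc_ses homr_tor])
qed

lemma homcoc_inj: "[| z el (tgr ES (L i) M); tmp ES M (L i) (Q i) (%f. f) z = 0[tgr ES (Q i) M] |] ==> z = 0[tgr ES (L i) M]"
  by (rule tor0_ses(2)[OF M homcoc_ses homr_tor homcoc_tor])

text \<open>Tensoring preserves exactness of \<open>Hom(P, T)\<close>: each differential factors
  through the next module of cocycles, whose inclusion stays injective by the vanishing of Tor, and
  right exactness handles the remaining surjection.\<close>

lemma homcoc_exact:
  assumes z: "z el (tgr ES (Q i) M)" and dz: "tmp ES M (Q i) (Q (Suc i)) (dm i) z = 0[tgr ES (Q (Suc i)) M]"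
  shows "EX y:carrier (tgr ES (L i) M). tmp ES M (L i) (Q i) (%f. f) y = z"
proof -
  have "tmp ES M (L (Suc i)) (Q (Suc i)) (%f. f) (tmp ES M (Q i) (L (Suc i)) (dm i) z) = 0[tgr ES (Q (Suc i)) M]"
    using tmp_comp[OF M dm_lin homcoc_incl z] dz by simp
  then have "tmp ES M (Q i) (L (Suc i)) (dm i) z = 0[tgr ES (L (Suc i)) M]"
    by (rule homcoc_inj[OF addm_simps(1)[OF tmp_addm[OF M dm_lin] z]])
  then show ?thesis
    using homcoc_ses[of i] z lin_closed[OF homcoc_incl[of i]] by (intro tmp_exact[OF M homcoc_incl dm_lin]) (auto simp: ses_def)
qed

text \<open>The tensor product of \<open>Hom(P, T)\<close> with \<open>M\<close> is the complex
  \<open>Hom(P, G)\<close>, whose cohomology is Ext of \<open>T\<close> into \<open>G\<close>. It is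
  exact in positive degrees, and its cocycles in degree 0 are \<open>Hom(T, G)\<close> on one side
  and the endomorphism ring tensored with \<open>M\<close>, that is \<open>M\<close>, on the
  other.\<close>

lemma ext_tensor_and_unit:
  shows "ext0 R T G"
    and "!!m. [| m el M; !!t. t el T ==> ten ES Tr M t m = 0[G] |] ==> m = 0[M]"
    and "!!g. lin R T G g ==> EX m:carrier M. ALL t:carrier T. g t = ten ES Tr M t m"
proof -
  note [simp] = homr_simps[OF T]
  obtain k where k0: "ALL i. eval_iso (addr R (reg_mod R) (P i)) (tgr ES (Q i) M) (hg R (P i) G) (mod_hom R (P i) T) (carrier M)
      (ten ES (Q i) M) (%f m. \<lambda>x\<in>carrier (P i). ten ES Tr M (f x) m) (k i)"
    by (rule exE[OF choice[OF allI]]) (rule homr_tensor[OF T Pm M])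
  note K = eval_isoD[OF spec[OF k0] fg, unfolded hg_simps]
  note k = K(1) and kt = K(2) and ks = K(3) and ki = K(4)
  have km: "k i z : mod_hom R (P i) G" if "z el (tgr ES (Q i) M)" for i z
    using addm_simps(1)[OF k that] by simp
  let ?D = "%i. tmp ES M (Q i) (Q (Suc i)) (dm i)"
  note Dl = homr_map[OF T PD(2)]
  note Da = tmp_addm[OF M Dl]
  have nat: "k (Suc i) (?D i z) = compose (carrier (P (Suc i))) (k i z) (d i)" if z: "z el (tgr ES (Q i) M)" for i z
  proof -
    have pc: "addm (hg R (P i) G) (hg R (P (Suc i)) G) (%g. compose (carrier (P (Suc i))) g (d i))"
      by (rule addm_to_hg[OF hg_ag[OF Pm Gm] Pm Gm])
        (use restrict_mod_hom[OF lin_comp[OF PD(2) mod_hom_lin[OF _ Pm Gm]]] lin_closed[OF PD(2)] in "auto simp: compose_def")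
    show ?thesis
    proof (rule ten_eqI[OF Qm M addm_comp[OF Da k] addm_comp[OF k pc] _ z])
      show "k (Suc i) (?D i (ten ES (Q i) M f m)) = compose (carrier (P (Suc i))) (k i (ten ES (Q i) M f m)) (d i)"
        if "f el (Q i)" "m el M" for f m
        using that lin_closed[OF Dl] by (simp add: tmp_ten[OF M Dl] kt) (auto simp: fun_eq_iff compose_def lin_closed[OF PD(2)])
    qed
  qed
  have cyc: "EX y:carrier (tgr ES (L i) M). tmp ES M (L i) (Q i) (%f. f) y = z"
    if z: "z el (tgr ES (Q i) M)" and c: "!!x. x el (P (Suc i)) ==> k i z (d i x) = 0[G]" for i z
  proof (rule homcoc_exact[OF z], rule ki)
    show "k (Suc i) (?D i z) = k (Suc i) 0[tgr ES (Q (Suc i)) M]"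
      unfolding nat[OF z] addm_simps(3)[OF k] using c by (auto simp: compose_def fun_eq_iff)
  qed (use addm_simps(1)[OF Da z] ag_simps(1)[OF tgr_ag[OF Qm M]] in simp_all)
  have "extv R P d G"
    unfolding extv_def
  proof (intro allI impI, elim conjE)
    fix i c assume c: "lin R (P (Suc i)) G c" "ALL x:carrier (P (Suc (Suc i))). c (d (Suc i) x) = 0[G]"
    obtain z where z: "z el (tgr ES (Q (Suc i)) M)" "k (Suc i) z = restrict c (carrier (P (Suc i)))"
      using ks[OF restrict_mod_hom[OF c(1)]] by blast
    obtain y where y: "y el (tgr ES (L (Suc i)) M)" "tmp ES M (L (Suc i)) (Q (Suc i)) (%f. f) y = z"
      using cyc[OF z(1)] z(2) c(2) lin_closed[OF PD(2)] by auto
    obtain w where w: "w el (tgr ES (Q i) M)" "tmp ES M (Q i) (L (Suc i)) (dm i) w = y"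
      using tmp_surj[OF M dm_lin _ y(1)] homcoc_ses[of i] by (auto simp: ses_def)
    have "?D i w = z" using tmp_comp[OF M dm_lin homcoc_incl w(1)] w(2) y(2) by simp
    then have "compose (carrier (P (Suc i))) (k i w) (d i) = restrict c (carrier (P (Suc i)))"
      using nat[OF w(1)] z(2) by simp
    then have "c x = k i w (d i x)" if "x el (P (Suc i))" for x
      using that by (auto simp: compose_def fun_eq_iff dest: spec[of _ x])
    then show "EX b. lin R (P i) G b & (ALL x:carrier (P (Suc i)). c x = b (d i x))"
      using mod_hom_lin[OF km[OF w(1)] Pm Gm] by blast
  qed
  then show "ext0 R T G" by (rule extv_ext0[OF P])
  \<comment> \<open>\<open>?E\<close> is the endomorphism ring as a right module over itself, and
    composing with the augmentation identifies it with the cocycles in degree 0.\<close>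
  let ?E = "homr R T T" and ?s = "%s. compose (carrier (P 0)) s eP"
  note Em = homr_lmod[OF T T]
  have sin: "?s s el (L 0)" if "s : mod_hom R T T" for s
    using restrict_mod_hom[OF lin_comp[OF PD(3) end_lin[OF T that]]] lin_closed[OF PD(2)[of 0]] PD(7) lin_simps(3)[OF end_lin[OF T that]]
    by (simp add: homcoc_iff compose_def)
  have sl: "lin Sop ?E (L 0) ?s"
    unfolding homcoc_def
    by (rule lin_sub_into[OF homr_map[OF T PD(3)] homcoc_lmod[unfolded homcoc_def]]) (use sin in "simp add: homcoc_def")
  have bij: "bij_betw ?s (carrier ?E) (carrier (L 0))"
    unfolding bij_betw_def
  proof (intro conjI inj_onI equalityI subsetI)
    fix s s' assume ss: "s el ?E" "s' el ?E" "?s s = ?s s'"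
    show "s = s'"
    proof (rule mod_hom_eqI)
      fix t assume "t el T"
      then obtain x where x: "x el (P 0)" "t = eP x" unfolding PD(4)[symmetric] by auto
      then show "s t = s' t" using fun_cong[OF ss(3), of x] by (simp add: compose_def)
    qed (use ss in simp_all)
  next
    fix f assume f: "f el (L 0)"
    then have fl: "lin R (P 0) T f" and fm: "f : mod_hom R (P 0) T" using mod_hom_lin[OF _ Pm T] by (auto simp: homcoc_iff)
    have z: "f x = 0[T]" if "x el (P 0)" "eP x = 0[T]" for x using PD(5)[OF that] f by (auto simp: homcoc_iff)
    obtain u where u: "lin R T T u" "!!x. x el (P 0) ==> u (eP x) = f x"
      using lin_factor[OF PD(3) fl PD(4) z] by blast
    have "f = ?s (restrict u (carrier T))"
      using u(2) mod_hom_arb[OF fm] lin_closed[OF PD(3)] by (auto simp: fun_eq_iff compose_def)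
    then show "f : ?s ` carrier ?E" using restrict_mod_hom[OF u(1)] by auto
  qed (use sin in auto)
  have one: "(\<lambda>t\<in>carrier T. t) : mod_hom R T T" by (rule restrict_mod_hom[OF lin_id[OF T]])
  let ?id = "\<lambda>t\<in>carrier T. t"
  have kone: "k 0 (tmp ES M (L 0) (Q 0) (%f. f) (ten ES (L 0) M (?s ?id) m)) = (\<lambda>x\<in>carrier (P 0). ten ES Tr M (eP x) m)"
    if m: "m el M" for m
  proof -
    have "?s ?id : mod_hom R (P 0) T" using sin[OF one] by (simp add: homcoc_iff)
    then show ?thesis using m lin_closed[OF PD(3)] by (simp add: tmp_ten[OF M homcoc_incl sin[OF one] m] kt)
      (auto simp: compose_def fun_eq_iff)
  qed
  show "m = 0[M]" if m: "m el M" and tz: "!!t. t el T ==> ten ES Tr M t m = 0[G]" for m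
  proof -
    let ?z = "ten ES (L 0) M (?s ?id) m"
    have zc: "?z el (tgr ES (L 0) M)" by (rule ten_closed[OF homcoc_lmod M sin[OF one] m])
    have "tmp ES M (L 0) (Q 0) (%f. f) ?z = 0[tgr ES (Q 0) M]"
      by (rule ki) (use addm_simps(1)[OF tmp_addm[OF M homcoc_incl] zc] ag_simps(1)[OF tgr_ag[OF Qm M]] tz lin_closed[OF PD(3)]
        in "auto simp: kone[OF m] addm_simps(3)[OF k] fun_eq_iff")
    then have z0: "?z = 0[tgr ES (L 0) M]" by (rule homcoc_inj[OF zc])
    \<comment> \<open>Passing back from cocycles to the endomorphism ring and letting it act on
      \<open>M\<close> recovers \<open>m\<close> from the tensor of the identity with
      \<open>m\<close>.\<close>
    let ?i = "inv_into (carrier ?E) ?s"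
    note il = lin_inv[OF sl bij]
    have i1: "?i (?s ?id) = ?id" using bij_betw_inv_into_left[OF bij, of "?id"] one by simp
    have "EX h. addm (tgr ES ?E M) M h & (ALL s:carrier ?E. ALL m:carrier M. h (ten ES ?E M s m) = s .[M] m)"
      by (rule ten_lift[OF Em M lmod_ag[OF M]])
        (use lmod_simps0[OF M] in "auto simp: lmod_simps0(4)[OF M, unfolded end_ring_simps, symmetric]")
    then obtain h where h: "addm (tgr ES ?E M) M h" "!!s m. [| s : mod_hom R T T; m el M |] ==> h (ten ES ?E M s m) = s .[M] m"
      by auto
    have "h (tmp ES M (L 0) ?E ?i ?z) = ?id .[M] m"
      using tmp_ten[OF M il sin[OF one] m] i1 h(2)[OF one m] by simp
    then have "h (tmp ES M (L 0) ?E ?i ?z) = m" using lmod_simps0(5)[OF M m] by simp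
    then show ?thesis unfolding z0 using addm_simps(3)[OF tmp_addm[OF M il]] addm_simps(3)[OF h(1)] by simp
  qed
  \<comment> \<open>The endomorphism ring tensored with \<open>M\<close> consists of tensors of the
    identity with elements of \<open>M\<close>, since any scalar moves to the right factor.\<close>
  have tone: "EX m:carrier M. y = ten ES ?E M ?id m" if y: "y el (tgr ES ?E M)" for y
  proof (rule ten_induct[OF Em M y])
    show "EX m:carrier M. 0[tgr ES ?E M] = ten ES ?E M ?id m"
      using addm_simps(3)[OF ten_addm_r[OF Em M, of "?id"]] one lmod_simps(1)[OF M] by (metis homr_simps(1)[OF T])
    show "EX m':carrier M. ten ES ?E M s m = ten ES ?E M ?id m'" if "s el ?E" "m el M" for s m
    proof -
      have "s .[?E] ?id = s" using that mod_hom_arb[of s R T T] by (auto simp: compose_def fun_eq_iff)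
      then show ?thesis using ten_balanced[OF Em M, of s ?id m] that one lmod_simps0(1)[OF M, of s m]
        by (intro bexI[of _ "s .[M] m"]) simp_all
    qed
    show "EX m:carrier M. u +[tgr ES ?E M] v = ten ES ?E M ?id m"
      if "EX m:carrier M. u = ten ES ?E M ?id m" "EX m:carrier M. v = ten ES ?E M ?id m" for u v
    proof -
      from that obtain m m' where mm: "m el M" "m' el M" "u = ten ES ?E M ?id m" "v = ten ES ?E M ?id m'" by auto
      then show ?thesis using ten_add_r[OF Em M, of ?id m m'] one lmod_simps(2)[OF M, of m m']
        by (intro bexI[of _ "m +[M] m'"]) simp_all
    qed
  qed
  show "EX m:carrier M. ALL t:carrier T. g t = ten ES Tr M t m" if g: "lin R T G g" for g
  proof -
    obtain z where z: "z el (tgr ES (Q 0) M)" "k 0 z = restrict (%x. g (eP x)) (carrier (P 0))"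
      using ks[OF restrict_mod_hom[OF lin_comp[OF PD(3) g]]] by blast
    obtain y where y: "y el (tgr ES (L 0) M)" "tmp ES M (L 0) (Q 0) (%f. f) y = z"
      using cyc[OF z(1)] z(2) lin_closed[OF PD(2)[of 0]] PD(7) lin_simps(3)[OF g] by auto
    obtain y' where y': "y' el (tgr ES ?E M)" "tmp ES M ?E (L 0) ?s y' = y"
      using tmp_surj[OF M sl _ y(1)] bij by (auto simp: bij_betw_def)
    obtain m where m: "m el M" "y' = ten ES ?E M ?id m" using tone[OF y'(1)] by auto
    have "y = ten ES (L 0) M (?s ?id) m" using y'(2) tmp_ten[OF M sl _ m(1), of "?id"] one m(2) by simp
    then have e: "restrict (%x. g (eP x)) (carrier (P 0)) = (\<lambda>x\<in>carrier (P 0). ten ES Tr M (eP x) m)"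
      using kone[OF m(1)] y(2) z(2) by simp
    have "g t = ten ES Tr M t m" if "t el T" for t
    proof -
      obtain x where x: "x el (P 0)" "t = eP x" using \<open>t el T\<close> unfolding PD(4)[symmetric] by auto
      then show ?thesis using fun_cong[OF e, of x] by simp
    qed
    then show ?thesis using m(1) by blast
  qed
qed

end

context
  assumes w: "wakamatsu_tilting R T" and pl: "finite_proj_dim R T"
    and pr: "finite_proj_dim (opp_ring (end_ring R T)) (right_mod (end_bimod T))"
begin

lemma wakamatsu_lmod: "left_module R T"
  using w by (simp add: wakamatsu_iff)

private lemmas Tw = wakamatsu_lmod
private lemmas b = bimod_end[OF Tw]

lemma KE_hom_counit:
  fixes N :: "('r, 'n) module"
  assumes N: "N : KE R TE"
  shows "hom_mod R TE N : KT ES TE"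
    and "EX h. lin R (tensor_mod ES TE (hom_mod R TE N)) N h &
      (ALL t:carrier T. ALL f:mod_hom R T N. h (ten ES Tr (hom_mod R TE N) t f) = f t) &
      (ALL x:carrier (tensor_mod ES TE (hom_mod R TE N)). h x = 0[N] --> x = 0[tensor_mod ES TE (hom_mod R TE N)]) &
      (ALL y:carrier N. EX x:carrier (tensor_mod ES TE (hom_mod R TE N)). h x = y)"
proof -
  let ?H = "hom_mod R TE N"
  have Nm: "left_module R N" and eN: "ext0 R T N" using N by (simp_all add: KE_end_iff[OF Tw])
  obtain C :: "nat => ('r, nat => 't) module" and e d where c: "corres R T C e d" using w unfolding wakamatsu_iff by blast
  obtain m where "sct (opp_ring ES) (std_res (opp_ring ES) Tr) (%i. std_bd (opp_ring ES)) m"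
    using pr unfolding finite_proj_dim_iff by blast
  \<comment> \<open>Finite projective dimension of the right module is known on its standard
    resolution; it is moved to the resolution that comes from the coresolution of R.\<close>
  note s = sct_transfer[OF std_pres[OF right_mod_end[OF Tw]] homr_pres[OF Tw c] addr_refl[OF right_mod_end[OF Tw]] this]
  note th = tor_hom_and_counit[OF Tw c s Nm eN] and H = hom_mod_lmod[OF Tw Nm]
  show "hom_mod R TE N : KT ES TE" using th(1) H by (simp add: KT_iff[OF right_mod_end[OF Tw]])
  note [simp] = hom_mod_simps[OF Tw]
  note fl = mod_hom_lin[OF _ Tw Nm]
  have "EX h. lin R (tensor_mod ES TE ?H) N h &
      (ALL t:carrier TE. ALL f:carrier ?H. h (ten ES Tr ?H t f) = f t)"
    by (rule tensor_mod_lift[OF b H Nm]) (auto simp: lin_simps[OF fl])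
  then obtain h where h: "lin R (tensor_mod ES TE ?H) N h"
    and ht: "!!t f. [| t el T; f : mod_hom R T N |] ==> h (ten ES Tr ?H t f) = f t" by auto
  have "addm (tgr ES Tr ?H) N h" using lin_addm[OF h] by (simp add: addm_tensor_mod)
  from th(2)[OF this ht] show "EX h. lin R (tensor_mod ES TE ?H) N h &
      (ALL t:carrier T. ALL f:mod_hom R T N. h (ten ES Tr ?H t f) = f t) &
      (ALL x:carrier (tensor_mod ES TE ?H). h x = 0[N] --> x = 0[tensor_mod ES TE ?H]) &
      (ALL y:carrier N. EX x:carrier (tensor_mod ES TE ?H). h x = y)"
    using h ht by (intro exI[of _ h]) (simp add: tensor_mod_simps)
qed

lemma KT_tensor_unit:
  fixes M :: "('t => 't, 'm) module"
  assumes M: "M : KT ES TE"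
  shows "tensor_mod ES TE M : KE R TE"
    and "!!m. [| m el M; !!t. t el T ==> ten ES Tr M t m = 0[tensor_mod ES TE M] |] ==> m = 0[M]"
    and "!!g. lin R T (tensor_mod ES TE M) g ==> EX m:carrier M. ALL t:carrier T. g t = ten ES Tr M t m"
proof -
  have Mm: "left_module ES M" and tM: "tor0 ES Tr M" using M by (simp_all add: KT_iff[OF right_mod_end[OF Tw]])
  obtain P :: "nat => ('r, nat => 'r) module" and d e where P: "pres R T P d e" and fg: "!!i. addr R (reg_mod R) (P i)"
    using w unfolding wakamatsu_iff by blast
  obtain n where "sct R (std_res R T) (%i. std_bd R) n" using pl unfolding finite_proj_dim_iff by blast
  note s = sct_transfer[OF std_pres[OF Tw] P addr_refl[OF Tw] this]
  have eT: "ext0 R T T" using w by (simp add: wakamatsu_iff)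
  note eu = ext_tensor_and_unit[OF Tw P fg eT s Mm tM]
  show "tensor_mod ES TE M : KE R TE" using eu(1) tensor_mod_lmod[OF b Mm] by (simp add: KE_end_iff[OF Tw])
  show "!!m. [| m el M; !!t. t el T ==> ten ES Tr M t m = 0[tensor_mod ES TE M] |] ==> m = 0[M]"
    "!!g. lin R T (tensor_mod ES TE M) g ==> EX m:carrier M. ALL t:carrier T. g t = ten ES Tr M t m"
    by (fact eu(2), fact eu(3))
qed

lemma BBM_functors:
  "is_functor ES (KT ES TE :: ('t => 't, 'm) module set) R (KE R TE) (tensor_functor ES TE)"
  "is_functor R (KE R TE :: ('r, 'n) module set) ES (KT ES TE) (hom_functor R TE)"
  subgoal by (rule tensor_is_functor[OF b KT_lmod KT_tensor_unit(1)])
  subgoal by (rule hom_is_functor[OF Tw KE_lmod KE_hom_counit(1)])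
  done

lemma BBM_unit: "nat_isomorphic ES (KT ES TE :: ('t => 't, 'm) module set) ES id_functor (hom_functor R TE \<circ>\<^sub>F tensor_functor ES TE)"
proof -
  let ?h = "%M m. \<lambda>t\<in>carrier T. ten ES Tr M t m"
  note [simp] = hom_mod_simps[OF Tw] and Tr = right_mod_end[OF Tw]
  have tm: "?h M m : mod_hom R T (tensor_mod ES TE M)" if "left_module ES M" "m el M" for M :: "('t => 't, 'm) module" and m
    using that ten_closed[OF Tr that(1)] ten_add_l[OF Tr that(1)] tensor_mod_smult_ten[OF b that(1)]
    by (intro restrict_mod_hom linI[OF Tw tensor_mod_lmod[OF b that(1)]]) (simp_all add: tensor_mod_simps)
  have l: "lin ES M (hom_mod R TE (tensor_mod ES TE M)) (?h M)" if M: "left_module ES M" for M :: "('t => 't, 'm) module"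
    by (rule linI[OF M hom_mod_lmod[OF Tw tensor_mod_lmod[OF b M]]])
      (use tm[OF M] ten_add_r[OF Tr M] ten_balanced[OF Tr M] lin_closed[OF end_lin[OF Tw]]
        in "auto simp: tensor_mod_simps fun_eq_iff compose_def")
  show ?thesis
  proof (rule nat_isomorphicI[OF is_functor_id, where h = ?h], unfold id_functor_def comp_functor_def mod_functor.simps tensor_functor_def hom_functor_def)
    fix M :: "('t => 't, 'm) module" assume M: "M : KT ES TE"
    note Mm = KT_lmod[OF M] and u = KT_tensor_unit[OF M]
    show "lin ES M (hom_mod R TE (tensor_mod ES TE M)) (?h M)" by (rule l[OF Mm])
    show "x = 0[M]" if x: "x el M" "?h M x = 0[hom_mod R TE (tensor_mod ES TE M)]" for x
    proof (rule u(2)[OF x(1)])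
      show "ten ES Tr M t x = 0[tensor_mod ES TE M]" if "t el T" for t using fun_cong[OF x(2), of t] that by simp
    qed
    show "EX x:carrier M. ?h M x = y" if "y el (hom_mod R TE (tensor_mod ES TE M))" for y
    proof -
      have y: "y : mod_hom R T (tensor_mod ES TE M)" using that by simp
      obtain m where "m el M" "ALL t:carrier T. y t = ten ES Tr M t m"
        using u(3)[OF mod_hom_lin[OF y Tw tensor_mod_lmod[OF b Mm]]] by blast
      then show ?thesis using mod_hom_arb[OF y] by (intro bexI[of _ m]) (auto simp: fun_eq_iff)
    qed
    fix N :: "('t => 't, 'm) module" and f x
    assume N: "N : KT ES TE" and f: "f : mod_hom ES M N" and x: "x el M"
    note fl = mod_hom_lin[OF f Mm KT_lmod[OF N]]
    show "?h N (f x) = (\<lambda>g\<in>mod_hom R TE (tensor_mod ES TE M). compose (carrier TE) (tensor_map ES Tr M Tr N (%t. t) f) g) (?h M x)"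
      using tm[OF Mm x] x tensor_map_addm(2)[OF lin_id[OF Tr] fl] by (simp add: mod_hom_end_bimod[OF Tw]) (auto simp: fun_eq_iff compose_def)
  qed
qed

lemma BBM_counit: "nat_isomorphic R (KE R TE :: ('r, 'n) module set) R (tensor_functor ES TE \<circ>\<^sub>F hom_functor R TE) id_functor"
proof -
  note [simp] = hom_mod_simps[OF Tw] and Tr = right_mod_end[OF Tw]
  have "ALL N:KE R TE. EX h. lin R (tensor_mod ES TE (hom_mod R TE N)) (N :: ('r, 'n) module) h &
      (ALL t:carrier T. ALL f:mod_hom R T N. h (ten ES Tr (hom_mod R TE N) t f) = f t) &
      (ALL x:carrier (tensor_mod ES TE (hom_mod R TE N)). h x = 0[N] --> x = 0[tensor_mod ES TE (hom_mod R TE N)]) &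
      (ALL y:carrier N. EX x:carrier (tensor_mod ES TE (hom_mod R TE N)). h x = y)"
    by (intro ballI KE_hom_counit(2))
  then obtain h where h: "ALL N:KE R TE. lin R (tensor_mod ES TE (hom_mod R TE N)) (N :: ('r, 'n) module) (h N) &
      (ALL t:carrier T. ALL f:mod_hom R T N. h N (ten ES Tr (hom_mod R TE N) t f) = f t) &
      (ALL x:carrier (tensor_mod ES TE (hom_mod R TE N)). h N x = 0[N] --> x = 0[tensor_mod ES TE (hom_mod R TE N)]) &
      (ALL y:carrier N. EX x:carrier (tensor_mod ES TE (hom_mod R TE N)). h N x = y)"
    by (rule bchoice[THEN exE])
  show ?thesis
  proof (rule nat_isomorphicI[OF is_functor_comp[OF BBM_functors(2) BBM_functors(1)], where h = h],
      unfold id_functor_def comp_functor_def mod_functor.simps tensor_functor_def)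
    fix M :: "('r, 'n) module" assume M: "M : KE R TE"
    let ?G = "%M. tensor_mod ES TE (obj (hom_functor R TE) M)"
    have ob: "obj (hom_functor R TE) M = hom_mod R TE M" for M :: "('r, 'n) module" by (simp add: hom_functor_def)
    show "lin R (?G M) M (h M)" "!!x. [| x el (?G M); h M x = 0[M] |] ==> x = 0[?G M]"
      "!!y. y el M ==> EX x:carrier (?G M). h M x = y"
      unfolding ob using h M by blast+
    fix N :: "('r, 'n) module" and f x
    assume N: "N : KE R TE" and f: "f : mod_hom R M N" and x: "x el (?G M)"
    note Mm = KE_lmod[OF M] and Nm = KE_lmod[OF N]
    note fl = mod_hom_lin[OF f Mm Nm]
    let ?H = "hom_mod R TE" and ?f = "arr (hom_functor R TE) M N f"
    have fh: "?f g = compose (carrier T) f g" if "g : mod_hom R T M" for g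
      using that by (simp add: hom_functor_def mod_hom_end_bimod[OF Tw])
    have "?f : mod_hom ES (?H M) (?H N)"
      using is_functor_arr[OF BBM_functors(2) M N f] by (simp add: ob)
    note Fl = mod_hom_lin[OF this hom_mod_lmod[OF Tw Mm] hom_mod_lmod[OF Tw Nm]]
    have hl: "lin R (tensor_mod ES TE (?H M)) M (h M)" "lin R (tensor_mod ES TE (?H N)) N (h N)" using h M N by blast+
    show "h N (tensor_map ES Tr (obj (hom_functor R TE) M) Tr (obj (hom_functor R TE) N) (%t. t) ?f x) = f (h M x)"
      unfolding ob
    proof (rule tensor_mod_eqI[OF b hom_mod_lmod[OF Tw Mm] lin_comp[OF tensor_mod_map[OF b Fl] hl(2)] lin_comp[OF hl(1) fl]])
      fix t g assume "t el TE" and "g el (?H M)"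
      then have t: "t el T" and g: "g : mod_hom R T M" by simp_all
      have "?f g : mod_hom R T N" using lin_closed[OF Fl] g by simp
      then show "h N (tensor_map ES Tr (?H M) Tr (?H N) (%t. t) ?f (ten ES Tr (?H M) t g)) = f (h M (ten ES Tr (?H M) t g))"
        using t g tensor_map_addm(2)[OF lin_id[OF Tr] Fl, of t g] h M N fh[OF g] by (simp add: compose_def)
    qed (use x ob in simp)
  qed
qed

end

end

section \<open>Transport along isomorphisms and change of the carrier type\<close>

lemma choice2: "ALL i. EX a b. P i a b ==> EX f g. ALL i. P i (f i) (g i)"
  by metis

definition lin_iso :: "'r ring => ('r, 'm) module => ('r, 'n) module => ('m => 'n) => ('n => 'm) => bool"
  where "lin_iso R M N f g \<longleftrightarrow> lin R M N f & lin R N M g & (ALL x:carrier M. g (f x) = x) & (ALL y:carrier N. f (g y) = y)"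

lemma lin_isoD:
  assumes "lin_iso R M N f g"
  shows "lin R M N f" "lin R N M g" "x el M ==> g (f x) = x" "y el N ==> f (g y) = y"
  using assms by (auto simp: lin_iso_def)

lemma lin_iso_zero: "[| lin_iso R M N f g; x el M |] ==> f x = 0[N] \<longleftrightarrow> x = 0[M]"
  unfolding lin_iso_def by (metis lin_simps(3))

lemma addr_lin_iso:
  assumes a: "addr R T M" and i: "lin_iso R M N f g"
  shows "addr R T N"
proof -
  note i = lin_isoD[OF i]
  obtain n p q where r: "retr R T M n p q" using a by (rule addrE)
  note p = retrD(3)[OF r] and q = retrD(4)[OF r]
  have "lsum N n (%k. f (q k (p k (g y)))) = y" if "y el N" for y
  proof -
    have "lsum N n (%k. f (q k (p k (g y)))) = f (lsum M n (%k. q k (p k (g y))))"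
      by (rule lin_lsum_apply[OF i(1), symmetric]) (rule lin_closed[OF q lin_closed[OF p lin_closed[OF i(2) that]]])
    then show ?thesis using retrD(5)[OF r lin_closed[OF i(2) that]] i(4)[OF that] by simp
  qed
  then have "retr R T N n (%k y. p k (g y)) (%k t. f (q k t))"
    unfolding retr_def using retrD(1)[OF r] lin_mod(2)[OF i(1)] lin_comp[OF i(2) p] lin_comp[OF q i(1)] by simp
  then show ?thesis unfolding addr_def by blast
qed

text \<open>The coordinates \<open>p k\<close> embed \<open>V\<close> into functions on the natural
  numbers, the type that \<open>wakamatsu_tilting\<close> prescribes; the \<open>q k\<close> recover
  the element.\<close>

lemma addr_small_copy:
  fixes M :: "('r, 'm) module" and V :: "('r, 'v) module"
  assumes a: "addr R M V"
  shows "EX (V' :: ('r, nat => 'm) module) f g. lin_iso R V V' f g"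
proof -
  obtain n p q where r: "retr R M V n p q" using a by (rule addrE)
  note M = retrD(1)[OF r] and V = retrD(2)[OF r] and p = retrD(3)[OF r] and q = retrD(4)[OF r]
  let ?C = "copies {..<n} M" and ?f = "%v k. if k < n then p k v else 0[M]" and ?g = "%w. lsum V n (%k. q k (w k))"
  note [simp] = lmod_simps[OF M]
  have f: "lin R V ?C ?f"
  proof (rule linI[OF V copies_lmod[OF M]])
    show "?f v el ?C" if v: "v el V" for v
    proof -
      have "finite {k. ?f v k ~= 0[M]}" by (rule finite_subset[of _ "{..<n}"]) auto
      then show ?thesis using lin_closed[OF p v] by (simp add: copies_carrier)
    qed
  qed (auto simp: fun_eq_iff lin_simps[OF p])
  have ev: "lin R ?C M (%w. w k)" for k
    by (rule linI[OF copies_lmod[OF M] M]) (simp_all add: copies_carrier)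
  have g: "lin R ?C V ?g" by (rule lin_lsum[OF copies_lmod[OF M] V lin_comp[OF ev q]])
  have gf: "?g (?f v) = v" if "v el V" for v using retrD(5)[OF r that] by simp
  let ?V = "?C\<lparr>carrier := ?f ` carrier V\<rparr>"
  have V': "left_module R ?V" by (rule img_lmod[OF f])
  have "lin R V ?V ?f" by (rule lin_sub_into[OF f V']) simp
  moreover have "lin R ?V V ?g" by (rule lin_sub_from[OF g V']) (use lin_closed[OF f] in auto)
  moreover have "?f (?g w) = w" if w: "w el ?V" for w
  proof -
    obtain v where v: "v el V" "w = ?f v" using w by auto
    show ?thesis unfolding v(2) gf[OF v(1)] ..
  qed
  ultimately have "lin_iso R V ?V ?f ?g" unfolding lin_iso_def using gf by blast
  then show ?thesis by blast
qed

lemma pres_lin_iso: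
  assumes P: "pres R V P d e" and i: "!!i. lin_iso R (P i) (P' i) (f i) (g i)" and pr: "!!i. projective R (P' i)"
  shows "pres R V P' (%i w. f i (d i (g (Suc i) w))) (%w. e (g 0 w))"
proof -
  note PD = presD[OF P] and I = lin_isoD[OF i]
  have im: "(%w. k (g j w)) ` carrier (P' j) = k ` carrier (P j)" for k :: "_ => 'z" and j
  proof (intro equalityI subsetI)
    show "z : k ` carrier (P j)" if "z : (%w. k (g j w)) ` carrier (P' j)" for z using that lin_closed[OF I(2)] by blast
    show "z : (%w. k (g j w)) ` carrier (P' j)" if zk: "z : k ` carrier (P j)" for z
    proof -
      obtain x where x: "x el (P j)" "z = k x" using zk by blast
      then show ?thesis using I(3)[OF x(1)] lin_closed[OF I(1) x(1)] by (intro image_eqI[of _ _ "f j x"]) simp_all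
    qed
  qed
  have ex: "w : (%w. f j (d j (g (Suc j) w))) ` carrier (P' (Suc j)) \<longleftrightarrow> g j w : d j ` carrier (P (Suc j))" if w: "w el (P' j)" for j w
  proof -
    have "w : (%x. f j (d j x)) ` carrier (P (Suc j)) \<longleftrightarrow> g j w : d j ` carrier (P (Suc j))"
    proof
      assume "w : (%x. f j (d j x)) ` carrier (P (Suc j))"
      then obtain x where "x el (P (Suc j))" "w = f j (d j x)" by blast
      then show "g j w : d j ` carrier (P (Suc j))" using I(3)[OF lin_closed[OF PD(2)]] by simp
    next
      assume "g j w : d j ` carrier (P (Suc j))"
      then obtain x where x: "x el (P (Suc j))" "g j w = d j x" by blast
      then show "w : (%x. f j (d j x)) ` carrier (P (Suc j))" using I(4)[OF w] by (intro image_eqI[of _ _ x]) simp_all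
    qed
    then show ?thesis using im[of "%x. f j (d j x)" "Suc j"] by simp
  qed
  have "f j (d j (g (Suc j) w)) = 0[P' j] \<longleftrightarrow> g (Suc j) w : d (Suc j) ` carrier (P (Suc (Suc j)))" if "w el (P' (Suc j))" for j w
    using lin_iso_zero[OF i lin_closed[OF PD(2) lin_closed[OF I(2) that]]] PD(6)[OF lin_closed[OF I(2) that]] PD(8)[of _ j] by auto
  moreover have "e (g 0 w) = 0[V] \<longleftrightarrow> g 0 w : d 0 ` carrier (P (Suc 0))" if "w el (P' 0)" for w
    using PD(5)[OF lin_closed[OF I(2) that]] PD(7) by auto
  ultimately show ?thesis
    unfolding pres_def using lin_comp[OF lin_comp[OF I(2) PD(2)] I(1)] lin_comp[OF I(2) PD(3)] im[of e 0] PD(4) pr ex by simp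
qed

lemma corres_lin_iso:
  assumes c: "corres R T C e d" and i: "!!i. lin_iso R (C i) (C' i) (f i) (g i)"
  shows "corres R T C' (%r. f 0 (e r)) (%j w. f (Suc j) (d j (g j w)))"
proof -
  note D = corresD[OF c] and I = lin_isoD[OF i]
  note R1 = ring_rules(13)[OF lmod_ring[OF lin_mod(1)[OF D(2)]]]
  note fd = lin_closed[OF D(3) lin_closed[OF I(2)]]
  have z: "f (Suc j) (d j (g j w)) = 0[C' (Suc j)] \<longleftrightarrow> d j (g j w) = 0[C (Suc j)]" if "w el (C' j)" for j w
    by (rule lin_iso_zero[OF i fd[OF that]])
  have im: "w : (%x. f j (k x)) ` K \<longleftrightarrow> g j w : k ` K" if "w el (C' j)" "!!x. x : K ==> k x el (C j)" for j w k and K :: "'z set"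
  proof
    assume "w : (%x. f j (k x)) ` K"
    then obtain x where "x : K" "w = f j (k x)" by blast
    then show "g j w : k ` K" using I(3)[OF that(2)] by simp
  next
    assume "g j w : k ` K"
    then obtain x where x: "x : K" "g j w = k x" by blast
    then show "w : (%x. f j (k x)) ` K" using I(4)[OF that(1)] by (intro image_eqI[of _ _ x]) simp_all
  qed
  have gi: "(%w. k (g j w)) ` carrier (C' j) = k ` carrier (C j)" for k :: "_ => 'z" and j
  proof (intro equalityI subsetI)
    show "z : k ` carrier (C j)" if "z : (%w. k (g j w)) ` carrier (C' j)" for z using that lin_closed[OF I(2)] by blast
    show "z : (%w. k (g j w)) ` carrier (C' j)" if zk: "z : k ` carrier (C j)" for z
    proof -
      obtain x where x: "x el (C j)" "z = k x" using zk by blast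
      then show ?thesis using I(3)[OF x(1)] lin_closed[OF I(1) x(1)] by (intro image_eqI[of _ _ "f j x"]) simp_all
    qed
  qed
  show ?thesis
    unfolding corres_def
  proof (intro conjI allI ballI impI; (elim conjE)?)
    show "addr R T (C' j)" for j by (rule addr_lin_iso[OF D(1) i])
    show "lin R (reg_mod R) (C' 0) (%r. f 0 (e r))" by (rule lin_comp[OF D(2) I(1)])
    show "lin R (C' j) (C' (Suc j)) (%w. f (Suc j) (d j (g j w)))" for j by (rule lin_comp[OF lin_comp[OF I(2) D(3)] I(1)])
    show "r = 0[R]" if "r el R" "f 0 (e r) = 0[C' 0]" for r
      using D(4)[OF that(1)] lin_iso_zero[OF i, of "e r" 0] lin_closed[OF D(2)] that by simp
    show "(f (Suc 0) (d 0 (g 0 w)) = 0[C' (Suc 0)]) = (w : (%r. f 0 (e r)) ` carrier R)" if "w el (C' 0)" for w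
      using z[OF that] D(5)[OF lin_closed[OF I(2) that]] im[OF that, of "carrier R" e] lin_closed[OF D(2)] by simp
    show "(f (Suc (Suc j)) (d (Suc j) (g (Suc j) w)) = 0[C' (Suc (Suc j))]) = (w : (%w. f (Suc j) (d j (g j w))) ` carrier (C' j))"
      if "w el (C' (Suc j))" for w j
      using z[OF that] D(6)[OF lin_closed[OF I(2) that]] im[OF that, of "carrier (C' j)" "%w. d j (g j w)"] fd gi[of "d j" j] by simp
    show "EX k. lin R (C' 0) T k & k (f 0 (e 1[R])) = t" if t: "t el T" for t
    proof -
      obtain k where "lin R (C 0) T k" "k (e 1[R]) = t" using D(7)[OF t] by blast
      then show ?thesis using lin_comp[OF I(2)] I(3)[of "e 1[R]" 0] lin_closed[OF D(2)] R1 by (intro exI[of _ "%w. k (g 0 w)"]) simp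
    qed
    show "EX k'. lin R (C' (Suc 0)) T k' & (ALL w:carrier (C' 0). k w = k' (f (Suc 0) (d 0 (g 0 w))))"
      if k: "lin R (C' 0) T k" "k (f 0 (e 1[R])) = 0[T]" for k
    proof -
      obtain k' where k': "lin R (C (Suc 0)) T k'" "!!x. x el (C 0) ==> k (f 0 x) = k' (d 0 x)"
        using D(8)[OF lin_comp[OF I(1) k(1)] k(2)] by auto
      have "k w = k' (g (Suc 0) (f (Suc 0) (d 0 (g 0 w))))" if "w el (C' 0)" for w
        using k'(2)[OF lin_closed[OF I(2) that]] I(4)[OF that] I(3)[OF fd[OF that]] by simp
      then show ?thesis using lin_comp[OF I(2) k'(1)] by blast
    qed
    show "EX k'. lin R (C' (Suc (Suc j))) T k' & (ALL w:carrier (C' (Suc j)). k w = k' (f (Suc (Suc j)) (d (Suc j) (g (Suc j) w))))"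
      if k: "lin R (C' (Suc j)) T k" "ALL w:carrier (C' j). k (f (Suc j) (d j (g j w))) = 0[T]" for k j
    proof -
      have "k (f (Suc j) (d j x)) = 0[T]" if "x el (C j)" for x
        using bspec[OF k(2) lin_closed[OF I(1) that]] I(3)[OF that] by simp
      from D(9)[OF lin_comp[OF I(1) k(1)] this]
      obtain k' where k': "lin R (C (Suc (Suc j))) T k'" "!!x. x el (C (Suc j)) ==> k (f (Suc j) x) = k' (d (Suc j) x)" by auto
      have "k w = k' (g (Suc (Suc j)) (f (Suc (Suc j)) (d (Suc j) (g (Suc j) w))))" if "w el (C' (Suc j))" for w
        using k'(2)[OF lin_closed[OF I(2) that]] I(4)[OF that] I(3)[OF fd[OF that]] by simp
      then show ?thesis using lin_comp[OF I(2) k'(1)] by blast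
    qed
  qed
qed

text \<open>Induced resolutions and coresolutions consist of tensor products, so their carriers have
  types other than those in \<open>wakamatsu_tilting\<close>. Copies in the prescribed types remove
  the discrepancy.\<close>

lemma wakamatsuI:
  fixes R :: "'r ring" and T :: "('r, 't) module" and P :: "nat => ('r, 'p) module" and C :: "nat => ('r, 'c) module"
  assumes P: "pres R T P dP eP" and fg: "!!i. addr R (reg_mod R) (P i)" and ex: "ext0 R T T" and C: "corres R T C eC dC"
  shows "wakamatsu_tilting R T"
proof -
  have "ALL i. EX V :: ('r, nat => 'r) module. EX fg. lin_iso R (P i) V (fst fg) (snd fg)"
    using addr_small_copy[OF fg] by (metis fst_conv snd_conv)
  then obtain V :: "nat => ('r, nat => 'r) module" and f where f: "ALL i. lin_iso R (P i) (V i) (fst (f i)) (snd (f i))"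
    by (elim choice2[THEN exE] exE)
  have Va: "addr R (reg_mod R) (V i)" for i by (rule addr_lin_iso[OF fg spec[OF f]])
  note V = pres_lin_iso[OF P spec[OF f] addr_reg_proj[OF Va]]
  have "ALL i. EX V :: ('r, nat => 't) module. EX fg. lin_iso R (C i) V (fst fg) (snd fg)"
    using addr_small_copy[OF corresD(1)[OF C]] by (metis fst_conv snd_conv)
  then obtain W :: "nat => ('r, nat => 't) module" and g where g: "ALL i. lin_iso R (C i) (W i) (fst (g i)) (snd (g i))"
    by (elim choice2[THEN exE] exE)
  note W = corres_lin_iso[OF C spec[OF g]]
  show ?thesis unfolding wakamatsu_iff using V Va ex W lin_mod(2)[OF presD(3)[OF P]] by blast
qed

section \<open>Frobenius systems and induced modules\<close>

lemma lsum_simps [simp]: "lsum (res \<phi> M) n f = lsum M n f" "lsum (reg_mod R) n g = lsum R n g"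
    "lsum (opp_ring R) n g = lsum R n g" "lsum (right_mod W) n w = lsum W n w"
  by (rule lsum_same; simp)+

text \<open>A Frobenius system: \<open>E\<close> is linear over \<open>R\<close> on both sides and
  \<open>x\<close>, \<open>y\<close> are dual bases for it. They are required to lie in
  \<open>A\<close> at every index, also beyond \<open>n\<close>, so that the closure rules carry no
  side condition.\<close>

definition frob :: "'r ring => 'a ring => ('r => 'a) => ('a => 'r) => nat => (nat => 'a) => (nat => 'a) => bool"
  where "frob R A \<iota> E n x y \<longleftrightarrow> ring R & ring A & \<iota> : ring_hom R A & addm A R E &
    (ALL r:carrier R. ALL a:carrier A. E (\<iota> r *[A] a) = r *[R] E a & E (a *[A] \<iota> r) = E a *[R] r) &
    (ALL k. x k el A & y k el A) &
    (ALL a:carrier A. lsum A n (%k. \<iota> (E (a *[A] y k)) *[A] x k) = a & lsum A n (%k. y k *[A] \<iota> (E (x k *[A] a))) = a)"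

text \<open>The two dual basis identities are mirror images of each other. This symmetry makes every
  result on left modules available for right modules.\<close>

lemma frob_opp: "frob R A \<iota> E n x y ==> frob (opp_ring R) (opp_ring A) \<iota> E n y x"
  unfolding frob_def using opp_ring[of R] opp_ring[of A] ring_hom_opp[of \<iota> R A]
  by (simp add: addm_def ring_ag)

definition trc :: "nat => (nat => 'a) => (nat => 'a) => ('a, 'u) module => ('a, 'v) module => ('u => 'v) => 'u => 'v"
  where "trc n x y U V f u = lsum V n (%k. y k .[V] f (x k .[U] u))"

text \<open>\<open>U\<close> is \<open>A \<otimes>\<^sub>R T\<close>, and at the same time \<open>Hom\<^sub>R(A, T)\<close>: \<open>h\<close> and \<open>e\<close> are the unit and
  the counit of the two adjunctions with the restriction of scalars.\<close>

definition ind :: "'r ring => 'a ring => ('r => 'a) => ('a => 'r) => nat => (nat => 'a) => (nat => 'a)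
    => ('r, 't) module => ('a, 'u) module => ('t => 'u) => ('u => 't) => bool"
  where "ind R A \<iota> E n x y T U h e \<longleftrightarrow> left_module A U & lin R T (res \<iota> U) h & lin R (res \<iota> U) T e &
    (ALL a:carrier A. ALL t:carrier T. e (a .[U] h t) = E a .[T] t) &
    (ALL u:carrier U. lsum U n (%k. y k .[U] h (e (x k .[U] u))) = u)"

definition add_iso :: "('m, 'd) ring_scheme => ('n, 'e) ring_scheme => ('m => 'n) => ('n => 'm) => bool"
  where "add_iso G H f g \<longleftrightarrow> addm G H f & addm H G g & (ALL z:carrier H. f (g z) = z) & (ALL z:carrier G. g (f z) = z)"

context
  fixes R :: "'r ring" and A :: "'a ring" and \<iota> E n x y
  assumes F: "frob R A \<iota> E n x y"
begin

private abbreviation (input) "tr \<equiv> trc n x y"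
private abbreviation (input) "In \<equiv> ind R A \<iota> E n x y"

lemma frob_simps:
  shows "ring R" "ring A" "\<iota> : ring_hom R A" "addm A R E"
    and "[| r el R; a el A |] ==> E (\<iota> r *[A] a) = r *[R] E a"
    and "[| r el R; a el A |] ==> E (a *[A] \<iota> r) = E a *[R] r"
    and "x k el A" "y k el A"
    and "a el A ==> lsum A n (%k. \<iota> (E (a *[A] y k)) *[A] x k) = a"
    and "a el A ==> lsum A n (%k. y k *[A] \<iota> (E (x k *[A] a))) = a"
    and "r el R ==> \<iota> r el A"
    and "a el A ==> E a el R"
  using F by (auto simp: frob_def ring_hom_closed addm_def)

private lemmas R = frob_simps(1) and A = frob_simps(2) and io = frob_simps(3)
private lemmas Rr = ring_rules[OF frob_simps(1)] and Ar = ring_rules[OF frob_simps(2)]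
private lemmas res_m = res_lmod[OF frob_simps(1,3)]
private lemmas res_l = res_lin[OF frob_simps(1,3)]
context
  notes [simp] = frob_simps(5-8,11-12) Ar(1-3) Rr(1-3) ring_simps0[OF frob_simps(2)] ring_simps0[OF frob_simps(1)]
begin

lemma iota_simps:
  "\<iota> 1[R] = 1[A]" "[| r el R; s el R |] ==> \<iota> (r *[R] s) = \<iota> r *[A] \<iota> s"
  "[| r el R; s el R |] ==> \<iota> (r +[R] s) = \<iota> r +[A] \<iota> s"
  using io by (simp_all add: ring_hom_one ring_hom_mult ring_hom_add)

context
  notes [simp] = iota_simps
begin

lemma E_sum: "addm A R E" by (rule frob_simps(4))

lemma frob_one: "lsum A n (%k. \<iota> (E (y k)) *[A] x k) = 1[A]" "lsum A n (%k. y k *[A] \<iota> (E (x k))) = 1[A]"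
  using frob_simps(9,10)[of "1[A]"] by simp_all

text \<open>The Casimir element, the sum of the tensors of \<open>y k\<close> with
  \<open>x k\<close>, commutes with \<open>a\<close>; a balanced map stands in for the tensor
  product of \<open>A\<close> with itself. Expanding \<open>x k\<close> times \<open>a\<close> along
  the \<open>x j\<close> gives coefficients that cross the balance and recombine with the
  \<open>y k\<close> to \<open>a\<close> times \<open>y j\<close>.\<close>

lemma casimir:
  assumes W: "abelian_group W" and l: "!!b. b el A ==> addm A W (%c. \<beta> b c)"
    and r: "!!c. c el A ==> addm A W (%b. \<beta> b c)"
    and bal: "!!b r c. [| b el A; r el R; c el A |] ==> \<beta> (b *[A] \<iota> r) c = \<beta> b (\<iota> r *[A] c)"
    and a: "a el A"
  shows "lsum W n (%k. \<beta> (y k) (x k *[A] a)) = lsum W n (%k. \<beta> (a *[A] y k) (x k))"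
proof -
  have c: "\<beta> b c el W" if "b el A" "c el A" for b c
    using addm_simps(1)[OF l[OF that(1)] that(2)] .
  have "\<beta> (y k) (x k *[A] a) = lsum W n (%j. \<beta> (y k *[A] \<iota> (E (x k *[A] (a *[A] y j)))) (x j))" for k
  proof -
    have "\<beta> (y k) (x k *[A] a) = \<beta> (y k) (lsum A n (%j. \<iota> (E (x k *[A] a *[A] y j)) *[A] x j))"
      using frob_simps(9)[of "x k *[A] a"] a by simp
    also have "\<dots> = lsum W n (%j. \<beta> (y k) (\<iota> (E (x k *[A] a *[A] y j)) *[A] x j))"
      by (rule addm_lsum[OF l]) (use a in simp_all)
    finally show ?thesis using a by (simp add: bal)
  qed
  then have "lsum W n (%k. \<beta> (y k) (x k *[A] a)) =
      lsum W n (%k. lsum W n (%j. \<beta> (y k *[A] \<iota> (E (x k *[A] (a *[A] y j)))) (x j)))" by simp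
  also have "\<dots> = lsum W n (%j. lsum W n (%k. \<beta> (y k *[A] \<iota> (E (x k *[A] (a *[A] y j)))) (x j)))"
    by (rule lsum_swap[OF W]) (use a c in simp)
  also have "\<dots> = lsum W n (%j. \<beta> (a *[A] y j) (x j))"
  proof (rule lsum_cong[OF refl refl], unfold simp_implies_def)
    fix j
    have "lsum W n (%k. \<beta> (y k *[A] \<iota> (E (x k *[A] (a *[A] y j)))) (x j)) =
        \<beta> (lsum A n (%k. y k *[A] \<iota> (E (x k *[A] (a *[A] y j))))) (x j)"
      by (rule addm_lsum[OF r, symmetric]) (use a in simp_all)
    then show "lsum W n (%k. \<beta> (y k *[A] \<iota> (E (x k *[A] (a *[A] y j)))) (x j)) = \<beta> (a *[A] y j) (x j)"
      using frob_simps(10)[of "a *[A] y j"] a by simp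
  qed
  finally show ?thesis .
qed

text \<open>A scalar \<open>a\<close> on the argument stands to the right of \<open>x k\<close>; the
  Casimir identity moves it to the left of \<open>y k\<close>. Linearity of \<open>f\<close> over
  \<open>R\<close> provides the balance.\<close>

lemma trc_lin:
  assumes U: "left_module A U" and V: "left_module A V" and f: "lin R (res \<iota> U) (res \<iota> V) f"
  shows "lin A U V (tr U V f)"
  unfolding trc_def
proof (rule linI[OF U V])
  note [simp] = lmod_simps[OF U] lmod_simps[OF V]
  note fc = lin_closed[OF f, simplified] and fs = lin_smult[OF f, simplified] and fa = lin_simps(2)[OF f, simplified]
  show "lsum V n (%k. y k .[V] f (x k .[U] u)) el V" if "u el U" for u
    by (rule lsum_closed[OF lmod_ag[OF V]]) (use that fc in simp)
  show "lsum V n (%k. y k .[V] f (x k .[U] (u +[U] u'))) =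
      lsum V n (%k. y k .[V] f (x k .[U] u)) +[V] lsum V n (%k. y k .[V] f (x k .[U] u'))"
    if "u el U" "u' el U" for u u'
    by (subst lsum_add[OF lmod_ag[OF V], symmetric]) (use that fc fa in simp_all)
  fix a u assume a: "a el A" and u: "u el U"
  have "lsum V n (%k. y k .[V] f ((x k *[A] a) .[U] u)) = lsum V n (%k. (a *[A] y k) .[V] f (x k .[U] u))"
  proof (rule casimir[OF lmod_ag[OF V] _ _ _ a, where \<beta> = "%b c. b .[V] f (c .[U] u)"])
    show "addm A V (%c. b .[V] f (c .[U] u))" if "b el A" for b
      by (rule addmI[OF ring_ag[OF A] lmod_ag[OF V]]) (use that u fc fa in simp_all)
    show "addm A V (%b. b .[V] f (c .[U] u))" if "c el A" for c
      by (rule smult_addm2[OF V]) (use that u fc in simp)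
  qed (use u fc fs in simp_all)
  then show "lsum V n (%k. y k .[V] f (x k .[U] (a .[U] u))) = a .[V] lsum V n (%k. y k .[V] f (x k .[U] u))"
    using a u fc by (subst addm_lsum[OF smult_addm[OF V a]]) simp_all
qed

lemma ind_simps:
  assumes "In T U h e"
  shows "left_module A U" "left_module R T" "lin R T (res \<iota> U) h" "lin R (res \<iota> U) T e"
    "[| a el A; t el T |] ==> e (a .[U] h t) = E a .[T] t"
    "u el U ==> lsum U n (%k. y k .[U] h (e (x k .[U] u))) = u"
    "t el T ==> h t el U" "u el U ==> e u el T"
    "[| r el R; t el T |] ==> h (r .[T] t) = \<iota> r .[U] h t"
    "[| r el R; u el U |] ==> e (\<iota> r .[U] u) = r .[T] e u"
  using assms lin_mod(1)[of R T "res \<iota> U" h] lin_closed[of R T "res \<iota> U" h] lin_closed[of R "res \<iota> U" T e]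
    lin_smult[of R T "res \<iota> U" h] lin_smult[of R "res \<iota> U" T e] by (auto simp: ind_def)

text \<open>Induction as left adjoint. At \<open>h t\<close> the counit leaves
  \<open>E (x k)\<close> times \<open>t\<close>, and the \<open>y k\<close> with these coefficients
  sum to 1.\<close>

lemma ind_ext:
  assumes I: "In T U h e" and Y: "left_module A Y" and f: "lin R T (res \<iota> Y) f"
  shows "lin A U Y (tr U Y (%u. f (e u)))" and "t el T ==> tr U Y (%u. f (e u)) (h t) = f t"
proof -
  note I = ind_simps[OF I]
  note [simp] = lmod_simps[OF Y] and fc = lin_closed[OF f, simplified] and fs = lin_smult[OF f, simplified]
  show "lin A U Y (tr U Y (%u. f (e u)))" by (rule trc_lin[OF I(1) Y lin_comp[OF I(4) f]])
  assume t: "t el T"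
  have "tr U Y (%u. f (e u)) (h t) = lsum Y n (%k. (y k *[A] \<iota> (E (x k))) .[Y] f t)"
    using t by (simp add: trc_def I(5) fs fc)
  also have "\<dots> = lsum A n (%k. y k *[A] \<iota> (E (x k))) .[Y] f t"
    by (rule lsum_smult[OF Y, symmetric]) (use t fc in simp_all)
  finally show "tr U Y (%u. f (e u)) (h t) = f t" using t fc by (simp add: frob_one)
qed

lemma ind_ext_unique:
  assumes I: "In T U h e" and f: "lin A U Y f" and g: "lin A U Y g"
    and fg: "!!t. t el T ==> f (h t) = g (h t)" and u: "u el U"
  shows "f u = g u"
proof -
  note s = lmod_simps(13)[OF ind_simps(1)[OF I]] and I = ind_simps[OF I]
  have "k (lsum U n (%k. y k .[U] h (e (x k .[U] u)))) = lsum Y n (%j. y j .[Y] k (h (e (x j .[U] u))))" if k: "lin A U Y k" for k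
    by (subst lin_lsum_apply[OF k]) (use u s I(7,8) in "simp_all add: lin_smult[OF k]")
  from this[OF f] this[OF g] show ?thesis using fg u I(6-8) s by simp
qed

text \<open>Induction as right adjoint, by the mirror identity: the \<open>x k\<close> with
  coefficients \<open>E (y k)\<close> on the left sum to 1.\<close>

lemma ind_coext:
  assumes I: "In T U h e" and Y: "left_module A Y" and f: "lin R (res \<iota> Y) T f"
  shows "lin A Y U (tr Y U (%v. h (f v)))" and "v el Y ==> e (tr Y U (%v. h (f v)) v) = f v"
proof -
  note I = ind_simps[OF I]
  note [simp] = lmod_simps[OF Y] lmod_simps[OF I(1)] and fc = lin_closed[OF f, simplified] and fs = lin_smult[OF f, simplified]
  show "lin A Y U (tr Y U (%v. h (f v)))" by (rule trc_lin[OF Y I(1) lin_comp[OF f I(3)]])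
  assume v: "v el Y"
  have "e (tr Y U (%v. h (f v)) v) = lsum T n (%k. e (y k .[U] h (f (x k .[Y] v))))"
    unfolding trc_def by (subst lin_lsum_apply[OF I(4), simplified]) (use v fc I(7) in simp_all)
  also have "\<dots> = lsum T n (%k. f (\<iota> (E (y k)) .[Y] (x k .[Y] v)))" using v by (simp add: I(5) fs fc)
  also have "\<dots> = f (lsum Y n (%k. (\<iota> (E (y k)) *[A] x k) .[Y] v))"
    by (subst lin_lsum_apply[OF f, simplified]) (use v in simp_all)
  also have "lsum Y n (%k. (\<iota> (E (y k)) *[A] x k) .[Y] v) = lsum A n (%k. \<iota> (E (y k)) *[A] x k) .[Y] v"
    by (rule lsum_smult[OF Y, symmetric]) (use v in simp_all)
  finally show "e (tr Y U (%v. h (f v)) v) = f v" using v by (simp add: frob_one)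
qed

lemma ind_coext_unique:
  assumes I: "In T U h e" and f: "lin A Y U f" and g: "lin A Y U g"
    and fg: "!!v. v el Y ==> e (f v) = e (g v)" and v: "v el Y"
  shows "f v = g v"
proof -
  note I = ind_simps[OF I] and s = lmod_simps(13)[OF lin_mod(1)[OF f]]
  have "k v = lsum U n (%j. y j .[U] h (e (k (x j .[Y] v))))" if k: "lin A Y U k" for k
    using I(6)[OF lin_closed[OF k v]] v by (simp add: lin_smult[OF k])
  from this[OF f] this[OF g] show ?thesis using fg s v by simp
qed

text \<open>Extending \<open>h'\<close> after \<open>f\<close> and coextending \<open>f\<close>
  after \<open>e\<close> yield the same trace formula, so one map is compatible with units and with
  counits. Hence it can be tested on either side, whichever is simpler.\<close>

lemma ind_map:
  assumes I: "In T U h e" and J: "In T' U' h' e'" and f: "lin R T T' f"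
  shows "lin A U U' (tr U U' (%u. h' (f (e u))))"
    and "t el T ==> tr U U' (%u. h' (f (e u))) (h t) = h' (f t)"
    and "u el U ==> e' (tr U U' (%u. h' (f (e u))) u) = f (e u)"
  using ind_ext[OF I ind_simps(1)[OF J] lin_comp[OF f ind_simps(3)[OF J]]]
    ind_coext[OF J ind_simps(1)[OF I] lin_comp[OF ind_simps(4)[OF I] f]] by auto

lemma ind_iso:
  assumes I: "In T U h e" and J: "In T U' h' e'"
  shows "lin A U U' (tr U U' (%u. h' (e u)))" and "u el U ==> tr U' U (%u. h (e' u)) (tr U U' (%u. h' (e u)) u) = u"
proof -
  note i = ind_map[OF I J lin_id[OF ind_simps(2)[OF I]]] and j = ind_map[OF J I lin_id[OF ind_simps(2)[OF I]]]
  show "lin A U U' (tr U U' (%u. h' (e u)))" by (rule i(1))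
  show "tr U' U (%u. h (e' u)) (tr U U' (%u. h' (e u)) u) = u" if "u el U"
    by (rule ind_ext_unique[OF I lin_comp[OF i(1) j(1)] lin_id[OF ind_simps(1)[OF I]] _ that]) (simp add: i(2) j(2))
qed

text \<open>An element is the sum of \<open>y k\<close> times the unit at its coordinates
  \<open>e' (x k u)\<close>. Preimages of the coordinates therefore assemble to a preimage of the
  element.\<close>

lemma ind_exact:
  assumes I: "In T U h e" and J: "In T' U' h' e'" and f: "lin R T T' f" and u: "u el U'"
    and ex: "!!k. e' (x k .[U'] u) : f ` carrier T"
  shows "u : tr U U' (%u. h' (f (e u))) ` carrier U"
proof -
  note m = ind_map[OF I J f]
  have "ALL k. EX t. t el T & e' (x k .[U'] u) = f t" using ex by blast
  then obtain t where t: "!!k. t k el T" "!!k. e' (x k .[U'] u) = f (t k)" by metis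
  have s: "y k .[U] h (t k) el U" for k
    using lmod_simps(13)[OF ind_simps(1)[OF I]] t ind_simps(7)[OF I] by simp
  have "u = tr U U' (%u. h' (f (e u))) (lsum U n (%k. y k .[U] h (t k)))"
    using ind_simps(6)[OF J u] s t ind_simps(7)[OF I] by (simp add: lin_lsum_apply[OF m(1)] lin_smult[OF m(1)] m(2))
  then show ?thesis by (rule image_eqI[OF _ lsum_closed[OF lmod_ag[OF ind_simps(1)[OF I]] s]])
qed

lemma bimod_ext: "bimod A R (ext_bimod A \<iota>)"
  unfolding bimod_def
proof (intro conjI ballI)
  show "left_module A (left_mod (ext_bimod A \<iota>))"
    by (rule lmodI[OF A ag_same[OF ring_ag[OF A]]]) (simp_all add: left_mod_def ext_bimod_def)
  show "left_module (opp_ring R) (right_mod (ext_bimod A \<iota>))"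
    by (rule lmodI[OF opp_ring[OF R] ag_same[OF ring_ag[OF A]]]) (simp_all add: right_mod_def ext_bimod_def)
qed (simp_all add: ext_bimod_def)

text \<open>Existence of induced modules: the tensor product with unit given by tensoring with 1 and
  counit given by \<open>E\<close> on the first factor. Elsewhere only the properties in
  \<open>ind\<close> are used, which leaves room for other models.\<close>

lemma ind_tensor:
  fixes M :: "('r, 'm) module"
  assumes M: "left_module R M"
  defines "t \<equiv> ten R (right_mod (ext_bimod A \<iota>)) M"
  shows "EX e. (ALL a:carrier A. ALL m:carrier M. e (t a m) = E a .[M] m) & In M (tensor_mod R (ext_bimod A \<iota>) M) (t 1[A]) e"
proof -
  let ?B = "ext_bimod A \<iota>" and ?U = "tensor_mod R (ext_bimod A \<iota>) M"
  note b = bimod_ext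
  note Tr = bimod_right[OF b] and U = tensor_mod_lmod[OF b M]
  have Bs: "carrier ?B = carrier A" "ring.add ?B = ring.add A" "rsmult ?B a r = a *[A] \<iota> r" "module.smult ?B = monoid.mult A" for a r
    by (simp_all add: ext_bimod_def)
  note [simp] = lmod_simps[OF M]
  have tc: "t a m el ?U" if "a el A" "m el M" for a m
    using ten_closed[OF Tr M, of a m] that by (simp add: t_def tensor_mod_simps Bs)
  have tsm: "a .[?U] t c m = t (a *[A] c) m" if "a el A" "c el A" "m el M" for a c m
    using tensor_mod_smult_ten[OF b M that(1), of c m] that by (simp add: t_def Bs)
  have tb: "t (a *[A] \<iota> r) m = t a (r .[M] m)" if "a el A" "r el R" "m el M" for a r m
    using ten_balanced[OF Tr M, of r a m] that by (simp add: t_def Bs)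
  have tar: "t a (m +[M] m') = t a m +[?U] t a m'" if "a el A" "m el M" "m' el M" for a m m'
    using ten_add_r[OF Tr M, of a m m'] that by (simp add: t_def tensor_mod_simps Bs)
  have tal: "addm A ?U (%a. t a m)" if "m el M" for m
    by (rule addmI[OF ring_ag[OF A] lmod_ag[OF U]]) (use tc ten_add_l[OF Tr M] that in "simp_all add: t_def tensor_mod_simps Bs")
  note Ea = addm_simps[OF E_sum]
  have "EX e. addm (tgr R (right_mod ?B) M) M e & (ALL a:carrier (right_mod ?B). ALL m:carrier M. e (ten R (right_mod ?B) M a m) = E a .[M] m)"
    by (rule ten_lift[OF Tr M lmod_ag[OF M]]) (simp_all add: Bs Ea(2))
  then obtain e where e: "addm ?U M e" and et: "!!a m. [| a el A; m el M |] ==> e (t a m) = E a .[M] m"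
    by (auto simp: addm_tensor_mod t_def Bs)
  have h: "lin R M (res \<iota> ?U) (t 1[A])"
    by (rule linI[OF M res_m[OF U]]) (use tb[of "1[A]"] in "simp_all add: tc tar tsm")
  have esm: "e (\<iota> r .[?U] u) = r .[M] e u" if "r el R" "u el ?U" for r u
  proof (rule ten_eqI[OF Tr M, of M "%u. e (\<iota> r .[?U] u)" "%u. r .[M] e u"])
    show "addm (tgr R (right_mod ?B) M) M (%u. e (\<iota> r .[?U] u))"
      using addm_comp[OF smult_addm[OF U, of "\<iota> r"] e] that by (simp add: addm_tensor_mod)
    show "addm (tgr R (right_mod ?B) M) M (%u. r .[M] e u)"
      using addm_comp[OF e smult_addm[OF M that(1)]] by (simp add: addm_tensor_mod)
    show "e (\<iota> r .[?U] ten R (right_mod ?B) M a m) = r .[M] e (ten R (right_mod ?B) M a m)"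
      if "a el (right_mod ?B)" "m el M" for a m
      using that \<open>r el R\<close> tsm[of "\<iota> r" a m] et[of a m] et[of "\<iota> r *[A] a" m] by (simp add: t_def Bs)
  qed (use that in "simp add: tensor_mod_simps")
  have el: "lin R (res \<iota> ?U) M e"
    unfolding lin_def using res_m[OF U] M e esm by (simp add: addm_def ag_same[OF lmod_ag[OF U]])
  have "lsum ?U n (%k. y k .[?U] t 1[A] (e (x k .[?U] u))) = u" if "u el ?U" for u
  proof (rule tensor_mod_eqI[OF b M trc_lin[OF U U lin_comp[OF el h], unfolded trc_def] lin_id[OF U] _ that])
    fix a m assume "a el ?B" and m: "m el M"
    then have a: "a el A" by (simp add: Bs)
    have "lsum ?U n (%k. y k .[?U] t 1[A] (e (x k .[?U] t a m))) = lsum ?U n (%k. t (y k *[A] \<iota> (E (x k *[A] a))) m)"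
      using a m by (simp add: tsm et tb)
    also have "\<dots> = t (lsum A n (%k. y k *[A] \<iota> (E (x k *[A] a)))) m"
      by (rule addm_lsum[OF tal[OF m], symmetric]) (use a in simp)
    finally show "lsum ?U n (%k. y k .[?U] t 1[A] (e (x k .[?U] ten R (right_mod ?B) M a m))) = ten R (right_mod ?B) M a m"
      using frob_simps(10)[OF a] by (simp add: t_def)
  qed
  then have "In M ?U (t 1[A]) e"
    unfolding ind_def using U h el by (simp add: tsm et)
  then show ?thesis using et by blast
qed

lemma ind_reg: "In (reg_mod R) (reg_mod A) \<iota> E"
proof -
  note a = reg_mod_lmod[OF A]
  have "lin R (reg_mod R) (res \<iota> (reg_mod A)) \<iota>" by (rule linI[OF reg_mod_lmod[OF R] res_m[OF a]]) simp_all
  moreover have "lin R (res \<iota> (reg_mod A)) (reg_mod R) E"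
    by (rule linI[OF res_m[OF a] reg_mod_lmod[OF R]]) (simp_all add: addm_simps[OF E_sum])
  ultimately show ?thesis unfolding ind_def using a frob_simps(10) by simp
qed

lemma ind_addr:
  assumes I: "In T U h e" and J: "In T' U' h' e'" and a: "addr R T T'"
  shows "addr A U U'"
proof -
  obtain m p q where r: "retr R T T' m p q" using a by (rule addrE)
  note p = ind_map[OF J I retrD(3)[OF r]] and q = ind_map[OF I J retrD(4)[OF r]]
  note l = lin_lsum[OF ind_simps(1)[OF J] ind_simps(1)[OF J] lin_comp[OF p(1) q(1)]]
  have "lsum U' m (%k. tr U U' (%u. h' (q k (e u))) (tr U' U (%u. h (p k (e' u))) u)) = u" if "u el U'" for u
  proof (rule ind_ext_unique[OF J l lin_id[OF ind_simps(1)[OF J]] _ that])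
    fix t assume t: "t el T'"
    have "lsum U' m (%k. tr U U' (%u. h' (q k (e u))) (tr U' U (%u. h (p k (e' u))) (h' t))) = lsum U' m (%k. h' (q k (p k t)))"
      using t lin_closed[OF retrD(3)[OF r]] by (simp add: p(2) q(2))
    also have "\<dots> = h' (lsum T' m (%k. q k (p k t)))"
      by (rule lin_lsum_apply[OF ind_simps(3)[OF J], simplified, symmetric]) (rule lin_closed[OF retrD(4)[OF r] lin_closed[OF retrD(3)[OF r] t]])
    finally show "lsum U' m (%k. tr U U' (%u. h' (q k (e u))) (tr U' U (%u. h (p k (e' u))) (h' t))) = h' t" using retrD(5)[OF r t] by simp
  qed
  then have "retr A U U' m (%k. tr U' U (%u. h (p k (e' u)))) (%k. tr U U' (%u. h' (q k (e u))))"
    unfolding retr_def using p(1) q(1) ind_simps(1)[OF I] ind_simps(1)[OF J] by simp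
  then show ?thesis unfolding addr_def by blast
qed

text \<open>Lift the unit through the surjection by projectivity over \<open>R\<close> and extend
  the lift over \<open>A\<close>; uniqueness of extensions shows that it is a section.\<close>

lemma ind_proj:
  fixes U :: "('a, 'u) module"
  assumes I: "In T U h e" and P: "projective R T"
  shows "projective A U"
proof (rule projI[OF ind_simps(1)[OF I]])
  fix g assume g: "lin A (free_mod (carrier U) A) U g" and gs: "g ` carrier (free_mod (carrier U) A) = carrier U"
  obtain s where s: "lin R T (res \<iota> (free_mod (carrier U) A)) s" "!!t. t el T ==> g (s t) = h t"
    using proj_lift[OF P ind_simps(3)[OF I] res_l[OF g]] gs ind_simps(7)[OF I] by auto
  note c = ind_ext[OF I lin_mod(1)[OF g] s(1)]
  have "g (tr U (free_mod (carrier U) A) (%u. s (e u)) u) = u" if "u el U" for u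
    by (rule ind_ext_unique[OF I lin_comp[OF c(1) g] lin_id[OF ind_simps(1)[OF I]] _ that]) (simp add: c(2) s(2))
  then show "EX s. lin A U (free_mod (carrier U) A) s & (ALL u:carrier U. g (s u) = u)" using c(1) by blast
qed

text \<open>Restriction has the exact right adjoint given by coinduction, here the same as
  induction. The coextension of the identity of \<open>Q\<close> is lifted through the induced
  surjection, and the counit of this lift is a section of \<open>g\<close>.\<close>

lemma res_proj:
  fixes Q :: "('a, 'q) module"
  assumes Q: "projective A Q"
  shows "projective R (res \<iota> Q)"
proof -
  let ?R = "res \<iota> Q"
  note Qm = proj_lmod[OF Q] and rQ = res_m[OF proj_lmod[OF Q]]
  show ?thesis
  proof (rule projI[OF rQ])
    let ?F = "free_mod (carrier ?R) R"
    fix g assume g: "lin R ?F ?R g" and gs: "g ` carrier ?F = carrier ?R"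
    let ?V = "tensor_mod R (ext_bimod A \<iota>) ?F" and ?W = "tensor_mod R (ext_bimod A \<iota>) ?R"
    obtain h e where V: "In ?F ?V h e" using ind_tensor[OF lin_mod(1)[OF g]] by blast
    obtain h' e' where W: "In ?R ?W h' e'" using ind_tensor[OF rQ] by blast
    note G = ind_map[OF V W g] and c = ind_coext[OF W Qm lin_id[OF rQ]]
    let ?G = "tr ?V ?W (%u. h' (g (e u)))"
    have "tr Q ?W h' v : ?G ` carrier ?V" if "v el Q" for v
      by (rule ind_exact[OF V W g lin_closed[OF c(1) that]])
        (use that gs lin_closed[OF c(1) that] lmod_simps(13)[OF ind_simps(1)[OF W]] ind_simps(8)[OF W] in simp)
    from proj_lift[OF Q c(1) G(1) this] obtain s where s: "lin A Q ?V s" "!!v. v el Q ==> ?G (s v) = tr Q ?W h' v" by auto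
    have "g (e (s v)) = v" if "v el Q" for v
      using G(3)[OF lin_closed[OF s(1) that]] s(2)[OF that] c(2)[OF that] by simp
    then show "EX s. lin R ?R ?F s & (ALL v:carrier ?R. g (s v) = v)"
      using lin_comp[OF res_l[OF s(1)] ind_simps(4)[OF V]] by (intro exI[of _ "%v. e (s v)"]) simp
  qed
qed

end

end

subsection \<open>Change of rings for resolutions, Ext and Tor\<close>

lemma res_pres:
  assumes P: "pres A V Q d e"
  shows "pres R (res \<iota> V) (%i. res \<iota> (Q i)) d e"
  using P unfolding pres_def by (simp add: res_proj res_lin[OF frob_simps(1,3)])

text \<open>One direction reads the vanishing of the image through the counit on all multiples
  \<open>x k u\<close>, which puts these coordinates in the image of \<open>f\<close>; the other is
  functoriality.\<close>

lemma ind_exact_iff: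
  assumes I: "In T U h e" and J: "In T' U' h' e'" and K: "In T'' U'' h'' e''"
    and f: "lin R T T' f" and g: "lin R T' T'' g" and u: "u el U'"
    and ex: "!!t. t el T' ==> g t = 0[T''] \<longleftrightarrow> t : f ` carrier T"
  shows "tr U' U'' (%u. h'' (g (e' u))) u = 0[U''] \<longleftrightarrow> u : tr U U' (%u. h' (f (e u))) ` carrier U"
proof
  note f' = ind_map[OF I J f] and g' = ind_map[OF J K g]
  note Um = lmod_simps[OF ind_simps(1)[OF J]] and e0 = lin_simps(3)[OF ind_simps(4)[OF K], simplified]
  note xA = frob_simps(7)
  {
    assume z: "tr U' U'' (%u. h'' (g (e' u))) u = 0[U'']"
    show "u : tr U U' (%u. h' (f (e u))) ` carrier U"
    proof (rule ind_exact[OF I J f u])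
      fix k
      have "g (e' (x k .[U'] u)) = 0[T'']"
        using g'(3)[of "x k .[U'] u"] u xA[of k] z e0 lmod_simps[OF ind_simps(1)[OF K]] by (simp add: Um lin_smult[OF g'(1)])
      then show "e' (x k .[U'] u) : f ` carrier T" using ex ind_simps(8)[OF J] u xA[of k] by (simp add: Um)
    qed
  next
    assume "u : tr U U' (%u. h' (f (e u))) ` carrier U"
    then obtain v where v: "v el U" "u = tr U U' (%u. h' (f (e u))) v" by blast
    have "g (f (e w)) = 0[T'']" if "w el U" for w
      using ex[OF lin_closed[OF f ind_simps(8)[OF I that]]] ind_simps(8)[OF I that] by blast
    then show "tr U' U'' (%u. h'' (g (e' u))) u = 0[U'']"
      unfolding v(2)
      by (intro ind_coext_unique[OF K lin_comp[OF f'(1) g'(1)] lin_zero[OF ind_simps(1)[OF I] ind_simps(1)[OF K]] _ v(1)])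
        (simp add: g'(3) f'(3) lin_closed[OF f'(1)] e0)
  }
qed

lemma ind_surj:
  assumes I: "In T U h e" and J: "In T' U' h' e'" and f: "lin R T T' f" and s: "f ` carrier T = carrier T'"
  shows "tr U U' (%u. h' (f (e u))) ` carrier U = carrier U'"
proof (intro equalityI subsetI)
  show "u el U'" if "u : tr U U' (%u. h' (f (e u))) ` carrier U" for u
    using that lin_closed[OF ind_map(1)[OF I J f]] by auto
  show "u : tr U U' (%u. h' (f (e u))) ` carrier U" if "u el U'" for u
    by (rule ind_exact[OF I J f that])
      (use that s ind_simps(8)[OF J] lmod_simps(13)[OF ind_simps(1)[OF J]] frob_simps(7) in simp)
qed

text \<open>Injectivity as exactness with the zero map on the left, so it is an instance of the
  preceding equivalence.\<close>

lemma ind_inj: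
  assumes I: "In T U h e" and J: "In T' U' h' e'" and f: "lin R T T' f" and u: "u el U"
    and z: "!!t. [| t el T; f t = 0[T'] |] ==> t = 0[T]" and u0: "tr U U' (%u. h' (f (e u))) u = 0[U']"
  shows "u = 0[U]"
proof -
  note Tm = ind_simps(2)[OF I]
  have "f t = 0[T'] \<longleftrightarrow> t : (%t. 0[T]) ` carrier T" if "t el T" for t
    using z[OF that] lin_simps(3)[OF f] lmod_simps(1)[OF Tm] by auto
  from ind_exact_iff[OF I I J lin_zero[OF Tm Tm] f u this] obtain v where
    v: "v el U" "u = tr U U (%u. h 0[T]) v" using u0 by auto
  then show ?thesis
    using lin_simps(3)[OF ind_simps(3)[OF I]] lmod_simps[OF ind_simps(1)[OF I]] frob_simps(8)
      lsum_zero[OF lmod_ag[OF ind_simps(1)[OF I]], of n] by (simp add: trc_def)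
qed

lemma ind_pres:
  assumes P: "pres R T P d eP" and I: "In T U hU eU" and J: "!!i. In (P i) (Q i) (h i) (e i)"
  shows "pres A U Q (%i. tr (Q (Suc i)) (Q i) (%u. h i (d i (e (Suc i) u)))) (tr (Q 0) U (%u. hU (eP (e 0 u))))"
proof -
  note PD = presD[OF P]
  have a: "eP t = 0[T] \<longleftrightarrow> t : d 0 ` carrier (P (Suc 0))" if "t el (P 0)" for t
    using PD(5)[OF that] PD(7) by auto
  have b: "d i t = 0[P i] \<longleftrightarrow> t : d (Suc i) ` carrier (P (Suc (Suc i)))" if "t el (P (Suc i))" for i t
    using PD(6)[OF that] PD(8)[of _ i] by auto
  show ?thesis
    unfolding pres_def
    using ind_proj[OF J PD(1)] ind_map(1)[OF J J PD(2)] ind_map(1)[OF J I PD(3)] ind_surj[OF J I PD(3,4)]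
      ind_exact_iff[OF J J I PD(2,3) _ a] ind_exact_iff[OF J J J PD(2) PD(2) _ b] by simp
qed

lemma ind_sct:
  assumes J: "!!i. In (P i) (Q i) (h i) (e i)" and d: "!!i. lin R (P (Suc i)) (P i) (d i)" and s: "sct R P d m"
  shows "sct A Q (%i. tr (Q (Suc i)) (Q i) (%u. h i (d i (e (Suc i) u)))) m"
proof -
  obtain s where s: "lin R (P (Suc m)) (P (Suc m)) s" and sd: "!!t. t el (P (Suc (Suc m))) ==> s (d (Suc m) t) = 0[P (Suc m)]"
    and ds: "!!t. t el (P (Suc m)) ==> d m (s t) = d m t" using s by (auto simp: sct_def)
  note D = ind_map[OF J J d] and S = ind_map[OF J J s] and Qm = ind_simps(1)[OF J] and ec = ind_simps(8)[OF J]
  let ?s = "tr (Q (Suc m)) (Q (Suc m)) (%u. h (Suc m) (s (e (Suc m) u)))"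
  let ?d = "%i. tr (Q (Suc i)) (Q i) (%u. h i (d i (e (Suc i) u)))"
  have "?s (?d (Suc m) u) = 0[Q (Suc m)]" if "u el (Q (Suc (Suc m)))" for u
    by (rule ind_coext_unique[OF J lin_comp[OF D(1) S(1)] lin_zero[OF Qm Qm] _ that])
      (simp add: S(3) D(3) lin_closed[OF D(1)] sd ec lin_simps(3)[OF ind_simps(4)[OF J], simplified])
  moreover have "?d m (?s u) = ?d m u" if "u el (Q (Suc m))" for u
    by (rule ind_coext_unique[OF J lin_comp[OF S(1) D(1)] D(1) _ that]) (simp add: S(3) D(3) lin_closed[OF S(1)] ds ec)
  ultimately show ?thesis unfolding sct_def using S(1) by blast
qed

lemma ind_tensor_family:
  fixes P :: "nat => ('r, 'p) module"
  assumes "!!i. left_module R (P i)"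
  obtains h e where "!!i. In (P i) (tensor_mod R (ext_bimod A \<iota>) (P i)) (h i) (e i)"
proof -
  have "ALL i. EX p. In (P i) (tensor_mod R (ext_bimod A \<iota>) (P i)) (fst p) (snd p)"
    using ind_tensor[OF assms] by (metis fst_conv snd_conv)
  then obtain p where "ALL i. In (P i) (tensor_mod R (ext_bimod A \<iota>) (P i)) (fst (p i)) (snd (p i))" by (rule choice[THEN exE])
  then show thesis by (intro that[of "%i. fst (p i)" "%i. snd (p i)"]) simp
qed

lemma ind_finite_proj_dim:
  assumes I: "In T U h e" and f: "finite_proj_dim R T"
  shows "finite_proj_dim A U"
proof -
  note Tm = ind_simps(2)[OF I] and Um = ind_simps(1)[OF I]
  obtain m where m: "sct R (std_res R T) (%i. std_bd R) m" using f unfolding finite_proj_dim_iff by blast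
  note P = std_pres[OF Tm]
  obtain h' e' where J: "!!i. In (std_res R T i) (tensor_mod R (ext_bimod A \<iota>) (std_res R T i)) (h' i) (e' i)"
    by (rule ind_tensor_family[where P = "std_res R T", OF pres_lmod[OF P]]) (rule that)
  note s = sct_transfer[OF ind_pres[OF P I J] std_pres[OF Um] addr_refl[OF Um] ind_sct[OF J presD(2)[OF P] m]]
  show ?thesis unfolding finite_proj_dim_iff using Um s by blast
qed

text \<open>Here \<open>V\<close> acts as the coinduced module: restriction takes a projective
  resolution of \<open>Y\<close> to one over \<open>R\<close>, and composing with the counit
  identifies maps into \<open>V\<close> over \<open>A\<close> with maps into \<open>N\<close> over
  \<open>R\<close>.\<close>

lemma ext0_ind:
  assumes I: "In N V h e" and Y: "left_module A Y" and ex: "ext0 R (res \<iota> Y) N"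
  shows "ext0 A Y V"
proof (rule extv_ext0[OF std_pres[OF Y]])
  let ?Q = "std_res A Y" and ?d = "std_bd A"
  note Q = std_pres[OF Y]
  have v: "extv R (%i. res \<iota> (?Q i)) (%i. ?d) N" by (rule ext0_extv[OF res_pres[OF Q] ex])
  show "extv A ?Q (%i. ?d) V"
    unfolding extv_def
  proof (intro allI impI, elim conjE)
    fix i c assume c: "lin A (?Q (Suc i)) V c" and cd: "ALL u:carrier (?Q (Suc (Suc i))). c (?d u) = 0[V]"
    have "lin R (res \<iota> (?Q (Suc i))) N (%u. e (c u))"
      by (rule lin_comp[OF res_lin[OF frob_simps(1,3) c] ind_simps(4)[OF I]])
    moreover have "e (c (?d u)) = 0[N]" if "u el (res \<iota> (?Q (Suc (Suc i))))" for u
      using cd that lin_simps(3)[OF ind_simps(4)[OF I]] by simp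
    ultimately obtain b where b: "lin R (res \<iota> (?Q i)) N b" and cb: "!!u. u el (res \<iota> (?Q (Suc i))) ==> e (c u) = b (?d u)"
      by (rule extvD[OF v]) (assumption, rule that)
    note B = ind_coext[OF I pres_lmod[OF Q] b]
    have "c u = tr (?Q i) V (%v. h (b v)) (?d u)" if u: "u el (?Q (Suc i))" for u
      by (rule ind_coext_unique[OF I c lin_comp[OF presD(2)[OF Q] B(1)] _ u])
        (simp add: B(2) lin_closed[OF presD(2)[OF Q]] cb)
    then show "EX b. lin A (?Q i) V b & (ALL u:carrier (?Q (Suc i)). c u = b (?d u))" using B(1) by blast
  qed
qed

text \<open>The other adjunction: inducing a resolution of \<open>T\<close> resolves
  \<open>U\<close>, and maps from an induced module into \<open>Y\<close> over \<open>A\<close> are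
  maps from the original one over \<open>R\<close>.\<close>

lemma ext0_res:
  assumes I: "In T U hU eU" and Y: "left_module A Y" and ex: "ext0 A U Y"
  shows "ext0 R T (res \<iota> Y)"
proof -
  note Tm = ind_simps(2)[OF I]
  let ?P = "std_res R T" and ?d = "std_bd R"
  note P = std_pres[OF Tm]
  let ?Q = "%i. tensor_mod R (ext_bimod A \<iota>) (?P i)"
  obtain h e where J: "!!i. In (?P i) (?Q i) (h i) (e i)" by (rule ind_tensor_family[where P = "std_res R T", OF pres_lmod[OF P]]) (rule that)
  note Q = ind_pres[OF P I J]
  let ?D = "%i. tr (?Q (Suc i)) (?Q i) (%u. h i (?d (e (Suc i) u)))"
  note D = ind_map[OF J J presD(2)[OF P]]
  have v: "extv A ?Q ?D Y" by (rule ext0_extv[OF Q ex])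
  show ?thesis
  proof (rule extv_ext0[OF P], unfold extv_def, intro allI impI, elim conjE)
    fix i c assume c: "lin R (?P (Suc i)) (res \<iota> Y) c" and cd: "ALL u:carrier (?P (Suc (Suc i))). c (?d u) = 0[res \<iota> Y]"
    note C = ind_ext[OF J Y c]
    let ?c = "tr (?Q (Suc i)) Y (%u. c (e (Suc i) u))"
    have "?c (?D (Suc i) u) = 0[Y]" if "u el (?Q (Suc (Suc i)))" for u
      by (rule ind_ext_unique[OF J lin_comp[OF D(1) C(1)] lin_zero[OF ind_simps(1)[OF J] Y] _ that])
        (use cd in "simp add: D(2) C(2) lin_closed[OF presD(2)[OF P]]")
    from extvD[OF v C(1) this] obtain b where b: "lin A (?Q i) Y b" and cb: "!!u. u el (?Q (Suc i)) ==> ?c u = b (?D i u)" by auto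
    have "c u = b (h i (?d u))" if u: "u el (?P (Suc i))" for u
      using cb[OF ind_simps(7)[OF J u]] C(2)[OF u] D(2)[OF u] by simp
    then show "EX b. lin R (?P i) (res \<iota> Y) b & (ALL u:carrier (?P (Suc i)). c u = b (?d u))"
      using lin_comp[OF ind_simps(3)[OF J] res_lin[OF frob_simps(1,3) b]] by blast
  qed
qed

text \<open>The cancellation of \<open>A\<close> in a tensor product, for an abstract induced
  module. The inverse distributes the Casimir element over the two factors; it is balanced over
  \<open>A\<close> because that element commutes with scalars.\<close>

lemma tensor_ind_iso:
  assumes I: "In N V h e" and Y: "left_module (opp_ring A) Y"
  shows "EX \<phi> \<psi>. add_iso (tgr R (res \<iota> Y) N) (tgr A Y V) \<phi> \<psi> &
    (ALL t:carrier Y. ALL w:carrier N. \<phi> (ten R (res \<iota> Y) N t w) = ten A Y V t (h w)) &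
    (ALL t:carrier Y. ALL w:carrier V. \<psi> (ten A Y V t w) =
      lsum (tgr R (res \<iota> Y) N) n (%k. ten R (res \<iota> Y) N (y k .[Y] t) (e (x k .[V] w))))"
proof -
  note I = ind_simps[OF I]
  note Yr = res_lmod[OF opp_ring[OF frob_simps(1)] ring_hom_opp[OF frob_simps(3)] Y] and Nm = I(2) and Vm = I(1)
  note [simp] = frob_simps(5-8,11,12) I(5,7-10) lmod_simps[OF Y, simplified] lmod_simps[OF Vm] lmod_simps[OF Nm]
  note ringA = ring_rules[OF frob_simps(2)]
  let ?t = "ten R (res \<iota> Y) N" and ?u = "ten A Y V" and ?G = "tgr R (res \<iota> Y) N" and ?H = "tgr A Y V"
  note Gg = tgr_ag[OF Yr Nm] and Hg = tgr_ag[OF Y Vm]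
  note tc = ten_closed[OF Yr Nm, simplified] and uc = ten_closed[OF Y Vm]
  note tb = ten_balanced[OF Yr Nm, simplified] and ub = ten_balanced[OF Y Vm]
  note tl = ten_add_l[OF Yr Nm, simplified] and ul = ten_add_l[OF Y Vm]
  note tt = ten_add_r[OF Yr Nm, simplified] and uu = ten_add_r[OF Y Vm]
  note hl = lin_simps(2)[OF I(3), simplified] and el = lin_simps(2)[OF I(4), simplified]
  have "EX \<phi>. addm ?G ?H \<phi> & (ALL t:carrier (res \<iota> Y). ALL w:carrier N. \<phi> (?t t w) = ?u t (h w))"
    by (rule ten_lift[OF Yr Nm Hg]) (simp_all add: uc ul uu hl ub)
  then obtain \<phi> where \<phi>: "addm ?G ?H \<phi>" and \<phi>t: "!!t w. [| t el Y; w el N |] ==> \<phi> (?t t w) = ?u t (h w)" by auto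
  let ?f = "%t w. lsum ?G n (%k. ?t (y k .[Y] t) (e (x k .[V] w)))"
  have "EX \<psi>. addm ?H ?G \<psi> & (ALL t:carrier Y. ALL w:carrier V. \<psi> (?u t w) = ?f t w)"
  proof (rule ten_lift[OF Y Vm Gg])
    show "?f u w el ?G" if "u el Y" "w el V" for u w
      using that by (simp add: lsum_closed[OF Gg] tc)
    show "?f (u +[Y] u') w = ?f u w +[?G] ?f u' w"
      if "u el Y" "u' el Y" "w el V" for u u' w
      by (subst lsum_add[OF Gg, symmetric]) (use that in "simp_all add: tc tl tt el")
    show "?f u (w +[V] w') = ?f u w +[?G] ?f u w'"
      if "u el Y" "w el V" "w' el V" for u w w'
      by (subst lsum_add[OF Gg, symmetric]) (use that in "simp_all add: tc tl tt el")
    fix a u w assume *: "a el A" "u el Y" "w el V"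
    have "lsum ?G n (%k. ?t (y k .[Y] u) (e ((x k *[A] a) .[V] w))) = lsum ?G n (%k. ?t ((a *[A] y k) .[Y] u) (e (x k .[V] w)))"
      by (rule casimir[OF Gg _ _ _ *(1), where \<beta> = "%b c. ?t (b .[Y] u) (e (c .[V] w))"])
        (use * in "simp_all add: addmI[OF ring_ag[OF frob_simps(2)] Gg] tc tl tt el tb")
    then show "?f (a .[Y] u) w = ?f u (a .[V] w)" using * by simp
  qed
  then obtain \<psi> where \<psi>: "addm ?H ?G \<psi>" and \<psi>t: "!!u w. [| u el Y; w el V |] ==> \<psi> (?u u w) = ?f u w" by auto
  have a: "\<phi> (\<psi> z) = z" if "z el ?H" for z
  proof (rule ten_eqI[OF Y Vm addm_comp[OF \<psi> \<phi>] addm_id[OF Hg] _ that])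
    fix u w assume *: "u el Y" "w el V"
    have "\<phi> (\<psi> (?u u w)) = lsum ?H n (%k. ?u (y k .[Y] u) (h (e (x k .[V] w))))"
      unfolding \<psi>t[OF *] by (subst addm_lsum[OF \<phi>]) (use * in "simp_all add: tc \<phi>t")
    also have "\<dots> = lsum ?H n (%k. ?u u (y k .[V] h (e (x k .[V] w))))" using * by (simp add: ub)
    also have "\<dots> = ?u u (lsum V n (%k. y k .[V] h (e (x k .[V] w))))"
      by (rule addm_lsum[OF ten_addm_r[OF Y Vm *(1)], symmetric]) (use * in simp)
    finally show "\<phi> (\<psi> (?u u w)) = ?u u w" using I(6)[OF *(2)] by simp
  qed
  have b: "\<psi> (\<phi> z) = z" if "z el ?G" for z
  proof (rule ten_eqI[OF Yr Nm addm_comp[OF \<phi> \<psi>] addm_id[OF Gg] _ that])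
    fix t w assume "t el (res \<iota> Y)" "w el N"
    then have *: "t el Y" "w el N" by simp_all
    have "\<psi> (\<phi> (?t t w)) = lsum ?G n (%k. ?t ((y k *[A] \<iota> (E (x k))) .[Y] t) w)"
      using * by (simp add: \<phi>t \<psi>t tb[symmetric])
    also have "\<dots> = ?t (lsum Y n (%k. (y k *[A] \<iota> (E (x k))) .[Y] t)) w"
      by (subst addm_lsum[OF ten_addm_l[OF Yr Nm *(2)], simplified]) (use * in "simp_all add: ringA")
    also have "lsum Y n (%k. (y k *[A] \<iota> (E (x k))) .[Y] t) = lsum A n (%k. y k *[A] \<iota> (E (x k))) .[Y] t"
      using lsum_smult[OF Y, of t n "%k. y k *[A] \<iota> (E (x k))"] * by (simp add: ringA)
    finally show "\<psi> (\<phi> (?t t w)) = ?t t w" using * frob_one lmod_simps(17)[OF Y *(1)] by simp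
  qed
  have i: "add_iso ?G ?H \<phi> \<psi>" unfolding add_iso_def using \<phi> \<psi> a b by simp
  show ?thesis by (intro exI[of _ \<phi>] exI[of _ \<psi>] conjI ballI i \<phi>t \<psi>t)
qed

subsection \<open>Wakamatsu tilting modules and extension of scalars\<close>

text \<open>Each coordinate of \<open>g\<close> with respect to the presentation of \<open>U\<close>
  over \<open>T\<close> is a map to \<open>T\<close> and extends along \<open>d\<close> by
  assumption. The \<open>q k\<close> reassemble these extensions into a map over \<open>R\<close>,
  and the adjunction makes it linear over \<open>A\<close>.\<close>

lemma ind_extend:
  assumes I: "In C D h e" and J: "In C' D' h' e'" and d: "lin R C C' d" and r: "retr R T (res \<iota> U) m p q"
    and U: "left_module A U" and g: "lin A D U g"
    and ex: "!!k. k < m ==> EX g'. lin R C' T g' & (ALL v:carrier C. p k (g (h v)) = g' (d v))"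
  shows "EX g'. lin A D' U g' & (ALL u:carrier D. g u = g' (tr D D' (%u. h' (d (e u))) u))"
proof -
  have "ALL k:{..<m}. EX g'. lin R C' T g' & (ALL v:carrier C. p k (g (h v)) = g' (d v))" using ex by simp
  then obtain g' where g': "ALL k:{..<m}. lin R C' T (g' k) & (ALL v:carrier C. p k (g (h v)) = g' k (d v))" by (rule bchoice[THEN exE])
  have G: "lin R C' (res \<iota> U) (%v. lsum (res \<iota> U) m (%k. q k (g' k v)))"
    by (rule lin_lsum[OF ind_simps(2)[OF J] retrD(2)[OF r] lin_comp[OF _ retrD(4)[OF r]]]) (use g' in auto)
  note X = ind_ext[OF J U G] and M = ind_map[OF I J d]
  have "g u = tr D' U (%u. lsum (res \<iota> U) m (%k. q k (g' k (e' u)))) (tr D D' (%u. h' (d (e u))) u)" if "u el D" for u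
  proof (rule ind_ext_unique[OF I g lin_comp[OF M(1) X(1)] _ that])
    fix t assume t: "t el C"
    have "lsum U m (%k. q k (p k (g (h t)))) = g (h t)"
      using retrD(5)[OF r, of "g (h t)"] lin_closed[OF g ind_simps(7)[OF I t]] by simp
    then show "g (h t) = tr D' U (%u. lsum (res \<iota> U) m (%k. q k (g' k (e' u)))) (tr D D' (%u. h' (d (e u))) (h t))"
      using g' t M(2)[OF t] X(2)[OF lin_closed[OF d t]] by simp
  qed
  then show ?thesis using X(1) by blast
qed

text \<open>Exactness of the induced sequence is formal. Exactness after \<open>Hom(-, U)\<close>
  over \<open>A\<close> amounts to exactness of the given sequence after \<open>Hom(-, U)\<close>
  over \<open>R\<close>, and this is where \<open>U\<close> in add T over \<open>R\<close> is
  indispensable to the argument.\<close>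

lemma ind_corres:
  assumes c: "corres R T C eC d" and I: "In T U hU eU" and J: "!!i. In (C i) (D i) (h i) (e i)" and a: "addr R T (res \<iota> U)"
  shows "corres A U D (tr (reg_mod A) (D 0) (%u. h 0 (eC (E u)))) (%j. tr (D j) (D (Suc j)) (%u. h (Suc j) (d j (e j u))))"
proof -
  note D = corresD[OF c] and K = ind_reg and U = ind_simps(1)[OF I]
  note A = frob_simps(2) and R = frob_simps(1)
  obtain m p q where r: "retr R T (res \<iota> U) m p q" using a by (rule addrE)
  note p = retrD(3)[OF r] and q = retrD(4)[OF r]
  note p0 = lin_simps(3)[OF p, simplified]
  note rl = res_lin[OF frob_simps(1,3)]
  let ?e = "tr (reg_mod A) (D 0) (%u. h 0 (eC (E u)))" and ?d = "%j. tr (D j) (D (Suc j)) (%u. h (Suc j) (d j (e j u)))"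
  note EM = ind_map[OF K J D(2)] and DM = ind_map[OF J J D(3)]
  have e1: "?e 1[A] = h 0 (eC 1[R])" using EM(2)[of "1[R]"] ring_rules[OF R] iota_simps by simp
  have eC: "eC 1[R] el (C 0)" using lin_closed[OF D(2)] ring_rules[OF R] by simp
  show ?thesis
    unfolding corres_def
  proof (intro conjI allI ballI impI; (elim conjE)?)
    show "addr A U (D j)" for j by (rule ind_addr[OF I J D(1)])
    show "lin A (reg_mod A) (D 0) ?e" by (rule EM(1))
    show "lin A (D j) (D (Suc j)) (?d j)" for j by (rule DM(1))
    show "a = 0[A]" if "a el A" "?e a = 0[D 0]" for a
      using ind_inj[OF K J D(2), of a] D(4) that by simp
    show "(?d 0 u = 0[D (Suc 0)]) = (u : ?e ` carrier A)" if "u el (D 0)" for u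
      using ind_exact_iff[OF K J J D(2) D(3) that] D(5) by simp
    show "(?d (Suc j) u = 0[D (Suc (Suc j))]) = (u : ?d j ` carrier (D j))" if "u el (D (Suc j))" for u j
      by (rule ind_exact_iff[OF J J J D(3) D(3) that]) (rule D(6))
    show "EX g. lin A (D 0) U g & g (?e 1[A]) = u" if u: "u el U" for u
    proof -
      have "ALL k:{..<m}. EX g. lin R (C 0) T g & g (eC 1[R]) = p k u" using D(7) lin_closed[OF p] u by simp
      then obtain g where g: "ALL k:{..<m}. lin R (C 0) T (g k) & g k (eC 1[R]) = p k u" by (rule bchoice[THEN exE])
      have G: "lin R (C 0) (res \<iota> U) (%v. lsum (res \<iota> U) m (%k. q k (g k v)))"
        by (rule lin_lsum[OF ind_simps(2)[OF J] retrD(2)[OF r] lin_comp[OF _ q]]) (use g in auto)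
      note X = ind_ext[OF J U G]
      show ?thesis using X(1) X(2)[OF eC] g retrD(5)[OF r, of u] u unfolding e1 by (intro exI[of _ "tr (D 0) U (%u. lsum (res \<iota> U) m (%k. q k (g k (e 0 u))))"]) simp
    qed
    show "EX g'. lin A (D (Suc 0)) U g' & (ALL u:carrier (D 0). g u = g' (?d 0 u))"
      if g: "lin A (D 0) U g" "g (?e 1[A]) = 0[U]" for g
    proof (rule ind_extend[OF J J D(3) r U g(1)])
      fix k assume k: "k < m"
      show "EX g'. lin R (C (Suc 0)) T g' & (ALL v:carrier (C 0). p k (g (h 0 v)) = g' (d 0 v))"
        by (rule D(8)[OF lin_comp[OF lin_comp[OF ind_simps(3)[OF J] rl[OF g(1)]] p[OF k]]]) (use g(2) p0[OF k] in "simp add: e1")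
    qed
    show "EX g'. lin A (D (Suc (Suc j))) U g' & (ALL u:carrier (D (Suc j)). g u = g' (?d (Suc j) u))"
      if g: "lin A (D (Suc j)) U g" "ALL u:carrier (D j). g (?d j u) = 0[U]" for g j
    proof (rule ind_extend[OF J J D(3) r U g(1)])
      fix k assume k: "k < m"
      have "p k (g (h (Suc j) (d j v))) = 0[T]" if "v el (C j)" for v
        using bspec[OF g(2) ind_simps(7)[OF J that]] DM(2)[OF that] p0[OF k] by simp
      then show "EX g'. lin R (C (Suc (Suc j))) T g' & (ALL v:carrier (C (Suc j)). p k (g (h (Suc j) v)) = g' (d (Suc j) v))"
        by (rule D(9)[OF lin_comp[OF lin_comp[OF ind_simps(3)[OF J] rl[OF g(1)]] p[OF k]]])
    qed
  qed
qed

lemma ind_wakamatsu: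
  fixes T :: "('r, 't) module" and U :: "('a, 'u) module"
  assumes I: "In T U h e" and a: "addr R T (res \<iota> U)" and w: "wakamatsu_tilting R T"
  shows "wakamatsu_tilting A U"
proof -
  obtain P :: "nat => ('r, nat => 'r) module" and dP eP where P: "pres R T P dP eP" and fg: "!!i. addr R (reg_mod R) (P i)"
    using w unfolding wakamatsu_iff by blast
  obtain C :: "nat => ('r, nat => 't) module" and eC dC where C: "corres R T C eC dC" using w unfolding wakamatsu_iff by blast
  have eT: "ext0 R T T" using w by (simp add: wakamatsu_iff)
  obtain hP jP where JP: "!!i. In (P i) (tensor_mod R (ext_bimod A \<iota>) (P i)) (hP i) (jP i)"
    by (rule ind_tensor_family[where P = P, OF pres_lmod[OF P]]) (rule that)
  obtain hC jC where JC: "!!i. In (C i) (tensor_mod R (ext_bimod A \<iota>) (C i)) (hC i) (jC i)"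
    by (rule ind_tensor_family[where P = C, OF addr_lmod(2)[OF corresD(1)[OF C]]]) (rule that)
  show ?thesis
    by (rule wakamatsuI[OF ind_pres[OF P I JP] ind_addr[OF ind_reg JP fg]
      ext0_ind[OF I ind_simps(1)[OF I] ext0_addr[OF a eT]] ind_corres[OF C I JC a]])
qed

end

section \<open>Exchange of tensor factors and vanishing of Tor under change of rings\<close>

lemma add_iso_comp: "[| add_iso G H f g; add_iso H K f' g' |] ==> add_iso G K (%z. f' (f z)) (%z. g (g' z))"
  unfolding add_iso_def using addm_comp[of G H f K f'] addm_comp[of K H g' G g] addm_simps(1)[of G H f] addm_simps(1)[of K H g'] by simp

lemma ten_swap:
  assumes T: "left_module (opp_ring S) T" and M: "left_module S M"
  shows "EX f. addm (tgr S T M) (tgr (opp_ring S) M T) f & (ALL t:carrier T. ALL m:carrier M. f (ten S T M t m) = ten (opp_ring S) M T m t)"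
proof -
  have M': "left_module (opp_ring (opp_ring S)) M" using M by (simp add: opp_opp)
  show ?thesis
    by (rule ten_lift[OF T M tgr_ag[OF M' T]]) (simp_all add: ten_closed[OF M' T] ten_add_l[OF M' T] ten_add_r[OF M' T] ten_balanced[OF M' T])
qed

lemma ten_swap_iso:
  assumes T: "left_module (opp_ring S) T" and M: "left_module S M"
  shows "EX f g. add_iso (tgr S T M) (tgr (opp_ring S) M T) f g &
    (ALL t:carrier T. ALL m:carrier M. f (ten S T M t m) = ten (opp_ring S) M T m t)"
proof -
  have M': "left_module (opp_ring (opp_ring S)) M" using M by (simp add: opp_opp)
  obtain f where f: "addm (tgr S T M) (tgr (opp_ring S) M T) f" "ALL t:carrier T. ALL m:carrier M. f (ten S T M t m) = ten (opp_ring S) M T m t"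
    using ten_swap[OF T M] by blast
  obtain g where g: "addm (tgr (opp_ring S) M T) (tgr S T M) g" "ALL m:carrier M. ALL t:carrier T. g (ten (opp_ring S) M T m t) = ten S T M t m"
    using ten_swap[OF M' T] by (auto simp: opp_opp)
  have "f (g z) = z" if "z el (tgr (opp_ring S) M T)" for z
    by (rule ten_eqI[OF M' T addm_comp[OF g(1) f(1)] addm_id[OF tgr_ag[OF M' T]] _ that]) (simp add: f(2) g(2))
  moreover have "g (f z) = z" if "z el (tgr S T M)" for z
    by (rule ten_eqI[OF T M addm_comp[OF f(1) g(1)] addm_id[OF tgr_ag[OF T M]] _ that]) (simp add: f(2) g(2))
  ultimately show ?thesis unfolding add_iso_def using f g by blast
qed

text \<open>\<open>tensor_ind_iso\<close> for the opposite rings, conjugated by the exchange of the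
  tensor factors, since here the right module is the induced one.\<close>

lemma tensor_res_iso:
  assumes F: "frob R A \<iota> E n x y" and I: "ind (opp_ring R) (opp_ring A) \<iota> E n y x T U h e" and W: "left_module A W"
  shows "EX \<phi> \<psi>. add_iso (tgr R T (res \<iota> W)) (tgr A U W) \<phi> \<psi> &
    (ALL t:carrier T. ALL w:carrier W. \<phi> (ten R T (res \<iota> W) t w) = ten A U W (h t) w)"
proof -
  let ?R = "res \<iota> W"
  note Wr = res_lmod[OF frob_simps(1,3)[OF F] W] and Tm = ind_simps(2)[OF frob_opp[OF F] I] and Um = ind_simps(1)[OF frob_opp[OF F] I]
  note hc = ind_simps(7)[OF frob_opp[OF F] I]
  have W': "left_module (opp_ring (opp_ring A)) W" using W by (simp add: opp_opp)
  obtain f g where f: "add_iso (tgr R T ?R) (tgr (opp_ring R) ?R T) f g"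
    and ft: "ALL t:carrier T. ALL w:carrier ?R. f (ten R T ?R t w) = ten (opp_ring R) ?R T w t"
    using ten_swap_iso[OF Tm Wr] by blast
  obtain f' g' where f': "add_iso (tgr (opp_ring R) ?R T) (tgr (opp_ring A) W U) f' g'"
    and ft': "ALL w:carrier W. ALL t:carrier T. f' (ten (opp_ring R) ?R T w t) = ten (opp_ring A) W U w (h t)"
    using tensor_ind_iso[OF frob_opp[OF F] I W'] by blast
  obtain k l where k: "add_iso (tgr (opp_ring A) W U) (tgr A U W) k l"
    and kt: "ALL w:carrier W. ALL u:carrier U. k (ten (opp_ring A) W U w u) = ten A U W u w"
    using ten_swap_iso[OF W' Um] by (auto simp: opp_opp)
  show ?thesis
    using add_iso_comp[OF f add_iso_comp[OF f' k]] ft ft' kt hc by (intro exI conjI) (assumption, simp)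
qed

lemma exact_transfer:
  assumes i: "!!i. add_iso (G i) (H i) (f i) (g i)" and D: "!!i. addm (G (Suc i)) (G i) (D i)"
    and nat: "!!i z. z el (G (Suc i)) ==> f i (D i z) = D' i (f (Suc i) z)"
    and ex: "!!i z. [| z el (G (Suc i)); D i z = 0[G i] |] ==> EX w:carrier (G (Suc (Suc i))). D (Suc i) w = z"
    and z: "z el (H (Suc i))" "D' i z = 0[H i]"
  shows "EX w:carrier (H (Suc (Suc i))). D' (Suc i) w = z"
proof -
  have f: "addm (G i) (H i) (f i)" and g: "addm (H i) (G i) (g i)" and fg: "!!z. z el (H i) ==> f i (g i z) = z"
    and gf: "!!z. z el (G i) ==> g i (f i z) = z" for i using i[of i] by (simp_all add: add_iso_def)
  note gz = addm_simps(1)[OF g z(1)]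
  have "f i (D i (g (Suc i) z)) = 0[H i]" using nat[OF gz] fg[OF z(1)] z(2) by simp
  then have "D i (g (Suc i) z) = 0[G i]" using gf[OF addm_simps(1)[OF D gz]] addm_simps(3)[OF g, of i] by simp
  then obtain w where w: "w el (G (Suc (Suc i)))" "D (Suc i) w = g (Suc i) z" using ex[OF gz] by blast
  show ?thesis using nat[OF w(1)] w(2) fg[OF z(1)] addm_simps(1)[OF f w(1)] by (intro bexI[of _ "f (Suc (Suc i)) w"]) simp_all
qed

text \<open>The functions \<open>a\<close> and \<open>b\<close> record what the isomorphisms do to
  pure tensors, so compatibility with the differentials has to be checked on pure tensors
  only.\<close>

lemma torv_iso:
  assumes M: "left_module S M" and M': "left_module S' M'" and d: "!!i. lin (opp_ring S) (P (Suc i)) (P i) (d i)"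
    and d': "!!i. lin (opp_ring S') (P' (Suc i)) (P' i) (d' i)"
    and ex: "!!i. EX f g. add_iso (tgr S (P i) M) (tgr S' (P' i) M') f g &
      (ALL t:carrier (P i). ALL m:carrier M. f (ten S (P i) M t m) = ten S' (P' i) M' (a i t) (b m))"
    and a: "!!i t. t el (P i) ==> a i t el (P' i)" and b: "!!m. m el M ==> b m el M'"
    and ad: "!!i t. t el (P (Suc i)) ==> a i (d i t) = d' i (a (Suc i) t)"
  shows "torv S P d M \<longleftrightarrow> torv S' P' d' M'"
proof -
  let ?G = "%i. tgr S (P i) M" and ?H = "%i. tgr S' (P' i) M'"
  let ?D = "%i. tmp S M (P (Suc i)) (P i) (d i)" and ?E = "%i. tmp S' M' (P' (Suc i)) (P' i) (d' i)"
  obtain f g where p: "ALL i. add_iso (?G i) (?H i) (f i) (g i) &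
    (ALL t:carrier (P i). ALL m:carrier M. f i (ten S (P i) M t m) = ten S' (P' i) M' (a i t) (b m))"
    by (rule exE[OF choice2[OF allI]], rule ex) (elim exE, rule that)
  have i: "add_iso (?G i) (?H i) (f i) (g i)" "add_iso (?H i) (?G i) (g i) (f i)" for i
    using spec[OF p, of i] by (simp_all add: add_iso_def)
  have f: "addm (?G i) (?H i) (f i)" and g: "addm (?H i) (?G i) (g i)" and fg: "!!z. z el (?H i) ==> f i (g i z) = z"
    and gf: "!!z. z el (?G i) ==> g i (f i z) = z" for i using i(1)[of i] by (simp_all add: add_iso_def)
  note D = tmp_addm[OF M d] and E = tmp_addm[OF M' d']
  have nat: "f i (?D i z) = ?E i (f (Suc i) z)" if "z el (?G (Suc i))" for i z
  proof (rule ten_eqI[OF lin_mod(1)[OF d] M addm_comp[OF D f] addm_comp[OF f E] _ that])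
    show "f i (?D i (ten S (P (Suc i)) M t m)) = ?E i (f (Suc i) (ten S (P (Suc i)) M t m))" if "t el (P (Suc i))" "m el M" for t m
      using p that by (simp add: tmp_ten[OF M d] tmp_ten[OF M' d'] lin_closed[OF d] a b ad)
  qed
  have nat': "g i (?E i z) = ?D i (g (Suc i) z)" if "z el (?H (Suc i))" for i z
    using nat[OF addm_simps(1)[OF g that]] fg[OF that] gf[OF addm_simps(1)[OF D addm_simps(1)[OF g that]]] by simp
  show ?thesis
    unfolding torv_def
    by (intro iffI allI ballI impI; rule exact_transfer[where D = ?D and D' = ?E, OF i(1) D nat]
      exact_transfer[where D = ?E and D' = ?D, OF i(2) E nat']; (assumption | blast))
qed

text \<open>A projective resolution of the right module \<open>T\<close> induces one of
  \<open>U\<close>, and the two tensor complexes agree by \<open>tensor_res_iso\<close>.\<close>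

lemma tor0_res:
  fixes T :: "('r, 't) module" and U :: "('a, 'u) module"
  assumes F: "frob R A \<iota> E n x y" and I: "ind (opp_ring R) (opp_ring A) \<iota> E n y x T U hU eU"
    and W: "left_module A W" and t: "tor0 A U W"
  shows "tor0 R T (res \<iota> W)"
proof -
  note F' = frob_opp[OF F] and Wr = res_lmod[OF frob_simps(1,3)[OF F] W]
  let ?P = "std_res (opp_ring R) T"
  note P = std_pres[OF ind_simps(2)[OF F' I]]
  obtain h e where J: "!!i. ind (opp_ring R) (opp_ring A) \<iota> E n y x (?P i) (tensor_mod (opp_ring R) (ext_bimod (opp_ring A) \<iota>) (?P i)) (h i) (e i)"
    by (rule ind_tensor_family[OF F', where P = ?P, OF pres_lmod[OF P]]) (rule that)
  note D = ind_map[OF F' J J presD(2)[OF P]]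
  have "torv R ?P (%i. std_bd (opp_ring R)) (res \<iota> W)"
    by (subst torv_iso[where P = ?P and P' = "%i. tensor_mod (opp_ring R) (ext_bimod (opp_ring A) \<iota>) (?P i)" and a = h and b = "%w. w", OF Wr W presD(2)[OF P] D(1)])
      (use tensor_res_iso[OF F J W] ind_simps(7)[OF F' J] D(2) tor0_torv[OF W ind_pres[OF F' P I J] t] in simp_all)
  then show ?thesis by (rule torv_tor0[OF Wr P])
qed

text \<open>A projective resolution of \<open>Y\<close> over \<open>A\<close> restricts to one over
  \<open>R\<close>, and the two tensor complexes agree by \<open>tensor_ind_iso\<close>.\<close>

lemma tor0_ind:
  fixes N :: "('r, 'n) module" and Y :: "('a, 'y) module"
  assumes F: "frob R A \<iota> E n x y" and I: "ind R A \<iota> E n x y N V h e"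
    and Y: "left_module (opp_ring A) Y" and t: "tor0 R (res \<iota> Y) N"
  shows "tor0 A Y V"
proof -
  note Nm = ind_simps(2)[OF F I] and Vm = ind_simps(1)[OF F I]
  note Q = std_pres[OF Y]
  note P = res_pres[OF frob_opp[OF F] Q]
  let ?Q = "std_res (opp_ring A) Y"
  have "EX f g. add_iso (tgr R (res \<iota> (?Q i)) N) (tgr A (?Q i) V) f g &
    (ALL t:carrier (res \<iota> (?Q i)). ALL w:carrier N. f (ten R (res \<iota> (?Q i)) N t w) = ten A (?Q i) V t (h w))" for i
    by (rule exE[OF tensor_ind_iso[OF F I pres_lmod[OF Q]]], elim exE conjE, intro exI conjI, assumption, simp)
  then have "torv A ?Q (%i. std_bd (opp_ring A)) V"
    by (subst torv_iso[where P = "%i. res \<iota> (?Q i)" and P' = ?Q and a = "%i t. t" and b = h, OF Nm Vm presD(2)[OF P] presD(2)[OF Q], symmetric])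
      (use ind_simps(7)[OF F I] tor0_torv[OF Nm P t] in simp_all)
  then show ?thesis by (rule torv_tor0[OF Vm Q])
qed

section \<open>Frobenius extensions\<close>

text \<open>The first dual basis identity exhibits \<open>A\<close> as finitely generated
  projective. The bimodule isomorphism sends \<open>a\<close> to the functional that multiplies by
  \<open>a\<close> on the right and applies \<open>E\<close>.\<close>

lemma frobenius_extensionI:
  assumes F: "frob R A \<iota> E n x y"
  shows "frobenius_extension R A \<iota>"
proof -
  let ?R = "res \<iota> (reg_mod A)"
  note R = frob_simps(1)[OF F] and A = frob_simps(2)[OF F] and io = frob_simps(3)[OF F] and E = frob_simps(4)[OF F]
  note [simp] = frob_simps(5-8,11-12)[OF F] ring_rules[OF A] ring_rules[OF R] iota_simps[OF F] addm_simps[OF E] ring_simps0[OF A] ring_simps0[OF R]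
  note Am = res_lmod[OF R io reg_mod_lmod[OF A]]
  have "lin R ?R (reg_mod R) (%a. E (a *[A] y k))" for k
    by (rule linI[OF Am reg_mod_lmod[OF R]]) simp_all
  moreover have "lin R (reg_mod R) ?R (%r. \<iota> r *[A] x k)" for k
    by (rule linI[OF reg_mod_lmod[OF R] Am]) simp_all
  ultimately have "retr R (reg_mod R) ?R n (%k a. E (a *[A] y k)) (%k r. \<iota> r *[A] x k)"
    unfolding retr_def using frob_simps(9)[OF F] Am reg_mod_lmod[OF R] by simp
  then have fg: "addr R (reg_mod R) ?R" unfolding addr_def by blast
  let ?f = "%a. \<lambda>z\<in>carrier A. E (z *[A] a)"
  have fh: "?f a : mod_hom R ?R (reg_mod R)" if "a el A" for a
    using that by (simp add: mod_hom_def)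
  have inj: "a = b" if ab: "a el A" "b el A" "?f a = ?f b" for a b
  proof -
    have e: "E (x k *[A] a) = E (x k *[A] b)" for k using fun_cong[OF ab(3), of "x k"] by simp
    show ?thesis using trans[OF sym[OF frob_simps(10)[OF F ab(1)]] frob_simps(10)[OF F ab(2), folded e]] .
  qed
  have surj: "g : ?f ` carrier A" if g: "g : mod_hom R ?R (reg_mod R)" for g
  proof
    have gl: "lin R ?R (reg_mod R) g" by (rule mod_hom_lin[OF g Am reg_mod_lmod[OF R]])
    note gc = lin_closed[OF gl, simplified]
    \<comment> \<open>The preimage of \<open>g\<close>, by the second dual basis identity with
      \<open>g\<close> in place of the functional of an element.\<close>
    let ?a = "lsum A n (%k. y k *[A] \<iota> (g (x k)))"
    show a: "?a el A" by (rule lsum_closed[OF ring_ag[OF A]]) (simp add: gc)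
    have "E (z *[A] ?a) = g z" if z: "z el A" for z
    proof -
      have "addm A A (%a. z *[A] a)" using smult_addm[OF reg_mod_lmod[OF A], of z] z by (simp add: addm_def ring_ag[OF A])
      from addm_comp[OF this E] have "E (z *[A] ?a) = lsum R n (%k. E (z *[A] (y k *[A] \<iota> (g (x k)))))"
        by (rule addm_lsum) (simp add: gc)
      also have "\<dots> = lsum R n (%k. E (z *[A] y k) *[R] g (x k))"
      proof (rule lsum_cong[OF refl refl], unfold simp_implies_def)
        fix k show "E (z *[A] (y k *[A] \<iota> (g (x k)))) = E (z *[A] y k) *[R] g (x k)"
          using z gc[of "x k"] frob_simps(6)[OF F, of "g (x k)" "z *[A] y k"] by simp
      qed
      also have "\<dots> = g (lsum A n (%k. \<iota> (E (z *[A] y k)) *[A] x k))"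
        using z by (subst lin_lsum_apply[OF gl, simplified]) (simp_all add: lin_smult[OF gl, simplified])
      finally show ?thesis using frob_simps(9)[OF F z] by simp
    qed
    then show "g = ?f ?a" using mod_hom_arb[OF g] by (auto simp: fun_eq_iff)
  qed
  have bij: "bij_betw (restrict ?f (carrier A)) (carrier A) (mod_hom R ?R (reg_mod R))"
    unfolding bij_betw_def using inj surj fh by (auto simp: inj_on_def)
  have Er: "E (z *[A] (a *[A] \<iota> r)) = E (z *[A] a) *[R] r" if "z el A" "a el A" "r el R" for z a r
    using frob_simps(6)[OF F that(3), of "z *[A] a"] that by simp
  have "restrict ?f (carrier A) : bimod_iso A R (ext_bimod A \<iota>) (frob_dual R A \<iota>)"
    using bij fh by (auto simp: Er bimod_iso_def mod_iso_def mod_hom_def[of A] mod_hom_def[of "opp_ring R"] ext_bimod_def frob_dual_def fun_eq_iff)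
  then show ?thesis unfolding frobenius_extension_def using R A io fg fg_proj_iff[of R "res \<iota> (reg_mod A)"] by blast
qed

text \<open>\<open>E\<close> is the functional that corresponds to 1. A dual basis of
  \<open>A\<close> over \<open>R\<close> consists of elements \<open>x k\<close> and functionals,
  and the \<open>y k\<close> are the elements that represent these functionals under the
  isomorphism.\<close>

lemma frobenius_extensionE:
  assumes f: "frobenius_extension R A \<iota>"
  shows "EX E n x y. frob R A \<iota> E n x y"
proof -
  let ?R = "res \<iota> (reg_mod A)"
  have R: "ring R" and A: "ring A" and io: "\<iota> : ring_hom R A" using f by (simp_all add: frobenius_extension_def)
  note [simp] = ring_rules[OF A] ring_rules[OF R] ring_simps0[OF A] ring_simps0[OF R] ring_hom_closed[OF io]
    ring_hom_add[OF io] ring_hom_mult[OF io] ring_hom_one[OF io]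
  note Am = res_lmod[OF R io reg_mod_lmod[OF A]]
  let ?H = "mod_hom R ?R (reg_mod R)"
  have "addr R (reg_mod R) ?R" using f fg_proj_iff[of R "res \<iota> (reg_mod A)"] by (simp add: frobenius_extension_def)
  then obtain n p q where r: "retr R (reg_mod R) ?R n p q" by (rule addrE)
  obtain \<phi> where \<phi>: "\<phi> : bimod_iso A R (ext_bimod A \<iota>) (frob_dual R A \<iota>)" using f unfolding frobenius_extension_def by blast
  have bij: "bij_betw \<phi> (carrier A) ?H"
    and ph: "!!a. a el A ==> \<phi> a : ?H"
    and pl: "!!a b. [| a el A; b el A |] ==> \<phi> (b *[A] a) = (\<lambda>z\<in>carrier A. \<phi> a (z *[A] b))"
    and pr: "!!a r. [| a el A; r el R |] ==> \<phi> (a *[A] \<iota> r) = (\<lambda>z\<in>carrier A. \<phi> a z *[R] r)"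
    using \<phi> by (auto simp: bimod_iso_def mod_iso_def mod_hom_def[of A] mod_hom_def[of "opp_ring R"] ext_bimod_def frob_dual_def)
  let ?E = "\<phi> 1[A]"
  have El: "lin R ?R (reg_mod R) ?E" by (rule mod_hom_lin[OF ph Am reg_mod_lmod[OF R]]) simp
  note Ec = lin_closed[OF El, simplified] and Es = lin_smult[OF El, simplified]
  have pE: "\<phi> a z = ?E (z *[A] a)" if "a el A" "z el A" for a z
    using pl[of "1[A]" a] that by simp
  have Er: "?E (a *[A] \<iota> r) = ?E a *[R] r" if "a el A" "r el R" for a r
    using pr[of "1[A]" r] pE[of "\<iota> r" a] that by simp
  have Ea: "addm A R ?E" using lin_addm[OF El] by (simp add: addm_def ring_ag[OF A] ring_ag[OF R])
  \<comment> \<open>The default 0 beyond \<open>n\<close> meets the demand of \<open>frob\<close>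
    that all \<open>x k\<close> lie in \<open>A\<close>.\<close>
  define x where "x k = (if k < n then q k 1[R] else 0[A])" for k
  have xc: "x k el A" for k using lin_closed[OF retrD(4)[OF r, of k], of "1[R]"] by (simp add: x_def)
  have "ALL k. EX y:carrier A. k < n --> (ALL a:carrier A. p k a = ?E (a *[A] y))"
  proof
    fix k
    show "EX y:carrier A. k < n --> (ALL a:carrier A. p k a = ?E (a *[A] y))"
    proof (cases "k < n")
      case True
      obtain y where y: "y el A" "\<phi> y = restrict (p k) (carrier A)"
        using restrict_mod_hom[OF retrD(3)[OF r True], simplified] bij_betw_imp_surj_on[OF bij, symmetric] by (metis imageE)
      have "p k a = ?E (a *[A] y)" if "a el A" for a using pE[OF y(1) that] y(2) that by simp
      then show ?thesis using y(1) by blast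
    next
      case False then show ?thesis by (intro bexI[of _ "0[A]"]) simp_all
    qed
  qed
  then obtain y where y: "!!k. y k el A" and py: "!!k a. [| k < n; a el A |] ==> p k a = ?E (a *[A] y k)"
    by metis
  have 1: "lsum A n (%k. \<iota> (?E (a *[A] y k)) *[A] x k) = a" if a: "a el A" for a
  proof -
    have "q k (p k a) = \<iota> (?E (a *[A] y k)) *[A] x k" if k: "k < n" for k
      using lin_reg_eq[OF retrD(4)[OF r k], of "p k a"] lin_closed[OF retrD(3)[OF r k], of a] a k py[OF k a] by (simp add: x_def)
    then show ?thesis using retrD(5)[OF r, of a] a by simp
  qed
  \<comment> \<open>The isomorphism is injective, so it is enough that both sides give the same
    functional; this reduces the second identity to the first.\<close>
  have 2: "lsum A n (%k. y k *[A] \<iota> (?E (x k *[A] a))) = a" if a: "a el A" for a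
  proof -
    let ?b = "lsum A n (%k. y k *[A] \<iota> (?E (x k *[A] a)))"
    have b: "?b el A" by (rule lsum_closed[OF ring_ag[OF A]]) (simp add: a xc y Ec)
    have "?E (z *[A] ?b) = ?E (z *[A] a)" if z: "z el A" for z
    proof -
      have "addm A A (%a. z *[A] a)" using smult_addm[OF reg_mod_lmod[OF A], of z] z by (simp add: addm_def ring_ag[OF A])
      from addm_comp[OF this Ea] have "?E (z *[A] ?b) = lsum R n (%k. ?E (z *[A] (y k *[A] \<iota> (?E (x k *[A] a)))))"
        by (rule addm_lsum) (simp add: a xc y Ec)
      also have "\<dots> = lsum R n (%k. ?E (z *[A] y k) *[R] ?E (x k *[A] a))"
      proof (rule lsum_cong[OF refl refl], unfold simp_implies_def)
        fix k show "?E (z *[A] (y k *[A] \<iota> (?E (x k *[A] a)))) = ?E (z *[A] y k) *[R] ?E (x k *[A] a)"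
          using Er[of "z *[A] y k" "?E (x k *[A] a)"] z a xc y Ec by simp
      qed
      also have "\<dots> = ?E (lsum A n (%k. (\<iota> (?E (z *[A] y k)) *[A] x k) *[A] a))"
        using z a xc y Ec by (subst lin_lsum_apply[OF El, simplified]) (simp_all add: Es)
      also have "lsum A n (%k. (\<iota> (?E (z *[A] y k)) *[A] x k) *[A] a) = lsum A n (%k. \<iota> (?E (z *[A] y k)) *[A] x k) *[A] a"
        using lsum_smult[OF reg_mod_lmod[OF A], of a n "%k. \<iota> (?E (z *[A] y k)) *[A] x k"] z a xc y Ec by simp
      finally show ?thesis using 1[OF z] by simp
    qed
    then have "\<phi> ?b = \<phi> a"
      by (intro mod_hom_eqI[OF ph[OF b] ph[OF a]]) (simp add: pE[OF b] pE[OF a])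
    then show ?thesis using bij b a by (auto simp: bij_betw_def inj_on_def)
  qed
  have "frob R A \<iota> ?E n x y"
    unfolding frob_def using R A io Ea Es Er xc y 1 2 by simp
  then show ?thesis by blast
qed

section \<open>Tools for natural isomorphisms and for induced modules\<close>

lemma bchoice2: "ALL i:C. EX a b. P i a b ==> EX f g. ALL i:C. P i (f i) (g i)"
  by metis

lemma nat_isomorphic_lin_isoI:
  assumes F: "is_functor R C S D F" and h: "!!M. M : C ==> lin_iso S (obj F M) (obj G M) (h M) (g M)"
    and nat: "!!M N f x. [| M : C; N : C; f : mod_hom R M N; x el (obj F M) |]
      ==> h N (arr F M N f x) = arr G M N f (h M x)"
  shows "nat_isomorphic R C S F G"
proof (rule nat_isomorphicI[OF F, where h = h])
  show "lin S (obj F M) (obj G M) (h M)" if "M : C" for M by (rule lin_isoD(1)[OF h[OF that]])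
  show "x = 0[obj F M]" if "M : C" "x el (obj F M)" "h M x = 0[obj G M]" for M x
    using lin_iso_zero[OF h[OF that(1)] that(2)] that(3) by simp
  show "EX x:carrier (obj F M). h M x = y" if "M : C" "y el (obj G M)" for M y
    using lin_isoD(4)[OF h[OF that(1)] that(2)] lin_closed[OF lin_isoD(2)[OF h[OF that(1)]] that(2)] by blast
qed (rule nat)

lemma res_is_functor:
  assumes R: "ring R" and \<phi>: "\<phi> : ring_hom R A" and D: "!!M. M : C ==> res \<phi> M : D"
  shows "is_functor A C R D (res_functor \<phi>)"
  using D ring_hom_closed[OF \<phi>] by (auto simp: is_functor_def res_functor_def mod_hom_def)

lemma ind_lin_iso:
  assumes F: "frob R A \<iota> E n x y" and I: "ind R A \<iota> E n x y T U h e" and J: "ind R A \<iota> E n x y T U' h' e'"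
  shows "lin_iso A U U' (trc n x y U U' (%u. h' (e u))) (trc n x y U' U (%u. h (e' u)))"
  unfolding lin_iso_def using ind_iso[OF F I J] ind_iso[OF F J I] by blast

lemma tensor_ext_eqI:
  assumes F: "frob R A \<iota> E n x y" and M: "left_module R M"
    and f: "lin A (tensor_mod R (ext_bimod A \<iota>) M) W f" and g: "lin A (tensor_mod R (ext_bimod A \<iota>) M) W g"
    and fg: "!!m. m el M ==> f (ten R (right_mod (ext_bimod A \<iota>)) M 1[A] m) = g (ten R (right_mod (ext_bimod A \<iota>)) M 1[A] m)"
    and u: "u el (tensor_mod R (ext_bimod A \<iota>) M)"
  shows "f u = g u"
proof -
  obtain e where "ind R A \<iota> E n x y M (tensor_mod R (ext_bimod A \<iota>) M) (ten R (right_mod (ext_bimod A \<iota>)) M 1[A]) e"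
    using ind_tensor[OF F M] by blast
  from ind_ext_unique[OF F this f g fg u] show ?thesis .
qed

lemma addm_res: "addm M (res \<phi> N) f \<longleftrightarrow> addm M N f" "addm (res \<phi> N) M g \<longleftrightarrow> addm N M g"
proof -
  have "abelian_group (res \<phi> N) \<longleftrightarrow> abelian_group N"
    using ag_same[of "res \<phi> N" N] ag_same[of N "res \<phi> N"] by auto
  then show "addm M (res \<phi> N) f \<longleftrightarrow> addm M N f" "addm (res \<phi> N) M g \<longleftrightarrow> addm N M g" by (simp_all add: addm_def)
qed

lemma lin_isoI:
  assumes f: "lin R M N f" and g: "!!y. y el N ==> g y el M"
    and gf: "!!x. x el M ==> g (f x) = x" and fg: "!!y. y el N ==> f (g y) = y"
  shows "lin_iso R M N f g"
proof -
  note M = lin_mod(1)[OF f] and N = lin_mod(2)[OF f]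
  note ms = lmod_simps(2,13)[OF M]
  have "lin R N M g"
  proof (rule linI[OF N M g])
    show "g (y +[N] z) = g y +[M] g z" if "y el N" "z el N" for y z
      using gf[OF ms(1)[OF g[OF that(1)] g[OF that(2)]]] lin_simps(2)[OF f g[OF that(1)] g[OF that(2)]] fg that by simp
    show "g (r .[N] y) = r .[M] g y" if "r el R" "y el N" for r y
      using gf[OF ms(2)[OF that(1) g[OF that(2)]]] lin_smult[OF f that(1) g[OF that(2)]] fg that by simp
  qed
  then show ?thesis unfolding lin_iso_def using f gf fg by blast
qed

section \<open>The extension of endomorphism rings\<close>

context
  fixes R :: "'r ring" and A :: "'a ring" and \<iota> E n x y and T :: "('r, 't) module" and U :: "('a, 'u) module" and h e
    and \<rho> :: "('t => 't) => 'u => 'u"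
  assumes F: "frob R A \<iota> E n x y" and I: "ind R A \<iota> E n x y T U h e"
    and \<rho>: "!!s. s : mod_hom R T T ==> \<rho> s : mod_hom A U U"
    and \<rho>h: "!!s t. [| s : mod_hom R T T; t el T |] ==> \<rho> s (h t) = h (s t)"
begin

private lemmas Tm = ind_simps(2)[OF F I]
private lemmas Um = ind_simps(1)[OF F I]
private lemmas hc = ind_simps(7)[OF F I]
private lemmas ec = ind_simps(8)[OF F I]
private lemmas sl = end_lin[OF ind_simps(2)[OF F I]]
private lemmas bl = end_lin[OF ind_simps(1)[OF F I]]
private lemmas sc = lin_closed[OF end_lin[OF ind_simps(2)[OF F I]]]
private lemmas bc = lin_closed[OF end_lin[OF ind_simps(1)[OF F I]]]

text \<open>\<open>\<rho> s\<close> is determined on the unit as the map induced by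
  \<open>s\<close>; by \<open>ind_map\<close> an induced map commutes with the counit as
  well.\<close>

lemma rho_e:
  assumes s: "s : mod_hom R T T" and u: "u el U"
  shows "e (\<rho> s u) = s (e u)"
proof -
  note m = ind_map[OF F I I sl[OF s]]
  have "\<rho> s u = trc n x y U U (%u. h (s (e u))) u"
    by (rule ind_ext_unique[OF F I bl[OF \<rho>[OF s]] m(1) _ u]) (simp add: \<rho>h[OF s] m(2))
  then show ?thesis using m(3)[OF u] by simp
qed

lemma end_U_eqI:
  assumes "b : mod_hom A U U" "b' : mod_hom A U U" "!!t. t el T ==> b (h t) = b' (h t)"
  shows "b = b'"
  by (rule mod_hom_eqI[OF assms(1,2)]) (rule ind_ext_unique[OF F I bl[OF assms(1)] bl[OF assms(2)] assms(3)])

lemma end_U_eqI2: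
  assumes "b : mod_hom A U U" "b' : mod_hom A U U" "!!u. u el U ==> e (b u) = e (b' u)"
  shows "b = b'"
  by (rule mod_hom_eqI[OF assms(1,2)]) (rule ind_coext_unique[OF F I bl[OF assms(1)] bl[OF assms(2)] assms(3)])

lemma rho_ring_hom: "\<rho> : ring_hom (end_ring R T) (end_ring A U)"
proof (rule ring_hom_memI)
  note SB = ring_rules[OF end_ring_ring[OF Tm], unfolded end_ring_simps] ring_rules[OF end_ring_ring[OF Um], unfolded end_ring_simps]
  note ha = lin_simps(2)[OF ind_simps(3)[OF F I], simplified]
  fix s s' assume s: "s el (end_ring R T)" "s' el (end_ring R T)"
  then have s: "s : mod_hom R T T" "s' : mod_hom R T T" by simp_all
  show "\<rho> s el (end_ring A U)" using \<rho>[OF s(1)] by simp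
  show "\<rho> (s *[end_ring R T] s') = \<rho> s *[end_ring A U] \<rho> s'"
    by (rule end_U_eqI) (use s SB in "simp_all add: \<rho> \<rho>h hc sc compose_def")
  show "\<rho> (s +[end_ring R T] s') = \<rho> s +[end_ring A U] \<rho> s'"
    by (rule end_U_eqI) (use s SB in "simp_all add: \<rho> \<rho>h hc sc ha")
next
  have "(\<lambda>t\<in>carrier T. t) : mod_hom R T T" "(\<lambda>t\<in>carrier U. t) : mod_hom A U U"
    using restrict_mod_hom[OF lin_id[OF Tm]] restrict_mod_hom[OF lin_id[OF Um]] by simp_all
  then show "\<rho> 1[end_ring R T] = 1[end_ring A U]" unfolding end_ring_simps
    by (intro end_U_eqI) (simp_all add: \<rho> \<rho>h hc)
qed

lemma lsum_end_ring: "u el U ==> lsum (end_ring A U) m f u = lsum U m (%k. f k u)"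
  by (induction m) auto

text \<open>A presentation of \<open>U\<close> over \<open>T\<close> by maps \<open>p k\<close>,
  \<open>q k\<close> over \<open>R\<close> becomes a pair of dual bases: extending
  \<open>q k\<close> along the unit and coextending \<open>p k\<close> along the counit gives
  endomorphisms of \<open>U\<close> over \<open>A\<close>. The same data, with the same unit and
  counit, present \<open>U\<close> as the right module induced from \<open>T\<close>.\<close>

lemma end_frob:
  assumes a: "addr R T (res \<iota> U)"
  obtains E' m x' y' where "frob (end_ring R T) (end_ring A U) \<rho> E' m x' y'"
    "ind (opp_ring (end_ring R T)) (opp_ring (end_ring A U)) \<rho> E' m y' x' (right_mod (end_bimod T)) (right_mod (end_bimod U)) h e"
    "!!b. b : mod_hom A U U ==> E' b = (\<lambda>t\<in>carrier T. e (b (h t)))"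
proof -
  let ?G = "right_mod (end_bimod U)"
  let ?R = "right_mod (end_bimod T)"
  let ?C = "carrier U"
  let ?S = "end_ring R T" and ?B = "end_ring A U"
  note S = end_ring_ring[OF Tm] and B = end_ring_ring[OF Um]
  note SB = ring_rules[OF S, unfolded end_ring_simps] ring_rules[OF B, unfolded end_ring_simps]
  obtain m p q where r: "retr R T (res \<iota> U) m p q" using a by (rule addrE)
  define E' where "E' b = (\<lambda>t\<in>carrier T. e (b (h t)))" for b
  \<comment> \<open>Zero beyond \<open>m\<close>, because \<open>frob\<close> asks for elements of
    the ring at every index.\<close>
  define x' where "x' k = (if k < m then restrict (trc n x y U U (%u. q k (e u))) ?C else 0[?B])" for k
  define y' where "y' k = (if k < m then restrict (trc n x y U U (%u. h (p k u))) ?C else 0[?B])" for k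
  note X = ind_ext[OF F I Um retrD(4)[OF r]] and Y = ind_coext[OF F I Um retrD(3)[OF r]]
  have xB: "x' k : mod_hom A U U" and yB: "y' k : mod_hom A U U" for k
    using restrict_mod_hom[OF X(1)] restrict_mod_hom[OF Y(1)] SB by (simp_all add: x'_def y'_def)
  have xh: "x' k (h t) = q k t" if "k < m" "t el T" for k t using X(2)[OF that] that hc by (simp add: x'_def)
  have ye: "e (y' k u) = p k u" if "k < m" "u el U" for k u using Y(2)[OF that] that by (simp add: y'_def)
  note pc = lin_closed[OF retrD(3)[OF r], simplified] and qc = lin_closed[OF retrD(4)[OF r], simplified]
  have EB: "E' b : mod_hom R T T" if b: "b : mod_hom A U U" for b
    unfolding E'_def
    by (rule restrict_mod_hom[OF lin_comp[OF lin_comp[OF ind_simps(3)[OF F I] res_lin[OF frob_simps(1,3)[OF F] bl[OF b]]] ind_simps(4)[OF F I]]])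
  have cU: "compose ?C b b' : mod_hom A U U" if "b : mod_hom A U U" "b' : mod_hom A U U" for b b'
    by (rule compose_mod_hom[OF that(2,1) Um Um Um])
  note ha = lin_simps(2)[OF ind_simps(3)[OF F I], simplified] and ea = lin_simps(2)[OF ind_simps(4)[OF F I], simplified]
  have Eadd: "addm ?B ?S E'"
    by (rule addmI[OF ring_ag[OF B] ring_ag[OF S]]) (auto simp: EB, auto simp: E'_def fun_eq_iff hc bc ea)
  have El: "E' (compose ?C b (\<rho> s)) = compose (carrier T) (E' b) s" if "s : mod_hom R T T" "b : mod_hom A U U" for s b
    using that by (auto simp: E'_def fun_eq_iff compose_def hc sc \<rho>h)
  have Er: "E' (compose ?C (\<rho> s) b) = compose (carrier T) s (E' b)" if "s : mod_hom R T T" "b : mod_hom A U U" for s b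
    using that by (auto simp: E'_def fun_eq_iff compose_def hc bc rho_e)
  \<comment> \<open>The product is reversed composition, so this is the first dual basis identity.
    Evaluated at the unit, it becomes the sum of \<open>q k\<close> after \<open>p k\<close> at
    \<open>b (h t)\<close>.\<close>
  have 1: "lsum ?B m (%k. compose ?C (x' k) (\<rho> (E' (compose ?C (y' k) b)))) = b" if b: "b : mod_hom A U U" for b
  proof (rule end_U_eqI[OF _ b])
    show "lsum ?B m (%k. compose ?C (x' k) (\<rho> (E' (compose ?C (y' k) b)))) : mod_hom A U U"
      using lsum_closed[OF ring_ag[OF B], of m "%k. compose ?C (x' k) (\<rho> (E' (compose ?C (y' k) b)))"]
      by (simp add: cU b xB yB EB \<rho>)
    show "lsum ?B m (%k. compose ?C (x' k) (\<rho> (E' (compose ?C (y' k) b)))) (h t) = b (h t)" if t: "t el T" for t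
    proof -
      have "compose ?C (x' k) (\<rho> (E' (compose ?C (y' k) b))) (h t) = q k (p k (b (h t)))" if k: "k < m" for k
        using b t k by (simp add: compose_def hc \<rho>h EB cU[unfolded compose_def] yB) (simp add: E'_def hc bc ye xh pc)
      then show ?thesis using retrD(5)[OF r, of "b (h t)"] b t by (simp add: lsum_end_ring hc bc)
    qed
  qed
  \<comment> \<open>The mirror identity is tested through the counit instead, where
    \<open>y' k\<close> is known: it reduces to the same decomposition, applied before
    \<open>b\<close>.\<close>
  have 2: "lsum ?B m (%k. compose ?C (\<rho> (E' (compose ?C b (x' k)))) (y' k)) = b" if b: "b : mod_hom A U U" for b
  proof (rule end_U_eqI2[OF _ b])
    show "lsum ?B m (%k. compose ?C (\<rho> (E' (compose ?C b (x' k)))) (y' k)) : mod_hom A U U"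
      using lsum_closed[OF ring_ag[OF B], of m "%k. compose ?C (\<rho> (E' (compose ?C b (x' k)))) (y' k)"]
      by (simp add: cU b xB yB EB \<rho>)
    show "e (lsum ?B m (%k. compose ?C (\<rho> (E' (compose ?C b (x' k)))) (y' k)) u) = e (b u)" if u: "u el U" for u
    proof -
      note el = lin_comp[OF res_lin[OF frob_simps(1,3)[OF F] bl[OF b]] ind_simps(4)[OF F I]]
      have k: "e (compose ?C (\<rho> (E' (compose ?C b (x' k)))) (y' k) u) = e (b (q k (p k u)))" if k: "k < m" for k
        using b u k bc[OF yB u] by (simp add: compose_def rho_e EB cU[unfolded compose_def] xB ye) (simp add: E'_def pc xh hc)
      have "e (lsum ?B m (%k. compose ?C (\<rho> (E' (compose ?C b (x' k)))) (y' k)) u) =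
          lsum T m (%k. e (compose ?C (\<rho> (E' (compose ?C b (x' k)))) (y' k) u))"
        unfolding lsum_end_ring[OF u]
        by (rule lin_lsum_apply[OF ind_simps(4)[OF F I], simplified]) (use b u in "simp add: bc[OF cU] \<rho> EB cU xB yB")
      also have "\<dots> = lsum T m (%k. e (b (q k (p k u))))" using k by simp
      also have "\<dots> = e (b (lsum U m (%k. q k (p k u))))"
        using lin_lsum_apply[OF el, of m "%k. q k (p k u)"] u by (simp add: qc pc)
      finally show ?thesis using retrD(5)[OF r, of u] u by simp
    qed
  qed
  have fr: "frob ?S ?B \<rho> E' m x' y'"
    unfolding frob_def using S B rho_ring_hom Eadd El Er xB yB 1 2 by simp
  have Tr: "left_module (opp_ring ?S) ?R" and Ur: "left_module (opp_ring ?B) ?G"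
    by (rule right_mod_end[OF Tm], rule right_mod_end[OF Um])
  note rU = res_lmod[OF opp_ring[OF S] ring_hom_opp[OF rho_ring_hom] Ur]
  have "lin (opp_ring ?S) ?R (res \<rho> ?G) h"
    by (rule linI[OF Tr rU]) (simp_all add: hc ha \<rho>h)
  moreover have "lin (opp_ring ?S) (res \<rho> ?G) ?R e"
    by (rule linI[OF rU Tr]) (simp_all add: ec ea rho_e)
  moreover have "lsum U m (%k. x' k (h (e (y' k u)))) = u" if u: "u el U" for u
    using retrD(5)[OF r, of u] u by (simp add: ye xh pc)
  moreover have "lsum (end_bimod U) k g = lsum U k g" for k g by (rule lsum_same) simp_all
  ultimately have "ind (opp_ring ?S) (opp_ring ?B) \<rho> E' m y' x' ?R ?G h e"
    unfolding ind_def using Ur by (simp add: E'_def)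
  then show thesis by (rule that[OF fr]) (simp add: E'_def)
qed

subsection \<open>Compatibility with extension and restriction of scalars\<close>

context
  fixes E' m x' y'
  assumes a: "addr R T (res \<iota> U)"
    and F': "frob (end_ring R T) (end_ring A U) \<rho> E' m x' y'"
    and I': "ind (opp_ring (end_ring R T)) (opp_ring (end_ring A U)) \<rho> E' m y' x' (right_mod (end_bimod T)) (right_mod (end_bimod U)) h e"
    and E': "!!b. b : mod_hom A U U ==> E' b = (\<lambda>t\<in>carrier T. e (b (h t)))"
begin

private abbreviation (input) "S \<equiv> end_ring R T"
private abbreviation (input) "B \<equiv> end_ring A U"
private abbreviation (input) "TS \<equiv> end_bimod T"
private abbreviation (input) "UB \<equiv> end_bimod U"
private abbreviation (input) "AR \<equiv> ext_bimod A \<iota>"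
private abbreviation (input) "BS \<equiv> ext_bimod (end_ring A U) \<rho>"
private abbreviation (input) "tT M \<equiv> ten (end_ring R T) (right_mod (end_bimod T)) M"
private abbreviation (input) "tU X' \<equiv> ten (end_ring A U) (right_mod (end_bimod U)) X'"
private abbreviation (input) "tA M \<equiv> ten R (right_mod (ext_bimod A \<iota>)) M 1[A]"
private abbreviation (input) "tB M \<equiv> ten (end_ring R T) (right_mod (ext_bimod (end_ring A U) \<rho>)) M (\<lambda>u\<in>carrier U. u)"

private lemmas Tr = right_mod_end[OF ind_simps(2)[OF F I]]
private lemmas Ur = right_mod_end[OF ind_simps(1)[OF F I]]
private lemmas bT = bimod_end[OF ind_simps(2)[OF F I]]
private lemmas bU = bimod_end[OF ind_simps(1)[OF F I]]
private lemmas bA = bimod_ext[OF F]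
private lemmas bB = bimod_ext[OF F']
private lemmas resA = res_lmod[OF frob_simps(1,3)[OF F]]
private lemmas resB = res_lmod[OF frob_simps(1,3)[OF F']]
private lemmas resAl = res_lin[OF frob_simps(1,3)[OF F]]
private lemmas ha = lin_simps(2)[OF ind_simps(3)[OF F I], simplified]
private lemmas ea = lin_simps(2)[OF ind_simps(4)[OF F I], simplified]

text \<open>The decomposition of an element of \<open>U\<close> by the Frobenius system of
  \<open>\<iota>\<close> is linear over the endomorphism ring of \<open>T\<close>, which acts
  through the second factor. So \<open>U\<close> restricted along \<open>\<rho>\<close> lies in the
  additive closure of the right module \<open>T\<close>.\<close>

lemma res_U_addr: "addr (opp_ring S) (right_mod TS) (res \<rho> (right_mod UB))"
proof -
  note rU = res_lmod[OF opp_ring[OF frob_simps(1)[OF F']] ring_hom_opp[OF frob_simps(3)[OF F']] Ur]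
  note u = lmod_simps[OF Um] and xy = frob_simps(7,8)[OF F]
  have "lin (opp_ring S) (res \<rho> (right_mod UB)) (right_mod TS) (%u. e (x k .[U] u))" for k
    by (rule linI[OF rU Tr])
      (simp_all add: u xy ec ea rho_e lin_smult[OF bl[OF \<rho>], symmetric] lin_closed[OF bl[OF \<rho>]])
  moreover have "lin (opp_ring S) (right_mod TS) (res \<rho> (right_mod UB)) (%t. y k .[U] h t)" for k
    by (rule linI[OF Tr rU]) (simp_all add: u xy hc ha \<rho>h lin_smult[OF bl[OF \<rho>]])
  moreover have "lsum (end_bimod U) j g = lsum U j g" for j g by (rule lsum_same) simp_all
  ultimately have "retr (opp_ring S) (right_mod TS) (res \<rho> (right_mod UB)) n (%k u. e (x k .[U] u)) (%k t. y k .[U] h t)"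
    unfolding retr_def using Tr rU ind_simps(6)[OF F I] by simp
  then show ?thesis unfolding addr_def by blast
qed

text \<open>Each functor is covered by one change of rings: Tor of an induced module reduces to Tor
  of the restricted \<open>U\<close>, which is in the additive closure of \<open>T\<close>
  (\<open>res_U_addr\<close>); Ext of an induced module reduces to Ext out of the restricted
  \<open>U\<close>, which is in add T by \<open>a\<close>; the two restrictions use that
  \<open>U\<close> is induced from \<open>T\<close> on either side.\<close>

lemma scalar_functors:
  "is_functor S (KT S TS :: ('t => 't, 'm) module set) B (KT B UB) (tensor_functor S BS)"
  "is_functor B (KT B UB :: (_, 'x) module set) S (KT S TS) (res_functor \<rho>)"
  "is_functor R (KE R TS :: ('r, 'n) module set) A (KE A UB) (tensor_functor R AR)"
  "is_functor A (KE A UB :: ('a, 'y) module set) R (KE R TS) (res_functor \<iota>)"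
proof -
  show "is_functor S (KT S TS :: ('t => 't, 'm) module set) B (KT B UB) (tensor_functor S BS)"
  proof (rule tensor_is_functor[OF bB KT_lmod])
    fix M :: "('t => 't, 'm) module" assume "M : KT S TS"
    then have M: "left_module S M" and t: "tor0 S (right_mod TS) M" by (simp_all add: KT_iff[OF Tr])
    obtain k where J: "ind S B \<rho> E' m x' y' M (tensor_mod S BS M) (ten S (right_mod BS) M 1[B]) k"
      using ind_tensor[OF F' M] by blast
    show "tensor_mod S BS M : KT B UB"
      unfolding KT_iff[OF Ur] using tensor_mod_lmod[OF bB M] tor0_ind[OF F' J Ur tor0_addr[OF M res_U_addr t]] by blast
  qed
  show "is_functor B (KT B UB :: (_, 'x) module set) S (KT S TS) (res_functor \<rho>)"
    by (rule res_is_functor[OF frob_simps(1,3)[OF F']]) (auto simp: KT_iff[OF Tr] KT_iff[OF Ur] intro: resB tor0_res[OF F' I'])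
  show "is_functor R (KE R TS :: ('r, 'n) module set) A (KE A UB) (tensor_functor R AR)"
  proof (rule tensor_is_functor[OF bA KE_lmod])
    fix N :: "('r, 'n) module" assume "N : KE R TS"
    then have N: "left_module R N" and t: "ext0 R T N" by (simp_all add: KE_end_iff[OF Tm])
    obtain k where J: "ind R A \<iota> E n x y N (tensor_mod R AR N) (tA N) k" using ind_tensor[OF F N] by blast
    show "tensor_mod R AR N : KE A UB"
      unfolding KE_end_iff[OF Um] using tensor_mod_lmod[OF bA N] ext0_ind[OF F J Um ext0_addr[OF a t]] by blast
  qed
  show "is_functor A (KE A UB :: ('a, 'y) module set) R (KE R TS) (res_functor \<iota>)"
    by (rule res_is_functor[OF frob_simps(1,3)[OF F]]) (auto simp: KE_end_iff[OF Tm] KE_end_iff[OF Um] intro: resA ext0_res[OF F I])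
qed

text \<open>The adjunction between induction and restriction: maps from \<open>T\<close> extend
  along the unit, and the inverse restricts along it.\<close>

lemma hom_res_compatible:
  fixes C :: "('a, 'y) module set"
  assumes C: "!!Y. Y : C ==> left_module A Y"
  shows "nat_isomorphic A C S (hom_functor R TS \<circ>\<^sub>F res_functor \<iota>) (res_functor \<rho> \<circ>\<^sub>F hom_functor A UB)"
\<comment> \<open>Only functoriality of the composite is at stake here, so all modules serve as the
  intermediate class and the target class is left unrestricted.\<close>
proof (rule nat_isomorphic_lin_isoI[OF is_functor_comp[where D = "{M. left_module R M}" and E = UNIV]])
  show "is_functor A C R {M. left_module R M} (res_functor \<iota>)"
    by (rule res_is_functor[OF frob_simps(1,3)[OF F]]) (simp add: C resA)
  show "is_functor R {M. left_module R M} S UNIV (hom_functor R TS)" by (rule hom_is_functor[OF Tm]) simp_all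
  let ?f = "%Y f. restrict (trc n x y U Y (%u. f (e u))) (carrier U)" and ?g = "%Y g. \<lambda>t\<in>carrier T. g (h t)"
  note [simp] = hom_mod_simps[OF Tm] hom_mod_simps[OF Um]
  have fm: "?f Y f : mod_hom A U Y" and fh: "!!t. t el T ==> ?f Y f (h t) = f t"
    if Y: "left_module A Y" and f: "f : mod_hom R T (res \<iota> Y)" for Y :: "('a, 'y) module" and f
    using restrict_mod_hom[OF ind_ext(1)[OF F I Y mod_hom_lin[OF f Tm resA[OF Y]]]]
      ind_ext(2)[OF F I Y mod_hom_lin[OF f Tm resA[OF Y]]] hc by simp_all
  have eq: "g = g'" if "left_module A Y" "g : mod_hom A U Y" "g' : mod_hom A U Y" "!!t. t el T ==> g (h t) = g' (h t)"
    for Y :: "('a, 'y) module" and g g'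
    by (rule mod_hom_eqI[OF that(2,3)])
      (rule ind_ext_unique[OF F I mod_hom_lin[OF that(2) Um that(1)] mod_hom_lin[OF that(3) Um that(1)] that(4)])
  have gm: "?g Y g : mod_hom R T (res \<iota> Y)" if "left_module A Y" "g : mod_hom A U Y" for Y :: "('a, 'y) module" and g
    by (rule restrict_mod_hom[OF lin_comp[OF ind_simps(3)[OF F I] resAl[OF mod_hom_lin[OF that(2) Um that(1)]]]])
  fix Y assume "Y : C"
  then have Y: "left_module A Y" by (rule C)
  note H = hom_mod_lmod[OF Tm resA[OF Y]] and K = hom_mod_lmod[OF Um Y]
  note rK = resB[OF K]
  note Hs = lmod_simps(2,13)[OF H, unfolded hom_mod_simps(1)[OF Tm]]
    and Ks = lmod_simps(2,13)[OF rK, unfolded res_simps(1) hom_mod_simps(1)[OF Um]]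
  have sc: "s t el T" if "s : mod_hom R T T" "t el T" for s t using lin_closed[OF sl[OF that(1)] that(2)] .
  have f: "lin S (hom_mod R TS (res \<iota> Y)) (res \<rho> (hom_mod A UB Y)) (?f Y)"
  proof (rule linI[OF H rK])
    show "?f Y g el (res \<rho> (hom_mod A UB Y))" if "g el (hom_mod R TS (res \<iota> Y))" for g
      using fm[OF Y] that by simp
    show "?f Y (g +[hom_mod R TS (res \<iota> Y)] g') = ?f Y g +[res \<rho> (hom_mod A UB Y)] ?f Y g'"
      if "g el (hom_mod R TS (res \<iota> Y))" "g' el (hom_mod R TS (res \<iota> Y))" for g g'
    proof -
      have g: "g : mod_hom R T (res \<iota> Y)" "g' : mod_hom R T (res \<iota> Y)" using that by simp_all
      show ?thesis
        by (rule eq[OF Y fm[OF Y Hs(1)[OF g]] Ks(1)[OF fm[OF Y g(1)] fm[OF Y g(2)]]], unfold fh[OF Y Hs(1)[OF g]])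
          (use fh[OF Y g(1)] fh[OF Y g(2)] hc in simp)
    qed
    show "?f Y (s .[hom_mod R TS (res \<iota> Y)] g) = s .[res \<rho> (hom_mod A UB Y)] ?f Y g"
      if s: "s el S" and "g el (hom_mod R TS (res \<iota> Y))" for s g
    proof -
      have g: "g : mod_hom R T (res \<iota> Y)" using that by simp
      show ?thesis
        by (rule eq[OF Y fm[OF Y Hs(2)[OF s g]] Ks(2)[OF s fm[OF Y g]]], unfold fh[OF Y Hs(2)[OF s g]])
          (use fh[OF Y g sc, of s] s hc sc[of s] in "simp add: \<rho>h")
    qed
  qed
  have "lin S (res \<rho> (hom_mod A UB Y)) (hom_mod R TS (res \<iota> Y)) (?g Y)"
    by (rule linI[OF rK H]) (use gm[OF Y] hc sc in "auto simp: fun_eq_iff \<rho>h")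
  then show "lin_iso S (obj (hom_functor R TS \<circ>\<^sub>F res_functor \<iota>) Y) (obj (res_functor \<rho> \<circ>\<^sub>F hom_functor A UB) Y) (?f Y) (?g Y)"
    unfolding lin_iso_def comp_functor_def hom_functor_def res_functor_def mod_functor.simps
  proof (intro conjI ballI f)
    show "?g Y (?f Y k) = k" if "k el (hom_mod R TS (res \<iota> Y))" for k
    proof
      fix t show "?g Y (?f Y k) t = k t"
        using fh[OF Y, of k t] hc[of t] mod_hom_arb[of k R T "res \<iota> Y" t] that by (cases "t el T") simp_all
    qed
    show "?f Y (?g Y k) = k" if "k el (res \<rho> (hom_mod A UB Y))" for k
      by (rule eq[OF Y fm[OF Y gm[OF Y]]]) (use that fh[OF Y gm[OF Y, of k]] in simp_all)
  qed
  fix Y' f k assume "Y' : C" and f: "f : mod_hom A Y Y'" and "k el (obj (hom_functor R TS \<circ>\<^sub>F res_functor \<iota>) Y)"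
  then have Y': "left_module A Y'" and k: "k : mod_hom R T (res \<iota> Y)" by (simp_all add: C comp_functor_def hom_functor_def res_functor_def)
  note fl = mod_hom_lin[OF f Y Y']
  have "compose (carrier T) f k : mod_hom R T (res \<iota> Y')"
    using restrict_mod_hom[OF lin_comp[OF mod_hom_lin[OF k Tm resA[OF Y]] resAl[OF fl]]] by (simp add: compose_def)
  moreover have "compose (carrier U) f (?f Y k) : mod_hom A U Y'"
    using compose_mod_hom[OF fm[OF Y k] f Um Y Y'] .
  ultimately have "?f Y' (compose (carrier T) f k) = compose (carrier U) f (?f Y k)"
  proof (intro eq[OF Y' fm[OF Y']])
    fix t assume t: "t el T" and c: "compose (carrier T) f k : mod_hom R T (res \<iota> Y')"
    show "?f Y' (compose (carrier T) f k) (h t) = compose (carrier U) f (?f Y k) (h t)"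
      unfolding fh[OF Y' c t] using fh[OF Y k t] t hc[OF t] by (simp add: compose_def)
  qed assumption+
  then show "?f Y' (arr (hom_functor R TS \<circ>\<^sub>F res_functor \<iota>) Y Y' f k) = arr (res_functor \<rho> \<circ>\<^sub>F hom_functor A UB) Y Y' f (?f Y k)"
    using k fm[OF Y k] by (simp add: comp_functor_def hom_functor_def res_functor_def mod_hom_end_bimod[OF Tm] mod_hom_end_bimod[OF Um])
qed

text \<open>The right module \<open>U\<close> is induced from \<open>T\<close> along
  \<open>\<rho>\<close>, so the ring change cancels by \<open>tensor_res_iso\<close>; on pure
  tensors the map applies the unit to the first factor.\<close>

lemma tensor_res_compatible:
  fixes C :: "('u => 'u, 'x) module set"
  assumes C: "!!M. M : C ==> left_module B M"
  shows "nat_isomorphic B C R (tensor_functor S TS \<circ>\<^sub>F res_functor \<rho>) (res_functor \<iota> \<circ>\<^sub>F tensor_functor B UB)"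
proof -
  let ?T = "tensor_functor S TS \<circ>\<^sub>F res_functor \<rho>"
  have "EX f g. lin_iso R (tensor_mod S TS (res \<rho> M)) (res \<iota> (tensor_mod B UB M)) f g &
      (ALL t:carrier T. ALL w:carrier M. f (tT (res \<rho> M) t w) = tU M (h t) w)" if "M : C" for M
  proof -
    note M = C[OF that] and Mr = resB[OF C[OF that]]
    let ?G = "tgr S (right_mod TS) (res \<rho> M)" and ?W = "tensor_mod B UB M"
    obtain f g where i: "add_iso ?G (tgr B (right_mod UB) M) f g"
      and ft: "ALL t:carrier (right_mod TS). ALL w:carrier M. f (tT (res \<rho> M) t w) = tU M (h t) w"
      using tensor_res_iso[OF F' I' M] by blast
    have "lin R (tensor_mod S TS (res \<rho> M)) (res \<iota> ?W) f"
    proof (rule tensor_mod_linI[OF bT Mr resA[OF tensor_mod_lmod[OF bU M]]])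
      show "addm ?G (res \<iota> ?W) f" using i by (simp add: add_iso_def addm_res addm_tensor_mod)
      show "f (tT (res \<rho> M) (r .[TS] t) w) = r .[res \<iota> ?W] f (tT (res \<rho> M) t w)"
        if "r el R" "t el TS" "w el (res \<rho> M)" for r t w
        using that ft tensor_mod_smult_ten[OF bU M, of "\<iota> r" "h t" w] frob_simps(11)[OF F] ind_simps(9)[OF F I] hc lmod_simps(13)[OF Tm]
        by simp
    qed
    note fl = this
    have ga: "addm (tgr B (right_mod UB) M) ?G g" using i by (simp add: add_iso_def)
    have "lin_iso R (tensor_mod S TS (res \<rho> M)) (res \<iota> ?W) f g"
      by (rule lin_isoI[OF fl]) (use i addm_simps(1)[OF ga] in "simp_all add: add_iso_def tensor_mod_simps")
    then show ?thesis using ft by (intro exI[of _ f] exI[of _ g]) simp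
  qed
  then have "ALL M:C. EX f g. lin_iso R (tensor_mod S TS (res \<rho> M)) (res \<iota> (tensor_mod B UB M)) f g &
      (ALL t:carrier T. ALL w:carrier M. f (tT (res \<rho> M) t w) = tU M (h t) w)" by blast
  then obtain f g where fg: "ALL M:C. lin_iso R (tensor_mod S TS (res \<rho> M)) (res \<iota> (tensor_mod B UB M)) (f M) (g M) &
      (ALL t:carrier T. ALL w:carrier M. f M (tT (res \<rho> M) t w) = tU M (h t) w)" by (elim bchoice2[THEN exE] exE)
  show ?thesis
  proof (rule nat_isomorphic_lin_isoI[OF is_functor_comp[where D = "{M. left_module S M}" and E = UNIV], where h = f and g = g])
    show "is_functor B C S {M. left_module S M} (res_functor \<rho>)"
      by (rule res_is_functor[OF frob_simps(1,3)[OF F']]) (simp add: C resB)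
    show "is_functor S {M. left_module S M} R UNIV (tensor_functor S TS)" by (rule tensor_is_functor[OF bT]) simp_all
    fix M assume M: "M : C"
    show "lin_iso R (obj ?T M) (obj (res_functor \<iota> \<circ>\<^sub>F tensor_functor B UB) M) (f M) (g M)"
      using fg M by (simp add: comp_functor_def tensor_functor_def res_functor_def)
    fix N k z assume N: "N : C" and k: "k : mod_hom B M N" and z: "z el (obj ?T M)"
    note kl = mod_hom_lin[OF k C[OF M] C[OF N]]
    note kr = res_lin[OF frob_simps(1,3)[OF F'] kl]
    note lM = lin_isoD(1)[OF conjunct1[OF bspec[OF fg M]]] and lN = lin_isoD(1)[OF conjunct1[OF bspec[OF fg N]]]
    have "f N (tensor_map S (right_mod TS) (res \<rho> M) (right_mod TS) (res \<rho> N) (%t. t) k z) =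
        tensor_map B (right_mod UB) M (right_mod UB) N (%t. t) k (f M z)"
    proof (rule tensor_mod_eqI[OF bT resB[OF C[OF M]] lin_comp[OF tensor_mod_map[OF bT kr] lN] lin_comp[OF lM resAl[OF tensor_mod_map[OF bU kl]]]])
      fix t w assume "t el TS" "w el (res \<rho> M)"
      then show "f N (tensor_map S (right_mod TS) (res \<rho> M) (right_mod TS) (res \<rho> N) (%t. t) k (tT (res \<rho> M) t w)) =
          tensor_map B (right_mod UB) M (right_mod UB) N (%t. t) k (f M (tT (res \<rho> M) t w))"
        using tensor_map_addm(2)[OF lin_id[OF Tr] kr, of t w] tensor_map_addm(2)[OF lin_id[OF Ur] kl, of "h t" w] fg M N hc lin_closed[OF kl] by simp
    qed (use z in "simp add: comp_functor_def tensor_functor_def res_functor_def")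
    then show "f N (arr ?T M N k z) = arr (res_functor \<iota> \<circ>\<^sub>F tensor_functor B UB) M N k (f M z)"
      by (simp add: comp_functor_def tensor_functor_def res_functor_def)
  qed
qed

text \<open>No direct chain of associativity isomorphisms is used. The module \<open>?W\<close> is
  shown to be induced from \<open>?G\<close> along \<open>\<iota>\<close>, with a unit and a counit
  that apply \<open>h\<close> and \<open>e\<close> to the first factor; induced modules are unique
  up to isomorphism.\<close>

lemma tensor_tensor_iso:
  fixes M :: "('t => 't, 'm) module"
  assumes M: "left_module S M"
  shows "EX f g. lin_iso A (tensor_mod R AR (tensor_mod S TS M)) (tensor_mod B UB (tensor_mod S BS M)) f g &
    (ALL t:carrier T. ALL w:carrier M. f (tA (tensor_mod S TS M) (tT M t w)) = tU (tensor_mod S BS M) (h t) (tB M w))"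
proof -
  let ?R = "right_mod UB"
  let ?G = "tensor_mod S TS M" and ?V = "tensor_mod S BS M"
  let ?W = "tensor_mod B UB ?V"
  obtain k where J: "ind S B \<rho> E' m x' y' M ?V (tB M) k" using ind_tensor[OF F' M] by auto
  note Gm = tensor_mod_lmod[OF bT M] and Vm = ind_simps(1)[OF F' J]
  note Wm = tensor_mod_lmod[OF bU Vm] and hV = ind_simps(7)[OF F' J] and hVs = ind_simps(9)[OF F' J]
  note hVa = lin_simps(2)[OF ind_simps(3)[OF F' J], simplified]
  note rU = res_lmod[OF opp_ring[OF frob_simps(1)[OF F']] ring_hom_opp[OF frob_simps(3)[OF F']] Ur]
  note el = ind_simps(4)[OF frob_opp[OF F'] I']
  obtain \<phi> \<psi> where i: "add_iso (tgr S (res \<rho> ?R) M) (tgr B ?R ?V) \<phi> \<psi>"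
    and \<phi>t: "ALL u:carrier ?R. ALL w:carrier M. \<phi> (ten S (res \<rho> ?R) M u w) = tU ?V u (tB M w)"
    using tensor_ind_iso[OF F' J Ur] by blast
  note \<phi> = i[unfolded add_iso_def, THEN conjunct1] and \<psi> = i[unfolded add_iso_def, THEN conjunct2, THEN conjunct1]
  \<comment> \<open>Since \<open>?W\<close> is the tensor product of \<open>U\<close> with
    \<open>M\<close> over the smaller ring, additive maps on it may be compared on tensors whose
    second factor is a unit \<open>tB M w\<close>.\<close>
  have eqW: "f z = g z" if f: "addm ?W Q f" and g: "addm ?W Q g"
    and eq: "!!u w. [| u el U; w el M |] ==> f (tU ?V u (tB M w)) = g (tU ?V u (tB M w))" and z: "z el ?W" for Q f g z
  proof -
    have zz: "z el (tgr B ?R ?V)" using z by (simp add: tensor_mod_simps)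
    have "f (\<phi> (\<psi> z)) = g (\<phi> (\<psi> z))"
      by (rule ten_eqI[OF rU M addm_comp[OF \<phi> f[unfolded addm_tensor_mod]] addm_comp[OF \<phi> g[unfolded addm_tensor_mod]]])
        (use \<phi>t eq addm_simps(1)[OF \<psi> zz] in simp_all)
    then show ?thesis using i zz by (simp add: add_iso_def)
  qed
  note ub = ten_balanced[OF Ur Vm] and ul = ten_add_l[OF Ur Vm] and ur = ten_add_r[OF Ur Vm] and uc = ten_closed[OF Ur Vm]
  have us: "c .[?W] tU ?V u v = tU ?V (c .[U] u) v" if "c el A" "u el U" "v el ?V" for c u v
    using tensor_mod_smult_ten[OF bU Vm that(1), of u v] that by simp
  have ts: "r .[?G] tT M t w = tT M (r .[T] t) w" if "r el R" "t el T" "w el M" for r t w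
    using tensor_mod_smult_ten[OF bT M that(1), of t w] that by simp
  have "EX \<eta>. lin R ?G (res \<iota> ?W) \<eta> & (ALL t:carrier TS. ALL w:carrier M. \<eta> (tT M t w) = tU ?V (h t) (tB M w))"
  proof (rule tensor_mod_lift[OF bT M resA[OF Wm]])
    show "tU ?V (h (rsmult TS t s)) (tB M w) = tU ?V (h t) (tB M (s .[M] w))"
      if "s el S" "t el TS" "w el M" for s t w
      using that ub[of "\<rho> s" "h t" "tB M w"] hV hc \<rho> by (simp add: hVs \<rho>h)
  qed (use hV hc uc ul ur us frob_simps(11)[OF F] ind_simps(9)[OF F I] in "simp_all add: tensor_mod_simps ha hVa")
  then obtain \<eta> where \<eta>: "lin R ?G (res \<iota> ?W) \<eta>"
    and \<eta>t: "!!t w. [| t el T; w el M |] ==> \<eta> (tT M t w) = tU ?V (h t) (tB M w)" by auto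
  define \<epsilon> where "\<epsilon> z = tmp S M (res \<rho> ?R) (right_mod TS) e (\<psi> z)" for z
  have \<epsilon>a: "addm ?W ?G \<epsilon>" using addm_comp[OF \<psi> tmp_addm[OF M el]] by (simp add: \<epsilon>_def[abs_def] addm_tensor_mod)
  have \<epsilon>t: "\<epsilon> (tU ?V u (tB M w)) = tT M (e u) w" if "u el U" "w el M" for u w
  proof -
    have "\<psi> (tU ?V u (tB M w)) = ten S (res \<rho> ?R) M u w"
      using \<phi>t i that ten_closed[OF rU M, of u w] by (simp add: add_iso_def flip: bspec[OF bspec[OF \<phi>t]])
    then show ?thesis using tmp_ten[OF M el, of u w] that by (simp add: \<epsilon>_def)
  qed
  have \<epsilon>s: "\<epsilon> (\<iota> r .[?W] z) = r .[?G] \<epsilon> z" if r: "r el R" and z: "z el ?W" for r z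
  proof (rule eqW[OF addm_comp[OF smult_addm[OF Wm] \<epsilon>a] addm_comp[OF \<epsilon>a smult_addm[OF Gm]] _ z])
    show "\<epsilon> (\<iota> r .[?W] tU ?V u (tB M w)) = r .[?G] \<epsilon> (tU ?V u (tB M w))" if "u el U" "w el M" for u w
      using that r frob_simps(11)[OF F] hV lmod_simps(13)[OF Um] ec by (simp add: us \<epsilon>t ts ind_simps(10)[OF F I])
  qed (use r frob_simps(11)[OF F] in simp_all)
  have \<epsilon>: "lin R (res \<iota> ?W) ?G \<epsilon>" unfolding lin_def using resA[OF Wm] Gm \<epsilon>a \<epsilon>s by (simp add: addm_res)
  have c1: "\<epsilon> (c .[?W] \<eta> z) = E c .[?G] z" if c: "c el A" and z: "z el ?G" for c z
  proof (rule ten_eqI[OF Tr M, of ?G "%z. \<epsilon> (c .[?W] \<eta> z)" "%z. E c .[?G] z"])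
    show "addm (tgr S (right_mod TS) M) ?G (%z. \<epsilon> (c .[?W] \<eta> z))"
      using addm_comp[OF addm_comp[OF lin_addm[OF \<eta>, unfolded addm_res] smult_addm[OF Wm c]] \<epsilon>a] by (simp add: addm_tensor_mod)
    show "addm (tgr S (right_mod TS) M) ?G (%z. E c .[?G] z)"
      using smult_addm[OF Gm frob_simps(12)[OF F c]] by (simp add: addm_tensor_mod)
    show "\<epsilon> (c .[?W] \<eta> (tT M t w)) = E c .[?G] tT M t w" if "t el (right_mod TS)" "w el M" for t w
      using that c hV hc lmod_simps(13)[OF Um c] frob_simps(12)[OF F] by (simp add: \<eta>t us \<epsilon>t ts ind_simps(5)[OF F I])
  qed (use z in "simp add: tensor_mod_simps")
  have c2: "lsum ?W n (%k. y k .[?W] \<eta> (\<epsilon> (x k .[?W] z))) = z" if z: "z el ?W" for z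
  proof (rule eqW[OF _ addm_id[OF lmod_ag[OF Wm]] _ z])
    show "addm ?W ?W (%z. lsum ?W n (%k. y k .[?W] \<eta> (\<epsilon> (x k .[?W] z))))"
      by (intro addm_lsum_maps lmod_ag[OF Wm] addm_comp[OF addm_comp[OF addm_comp[OF smult_addm[OF Wm] \<epsilon>a]
        lin_addm[OF \<eta>, unfolded addm_res]] smult_addm[OF Wm]] frob_simps(7,8)[OF F])
    fix u w assume *: "u el U" "w el M"
    note s = lmod_simps(13)[OF Um] and xy = frob_simps(7,8)[OF F]
    have "lsum ?W n (%k. y k .[?W] \<eta> (\<epsilon> (x k .[?W] tU ?V u (tB M w)))) = lsum ?W n (%k. tU ?V (y k .[U] h (e (x k .[U] u))) (tB M w))"
      using * hV hc ec s xy by (simp add: us \<epsilon>t \<eta>t)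
    also have "\<dots> = tU ?V (lsum ?R n (%k. y k .[U] h (e (x k .[U] u)))) (tB M w)"
      unfolding lsum_tensor_mod by (rule addm_lsum[OF ten_addm_l[OF Ur Vm], symmetric]) (use * hV hc ec s xy in simp_all)
    also have "lsum ?R n (%k. y k .[U] h (e (x k .[U] u))) = u"
      using ind_simps(6)[OF F I *(1)] lsum_same[of "end_bimod U" U] by simp
    finally show "lsum ?W n (%k. y k .[?W] \<eta> (\<epsilon> (x k .[?W] tU ?V u (tB M w)))) = tU ?V u (tB M w)" .
  qed
  have K: "ind R A \<iota> E n x y ?G ?W \<eta> \<epsilon>" unfolding ind_def using Wm \<eta> \<epsilon> c1 c2 by blast
  obtain j where L: "ind R A \<iota> E n x y ?G (tensor_mod R AR ?G) (tA ?G) j" using ind_tensor[OF F Gm] by blast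
  have "trc n x y (tensor_mod R AR ?G) ?W (%u. \<eta> (j u)) (tA ?G (tT M t w)) = tU ?V (h t) (tB M w)"
    if "t el T" "w el M" for t w
    using ind_ext(2)[OF F L Wm \<eta>, of "tT M t w"] ten_closed[OF Tr M, of t w] that by (simp add: \<eta>t tensor_mod_simps)
  then show ?thesis using ind_lin_iso[OF F L K] by blast
qed

text \<open>Naturality is checked first on units, by uniqueness of extensions from
  \<open>tensor_ext_eqI\<close>, and there on pure tensors.\<close>

lemma tensor_compatible:
  fixes C :: "('t => 't, 'm) module set"
  assumes C: "!!M. M : C ==> left_module S M"
  shows "nat_isomorphic S C A (tensor_functor R AR \<circ>\<^sub>F tensor_functor S TS) (tensor_functor B UB \<circ>\<^sub>F tensor_functor S BS)"
proof -
  let ?T = "tensor_functor R AR \<circ>\<^sub>F tensor_functor S TS"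
  have "ALL M:C. EX f g. lin_iso A (tensor_mod R AR (tensor_mod S TS M)) (tensor_mod B UB (tensor_mod S BS M)) f g &
    (ALL t:carrier T. ALL w:carrier M. f (tA (tensor_mod S TS M) (tT M t w)) = tU (tensor_mod S BS M) (h t) (tB M w))"
    by (intro ballI tensor_tensor_iso C)
  then obtain f g where fg: "ALL M:C. lin_iso A (tensor_mod R AR (tensor_mod S TS M)) (tensor_mod B UB (tensor_mod S BS M)) (f M) (g M) &
    (ALL t:carrier T. ALL w:carrier M. f M (tA (tensor_mod S TS M) (tT M t w)) = tU (tensor_mod S BS M) (h t) (tB M w))"
    by (elim bchoice2[THEN exE] exE)
  show ?thesis
  proof (rule nat_isomorphic_lin_isoI[OF is_functor_comp[where D = "{M. left_module R M}" and E = UNIV], where h = f and g = g])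
    show "is_functor S C R {M. left_module R M} (tensor_functor S TS)"
      by (rule tensor_is_functor[OF bT C]) (simp_all add: C tensor_mod_lmod[OF bT])
    show "is_functor R {M. left_module R M} A UNIV (tensor_functor R AR)" by (rule tensor_is_functor[OF bA]) simp_all
    fix M assume M: "M : C"
    show "lin_iso A (obj ?T M) (obj (tensor_functor B UB \<circ>\<^sub>F tensor_functor S BS) M) (f M) (g M)"
      using fg M by (simp add: comp_functor_def tensor_functor_def)
    fix N k z assume N: "N : C" and k: "k : mod_hom S M N" and z: "z el (obj ?T M)"
    note Mm = C[OF M] and Nm = C[OF N]
    note kl = mod_hom_lin[OF k Mm Nm]
    note kT = tensor_mod_map[OF bT kl] and kB = tensor_mod_map[OF bB kl]
    note kA = tensor_mod_map[OF bA kT] and kU = tensor_mod_map[OF bU kB]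
    note lM = lin_isoD(1)[OF conjunct1[OF bspec[OF fg M]]] and lN = lin_isoD(1)[OF conjunct1[OF bspec[OF fg N]]]
    let ?kT = "tensor_map S (right_mod TS) M (right_mod TS) N (%t. t) k"
    let ?kB = "tensor_map S (right_mod BS) M (right_mod BS) N (%t. t) k"
    let ?kA = "tensor_map R (right_mod AR) (tensor_mod S TS M) (right_mod AR) (tensor_mod S TS N) (%t. t) ?kT"
    let ?kU = "tensor_map B (right_mod UB) (tensor_mod S BS M) (right_mod UB) (tensor_mod S BS N) (%t. t) ?kB"
    obtain j where JM: "ind R A \<iota> E n x y (tensor_mod S TS M) (tensor_mod R AR (tensor_mod S TS M)) (tA (tensor_mod S TS M)) j"
      using ind_tensor[OF F tensor_mod_lmod[OF bT Mm]] by blast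
    obtain j' where BM: "ind S B \<rho> E' m x' y' M (tensor_mod S BS M) (tB M) j'" using ind_tensor[OF F' Mm] by auto
    note hl = ind_simps(3)[OF F JM]
    have one: "1[A] el (right_mod AR)" "(\<lambda>u\<in>carrier U. u) el (right_mod BS)"
      using ring_rules(13)[OF frob_simps(2)[OF F]] restrict_mod_hom[OF lin_id[OF Um]] by (simp_all add: ext_bimod_def)
    have "f N (?kA (tA (tensor_mod S TS M) v)) = ?kU (f M (tA (tensor_mod S TS M) v))" if v: "v el (tensor_mod S TS M)" for v
    proof (rule tensor_mod_eqI[OF bT Mm lin_comp[OF hl resAl[OF lin_comp[OF kA lN]]] lin_comp[OF hl resAl[OF lin_comp[OF lM kU]]] _ v])
      fix t w assume "t el TS" and w: "w el M"
      then have t: "t el T" by simp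
      have "?kA (tA (tensor_mod S TS M) (tT M t w)) = tA (tensor_mod S TS N) (tT N t (k w))"
        using tensor_map_addm(2)[OF lin_id[OF bimod_right[OF bA]] kT one(1), of "tT M t w"] ten_closed[OF Tr Mm, of t w] t w
          tensor_map_addm(2)[OF lin_id[OF Tr] kl, of t w] by (simp add: tensor_mod_simps)
      moreover have "?kU (tU (tensor_mod S BS M) (h t) (tB M w)) = tU (tensor_mod S BS N) (h t) (tB N (k w))"
        using tensor_map_addm(2)[OF lin_id[OF Ur] kB, of "h t" "tB M w"] ind_simps(7)[OF F' BM w] hc[OF t] w
          tensor_map_addm(2)[OF lin_id[OF bimod_right[OF bB]] kl one(2), of w] by simp
      ultimately show "f N (?kA (tA (tensor_mod S TS M) (tT M t w))) = ?kU (f M (tA (tensor_mod S TS M) (tT M t w)))"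
        using fg M N t w lin_closed[OF kl w] by simp
    qed
    then have "f N (?kA z) = ?kU (f M z)"
      by (rule tensor_ext_eqI[OF F tensor_mod_lmod[OF bT Mm] lin_comp[OF kA lN] lin_comp[OF lM kU]])
        (use z in "simp_all add: comp_functor_def tensor_functor_def")
    then show "f N (arr ?T M N k z) = arr (tensor_functor B UB \<circ>\<^sub>F tensor_functor S BS) M N k (f M z)"
      by (simp add: comp_functor_def tensor_functor_def)
  qed
qed

text \<open>The group \<open>Hom(U, V)\<close> with \<open>V\<close> induced from \<open>N\<close>
  is itself induced from \<open>Hom(T, N)\<close> along \<open>\<rho>\<close>: the unit
  \<open>\<eta>\<close> sends a map to the induced map, and the counit \<open>\<epsilon>\<close>
  composes with the unit of \<open>U\<close> and the counit of \<open>V\<close>.\<close>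

lemma hom_tensor_iso:
  fixes N :: "('r, 'n) module"
  assumes N: "left_module R N"
  shows "EX f g. lin_iso B (tensor_mod S BS (hom_mod R TS N)) (hom_mod A UB (tensor_mod R AR N)) f g &
    (ALL k:mod_hom R T N. ALL t:carrier T. f (tB (hom_mod R TS N) k) (h t) = tA N (k t))"
proof -
  let ?V = "tensor_mod R AR N"
  let ?H = "hom_mod R TS N" and ?K = "hom_mod A UB (tensor_mod R AR N)"
  obtain j where J: "ind R A \<iota> E n x y N ?V (tA N) j" using ind_tensor[OF F N] by blast
  note Vm = ind_simps(1)[OF F J]
  note H = hom_mod_lmod[OF Tm N] and K = hom_mod_lmod[OF Um Vm]
  note rK = resB[OF K]
  note Hs = lmod_simps(2,13)[OF H, unfolded hom_mod_simps(1)[OF Tm]]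
    and Ks = lmod_simps(2,13)[OF rK, unfolded res_simps(1) hom_mod_simps(1)[OF Um]]
    and Kb = lmod_simps(13)[OF K, unfolded hom_mod_simps(1)[OF Um]]
  note hs = hom_mod_simps[OF Tm] hom_mod_simps[OF Um]
  have sc: "s t el T" if "s : mod_hom R T T" "t el T" for s t using lin_closed[OF sl[OF that(1)] that(2)] .
  have bc: "b u el U" if "b : mod_hom A U U" "u el U" for b u using lin_closed[OF bl[OF that(1)] that(2)] .
  note kl = mod_hom_lin[OF _ Tm N] and gl = mod_hom_lin[OF _ Um Vm]
  define \<eta> where "\<eta> k = restrict (trc n x y U ?V (%u. tA N (k (e u)))) (carrier U)" for k
  define \<epsilon> where "\<epsilon> g = (\<lambda>t\<in>carrier T. j (g (h t)))" for g
  have \<eta>m: "\<eta> k : mod_hom A U ?V" and \<eta>h: "!!t. t el T ==> \<eta> k (h t) = tA N (k t)"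
    and \<eta>j: "!!u. u el U ==> j (\<eta> k u) = k (e u)" if k: "k : mod_hom R T N" for k
    using ind_map[OF F I J kl[OF k]] restrict_mod_hom[OF ind_map(1)[OF F I J kl[OF k]]] hc by (simp_all add: \<eta>_def)
  have \<epsilon>m: "\<epsilon> g : mod_hom R T N" if g: "g : mod_hom A U ?V" for g
    unfolding \<epsilon>_def by (rule restrict_mod_hom[OF lin_comp[OF lin_comp[OF ind_simps(3)[OF F I] resAl[OF gl[OF g]]] ind_simps(4)[OF F J]]])
  have eq: "g = g'" if "g : mod_hom A U ?V" "g' : mod_hom A U ?V" "!!t. t el T ==> g (h t) = g' (h t)" for g g'
    by (rule mod_hom_eqI[OF that(1,2)]) (rule ind_ext_unique[OF F I gl[OF that(1)] gl[OF that(2)] that(3)])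
  have eq2: "g = g'" if "g : mod_hom A U ?V" "g' : mod_hom A U ?V" "!!u. u el U ==> j (g u) = j (g' u)" for g g'
    by (rule mod_hom_eqI[OF that(1,2)]) (rule ind_coext_unique[OF F J gl[OF that(1)] gl[OF that(2)] that(3)])
  have hVa: "tA N (v +[N] w) = tA N v +[?V] tA N w" if "v el N" "w el N" for v w
    using lin_simps(2)[OF ind_simps(3)[OF F J]] that by simp
  have ja: "j (v +[?V] w) = j v +[N] j w" if "v el ?V" "w el ?V" for v w
    using lin_simps(2)[OF ind_simps(4)[OF F J]] that by simp
  have \<eta>: "lin S ?H (res \<rho> ?K) \<eta>"
  proof (rule linI[OF H rK], unfold res_simps(1) hom_mod_simps(1)[OF Tm] hom_mod_simps(1)[OF Um])
    show "\<eta> k : mod_hom A U ?V" if "k : mod_hom R T N" for k by (rule \<eta>m[OF that])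
    show "\<eta> (k +[?H] l) = \<eta> k +[res \<rho> ?K] \<eta> l" if k: "k : mod_hom R T N" "l : mod_hom R T N" for k l
      by (rule eq[OF \<eta>m[OF Hs(1)[OF k]] Ks(1)[OF \<eta>m[OF k(1)] \<eta>m[OF k(2)]]], unfold \<eta>h[OF Hs(1)[OF k]])
        (use \<eta>h[OF k(1)] \<eta>h[OF k(2)] hc lin_closed[OF kl[OF k(1)]] lin_closed[OF kl[OF k(2)]] in "simp add: hs hVa")
    show "\<eta> (s .[?H] k) = s .[res \<rho> ?K] \<eta> k" if s: "s el S" and k: "k : mod_hom R T N" for s k
      by (rule eq[OF \<eta>m[OF Hs(2)[OF s k]] Ks(2)[OF s \<eta>m[OF k]]], unfold \<eta>h[OF Hs(2)[OF s k]])
        (use \<eta>h[OF k sc] s hc sc in "simp add: hs \<rho>h")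
  qed
  have \<epsilon>: "lin S (res \<rho> ?K) ?H \<epsilon>"
    by (rule linI[OF rK H]) (use \<epsilon>m hc sc lin_closed[OF gl] in "auto simp: hs \<epsilon>_def fun_eq_iff \<rho>h ja")
  have c1: "\<epsilon> (b .[?K] \<eta> k) = E' b .[?H] k" if b: "b : mod_hom A U U" and k: "k : mod_hom R T N" for b k
    using hc bc[OF b] by (auto simp: hs \<epsilon>_def E'[OF b] \<eta>j[OF k] fun_eq_iff)
  have xB: "x' i : mod_hom A U U" and yB: "y' i : mod_hom A U U" for i
    using frob_simps(7,8)[OF F', of i] by simp_all
  have lK: "lsum ?K i f u = lsum ?V i (%k. f k u)" if "u el U" for i f u
    using that by (induction i) (simp_all add: hs)
  \<comment> \<open>Tested through the counit \<open>j\<close>: there each summand becomes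
    \<open>j\<close> of \<open>g\<close> at a term of the dual basis decomposition of
    \<open>u\<close> over the endomorphism rings.\<close>
  have c2: "lsum ?K m (%k. y' k .[?K] \<eta> (\<epsilon> (x' k .[?K] g))) = g" if g: "g : mod_hom A U ?V" for g
  proof (rule eq2[OF _ g])
    have xg: "x' k .[?K] g : mod_hom A U ?V" for k by (rule Kb) (use xB g in simp_all)
    note em = \<eta>m[OF \<epsilon>m[OF xg]]
    have yk: "y' k .[?K] \<eta> (\<epsilon> (x' k .[?K] g)) : mod_hom A U ?V" for k by (rule Kb) (use yB em in simp_all)
    show "lsum ?K m (%k. y' k .[?K] \<eta> (\<epsilon> (x' k .[?K] g))) : mod_hom A U ?V"
      by (rule lsum_closed[OF lmod_ag[OF K], unfolded hom_mod_simps(1)[OF Um]]) (rule yk)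
    fix u assume u: "u el U"
    note yu = bc[OF yB u]
    have gj: "lin R (res \<iota> U) N (%u. j (g u))" by (rule lin_comp[OF resAl[OF gl[OF g]] ind_simps(4)[OF F J]])
    have v: "(y' k .[?K] \<eta> (\<epsilon> (x' k .[?K] g))) u = \<eta> (\<epsilon> (x' k .[?K] g)) (y' k u)" for k using u by (simp add: hs)
    have "j (lsum ?K m (%k. y' k .[?K] \<eta> (\<epsilon> (x' k .[?K] g))) u) = lsum N m (%k. j (\<eta> (\<epsilon> (x' k .[?K] g)) (y' k u)))"
      unfolding lK[OF u] v by (rule lin_lsum_apply[OF ind_simps(4)[OF F J], simplified]) (rule lin_closed[OF gl[OF em] yu])
    also have "\<dots> = lsum N m (%k. \<epsilon> (x' k .[?K] g) (e (y' k u)))" by (simp add: \<eta>j[OF \<epsilon>m[OF xg] yu])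
    also have "\<dots> = lsum N m (%k. j (g (x' k (h (e (y' k u))))))" using ec[OF yu] hc by (simp add: \<epsilon>_def hs)
    also have "\<dots> = j (g (lsum U m (%k. x' k (h (e (y' k u))))))"
      using lin_lsum_apply[OF gj, of m "%k. x' k (h (e (y' k u)))"] bc[OF xB hc[OF ec[OF yu]]] by simp
    also have "lsum U m (%k. x' k (h (e (y' k u)))) = u"
      using ind_simps(6)[OF frob_opp[OF F'] I', of u] lsum_same[of "end_bimod U" U] u by simp
    finally show "j (lsum ?K m (%k. y' k .[?K] \<eta> (\<epsilon> (x' k .[?K] g))) u) = j (g u)" .
  qed
  have L: "ind S B \<rho> E' m x' y' ?H ?K \<eta> \<epsilon>" unfolding ind_def using K \<eta> \<epsilon> c1 c2 by (simp add: hs(1,5))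
  obtain i where W: "ind S B \<rho> E' m x' y' ?H (tensor_mod S BS ?H) (tB ?H) i" using ind_tensor[OF F' H] by auto
  have "trc m x' y' (tensor_mod S BS ?H) ?K (%u. \<eta> (i u)) (tB ?H k) (h t) = tA N (k t)"
    if k: "k : mod_hom R T N" and t: "t el T" for k t
    using ind_ext(2)[OF F' W K \<eta>, of k] \<eta>h[OF k t] k by (simp add: hs(1))
  then show ?thesis using ind_lin_iso[OF F' W L] by blast
qed

text \<open>On both sides a map is fixed by its values at the units, first those of the extended Hom
  module and then those of \<open>U\<close>; at these places both composites are the unit of the
  image of \<open>l t\<close> under \<open>k\<close>.\<close>

lemma hom_compatible:
  fixes C :: "('r, 'n) module set"
  assumes C: "!!N. N : C ==> left_module R N"
  shows "nat_isomorphic R C B (tensor_functor S BS \<circ>\<^sub>F hom_functor R TS) (hom_functor A UB \<circ>\<^sub>F tensor_functor R AR)"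
proof -
  let ?T = "tensor_functor S BS \<circ>\<^sub>F hom_functor R TS"
  have "ALL N:C. EX f g. lin_iso B (tensor_mod S BS (hom_mod R TS N)) (hom_mod A UB (tensor_mod R AR N)) f g &
    (ALL k:mod_hom R T N. ALL t:carrier T. f (tB (hom_mod R TS N) k) (h t) = tA N (k t))"
    by (intro ballI hom_tensor_iso C)
  then obtain f g where fg: "ALL N:C. lin_iso B (tensor_mod S BS (hom_mod R TS N)) (hom_mod A UB (tensor_mod R AR N)) (f N) (g N) &
    (ALL k:mod_hom R T N. ALL t:carrier T. f N (tB (hom_mod R TS N) k) (h t) = tA N (k t))"
    by (elim bchoice2[THEN exE] exE)
  note hs = hom_mod_simps[OF Tm] hom_mod_simps[OF Um]
  have fT: "is_functor R C S {M. left_module S M} (hom_functor R TS)"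
    by (rule hom_is_functor[OF Tm C]) (simp_all add: C hom_mod_lmod[OF Tm])
  have fU: "is_functor A {M :: ('a, ('a \<times> 'n \<Rightarrow>\<^sub>0 int) set) module. left_module A M} B UNIV (hom_functor A UB)"
    by (rule hom_is_functor[OF Um]) simp_all
  show ?thesis
  proof (rule nat_isomorphic_lin_isoI[OF is_functor_comp[OF fT, where E = UNIV], where h = f and g = g])
    show "is_functor S {M. left_module S M} B UNIV (tensor_functor S BS)" by (rule tensor_is_functor[OF bB]) simp_all
    fix N assume N: "N : C"
    show "lin_iso B (obj ?T N) (obj (hom_functor A UB \<circ>\<^sub>F tensor_functor R AR) N) (f N) (g N)"
      using fg N by (simp add: comp_functor_def tensor_functor_def hom_functor_def)
    fix N' k z assume N': "N' : C" and k: "k : mod_hom R N N'" and z: "z el (obj ?T N)"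
    note Nm = C[OF N] and N'm = C[OF N']
    note kl = mod_hom_lin[OF k Nm N'm]
    let ?V = "%N. tensor_mod R AR N" and ?H = "%N. hom_mod R TS N"
    note Vm = tensor_mod_lmod[OF bA Nm] and V'm = tensor_mod_lmod[OF bA N'm]
    note H = hom_mod_lmod[OF Tm Nm] and H' = hom_mod_lmod[OF Tm N'm] and K = hom_mod_lmod[OF Um Vm] and K' = hom_mod_lmod[OF Um V'm]
    let ?kA = "tensor_map R (right_mod AR) N (right_mod AR) N' (%t. t) k"
    let ?kH = "arr (hom_functor R TS) N N' k" and ?kK = "arr (hom_functor A UB) (?V N) (?V N') ?kA"
    let ?kB = "tensor_map S (right_mod BS) (?H N) (right_mod BS) (?H N') (%t. t) ?kH"
    have kA: "?kA : mod_hom A (?V N) (?V N')"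
      using is_functor_arr[OF tensor_is_functor[OF bA, where C = C and D = UNIV], OF C _ N N' k] by (simp add: tensor_functor_def)
    have kH: "?kH : mod_hom S (?H N) (?H N')" using is_functor_arr[OF fT N N' k] by (simp add: hom_functor_def)
    have kK: "?kK : mod_hom B (hom_mod A UB (?V N)) (hom_mod A UB (?V N'))"
      using is_functor_arr[OF fU _ _ kA] Vm V'm by (simp add: hom_functor_def)
    note kHl = mod_hom_lin[OF kH H H'] and kKl = mod_hom_lin[OF kK K K']
    note kB = tensor_mod_map[OF bB kHl]
    note lN = lin_isoD(1)[OF conjunct1[OF bspec[OF fg N]]] and lN' = lin_isoD(1)[OF conjunct1[OF bspec[OF fg N']]]
    have one: "1[A] el (right_mod AR)" "(\<lambda>u\<in>carrier U. u) el (right_mod BS)"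
      using ring_rules(13)[OF frob_simps(2)[OF F]] restrict_mod_hom[OF lin_id[OF Um]] by (simp_all add: ext_bimod_def)
    have "f N' (?kB (tB (?H N) l)) = ?kK (f N (tB (?H N) l))" if "l el (?H N)" for l
    proof -
      have l: "l : mod_hom R T N" using that by (simp add: hs)
      have kHe: "?kH l = compose (carrier T) k l" using l by (simp add: hom_functor_def mod_hom_end_bimod[OF Tm])
      have kHm: "?kH l : mod_hom R T N'" using lin_closed[OF kHl that] by (simp add: hs)
      have kBe: "?kB (tB (?H N) l) = tB (?H N') (?kH l)"
        by (rule tensor_map_addm(2)[OF lin_id[OF bimod_right[OF bB]] kHl one(2) that])
      obtain i i' where J: "ind S B \<rho> E' m x' y' (?H N) (tensor_mod S BS (?H N)) (tB (?H N)) i"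
        and J': "ind S B \<rho> E' m x' y' (?H N') (tensor_mod S BS (?H N')) (tB (?H N')) i'"
        using ind_tensor[OF F' H] ind_tensor[OF F' H'] by auto
      have fl: "f N (tB (?H N) l) : mod_hom A U (?V N)" using lin_closed[OF lN ind_simps(7)[OF F' J that]] by (simp add: hs)
      have gl: "f N' (tB (?H N') (?kH l)) : mod_hom A U (?V N')"
        using lin_closed[OF lN' ind_simps(7)[OF F' J' lin_closed[OF kHl that]]] by (simp add: hs)
      have kKe: "?kK (f N (tB (?H N) l)) = compose (carrier U) ?kA (f N (tB (?H N) l))"
        using fl by (simp add: hom_functor_def mod_hom_end_bimod[OF Um])
      have cl: "compose (carrier U) ?kA (f N (tB (?H N) l)) : mod_hom A U (?V N')" by (rule compose_mod_hom[OF fl kA Um Vm V'm])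
      show ?thesis unfolding kBe kKe
      proof (rule mod_hom_eqI[OF gl cl], rule ind_ext_unique[OF F I mod_hom_lin[OF gl Um V'm] mod_hom_lin[OF cl Um V'm]])
        fix t assume t: "t el T"
        have lt: "l t el N" by (rule lin_closed[OF mod_hom_lin[OF l Tm Nm] t])
        have "f N' (tB (?H N') (?kH l)) (h t) = tA N' (k (l t))" using fg N' kHm t kHe by (simp add: compose_def)
        also have "\<dots> = ?kA (tA N (l t))"
          by (rule tensor_map_addm(2)[OF lin_id[OF bimod_right[OF bA]] kl one(1) lt, symmetric])
        also have "\<dots> = compose (carrier U) ?kA (f N (tB (?H N) l)) (h t)" using fg N l t hc[OF t] by (simp add: compose_def)
        finally show "f N' (tB (?H N') (?kH l)) (h t) = compose (carrier U) ?kA (f N (tB (?H N) l)) (h t)" .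
      qed
    qed
    then have "f N' (?kB z) = ?kK (f N z)"
      by (rule tensor_ext_eqI[OF F' H lin_comp[OF kB lN'] lin_comp[OF lN kKl], unfolded end_ring_simps])
        (use z in "simp_all add: comp_functor_def tensor_functor_def hom_functor_def")
    then show "f N' (arr ?T N N' k z) = arr (hom_functor A UB \<circ>\<^sub>F tensor_functor R AR) N N' k (f N z)"
      by (simp add: comp_functor_def tensor_functor_def hom_functor_def)
  qed
qed

end

end

theorem corollary4p3:
  fixes R :: "'r ring" and A :: "'a ring" and \<iota> :: "'r \<Rightarrow> 'a"
    and T :: "('r, 't) module" and U :: "('a, ('a \<times> 't \<Rightarrow>\<^sub>0 int) set) module"
    and S :: "('t \<Rightarrow> 't) ring"
    and B :: "(('a \<times> 't \<Rightarrow>\<^sub>0 int) set \<Rightarrow> ('a \<times> 't \<Rightarrow>\<^sub>0 int) set) ring"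
    and \<rho> :: "('t \<Rightarrow> 't) \<Rightarrow> ('a \<times> 't \<Rightarrow>\<^sub>0 int) set \<Rightarrow> ('a \<times> 't \<Rightarrow>\<^sub>0 int) set"
    and T\<^sub>S :: "('r, 't, 't \<Rightarrow> 't) bimodule"
    and U\<^sub>B :: "('a, ('a \<times> 't \<Rightarrow>\<^sub>0 int) set,
                 ('a \<times> 't \<Rightarrow>\<^sub>0 int) set \<Rightarrow> ('a \<times> 't \<Rightarrow>\<^sub>0 int) set) bimodule"
    and A\<^sub>R :: "('a, 'a, 'r) bimodule"
    and B\<^sub>S :: "(('a \<times> 't \<Rightarrow>\<^sub>0 int) set \<Rightarrow> ('a \<times> 't \<Rightarrow>\<^sub>0 int) set,
                 ('a \<times> 't \<Rightarrow>\<^sub>0 int) set \<Rightarrow> ('a \<times> 't \<Rightarrow>\<^sub>0 int) set, 't \<Rightarrow> 't) bimodule"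
  assumes "frobenius_extension R A \<iota>"
    and "wakamatsu_tilting R T"
    and "A\<^sub>R = ext_bimod A \<iota>"
    and "U = tensor_mod R A\<^sub>R T"
    and "S = end_ring R T"
    and "B = end_ring A U"
    and "\<rho> = (\<lambda>s. tensor_map R (right_mod A\<^sub>R) T (right_mod A\<^sub>R) T (\<lambda>a. a) s)"
    and "B\<^sub>S = ext_bimod B \<rho>"
    and "T\<^sub>S = end_bimod T"
    and "U\<^sub>B = end_bimod U"
    and "res \<iota> U \<in> add_mod R T"
    and "finite_proj_dim R T"
    and "finite_proj_dim (opp_ring S) (right_mod T\<^sub>S)"
  shows "wakamatsu_tilting A U \<and>
    frobenius_extension S B \<rho> \<and>
    finite_proj_dim A U \<and> finite_proj_dim (opp_ring B) (right_mod U\<^sub>B) \<and>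

    \<comment> \<open>the equivalence associated with \<open>T\<close>\<close>
    is_functor S (KT S T\<^sub>S :: ('t \<Rightarrow> 't, 'm) module set) R (KE R T\<^sub>S) (tensor_functor S T\<^sub>S) \<and>
    is_functor R (KE R T\<^sub>S :: ('r, 'n) module set) S (KT S T\<^sub>S) (hom_functor R T\<^sub>S) \<and>
    nat_isomorphic S (KT S T\<^sub>S :: ('t \<Rightarrow> 't, 'm) module set) S
      id_functor (hom_functor R T\<^sub>S \<circ>\<^sub>F tensor_functor S T\<^sub>S) \<and>
    nat_isomorphic R (KE R T\<^sub>S :: ('r, 'n) module set) R
      (tensor_functor S T\<^sub>S \<circ>\<^sub>F hom_functor R T\<^sub>S) id_functor \<and>

    \<comment> \<open>the equivalence associated with \<open>U\<close>\<close>
    is_functor B (KT B U\<^sub>B :: (_, 'x) module set) A (KE A U\<^sub>B) (tensor_functor B U\<^sub>B) \<and>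
    is_functor A (KE A U\<^sub>B :: ('a, 'y) module set) B (KT B U\<^sub>B) (hom_functor A U\<^sub>B) \<and>
    nat_isomorphic B (KT B U\<^sub>B :: (_, 'x) module set) B
      id_functor (hom_functor A U\<^sub>B \<circ>\<^sub>F tensor_functor B U\<^sub>B) \<and>
    nat_isomorphic A (KE A U\<^sub>B :: ('a, 'y) module set) A
      (tensor_functor B U\<^sub>B \<circ>\<^sub>F hom_functor A U\<^sub>B) id_functor \<and>

    \<comment> \<open>extension and restriction of scalars\<close>
    is_functor S (KT S T\<^sub>S :: ('t \<Rightarrow> 't, 'm) module set) B (KT B U\<^sub>B) (tensor_functor S B\<^sub>S) \<and>
    is_functor B (KT B U\<^sub>B :: (_, 'x) module set) S (KT S T\<^sub>S) (res_functor \<rho>) \<and>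
    is_functor R (KE R T\<^sub>S :: ('r, 'n) module set) A (KE A U\<^sub>B) (tensor_functor R A\<^sub>R) \<and>
    is_functor A (KE A U\<^sub>B :: ('a, 'y) module set) R (KE R T\<^sub>S) (res_functor \<iota>) \<and>

    \<comment> \<open>compatibility\<close>
    nat_isomorphic S (KT S T\<^sub>S :: ('t \<Rightarrow> 't, 'm) module set) A
      (tensor_functor R A\<^sub>R \<circ>\<^sub>F tensor_functor S T\<^sub>S)
      (tensor_functor B U\<^sub>B \<circ>\<^sub>F tensor_functor S B\<^sub>S) \<and>
    nat_isomorphic R (KE R T\<^sub>S :: ('r, 'n) module set) B
      (tensor_functor S B\<^sub>S \<circ>\<^sub>F hom_functor R T\<^sub>S)
      (hom_functor A U\<^sub>B \<circ>\<^sub>F tensor_functor R A\<^sub>R) \<and>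
    nat_isomorphic B (KT B U\<^sub>B :: (_, 'x) module set) R
      (tensor_functor S T\<^sub>S \<circ>\<^sub>F res_functor \<rho>)
      (res_functor \<iota> \<circ>\<^sub>F tensor_functor B U\<^sub>B) \<and>
    nat_isomorphic A (KE A U\<^sub>B :: ('a, 'y) module set) S
      (hom_functor R T\<^sub>S \<circ>\<^sub>F res_functor \<iota>)
      (res_functor \<rho> \<circ>\<^sub>F hom_functor A U\<^sub>B)"
proof -
  obtain E n x y where F: "frob R A \<iota> E n x y" using frobenius_extensionE[OF assms(1)] by blast
  have Tm: "left_module R T" by (rule wakamatsu_lmod[OF assms(2,12) assms(13)[unfolded assms(5,9)]])
  note bA = bimod_ext[OF F] and U = assms(4)[unfolded assms(3)]
  let ?h = "ten R (right_mod (ext_bimod A \<iota>)) T \<one>\<^bsub>A\<^esub>"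
  obtain e where I: "ind R A \<iota> E n x y T U ?h e" using ind_tensor[OF F Tm] unfolding U by blast
  have a: "addr R T (res \<iota> U)" using assms(11) unfolding add_mod_addr[OF Tm] .
  \<comment> \<open>The concrete ring map enters the earlier results only through two properties: it
    takes values in endomorphisms of \<open>U\<close>, and it commutes with the unit, which is
    tensoring with 1.\<close>
  have \<rho>: "\<rho> s \<in> mod_hom A U U" if s: "s \<in> mod_hom R T T" for s
    unfolding assms(7,3) U
    by (rule mod_homI[OF tensor_mod_map[OF bA end_lin[OF Tm s]]]) (use tensor_map_extensional in \<open>simp add: tensor_mod_simps\<close>)
  have \<rho>h: "\<rho> s (?h t) = ?h (s t)" if s: "s \<in> mod_hom R T T" and t: "t \<in> carrier T" for s t
    unfolding assms(7,3)
    by (rule tensor_map_addm(2)[OF lin_id[OF bimod_right[OF bA]] end_lin[OF Tm s] _ t])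
      (use ring_rules(13)[OF frob_simps(2)[OF F]] in \<open>simp add: ext_bimod_def\<close>)
  obtain E' m x' y' where F': "frob (end_ring R T) (end_ring A U) \<rho> E' m x' y'"
    and I': "ind (opp_ring (end_ring R T)) (opp_ring (end_ring A U)) \<rho> E' m y' x' (right_mod (end_bimod T)) (right_mod (end_bimod U)) ?h e"
    and E': "\<And>b. b \<in> mod_hom A U U \<Longrightarrow> E' b = (\<lambda>t\<in>carrier T. e (b (?h t)))"
    by (rule end_frob[OF F I \<rho> \<rho>h a]) (assumption+, rule that)
  note pT = assms(13)[unfolded assms(5,9)]
  have wU: "wakamatsu_tilting A U" by (rule ind_wakamatsu[OF F I a assms(2)])
  have plU: "finite_proj_dim A U" by (rule ind_finite_proj_dim[OF F I assms(12)])
  have prU: "finite_proj_dim (opp_ring (end_ring A U)) (right_mod (end_bimod U))"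
    by (rule ind_finite_proj_dim[OF frob_opp[OF F'] I' pT])
  \<comment> \<open>The equivalence is instantiated twice, for \<open>T\<close> and for
    \<open>U\<close> with the properties just transferred; the compatibility statements hold for
    arbitrary classes of modules and are restricted to \<open>KT\<close> and \<open>KE\<close> by
    \<open>KT_lmod\<close> and \<open>KE_lmod\<close>.\<close>
  show ?thesis
    unfolding assms(3,5,6,8,9,10)
    by (intro conjI wU plU prU frobenius_extensionI[OF F']
      BBM_functors[OF assms(2,12) pT] BBM_unit[OF assms(2,12) pT] BBM_counit[OF assms(2,12) pT]
      BBM_functors[OF wU plU prU] BBM_unit[OF wU plU prU] BBM_counit[OF wU plU prU]
      scalar_functors[OF F I \<rho> \<rho>h a F' I' E'] tensor_compatible[OF F I \<rho> \<rho>h a F' I' E'] hom_compatible[OF F I \<rho> \<rho>h a F' I' E']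
      tensor_res_compatible[OF F I \<rho> \<rho>h a F' I' E'] hom_res_compatible[OF F I \<rho> \<rho>h a F' I' E'] KT_lmod KE_lmod)
qed

end
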